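(* A weak equivalence of cosimplicial 2-groupoids $\mathcal{G}^\bullet\to\mathcal{H}^\bullet$ induces a weak equivalence of 2-groupoids $\mathbf{Desc}(\mathcal{G}^\bullet)\to\mathbf{Desc}(\mathcal{H}^\bullet)$.
   Context: **2-groupoids.** A (strict) 2-groupoid is a small category enriched in groupoids in which all morphisms are invertible: it has objects, 1-morphisms $f:x\to y$, and 2-morphisms $a:f\Rightarrow g$ between parallel 1-morphisms, with a strictly associative and unital composition $\circ$ of 1-morphisms, a vertical composition $*$ of 2-morphisms ($b*a$ is $a$ followed by $b$) and a horizontal composition $\circ$ of 2-morphisms satisfying the usual associativity, unit and interchange laws, and all 1- and 2-morphisms are invertible. $2\mathcal{G}pd$ is the category of 2-groupoids and strict 2-functors. **2-nerve.** A simplicial set $X$ is 3-coskeletal if the canonical map $X\to Cosk_3X$ is an isomorphism (such an $X$ is determined by its 3-truncation). The 2-nerve $\mathbb{N}:2\mathcal{G}pd\to s\mathcal{S}et$ sends $\mathcal{G}$ to the 3-coskeletal simplicial set $\mathbb{N}\mathcal{G}$ whose 0-simplices are the objects of $\mathcal{G}$; whose 1-simplices are the 1-morphisms; whose 2-simplices are the data of objects $x_0,x_1,x_2$, 1-morphisms $g_{ij}:x_i\to x_j$ ($i<j$) and a 2-morphism $a_{012}:g_{02}\Rightarrow g_{12}\circ g_{01}$; and whose 3-simplices are the data of objects $x_0,\dots,x_3$, 1-morphisms $g_{ij}:x_i\to x_j$ ($i<j$) and 2-morphisms $a_{ijk}:g_{ik}\Rightarrow g_{jk}\circ g_{ij}$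 ($i<j<k$) such that $(1_{g_{23}}\circ a_{012})*a_{023}=(a_{123}\circ 1_{g_{01}})*a_{013}$. Faces and degeneracies are the evident ones. **Weak equivalences.** A map of 2-groupoids is a weak equivalence iff the induced map of 2-nerves is a weak equivalence of simplicial sets (Kan–Quillen). A map of cosimplicial 2-groupoids $\mathcal{G}^\bullet\to\mathcal{H}^\bullet$ is a weak equivalence if $\mathcal{G}^n\to\mathcal{H}^n$ is a weak equivalence for every $n$. **Cosimplicial objects and restricted totalization.** $\mathbb{\Delta}$ is the category of finite non-empty ordinals and weakly order preserving maps; $\mathbb{\Delta}_r\subset\mathbb{\Delta}$ has the same objects and only the injective maps. Cosimplicial (resp. restricted cosimplicial) objects are functors out of $\mathbb{\Delta}$ (resp. $\mathbb{\Delta}_r$), and $r$ denotes restriction along $\mathbb{\Delta}_r\subset\mathbb{\Delta}$. $\Delta^\bullet$ is the cosimplicial simplicial set with $\Delta^n$ in cosimplicial degree $n$. For a restricted cosimplicial simplicial set $X^\bullet$, $Tot_r(X^\bullet)$ is the simplicial set whose $n$-simplices are the natural transformations $r\Delta^\bullet\times\Delta^n\to X^\bullet$ of functors $\mathbb{\Delta}_r\to s\mathcal{S}et$ (with $\Delta^n$ constant in the cosimplicial direction). For a cosimplicial $X^\bullet$ one writes $Tot_r(X^\bullet)$ for $Tot_r(rX^\bullet)$. **Descent 2-groupoid.** For a cosimplicial 2-groupoid $\mathcal{G}^\bullet$, $\mathbf{Desc}(\mathcal{G}^\bullet):=Tot_r(\mathbb{N}\mathcal{G}^\bullet)$, where $\mathbb{N}$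 is applied in each cosimplicial degree. This simplicial set is regarded as (the 2-nerve of) a 2-groupoid; accordingly, a map $\mathbf{Desc}(\mathcal{G}^\bullet)\to\mathbf{Desc}(\mathcal{H}^\bullet)$ is a weak equivalence of 2-groupoids iff the map of simplicial sets $Tot_r(\mathbb{N}\mathcal{G}^\bullet)\to Tot_r(\mathbb{N}\mathcal{H}^\bullet)$ is a weak equivalence. *)

theory Defs
  imports Main "HOL-Library.FuncSet"
begin

section \<open>The simplex category and simplicial sets\<close>

text \<open>
  The ordinal $[n]$ is \<open>{..n}\<close>. Its morphisms are extensional functions, so that they are
  equal in HOL exactly when they agree on their domain.
\<close>

definition Delta :: "nat \<Rightarrow> nat \<Rightarrow> (nat \<Rightarrow> nat) set" where
  "Delta m n = {\<alpha> \<in> {..m} \<rightarrow>\<^sub>E {..n}. \<forall>i\<le>m. \<forall>j\<le>m. i \<le> j \<longrightarrow> \<alpha> i \<le> \<alpha> j}"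

definition Delta_r :: "nat \<Rightarrow> nat \<Rightarrow> (nat \<Rightarrow> nat) set" where
  "Delta_r m n = {\<alpha> \<in> Delta m n. inj_on \<alpha> {..m}}"

text \<open>\<open>sact X m n \<alpha>\<close> is the operator $\alpha^* : X_n \to X_m$ of $\alpha : [m] \to [n]$.\<close>

record 'x sset =
  simplices :: "nat \<Rightarrow> 'x set"
  sact :: "nat \<Rightarrow> nat \<Rightarrow> (nat \<Rightarrow> nat) \<Rightarrow> 'x \<Rightarrow> 'x"

definition simplicial_set :: "'x sset \<Rightarrow> bool" where
  "simplicial_set X \<longleftrightarrow>
     (\<forall>m n. \<forall>\<alpha>\<in>Delta m n. \<forall>x\<in>simplices X n. sact X m n \<alpha> x \<in> simplices X m) \<and>
     (\<forall>n. \<forall>x\<in>simplices X n. sact X n n (\<lambda>i\<in>{..n}. i) x = x) \<and>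
     (\<forall>k m n. \<forall>\<alpha>\<in>Delta k m. \<forall>\<beta>\<in>Delta m n. \<forall>x\<in>simplices X n.
        sact X k n (compose {..k} \<beta> \<alpha>) x = sact X k m \<alpha> (sact X m n \<beta> x))"

definition simplicial_map :: "'x sset \<Rightarrow> 'y sset \<Rightarrow> (nat \<Rightarrow> 'x \<Rightarrow> 'y) \<Rightarrow> bool" where
  "simplicial_map X Y f \<longleftrightarrow>
     (\<forall>n. f n \<in> simplices X n \<rightarrow> simplices Y n) \<and>
     (\<forall>m n. \<forall>\<alpha>\<in>Delta m n. \<forall>x\<in>simplices X n. f m (sact X m n \<alpha> x) = sact Y m n \<alpha> (f n x))"

text \<open>The set of maps $X \to Y$; extensionality gives each map a unique representative.\<close>

definition sset_hom :: "'x sset \<Rightarrow> 'y sset \<Rightarrow> (nat \<Rightarrow> 'x \<Rightarrow> 'y) set" where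
  "sset_hom X Y = {f. simplicial_map X Y f \<and> (\<forall>n. f n \<in> extensional (simplices X n))}"

definition std_simplex :: "nat \<Rightarrow> (nat \<Rightarrow> nat) sset" where
  "std_simplex n = \<lparr>simplices = (\<lambda>m. Delta m n), sact = (\<lambda>k m \<alpha> u. compose {..k} u \<alpha>)\<rparr>"

definition boundary :: "nat \<Rightarrow> (nat \<Rightarrow> nat) sset" where
  "boundary n = (std_simplex n)\<lparr>simplices := (\<lambda>m. {u \<in> Delta m n. u ` {..m} \<noteq> {..n}})\<rparr>"

definition horn :: "nat \<Rightarrow> nat \<Rightarrow> (nat \<Rightarrow> nat) sset" where
  "horn n k = (std_simplex n)\<lparr>simplices := (\<lambda>m. {u \<in> Delta m n. \<exists>i\<le>n. i \<noteq> k \<and> i \<notin> u ` {..m}})\<rparr>"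

definition sset_prod :: "'x sset \<Rightarrow> 'y sset \<Rightarrow> ('x \<times> 'y) sset" where
  "sset_prod X Y = \<lparr>simplices = (\<lambda>n. simplices X n \<times> simplices Y n),
     sact = (\<lambda>m n \<alpha> (x, y). (sact X m n \<alpha> x, sact Y m n \<alpha> y))\<rparr>"

section \<open>Weak equivalences of Kan complexes\<close>

definition kan_complex :: "'x sset \<Rightarrow> bool" where
  "kan_complex X \<longleftrightarrow> simplicial_set X \<and>
     (\<forall>n\<ge>1. \<forall>k\<le>n. \<forall>h\<in>sset_hom (horn n k) X.
        \<exists>t\<in>sset_hom (std_simplex n) X. \<forall>m. \<forall>u\<in>simplices (horn n k) m. t m u = h m u)"

definition path_rel :: "'x sset \<Rightarrow> ('x \<times> 'x) set" where
  "path_rel X = {(x, y). \<exists>e\<in>simplices X 1.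
      sact X 0 1 (\<lambda>i\<in>{..0}. 0) e = x \<and> sact X 0 1 (\<lambda>i\<in>{..0}. 1) e = y}"

definition pi0 :: "'x sset \<Rightarrow> 'x set set" where
  "pi0 X = simplices X 0 // path_rel X"

definition pi0_map :: "'x sset \<Rightarrow> 'y sset \<Rightarrow> (nat \<Rightarrow> 'x \<Rightarrow> 'y) \<Rightarrow> 'x set \<Rightarrow> 'y set" where
  "pi0_map X Y f C = path_rel Y `` (f 0 ` C)"

text \<open>
  The homotopy group $\pi_n(X, v)$: maps $\Delta^n \to X$ sending $\partial\Delta^n$ to $v$,
  modulo homotopy $\Delta^n \times \Delta^1 \to X$ relative to $\partial\Delta^n$.
  The relations \<open>path_rel\<close> and \<open>sphere_htpy\<close> are equivalence relations when \<open>X\<close> is Kan.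
\<close>

definition const_at :: "'x sset \<Rightarrow> 'x \<Rightarrow> nat \<Rightarrow> 'x" where
  "const_at X v m = sact X m 0 (\<lambda>i\<in>{..m}. 0) v"

definition spheres :: "'x sset \<Rightarrow> nat \<Rightarrow> 'x \<Rightarrow> (nat \<Rightarrow> (nat \<Rightarrow> nat) \<Rightarrow> 'x) set" where
  "spheres X n v = {\<alpha> \<in> sset_hom (std_simplex n) X.
      \<forall>m. \<forall>u\<in>simplices (boundary n) m. \<alpha> m u = const_at X v m}"

definition sphere_htpy ::
    "'x sset \<Rightarrow> nat \<Rightarrow> 'x \<Rightarrow> ((nat \<Rightarrow> (nat \<Rightarrow> nat) \<Rightarrow> 'x) \<times> (nat \<Rightarrow> (nat \<Rightarrow> nat) \<Rightarrow> 'x)) set" where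
  "sphere_htpy X n v = {(\<alpha>, \<beta>). \<alpha> \<in> spheres X n v \<and> \<beta> \<in> spheres X n v \<and>
      (\<exists>h\<in>sset_hom (sset_prod (std_simplex n) (std_simplex 1)) X.
         \<forall>m. (\<forall>u\<in>Delta m n. h m (u, \<lambda>i\<in>{..m}. 0) = \<alpha> m u \<and> h m (u, \<lambda>i\<in>{..m}. 1) = \<beta> m u) \<and>
             (\<forall>u\<in>simplices (boundary n) m. \<forall>w\<in>Delta m 1. h m (u, w) = const_at X v m))}"

definition homotopy_group ::
    "'x sset \<Rightarrow> nat \<Rightarrow> 'x \<Rightarrow> (nat \<Rightarrow> (nat \<Rightarrow> nat) \<Rightarrow> 'x) set set" where
  "homotopy_group X n v = spheres X n v // sphere_htpy X n v"

definition homotopy_group_map ::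
    "'x sset \<Rightarrow> 'y sset \<Rightarrow> (nat \<Rightarrow> 'x \<Rightarrow> 'y) \<Rightarrow> nat \<Rightarrow> 'x \<Rightarrow>
     (nat \<Rightarrow> (nat \<Rightarrow> nat) \<Rightarrow> 'x) set \<Rightarrow> (nat \<Rightarrow> (nat \<Rightarrow> nat) \<Rightarrow> 'y) set" where
  "homotopy_group_map X Y f n v C =
     sphere_htpy Y n (f 0 v) `` ((\<lambda>\<alpha> m. compose (Delta m n) (f m) (\<alpha> m)) ` C)"

text \<open>
  Kan--Quillen weak equivalences between Kan complexes, i.e. isomorphisms on $\pi_0$ and on all
  homotopy groups at all base points. (The map induced on $\pi_n$, $n \ge 1$, is always a
  homomorphism, so bijectivity is the whole condition.) Kan complexes are all that is needed
  below: 2-nerves of 2-groupoids are Kan complexes, and restricted totalizations of levelwise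
  Kan cosimplicial simplicial sets are Kan complexes.
\<close>

definition weak_equivalence :: "'x sset \<Rightarrow> 'y sset \<Rightarrow> (nat \<Rightarrow> 'x \<Rightarrow> 'y) \<Rightarrow> bool" where
  "weak_equivalence X Y f \<longleftrightarrow>
     kan_complex X \<and> kan_complex Y \<and> simplicial_map X Y f \<and>
     bij_betw (pi0_map X Y f) (pi0 X) (pi0 Y) \<and>
     (\<forall>n\<ge>1. \<forall>v\<in>simplices X 0.
        bij_betw (homotopy_group_map X Y f n v) (homotopy_group X n v) (homotopy_group Y n (f 0 v)))"

section \<open>2-groupoids\<close>

text \<open>
  \<open>comp1 \<G> g f\<close> is $g \circ f$, \<open>vcomp \<G> b a\<close> is $b * a$ and \<open>hcomp \<G> b a\<close> is $b \circ a$.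
\<close>

record ('o, 'm, 'c) two_cat =
  Obj :: "'o set"
  Mor :: "'m set"
  Cell :: "'c set"
  src1 :: "'m \<Rightarrow> 'o"
  tgt1 :: "'m \<Rightarrow> 'o"
  unit1 :: "'o \<Rightarrow> 'm"
  comp1 :: "'m \<Rightarrow> 'm \<Rightarrow> 'm"
  src2 :: "'c \<Rightarrow> 'm"
  tgt2 :: "'c \<Rightarrow> 'm"
  unit2 :: "'m \<Rightarrow> 'c"
  vcomp :: "'c \<Rightarrow> 'c \<Rightarrow> 'c"
  hcomp :: "'c \<Rightarrow> 'c \<Rightarrow> 'c"

definition hom1 :: "('o, 'm, 'c) two_cat \<Rightarrow> 'o \<Rightarrow> 'o \<Rightarrow> 'm set" where
  "hom1 \<G> x y = {f \<in> Mor \<G>. src1 \<G> f = x \<and> tgt1 \<G> f = y}"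

definition hom2 :: "('o, 'm, 'c) two_cat \<Rightarrow> 'm \<Rightarrow> 'm \<Rightarrow> 'c set" where
  "hom2 \<G> f g = {a \<in> Cell \<G>. src2 \<G> a = f \<and> tgt2 \<G> a = g}"

locale two_groupoid =
  fixes \<G> :: "('o, 'm, 'c) two_cat"
  assumes src1_obj: "f \<in> Mor \<G> \<Longrightarrow> src1 \<G> f \<in> Obj \<G>"
    and tgt1_obj: "f \<in> Mor \<G> \<Longrightarrow> tgt1 \<G> f \<in> Obj \<G>"
    and unit1_hom: "x \<in> Obj \<G> \<Longrightarrow> unit1 \<G> x \<in> hom1 \<G> x x"
    and comp1_hom: "f \<in> hom1 \<G> x y \<Longrightarrow> g \<in> hom1 \<G> y z \<Longrightarrow> comp1 \<G> g f \<in> hom1 \<G> x z"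
    and comp1_assoc: "f \<in> hom1 \<G> w x \<Longrightarrow> g \<in> hom1 \<G> x y \<Longrightarrow> h \<in> hom1 \<G> y z \<Longrightarrow>
          comp1 \<G> h (comp1 \<G> g f) = comp1 \<G> (comp1 \<G> h g) f"
    and comp1_unit_left: "f \<in> hom1 \<G> x y \<Longrightarrow> comp1 \<G> (unit1 \<G> y) f = f"
    and comp1_unit_right: "f \<in> hom1 \<G> x y \<Longrightarrow> comp1 \<G> f (unit1 \<G> x) = f"
    and inverse1: "f \<in> hom1 \<G> x y \<Longrightarrow>
          \<exists>g\<in>hom1 \<G> y x. comp1 \<G> g f = unit1 \<G> x \<and> comp1 \<G> f g = unit1 \<G> y"
    and src2_mor: "a \<in> Cell \<G> \<Longrightarrow> src2 \<G> a \<in> Mor \<G>"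
    and tgt2_mor: "a \<in> Cell \<G> \<Longrightarrow> tgt2 \<G> a \<in> Mor \<G>"
    and parallel_src: "a \<in> Cell \<G> \<Longrightarrow> src1 \<G> (src2 \<G> a) = src1 \<G> (tgt2 \<G> a)"
    and parallel_tgt: "a \<in> Cell \<G> \<Longrightarrow> tgt1 \<G> (src2 \<G> a) = tgt1 \<G> (tgt2 \<G> a)"
    and unit2_hom: "f \<in> Mor \<G> \<Longrightarrow> unit2 \<G> f \<in> hom2 \<G> f f"
    and vcomp_hom: "a \<in> hom2 \<G> f g \<Longrightarrow> b \<in> hom2 \<G> g h \<Longrightarrow> vcomp \<G> b a \<in> hom2 \<G> f h"
    and vcomp_assoc: "a \<in> hom2 \<G> f g \<Longrightarrow> b \<in> hom2 \<G> g h \<Longrightarrow> c \<in> hom2 \<G> h k \<Longrightarrow>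
          vcomp \<G> c (vcomp \<G> b a) = vcomp \<G> (vcomp \<G> c b) a"
    and vcomp_unit_left: "a \<in> hom2 \<G> f g \<Longrightarrow> vcomp \<G> (unit2 \<G> g) a = a"
    and vcomp_unit_right: "a \<in> hom2 \<G> f g \<Longrightarrow> vcomp \<G> a (unit2 \<G> f) = a"
    and inverse2: "a \<in> hom2 \<G> f g \<Longrightarrow>
          \<exists>b\<in>hom2 \<G> g f. vcomp \<G> b a = unit2 \<G> f \<and> vcomp \<G> a b = unit2 \<G> g"
    and hcomp_hom: "f \<in> hom1 \<G> x y \<Longrightarrow> g \<in> hom1 \<G> y z \<Longrightarrow>
          a \<in> hom2 \<G> f f' \<Longrightarrow> b \<in> hom2 \<G> g g' \<Longrightarrow>
          hcomp \<G> b a \<in> hom2 \<G> (comp1 \<G> g f) (comp1 \<G> g' f')"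
    and hcomp_assoc: "f \<in> hom1 \<G> w x \<Longrightarrow> g \<in> hom1 \<G> x y \<Longrightarrow> h \<in> hom1 \<G> y z \<Longrightarrow>
          a \<in> hom2 \<G> f f' \<Longrightarrow> b \<in> hom2 \<G> g g' \<Longrightarrow> c \<in> hom2 \<G> h h' \<Longrightarrow>
          hcomp \<G> c (hcomp \<G> b a) = hcomp \<G> (hcomp \<G> c b) a"
    and hcomp_unit_left: "f \<in> hom1 \<G> x y \<Longrightarrow> a \<in> hom2 \<G> f f' \<Longrightarrow>
          hcomp \<G> (unit2 \<G> (unit1 \<G> y)) a = a"
    and hcomp_unit_right: "f \<in> hom1 \<G> x y \<Longrightarrow> a \<in> hom2 \<G> f f' \<Longrightarrow>
          hcomp \<G> a (unit2 \<G> (unit1 \<G> x)) = a"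
    and hcomp_unit2: "f \<in> hom1 \<G> x y \<Longrightarrow> g \<in> hom1 \<G> y z \<Longrightarrow>
          hcomp \<G> (unit2 \<G> g) (unit2 \<G> f) = unit2 \<G> (comp1 \<G> g f)"
    and interchange: "f \<in> hom1 \<G> x y \<Longrightarrow> g \<in> hom1 \<G> y z \<Longrightarrow>
          a \<in> hom2 \<G> f f' \<Longrightarrow> a' \<in> hom2 \<G> f' f'' \<Longrightarrow> b \<in> hom2 \<G> g g' \<Longrightarrow> b' \<in> hom2 \<G> g' g'' \<Longrightarrow>
          hcomp \<G> (vcomp \<G> b' b) (vcomp \<G> a' a) = vcomp \<G> (hcomp \<G> b' a') (hcomp \<G> b a)"

record ('o, 'm, 'c, 'p, 'q, 'd) two_fun =
  on_obj :: "'o \<Rightarrow> 'p"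
  on_mor :: "'m \<Rightarrow> 'q"
  on_cell :: "'c \<Rightarrow> 'd"

definition two_functor ::
    "('o, 'm, 'c) two_cat \<Rightarrow> ('p, 'q, 'd) two_cat \<Rightarrow> ('o, 'm, 'c, 'p, 'q, 'd) two_fun \<Rightarrow> bool" where
  "two_functor \<G> \<H> F \<longleftrightarrow>
     (\<forall>x\<in>Obj \<G>. on_obj F x \<in> Obj \<H>) \<and>
     (\<forall>f\<in>Mor \<G>. on_mor F f \<in> hom1 \<H> (on_obj F (src1 \<G> f)) (on_obj F (tgt1 \<G> f))) \<and>
     (\<forall>a\<in>Cell \<G>. on_cell F a \<in> hom2 \<H> (on_mor F (src2 \<G> a)) (on_mor F (tgt2 \<G> a))) \<and>
     (\<forall>x\<in>Obj \<G>. on_mor F (unit1 \<G> x) = unit1 \<H> (on_obj F x)) \<and>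
     (\<forall>f\<in>Mor \<G>. \<forall>g\<in>Mor \<G>. tgt1 \<G> f = src1 \<G> g \<longrightarrow>
        on_mor F (comp1 \<G> g f) = comp1 \<H> (on_mor F g) (on_mor F f)) \<and>
     (\<forall>f\<in>Mor \<G>. on_cell F (unit2 \<G> f) = unit2 \<H> (on_mor F f)) \<and>
     (\<forall>a\<in>Cell \<G>. \<forall>b\<in>Cell \<G>. tgt2 \<G> a = src2 \<G> b \<longrightarrow>
        on_cell F (vcomp \<G> b a) = vcomp \<H> (on_cell F b) (on_cell F a)) \<and>
     (\<forall>a\<in>Cell \<G>. \<forall>b\<in>Cell \<G>. tgt1 \<G> (src2 \<G> a) = src1 \<G> (src2 \<G> b) \<longrightarrow>
        on_cell F (hcomp \<G> b a) = hcomp \<H> (on_cell F b) (on_cell F a))"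

definition two_fun_id :: "('o, 'm, 'c, 'o, 'm, 'c) two_fun" where
  "two_fun_id = \<lparr>on_obj = id, on_mor = id, on_cell = id\<rparr>"

definition two_fun_comp ::
    "('p, 'q, 'd, 'r, 's, 'e) two_fun \<Rightarrow> ('o, 'm, 'c, 'p, 'q, 'd) two_fun \<Rightarrow>
     ('o, 'm, 'c, 'r, 's, 'e) two_fun" where
  "two_fun_comp K F = \<lparr>on_obj = on_obj K \<circ> on_obj F, on_mor = on_mor K \<circ> on_mor F,
     on_cell = on_cell K \<circ> on_cell F\<rparr>"

text \<open>Equality of 2-functors out of \<open>\<G>\<close>; values off the carriers are irrelevant.\<close>

definition two_fun_eq ::
    "('o, 'm, 'c) two_cat \<Rightarrow> ('o, 'm, 'c, 'p, 'q, 'd) two_fun \<Rightarrow>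
     ('o, 'm, 'c, 'p, 'q, 'd) two_fun \<Rightarrow> bool" where
  "two_fun_eq \<G> F F' \<longleftrightarrow>
     (\<forall>x\<in>Obj \<G>. on_obj F x = on_obj F' x) \<and>
     (\<forall>f\<in>Mor \<G>. on_mor F f = on_mor F' f) \<and>
     (\<forall>a\<in>Cell \<G>. on_cell F a = on_cell F' a)"

section \<open>The 2-nerve\<close>

text \<open>
  An $n$-simplex of the 2-nerve consists of objects $x_i$ ($i \le n$), 1-morphisms $g_{ij}$
  ($i < j \le n$) and 2-morphisms $a_{ijk}$ ($i < j < k \le n$), stored as extensional functions,
  with the tetrahedron identity for all $i < j < k < l \le n$. For $n \le 3$ these are the simplices
  of the given 3-truncation; for $n > 3$ they are the compatible families of $3$-dimensional faces
  over $\Delta^n$, i.e. the $n$-simplices of the 3-coskeleton of that truncation.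
\<close>

type_synonym ('o, 'm, 'c) nerve_simplex =
  "(nat \<Rightarrow> 'o) \<times> (nat \<times> nat \<Rightarrow> 'm) \<times> (nat \<times> nat \<times> nat \<Rightarrow> 'c)"

definition pairs :: "nat \<Rightarrow> (nat \<times> nat) set" where
  "pairs n = {(i, j). i < j \<and> j \<le> n}"

definition triples :: "nat \<Rightarrow> (nat \<times> nat \<times> nat) set" where
  "triples n = {(i, j, k). i < j \<and> j < k \<and> k \<le> n}"

definition nerve_simplices ::
    "('o, 'm, 'c) two_cat \<Rightarrow> nat \<Rightarrow> ('o, 'm, 'c) nerve_simplex set" where
  "nerve_simplices \<G> n = {(x, g, a).
     x \<in> {..n} \<rightarrow>\<^sub>E Obj \<G> \<and>
     g \<in> (\<Pi>\<^sub>E (i, j)\<in>pairs n. hom1 \<G> (x i) (x j)) \<and>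
     a \<in> (\<Pi>\<^sub>E (i, j, k)\<in>triples n. hom2 \<G> (g (i, k)) (comp1 \<G> (g (j, k)) (g (i, j)))) \<and>
     (\<forall>i j k l. i < j \<and> j < k \<and> k < l \<and> l \<le> n \<longrightarrow>
        vcomp \<G> (hcomp \<G> (unit2 \<G> (g (k, l))) (a (i, j, k))) (a (i, k, l)) =
        vcomp \<G> (hcomp \<G> (a (j, k, l)) (unit2 \<G> (g (i, j)))) (a (i, j, l)))}"

text \<open>
  The 1- and 2-morphisms of a simplex at weakly increasing indices: on degenerate edges and
  triangles they are identities. They define the simplicial operators (faces and degeneracies).
\<close>

definition edge :: "('o, 'm, 'c) two_cat \<Rightarrow> ('o, 'm, 'c) nerve_simplex \<Rightarrow> nat \<Rightarrow> nat \<Rightarrow> 'm" where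
  "edge \<G> s i j = (case s of (x, g, a) \<Rightarrow> if i = j then unit1 \<G> (x i) else g (i, j))"

definition triangle ::
    "('o, 'm, 'c) two_cat \<Rightarrow> ('o, 'm, 'c) nerve_simplex \<Rightarrow> nat \<Rightarrow> nat \<Rightarrow> nat \<Rightarrow> 'c" where
  "triangle \<G> s i j k = (case s of (x, g, a) \<Rightarrow>
     if i = j \<or> j = k then unit2 \<G> (edge \<G> s i k) else a (i, j, k))"

definition nerve :: "('o, 'm, 'c) two_cat \<Rightarrow> ('o, 'm, 'c) nerve_simplex sset" where
  "nerve \<G> = \<lparr>simplices = nerve_simplices \<G>,
     sact = (\<lambda>m n \<alpha> s.
       (\<lambda>i\<in>{..m}. fst s (\<alpha> i),
        \<lambda>(i, j)\<in>pairs m. edge \<G> s (\<alpha> i) (\<alpha> j),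
        \<lambda>(i, j, k)\<in>triples m. triangle \<G> s (\<alpha> i) (\<alpha> j) (\<alpha> k)))\<rparr>"

definition nerve_map ::
    "('o, 'm, 'c, 'p, 'q, 'd) two_fun \<Rightarrow> nat \<Rightarrow>
     ('o, 'm, 'c) nerve_simplex \<Rightarrow> ('p, 'q, 'd) nerve_simplex" where
  "nerve_map F n = (\<lambda>(x, g, a).
     (compose {..n} (on_obj F) x, compose (pairs n) (on_mor F) g, compose (triples n) (on_cell F) a))"

definition two_weak_equivalence ::
    "('o, 'm, 'c) two_cat \<Rightarrow> ('p, 'q, 'd) two_cat \<Rightarrow> ('o, 'm, 'c, 'p, 'q, 'd) two_fun \<Rightarrow> bool" where
  "two_weak_equivalence \<G> \<H> F \<longleftrightarrow>
     two_functor \<G> \<H> F \<and> weak_equivalence (nerve \<G>) (nerve \<H>) (nerve_map F)"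

section \<open>Cosimplicial 2-groupoids\<close>

text \<open>\<open>gact G m n \<alpha>\<close> is the 2-functor $G^m \to G^n$ induced by $\alpha : [m] \to [n]$.\<close>

record ('o, 'm, 'c) cosimp_two_cat =
  glevel :: "nat \<Rightarrow> ('o, 'm, 'c) two_cat"
  gact :: "nat \<Rightarrow> nat \<Rightarrow> (nat \<Rightarrow> nat) \<Rightarrow> ('o, 'm, 'c, 'o, 'm, 'c) two_fun"

definition cosimplicial_two_groupoid :: "('o, 'm, 'c) cosimp_two_cat \<Rightarrow> bool" where
  "cosimplicial_two_groupoid G \<longleftrightarrow>
     (\<forall>n. two_groupoid (glevel G n)) \<and>
     (\<forall>m n. \<forall>\<alpha>\<in>Delta m n. two_functor (glevel G m) (glevel G n) (gact G m n \<alpha>)) \<and>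
     (\<forall>n. two_fun_eq (glevel G n) (gact G n n (\<lambda>i\<in>{..n}. i)) two_fun_id) \<and>
     (\<forall>k m n. \<forall>\<alpha>\<in>Delta k m. \<forall>\<beta>\<in>Delta m n.
        two_fun_eq (glevel G k) (gact G k n (compose {..k} \<beta> \<alpha>))
          (two_fun_comp (gact G m n \<beta>) (gact G k m \<alpha>)))"

definition cosimplicial_two_map ::
    "('o, 'm, 'c) cosimp_two_cat \<Rightarrow> ('p, 'q, 'd) cosimp_two_cat \<Rightarrow>
     (nat \<Rightarrow> ('o, 'm, 'c, 'p, 'q, 'd) two_fun) \<Rightarrow> bool" where
  "cosimplicial_two_map G H \<Phi> \<longleftrightarrow>
     (\<forall>n. two_functor (glevel G n) (glevel H n) (\<Phi> n)) \<and>
     (\<forall>m n. \<forall>\<alpha>\<in>Delta m n.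
        two_fun_eq (glevel G m) (two_fun_comp (\<Phi> n) (gact G m n \<alpha>))
          (two_fun_comp (gact H m n \<alpha>) (\<Phi> m)))"

definition cosimplicial_weak_equivalence ::
    "('o, 'm, 'c) cosimp_two_cat \<Rightarrow> ('p, 'q, 'd) cosimp_two_cat \<Rightarrow>
     (nat \<Rightarrow> ('o, 'm, 'c, 'p, 'q, 'd) two_fun) \<Rightarrow> bool" where
  "cosimplicial_weak_equivalence G H \<Phi> \<longleftrightarrow>
     cosimplicial_two_map G H \<Phi> \<and>
     (\<forall>n. two_weak_equivalence (glevel G n) (glevel H n) (\<Phi> n))"

section \<open>Restricted totalization and descent\<close>

text \<open>
  \<open>xact X p q \<delta> k\<close> is the map $X^p_k \to X^q_k$ induced by $\delta : [p] \to [q]$.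
  \<open>Tot_r\<close> uses it for injective \<open>\<delta>\<close> only, so it is the totalization of the restricted object $rX$.
\<close>

record 'x cosimp_sset =
  xlevel :: "nat \<Rightarrow> 'x sset"
  xact :: "nat \<Rightarrow> nat \<Rightarrow> (nat \<Rightarrow> nat) \<Rightarrow> nat \<Rightarrow> 'x \<Rightarrow> 'x"

type_synonym 'x tot_simplex = "nat \<Rightarrow> nat \<Rightarrow> (nat \<Rightarrow> nat) \<times> (nat \<Rightarrow> nat) \<Rightarrow> 'x"

definition Tot_r :: "'x cosimp_sset \<Rightarrow> 'x tot_simplex sset" where
  "Tot_r X = \<lparr>simplices = (\<lambda>n. {t.
       (\<forall>p. t p \<in> sset_hom (sset_prod (std_simplex p) (std_simplex n)) (xlevel X p)) \<and>
       (\<forall>p q. \<forall>\<delta>\<in>Delta_r p q. \<forall>k. \<forall>u\<in>Delta k p. \<forall>w\<in>Delta k n.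
          t q k (compose {..k} \<delta> u, w) = xact X p q \<delta> k (t p k (u, w)))}),
     sact = (\<lambda>m n \<theta> t p k. \<lambda>(u, w)\<in>Delta k p \<times> Delta k m. t p k (u, compose {..k} \<theta> w))\<rparr>"

text \<open>The map $\mathrm{Tot}_r(X) \to \mathrm{Tot}_r(Y)$ induced by $f^p : X^p \to Y^p$.\<close>

definition Tot_r_map ::
    "(nat \<Rightarrow> nat \<Rightarrow> 'x \<Rightarrow> 'y) \<Rightarrow> nat \<Rightarrow> 'x tot_simplex \<Rightarrow> 'y tot_simplex" where
  "Tot_r_map f n t p k = compose (Delta k p \<times> Delta k n) (f p k) (t p k)"

definition cosimp_nerve ::
    "('o, 'm, 'c) cosimp_two_cat \<Rightarrow> ('o, 'm, 'c) nerve_simplex cosimp_sset" where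
  "cosimp_nerve G = \<lparr>xlevel = (\<lambda>n. nerve (glevel G n)),
     xact = (\<lambda>p q \<delta>. nerve_map (gact G p q \<delta>))\<rparr>"

definition Desc :: "('o, 'm, 'c) cosimp_two_cat \<Rightarrow> ('o, 'm, 'c) nerve_simplex tot_simplex sset" where
  "Desc G = Tot_r (cosimp_nerve G)"

definition Desc_map ::
    "(nat \<Rightarrow> ('o, 'm, 'c, 'p, 'q, 'd) two_fun) \<Rightarrow> nat \<Rightarrow>
     ('o, 'm, 'c) nerve_simplex tot_simplex \<Rightarrow> ('p, 'q, 'd) nerve_simplex tot_simplex" where
  "Desc_map \<Phi> = Tot_r_map (\<lambda>n. nerve_map (\<Phi> n))"

end

theory Submission
  imports Defs
begin

text \<open>
  The restricted totalization has no codegeneracies to respect, so a simplex of it can be built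
  one cosimplicial degree at a time: in degree $p$ its values on $\partial\Delta^p\times\Delta^n$ are
  determined by the lower degrees, and those on the rest of $\Delta^p\times\Delta^n$ are free. Hence a
  lifting problem for the totalization against an inclusion $A\subset\Delta^n$ reduces to lifting
  problems for the simplicial sets $X^p$ against
  $\partial\Delta^p\times\Delta^n\cup\Delta^p\times A\subset\Delta^p\times\Delta^n$ (\<open>Tot_lift\<close>). For a horn $A$
  this inclusion is anodyne (\<open>kan_extend\<close>), so totalizations of levelwise Kan complexes are Kan
  complexes (\<open>kan_Tot\<close>). For the boundary $A=\partial\Delta^n$, trivial fibrations lift against it
  (\<open>triv_fib_lift\<close>), so totalization preserves levelwise trivial fibrations (\<open>triv_fib_Tot\<close>).

  A map \<open>f : X \<rightarrow> Y\<close> of Kan complexes factors through its mapping path space $P=X\times_Y Y^{\Delta^1}$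
  as a section of the projection \<open>P \<rightarrow> X\<close> followed by the projection \<open>P \<rightarrow> Y\<close>. The first projection is
  always a trivial fibration, and the second one is if \<open>f\<close> is a weak equivalence. All of this is
  natural, hence applies degreewise to a map of cosimplicial Kan complexes, and totalization
  preserves it. A section of a trivial fibration followed by a trivial fibration is a weak
  equivalence (\<open>weak_equivalence_of_span\<close>, \<open>weak_equivalence_Tot\<close>).

  That \<open>P \<rightarrow> Y\<close> is a trivial fibration means that simplices of \<open>Y\<close> whose boundary is lifted to \<open>X\<close> can
  be lifted up to a homotopy relative to the boundary (\<open>lifts_up_to_homotopy\<close>). For nerves of
  2-groupoids it is derived by hand from the bijections on homotopy classes. Bijectivity on
  $\pi_0$, $\pi_1$ and $\pi_2$ says that the 2-functor is surjective on objects up to 1-morphisms,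
  surjective on parallel 1-morphisms up to 2-morphisms, and bijective on parallel 2-morphisms;
  at first only for automorphisms of objects and of identities, and then in general because
  1-morphisms are invertible (\<open>object_lift\<close>, \<open>mor_lift\<close>, \<open>cell_lift\<close>, \<open>cell_inj\<close>). This gives the lifts
  in dimensions 0 and 1 up to homotopy, and strict lifts from dimension 2 on, where a simplex of a
  nerve is determined by its edges and triangles (\<open>nerve_lifts_up_to_homotopy\<close>).
\<close>


section \<open>The simplex category\<close>

abbreviation cmp :: "nat \<Rightarrow> (nat \<Rightarrow> nat) \<Rightarrow> (nat \<Rightarrow> nat) \<Rightarrow> nat \<Rightarrow> nat" where
  "cmp k \<beta> \<alpha> \<equiv> compose {..k} \<beta> \<alpha>"

abbreviation idD :: "nat \<Rightarrow> nat \<Rightarrow> nat" where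
  "idD n \<equiv> (\<lambda>i\<in>{..n}. i)"

abbreviation constD :: "nat \<Rightarrow> nat \<Rightarrow> nat \<Rightarrow> nat" where
  "constD m c \<equiv> (\<lambda>i\<in>{..m}. c)"

definition coface :: "nat \<Rightarrow> nat \<Rightarrow> nat \<Rightarrow> nat" where
  "coface n r = (\<lambda>i\<in>{..n}. if i < r then i else Suc i)"

definition codegen :: "nat \<Rightarrow> nat \<Rightarrow> nat \<Rightarrow> nat" where
  "codegen n r = (\<lambda>i\<in>{..Suc n}. if i \<le> r then i else i - 1)"

lemma Delta_le: "\<alpha> \<in> Delta m n \<Longrightarrow> i \<le> m \<Longrightarrow> \<alpha> i \<le> n"
  by (auto simp: Delta_def PiE_def Pi_def)

lemma Delta_mono: "\<alpha> \<in> Delta m n \<Longrightarrow> i \<le> j \<Longrightarrow> j \<le> m \<Longrightarrow> \<alpha> i \<le> \<alpha> j"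
  by (auto simp: Delta_def)

lemma Delta_undefined: "\<alpha> \<in> Delta m n \<Longrightarrow> m < i \<Longrightarrow> \<alpha> i = undefined"
  by (auto simp: Delta_def PiE_def extensional_def)

lemma DeltaI:
  assumes "\<And>i. i \<le> m \<Longrightarrow> \<alpha> i \<le> n" and "\<And>i j. i \<le> j \<Longrightarrow> j \<le> m \<Longrightarrow> \<alpha> i \<le> \<alpha> j"
    and "\<And>i. m < i \<Longrightarrow> \<alpha> i = undefined"
  shows "\<alpha> \<in> Delta m n"
  using assms by (auto simp: Delta_def PiE_def extensional_def)

lemma Delta_eqI:
  assumes "\<alpha> \<in> Delta m n" and "\<beta> \<in> Delta m n'" and "\<And>i. i \<le> m \<Longrightarrow> \<alpha> i = \<beta> i"
  shows "\<alpha> = \<beta>"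
proof
  show "\<alpha> i = \<beta> i" for i
    using assms(3) Delta_undefined[OF assms(1), of i] Delta_undefined[OF assms(2), of i]
    by (cases "i \<le> m") auto
qed

lemma cmp_apply[simp]: "cmp k \<beta> \<alpha> i = (if i \<le> k then \<beta> (\<alpha> i) else undefined)"
  by (simp add: compose_def)

lemma Delta_cmp[intro, simp]: "\<alpha> \<in> Delta k m \<Longrightarrow> \<beta> \<in> Delta m n \<Longrightarrow> cmp k \<beta> \<alpha> \<in> Delta k n"
  by (rule DeltaI) (auto intro: Delta_le Delta_mono)

lemma cmp_assoc: "\<alpha> \<in> Delta k m \<Longrightarrow> cmp k (cmp m \<gamma> \<beta>) \<alpha> = cmp k \<gamma> (cmp k \<beta> \<alpha>)"
  by (auto simp: fun_eq_iff Delta_le)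

lemma idD_Delta[intro, simp]: "idD n \<in> Delta n n"
  by (rule DeltaI) auto

lemma constD_Delta[intro]: "c \<le> n \<Longrightarrow> constD m c \<in> Delta m n"
  by (rule DeltaI) auto

lemma cmp_idD_left[simp]: "\<alpha> \<in> Delta m n \<Longrightarrow> cmp m (idD n) \<alpha> = \<alpha>"
  by (auto simp: fun_eq_iff Delta_le Delta_undefined)

lemma cmp_idD_right[simp]: "\<alpha> \<in> Delta m n \<Longrightarrow> cmp m \<alpha> (idD m) = \<alpha>"
  by (auto simp: fun_eq_iff Delta_le Delta_undefined)

lemma cmp_constD_left[simp]: "\<alpha> \<in> Delta k m \<Longrightarrow> cmp k (constD m c) \<alpha> = constD k c"
  by (auto simp: fun_eq_iff Delta_le)

lemma cmp_constD_right[simp]: "cmp k \<beta> (constD k c) = constD k (\<beta> c)"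
  by (auto simp: fun_eq_iff)

lemma Delta_0: "\<alpha> \<in> Delta m 0 \<longleftrightarrow> \<alpha> = constD m 0"
proof
  assume a: "\<alpha> \<in> Delta m 0"
  show "\<alpha> = constD m 0"
    by (rule Delta_eqI[OF a constD_Delta[OF order_refl]]) (use Delta_le[OF a] in simp)
qed auto

lemma Delta_r_Delta: "\<delta> \<in> Delta_r m n \<Longrightarrow> \<delta> \<in> Delta m n"
  by (simp add: Delta_r_def)

lemma Delta_r_strict: "\<delta> \<in> Delta_r m n \<Longrightarrow> i < j \<Longrightarrow> j \<le> m \<Longrightarrow> \<delta> i < \<delta> j"
  using Delta_mono[OF Delta_r_Delta, of \<delta> m n i j] inj_onD[of \<delta> "{..m}" i j]
  by (force simp: Delta_r_def order.order_iff_strict)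

lemma Delta_rI:
  assumes "\<delta> \<in> Delta m n" and "\<And>i j. i < j \<Longrightarrow> j \<le> m \<Longrightarrow> \<delta> i < \<delta> j"
  shows "\<delta> \<in> Delta_r m n"
proof -
  have "inj_on \<delta> {..m}"
    by (rule inj_onI) (metis assms(2) atMost_iff less_irrefl linorder_neqE_nat)
  with assms(1) show ?thesis by (simp add: Delta_r_def)
qed

lemma Delta_r_cmp[intro, simp]:
  assumes "\<alpha> \<in> Delta_r k m" "\<beta> \<in> Delta_r m n" shows "cmp k \<beta> \<alpha> \<in> Delta_r k n"
proof (rule Delta_rI)
  show "cmp k \<beta> \<alpha> \<in> Delta k n" using assms Delta_r_Delta by blast
  fix i j :: nat assume ij: "i < j" "j \<le> k"
  then have "\<alpha> i < \<alpha> j" "\<alpha> j \<le> m"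
    using assms(1) Delta_r_strict Delta_le Delta_r_Delta by blast+
  then show "cmp k \<beta> \<alpha> i < cmp k \<beta> \<alpha> j" using ij Delta_r_strict[OF assms(2)] by simp
qed

lemma idD_Delta_r[intro, simp]: "idD n \<in> Delta_r n n"
  by (rule Delta_rI) auto

text \<open>
  A strictly increasing map cannot save up: this bounds an injective operator from both sides and
  leaves only the identity when source and target agree.
\<close>

lemma Delta_r_gap: "\<delta> \<in> Delta_r m n \<Longrightarrow> i + d \<le> m \<Longrightarrow> \<delta> i + d \<le> \<delta> (i + d)"
proof (induction d)
  case (Suc d)
  then have "\<delta> i + d \<le> \<delta> (i + d)" by simp
  also have "\<dots> < \<delta> (i + Suc d)" using Suc.prems by (auto intro: Delta_r_strict)
  finally show ?case by simp
qed simp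

lemma Delta_r_ge: "\<delta> \<in> Delta_r m n \<Longrightarrow> i \<le> m \<Longrightarrow> i \<le> \<delta> i"
  using Delta_r_gap[of \<delta> m n 0 i] by simp

lemma Delta_r_dim_le: "\<delta> \<in> Delta_r m n \<Longrightarrow> m \<le> n"
  using Delta_r_ge[of \<delta> m n m] Delta_le[OF Delta_r_Delta, of \<delta> m n m] by simp

lemma Delta_r_same_dim: "\<delta> \<in> Delta_r n n \<Longrightarrow> \<delta> = idD n"
proof (rule Delta_eqI)
  assume d: "\<delta> \<in> Delta_r n n"
  show "\<delta> \<in> Delta n n" using d by (rule Delta_r_Delta)
  show "idD n \<in> Delta n n" by simp
  fix i assume i: "i \<le> n"
  have "\<delta> i + (n - i) \<le> \<delta> n" using Delta_r_gap[OF d, of i "n - i"] i by simp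
  also have "\<delta> n \<le> n" using Delta_le[OF Delta_r_Delta[OF d]] by simp
  finally show "\<delta> i = idD n i" using Delta_r_ge[OF d i] i by simp
qed

lemma coface_Delta_r[intro, simp]: "coface n r \<in> Delta_r n (Suc n)"
  by (rule Delta_rI, rule DeltaI) (auto simp: coface_def)

lemma coface_Delta[intro, simp]: "coface n r \<in> Delta n (Suc n)"
  by (rule Delta_r_Delta) simp

lemma coface_image: "r \<le> Suc n \<Longrightarrow> coface n r ` {..n} = {..Suc n} - {r}"
proof (intro equalityI subsetI)
  fix x assume r: "r \<le> Suc n" and x: "x \<in> {..Suc n} - {r}"
  then have "x = coface n r (if x < r then x else x - 1)" and "(if x < r then x else x - 1) \<le> n"
    by (auto simp: coface_def)
  then show "x \<in> coface n r ` {..n}" by blast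
qed (auto simp: coface_def split: if_splits)

lemma codegen_Delta[intro, simp]: "codegen n r \<in> Delta (Suc n) n" if "r \<le> n"
  using that by (intro DeltaI) (auto simp: codegen_def)

lemma factor_coface:
  assumes u: "u \<in> Delta k (Suc p)" and r: "r \<le> Suc p" "r \<notin> u ` {..k}"
  obtains u' where "u' \<in> Delta k p" "u = cmp k (coface p r) u'"
proof
  define u' where "u' = (\<lambda>i\<in>{..k}. if u i < r then u i else u i - 1)"
  have ne: "u i \<noteq> r" if "i \<le> k" for i using r that by auto
  show u': "u' \<in> Delta k p"
  proof (rule DeltaI)
    fix i assume "i \<le> k"
    then show "u' i \<le> p" using Delta_le[OF u, of i] ne[of i] r by (auto simp: u'_def)
  next
    fix i j assume "i \<le> j" "j \<le> k"
    then show "u' i \<le> u' j"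
      using Delta_mono[OF u, of i j] ne[of i] ne[of j] by (auto simp: u'_def)
  qed (simp add: u'_def)
  show "u = cmp k (coface p r) u'"
  proof (rule Delta_eqI[OF u Delta_cmp[OF u' coface_Delta]])
    fix i assume "i \<le> k"
    then show "u i = cmp k (coface p r) u' i"
      using ne[of i] Delta_le[OF u, of i] r(1) by (auto simp: u'_def coface_def)
  qed
qed

lemma factor_nonsurj:
  assumes u: "u \<in> Delta k p" and ns: "u ` {..k} \<noteq> {..p}"
  obtains q r u' where "p = Suc q" "r \<le> p" "u' \<in> Delta k q" "u = cmp k (coface q r) u'"
proof -
  have "u ` {..k} \<subseteq> {..p}" using u Delta_le by blast
  with ns obtain r where r: "r \<le> p" "r \<notin> u ` {..k}" by blast
  have "p \<noteq> 0" using r u Delta_le[OF u, of 0] by (metis atMost_iff imageI le_0_eq zero_le)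
  then obtain q where q: "p = Suc q" using not0_implies_Suc by blast
  from factor_coface[of u k q r] u r q obtain u' where "u' \<in> Delta k q" "u = cmp k (coface q r) u'"
    by auto
  with q r that show thesis by blast
qed

text \<open>
  Omit the values that are missed one at a time.
\<close>

lemma epi_mono:
  assumes "u \<in> Delta k p"
  obtains q \<delta> v where "\<delta> \<in> Delta_r q p" "v \<in> Delta k q" "v ` {..k} = {..q}" "u = cmp k \<delta> v"
  using assms
proof (induction p arbitrary: u thesis rule: less_induct)
  case (less p)
  show thesis
  proof (cases "u ` {..k} = {..p}")
    case True
    show thesis
      by (rule less.prems(1)[OF idD_Delta_r less.prems(2) True])
        (rule cmp_idD_left[OF less.prems(2), symmetric])
  next
    case False
    from factor_nonsurj[OF less.prems(2) False] obtain q r u'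
      where 1: "p = Suc q" "r \<le> p" "u' \<in> Delta k q" "u = cmp k (coface q r) u'" by blast
    from less.IH[of q u'] 1 obtain q' \<delta> v where
      2: "\<delta> \<in> Delta_r q' q" "v \<in> Delta k q'" "v ` {..k} = {..q'}" "u' = cmp k \<delta> v"
      by (metis lessI)
    show thesis
    proof (rule less.prems(1))
      show "cmp q' (coface q r) \<delta> \<in> Delta_r q' p" using 1 2 by auto
      show "u = cmp k (cmp q' (coface q r) \<delta>) v" using 1 2 by (simp add: cmp_assoc)
    qed (use 2 in auto)
  qed
qed

text \<open>
  Picking the least preimage is monotone because \<open>\<delta>\<close> is strictly monotone; this is what splits
  a map over the injections that land in its image.
\<close>

lemma section_over_image:
  assumes \<delta>: "\<delta> \<in> Delta_r q p" and \<theta>: "\<theta> \<in> Delta k p" and im: "\<delta> ` {..q} \<subseteq> \<theta> ` {..k}"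
  obtains \<eta> where "\<eta> \<in> Delta q k" "cmp q \<theta> \<eta> = \<delta>"
proof -
  define P where "P i x \<longleftrightarrow> x \<le> k \<and> \<theta> x = \<delta> i" for i x
  define \<eta> where "\<eta> = (\<lambda>i\<in>{..q}. LEAST x. P i x)"
  have ex: "\<exists>x. P i x" if "i \<le> q" for i
    using im that unfolding P_def by (metis atMost_iff imageE image_subset_iff)
  have P: "P i (\<eta> i)" if "i \<le> q" for i
    using LeastI_ex[OF ex[OF that]] that by (simp add: \<eta>_def)
  have "\<eta> \<in> Delta q k"
  proof (rule DeltaI)
    fix i j assume ij: "i \<le> j" "j \<le> q"
    show "\<eta> i \<le> \<eta> j"
    proof (cases "i = j")
      case False
      then have "\<delta> i < \<delta> j" using ij Delta_r_strict[OF \<delta>] by simp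
      then have "\<theta> (\<eta> i) < \<theta> (\<eta> j)" using P[of i] P[of j] ij by (simp add: P_def)
      then show ?thesis using Delta_mono[OF \<theta>, of "\<eta> j" "\<eta> i"] P[of i] ij
        by (metis P_def leD le_trans linear)
    qed simp
  qed (use P in \<open>auto simp: P_def \<eta>_def\<close>)
  moreover have "cmp q \<theta> \<eta> = \<delta>"
    by (rule Delta_eqI[OF Delta_cmp[OF \<open>\<eta> \<in> Delta q k\<close> \<theta>] Delta_r_Delta[OF \<delta>]])
      (use P in \<open>simp add: P_def\<close>)
  ultimately show thesis using that by blast
qed

lemma cmp_image: "cmp k \<delta> v ` {..k} = \<delta> ` (v ` {..k})"
  by (auto simp: image_def)

text \<open>
  The two injections have the same image, so each factors through the other by
  \<open>section_over_image\<close>; the comparison map is an injective endomap of an ordinal.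
\<close>

lemma epi_mono_unique:
  assumes \<delta>: "\<delta> \<in> Delta_r q p" "v \<in> Delta k q" "v ` {..k} = {..q}"
    and \<delta>': "\<delta>' \<in> Delta_r q' p" "v' \<in> Delta k q'" "v' ` {..k} = {..q'}"
    and eq: "cmp k \<delta> v = cmp k \<delta>' v'"
  shows "q = q' \<and> \<delta> = \<delta>' \<and> v = v'"
proof -
  have im: "\<delta> ` {..q} = \<delta>' ` {..q'}"
    using cmp_image[of k \<delta> v] cmp_image[of k \<delta>' v'] eq \<delta>(3) \<delta>'(3) by simp
  have "q = q'"
    using card_image[of \<delta> "{..q}"] card_image[of \<delta>' "{..q'}"] im \<delta>(1) \<delta>'(1)
    by (simp add: Delta_r_def)
  obtain \<eta> where \<eta>: "\<eta> \<in> Delta q q'" "cmp q \<delta>' \<eta> = \<delta>"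
    using section_over_image[OF \<delta>(1) Delta_r_Delta[OF \<delta>'(1)]] im by auto
  have "inj_on \<eta> {..q}"
  proof (rule inj_onI)
    fix i j assume "i \<in> {..q}" "j \<in> {..q}" "\<eta> i = \<eta> j"
    moreover from this have "\<delta> i = \<delta> j"
      using fun_cong[OF \<eta>(2), of i] fun_cong[OF \<eta>(2), of j] by simp
    ultimately show "i = j" using \<delta>(1) by (auto simp: Delta_r_def inj_on_def)
  qed
  then have "\<eta> = idD q" using \<eta>(1) \<open>q = q'\<close> by (intro Delta_r_same_dim) (simp add: Delta_r_def)
  then have "\<delta> = \<delta>'" using \<eta>(2) Delta_r_Delta[OF \<delta>'(1)] \<open>q = q'\<close> by simp
  moreover have "v = v'"
  proof (rule Delta_eqI[OF \<delta>(2) \<delta>'(2)])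
    fix i assume i: "i \<le> k"
    have "\<delta> (v i) = \<delta> (v' i)" using fun_cong[OF eq, of i] i \<open>\<delta> = \<delta>'\<close> by simp
    moreover have "v i \<le> q" "v' i \<le> q" using Delta_le \<delta>(2) \<delta>'(2) i \<open>q = q'\<close> by blast+
    ultimately show "v i = v' i" using \<delta>(1) by (auto simp: Delta_r_def inj_on_def)
  qed
  ultimately show ?thesis using \<open>q = q'\<close> by simp
qed

section \<open>Simplicial sets and maps\<close>

lemma sset_closed: "simplicial_set X \<Longrightarrow> \<alpha> \<in> Delta m n \<Longrightarrow> x \<in> simplices X n \<Longrightarrow> sact X m n \<alpha> x \<in> simplices X m"
  by (simp add: simplicial_set_def)

lemma sset_id: "simplicial_set X \<Longrightarrow> x \<in> simplices X n \<Longrightarrow> sact X n n (idD n) x = x"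
  by (simp add: simplicial_set_def)

lemma sset_comp: "simplicial_set X \<Longrightarrow> \<alpha> \<in> Delta k m \<Longrightarrow> \<beta> \<in> Delta m n \<Longrightarrow> x \<in> simplices X n \<Longrightarrow>
    sact X k m \<alpha> (sact X m n \<beta> x) = sact X k n (cmp k \<beta> \<alpha>) x"
  by (simp add: simplicial_set_def)

lemma smap_closed: "simplicial_map X Y f \<Longrightarrow> x \<in> simplices X n \<Longrightarrow> f n x \<in> simplices Y n"
  by (auto simp: simplicial_map_def)

lemma smap_nat: "simplicial_map X Y f \<Longrightarrow> \<alpha> \<in> Delta m n \<Longrightarrow> x \<in> simplices X n \<Longrightarrow>
    f m (sact X m n \<alpha> x) = sact Y m n \<alpha> (f n x)"
  by (auto simp: simplicial_map_def)

lemma simplicial_mapI: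
  assumes "\<And>n x. x \<in> simplices X n \<Longrightarrow> f n x \<in> simplices Y n"
    and "\<And>m n \<alpha> x. \<alpha> \<in> Delta m n \<Longrightarrow> x \<in> simplices X n \<Longrightarrow> f m (sact X m n \<alpha> x) = sact Y m n \<alpha> (f n x)"
  shows "simplicial_map X Y f"
  using assms by (auto simp: simplicial_map_def)

lemma smap_comp: "simplicial_map X Y f \<Longrightarrow> simplicial_map Y Z g \<Longrightarrow> simplicial_map X Z (\<lambda>n x. g n (f n x))"
  by (rule simplicial_mapI) (auto simp: smap_nat smap_closed)

lemma sset_homD: "f \<in> sset_hom X Y \<Longrightarrow> simplicial_map X Y f"
  by (simp add: sset_hom_def)

lemma sset_hom_ext: "f \<in> sset_hom X Y \<Longrightarrow> x \<notin> simplices X n \<Longrightarrow> f n x = undefined"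
  by (auto simp: sset_hom_def extensional_def)

lemma sset_hom_eqI:
  assumes "f \<in> sset_hom X Y" "g \<in> sset_hom X Z" "\<And>n x. x \<in> simplices X n \<Longrightarrow> f n x = g n x"
  shows "f = g"
proof (intro ext)
  show "f n x = g n x" for n x
    using assms sset_hom_ext[of f X Y] sset_hom_ext[of g X Z] by (cases "x \<in> simplices X n") auto
qed

text \<open>Restricting to the carrier makes a map extensional, at no cost on simplices.\<close>

lemma sset_hom_restrict:
  assumes "simplicial_set X" and "simplicial_map X Y f"
  shows "(\<lambda>n. \<lambda>x\<in>simplices X n. f n x) \<in> sset_hom X Y"
  using assms by (auto simp: sset_hom_def simplicial_map_def simplicial_set_def)

text \<open>
  Subcomplexes of $\Delta^n$ and of $\Delta^p\times\Delta^n$, given by their sets of simplices.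
  Boundaries and horns have this form.
\<close>

definition substd :: "nat \<Rightarrow> (nat \<Rightarrow> (nat \<Rightarrow> nat) set) \<Rightarrow> (nat \<Rightarrow> nat) sset" where
  "substd n A = (std_simplex n)\<lparr>simplices := A\<rparr>"

definition subprod :: "nat \<Rightarrow> nat \<Rightarrow> (nat \<Rightarrow> ((nat \<Rightarrow> nat) \<times> (nat \<Rightarrow> nat)) set) \<Rightarrow> ((nat \<Rightarrow> nat) \<times> (nat \<Rightarrow> nat)) sset" where
  "subprod p n C = (sset_prod (std_simplex p) (std_simplex n))\<lparr>simplices := C\<rparr>"

abbreviation stdprod :: "nat \<Rightarrow> nat \<Rightarrow> ((nat \<Rightarrow> nat) \<times> (nat \<Rightarrow> nat)) sset" where
  "stdprod p n \<equiv> sset_prod (std_simplex p) (std_simplex n)"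

definition pull :: "nat \<Rightarrow> (nat \<Rightarrow> nat) \<Rightarrow> (nat \<Rightarrow> nat) \<times> (nat \<Rightarrow> nat) \<Rightarrow> (nat \<Rightarrow> nat) \<times> (nat \<Rightarrow> nat)" where
  "pull k \<theta> s = (cmp k (fst s) \<theta>, cmp k (snd s) \<theta>)"

lemma simplices_std[simp]: "simplices (std_simplex n) m = Delta m n"
  and sact_std[simp]: "sact (std_simplex n) k m \<alpha> u = cmp k u \<alpha>"
  by (simp_all add: std_simplex_def)

lemma simplices_substd[simp]: "simplices (substd n A) = A"
  and sact_substd[simp]: "sact (substd n A) k m \<alpha> u = cmp k u \<alpha>"
  by (simp_all add: substd_def std_simplex_def)

lemma boundary_substd: "boundary n = substd n (\<lambda>m. {u \<in> Delta m n. u ` {..m} \<noteq> {..n}})"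
  by (simp add: boundary_def substd_def)

lemma horn_substd: "horn n k = substd n (\<lambda>m. {u \<in> Delta m n. \<exists>i\<le>n. i \<noteq> k \<and> i \<notin> u ` {..m}})"
  by (simp add: horn_def substd_def)

lemma simplices_stdprod[simp]: "simplices (stdprod p n) m = Delta m p \<times> Delta m n"
  and sact_stdprod[simp]: "sact (stdprod p n) k m \<alpha> s = pull k \<alpha> s"
  by (simp_all add: sset_prod_def std_simplex_def pull_def case_prod_beta)

lemma simplices_subprod[simp]: "simplices (subprod p n C) = C"
  and sact_subprod[simp]: "sact (subprod p n C) k m \<alpha> s = pull k \<alpha> s"
  by (simp_all add: subprod_def sset_prod_def std_simplex_def pull_def case_prod_beta)

lemma pull_Pair[simp]: "pull k \<theta> (u, w) = (cmp k u \<theta>, cmp k w \<theta>)"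
  by (simp add: pull_def)

lemma pull_closed[intro, simp]: "s \<in> Delta m p \<times> Delta m n \<Longrightarrow> \<theta> \<in> Delta k m \<Longrightarrow> pull k \<theta> s \<in> Delta k p \<times> Delta k n"
  by (auto simp: pull_def)

lemma pull_pull: "\<eta> \<in> Delta l k \<Longrightarrow> pull l \<eta> (pull k \<theta> s) = pull l (cmp l \<theta> \<eta>) s"
  by (simp add: pull_def cmp_assoc)

lemma pull_id[simp]: "s \<in> Delta m p \<times> Delta m n \<Longrightarrow> pull m (idD m) s = s"
  by (auto simp: pull_def)

lemma simplicial_std: "simplicial_set (std_simplex n)"
  by (auto simp: simplicial_set_def cmp_assoc)

lemma simplicial_stdprod: "simplicial_set (stdprod p n)"
  by (auto simp: simplicial_set_def cmp_assoc)

text \<open>The Yoneda lemma turns simplices into maps out of standard simplices, and back.\<close>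

lemma yoneda_map:
  assumes "simplicial_set X" "x \<in> simplices X n"
  shows "simplicial_map (std_simplex n) X (\<lambda>m u. sact X m n u x)"
  using assms by (intro simplicial_mapI) (auto intro: sset_closed simp: sset_comp)

lemma yoneda_hom:
  assumes "simplicial_set X" "x \<in> simplices X n"
  shows "(\<lambda>m. \<lambda>u\<in>Delta m n. sact X m n u x) \<in> sset_hom (std_simplex n) X"
  using sset_hom_restrict[OF simplicial_std yoneda_map[OF assms]] by simp

lemma map_std_simplex:
  assumes "simplicial_map (std_simplex n) X f" "u \<in> Delta m n"
  shows "f m u = sact X m n u (f n (idD n))"
  using smap_nat[OF assms(1), of u m n "idD n"] assms(2) by simp

lemma kan_simplicial: "kan_complex X \<Longrightarrow> simplicial_set X"
  by (simp add: kan_complex_def)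

lemma simplicial_horn: "simplicial_set (horn n k)"
proof -
  have "i \<notin> cmp m u \<alpha> ` {..m}" if "\<alpha> \<in> Delta m l" "i \<notin> u ` {..l}" for m l i u \<alpha>
    using that Delta_le[OF that(1)] by auto
  then have "\<exists>i\<le>n. i \<noteq> k \<and> i \<notin> cmp m u \<alpha> ` {..m}"
    if "\<alpha> \<in> Delta m l" "\<exists>i\<le>n. i \<noteq> k \<and> i \<notin> u ` {..l}" for m l u \<alpha>
    using that by metis
  then show ?thesis unfolding horn_substd simplicial_set_def
    by (auto simp: cmp_assoc simp del: cmp_apply)
qed

lemma simplicial_boundary: "simplicial_set (boundary n)"
proof -
  have "cmp m x \<alpha> ` {..m} \<noteq> {..n}" if "\<alpha> \<in> Delta m n'" "x \<in> Delta n' n" "x ` {..n'} \<noteq> {..n}" for m n' x \<alpha>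
  proof -
    have "cmp m x \<alpha> ` {..m} \<subseteq> x ` {..n'}" using Delta_le[OF that(1)] by auto
    moreover have "x ` {..n'} \<subseteq> {..n}" using Delta_le[OF that(2)] by auto
    ultimately show ?thesis using that(3) by blast
  qed
  then show ?thesis unfolding boundary_substd simplicial_set_def by (auto simp: cmp_assoc)
qed

text \<open>
  The Kan condition in the form used below: the horn is given by any simplicial map, and the filler
  is a simplex rather than a map out of $\Delta^n$.
\<close>

lemma kan_fill:
  assumes X: "kan_complex X" and nk: "n \<ge> 1" "k \<le> n" and h: "simplicial_map (horn n k) X h"
  obtains x where "x \<in> simplices X n" "\<And>m u. u \<in> simplices (horn n k) m \<Longrightarrow> sact X m n u x = h m u"
proof -
  let ?h = "\<lambda>m. \<lambda>u\<in>simplices (horn n k) m. h m u"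
  have "?h \<in> sset_hom (horn n k) X" by (rule sset_hom_restrict[OF simplicial_horn h])
  moreover have "\<forall>n\<ge>1. \<forall>k\<le>n. \<forall>h\<in>sset_hom (horn n k) X.
      \<exists>t\<in>sset_hom (std_simplex n) X. \<forall>m. \<forall>u\<in>simplices (horn n k) m. t m u = h m u"
    using X unfolding kan_complex_def by (rule conjunct2)
  ultimately have "\<exists>t\<in>sset_hom (std_simplex n) X. \<forall>m. \<forall>u\<in>simplices (horn n k) m. t m u = ?h m u"
    using nk by (elim allE[of _ n] allE[of _ k] impE) (auto elim!: ballE[of _ _ ?h] simp del: restrict_apply)
  then obtain t where t: "t \<in> sset_hom (std_simplex n) X" "\<And>m u. u \<in> simplices (horn n k) m \<Longrightarrow> t m u = ?h m u"
    by (elim bexE) (erule that, blast)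
  show thesis
  proof (rule that)
    show "t n (idD n) \<in> simplices X n" using smap_closed[OF sset_homD[OF t(1)], of "idD n" n] by simp
    fix m u assume u: "u \<in> simplices (horn n k) m"
    then have "u \<in> Delta m n" by (simp add: horn_substd)
    then show "sact X m n u (t n (idD n)) = h m u"
      using t(2)[OF u] u map_std_simplex[OF sset_homD[OF t(1)], of u m, symmetric] by simp
  qed
qed


section \<open>Extending maps over a product of two simplices\<close>

definition subcomplex :: "nat \<Rightarrow> nat \<Rightarrow> (nat \<Rightarrow> ((nat \<Rightarrow> nat) \<times> (nat \<Rightarrow> nat)) set) \<Rightarrow> bool" where
  "subcomplex p n C \<longleftrightarrow> (\<forall>m. C m \<subseteq> Delta m p \<times> Delta m n) \<and>
     (\<forall>m k. \<forall>\<theta>\<in>Delta k m. \<forall>s\<in>C m. pull k \<theta> s \<in> C k)"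

text \<open>
  A map from a subcomplex of $\Delta^p\times\Delta^n$ to \<open>X\<close> is kept as its graph: unions of
  chains of graphs are graphs, which is what Zorn's lemma asks for.
\<close>

type_synonym 'x graph = "(nat \<times> ((nat \<Rightarrow> nat) \<times> (nat \<Rightarrow> nat)) \<times> 'x) set"

locale partial_map =
  fixes p n :: nat and X :: "'x sset" and G :: "'x graph"
  assumes dom: "(m, s, x) \<in> G \<Longrightarrow> s \<in> Delta m p \<times> Delta m n"
    and val: "(m, s, x) \<in> G \<Longrightarrow> x \<in> simplices X m"
    and act: "(m, s, x) \<in> G \<Longrightarrow> \<theta> \<in> Delta k m \<Longrightarrow> (k, pull k \<theta> s, sact X k m \<theta> x) \<in> G"
    and unique: "(m, s, x) \<in> G \<Longrightarrow> (m, s, y) \<in> G \<Longrightarrow> x = y"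

lemmas partial_map_dom = partial_map.dom and partial_map_val = partial_map.val and partial_map_act = partial_map.act
  and partial_map_unique = partial_map.unique and partial_mapI = partial_map.intro

definition defined_on :: "'x graph \<Rightarrow> nat \<Rightarrow> ((nat \<Rightarrow> nat) \<times> (nat \<Rightarrow> nat)) \<Rightarrow> bool" where
  "defined_on G m s \<longleftrightarrow> (\<exists>x. (m, s, x) \<in> G)"

lemma defined_onI: "(m, s, x) \<in> G \<Longrightarrow> defined_on G m s"
  unfolding defined_on_def by (rule exI)

lemma defined_on_pull: "partial_map p n X G \<Longrightarrow> defined_on G m s \<Longrightarrow> \<theta> \<in> Delta k m \<Longrightarrow> defined_on G k (pull k \<theta> s)"
  unfolding defined_on_def by (elim exE) (rule exI, erule (2) partial_map_act)

lemma partial_map_graph: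
  assumes C: "subcomplex p n C" and g: "simplicial_map (subprod p n C) X g"
  shows "partial_map p n X {(m, s, x). s \<in> C m \<and> x = g m s}"
proof (rule partial_mapI)
  fix m s x k \<theta> assume a: "(m, s, x) \<in> {(m, s, x). s \<in> C m \<and> x = g m s}" and "\<theta> \<in> Delta k m"
  then show "(k, pull k \<theta> s, sact X k m \<theta> x) \<in> {(m, s, x). s \<in> C m \<and> x = g m s}"
    using C smap_nat[OF g, of \<theta> k m s] by (auto simp: subcomplex_def)
qed (use C smap_closed[OF g] in \<open>auto simp: subcomplex_def\<close>)

lemma partial_map_chain:
  assumes ch: "subset.chain {G. partial_map p n X G} \<G>"
  shows "partial_map p n X (\<Union>\<G>)"
proof (rule partial_mapI)
  have G: "partial_map p n X G" if "G \<in> \<G>" for G using ch that by (auto simp: subset.chain_def)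
  show "s \<in> Delta m p \<times> Delta m n" if "(m, s, x) \<in> \<Union>\<G>" for m s x
    using that partial_map_dom[OF G] by blast
  show "x \<in> simplices X m" if "(m, s, x) \<in> \<Union>\<G>" for m s x
    using that partial_map_val[OF G] by blast
  show "(k, pull k \<theta> s, sact X k m \<theta> x) \<in> \<Union>\<G>" if "(m, s, x) \<in> \<Union>\<G>" "\<theta> \<in> Delta k m" for m s x k \<theta>
    using that partial_map_act[OF G] by blast
  fix m s x y assume "(m, s, x) \<in> \<Union>\<G>" "(m, s, y) \<in> \<Union>\<G>"
  then obtain G H where GH: "G \<in> \<G>" "H \<in> \<G>" "(m, s, x) \<in> G" "(m, s, y) \<in> H" by blast
  then have "G \<subseteq> H \<or> H \<subseteq> G" using ch by (auto simp: subset.chain_def)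
  with GH have "(m, s, x) \<in> G \<and> (m, s, y) \<in> G \<or> (m, s, x) \<in> H \<and> (m, s, y) \<in> H" by blast
  then show "x = y" using partial_map_unique[OF G[OF GH(1)]] partial_map_unique[OF G[OF GH(2)]] by blast
qed

lemma partial_map_total_map:
  assumes G: "partial_map p n X G" and tot: "\<And>m s. s \<in> Delta m p \<times> Delta m n \<Longrightarrow> defined_on G m s"
  obtains \<phi> where "\<phi> \<in> sset_hom (stdprod p n) X" "\<And>m s x. (m, s, x) \<in> G \<Longrightarrow> \<phi> m s = x"
    "\<And>m s. s \<in> Delta m p \<times> Delta m n \<Longrightarrow> (m, s, \<phi> m s) \<in> G"
proof -
  define \<phi> where "\<phi> m s = (THE x. (m, s, x) \<in> G)" for m s
  have eq: "\<phi> m s = x" if "(m, s, x) \<in> G" for m s x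
    unfolding \<phi>_def using that partial_map_unique[OF G] by blast
  have mem: "(m, s, \<phi> m s) \<in> G" if "s \<in> Delta m p \<times> Delta m n" for m s
    using tot[OF that] unfolding defined_on_def by (metis eq)
  have "simplicial_map (stdprod p n) X \<phi>"
  proof (rule simplicial_mapI)
    fix m x assume "x \<in> simplices (stdprod p n) m"
    then show "\<phi> m x \<in> simplices X m" using partial_map_val[OF G mem] by simp
  next
    fix k m \<theta> x assume \<theta>: "\<theta> \<in> Delta k m" and "x \<in> simplices (stdprod p n) m"
    then have "(k, pull k \<theta> x, sact X k m \<theta> (\<phi> m x)) \<in> G" using partial_map_act[OF G mem] by simp
    then show "\<phi> k (sact (stdprod p n) k m \<theta> x) = sact X k m \<theta> (\<phi> m x)" by (simp add: eq)
  qed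
  from sset_hom_restrict[OF simplicial_stdprod this]
  have "(\<lambda>m. \<lambda>s\<in>Delta m p \<times> Delta m n. \<phi> m s) \<in> sset_hom (stdprod p n) X" by simp
  then show thesis
    by (rule that) (use eq mem partial_map_dom[OF G] in force)+
qed

text \<open>
  A simplex with distinct vertices can be adjoined freely: its pullbacks along different
  operators are different, so only the overlap with the old domain has to be checked.
\<close>

lemma partial_map_attach:
  assumes X: "simplicial_set X" and G: "partial_map p n X G"
    and s: "s \<in> Delta m p \<times> Delta m n" and inj: "inj_on (\<lambda>i. (fst s i, snd s i)) {..m}"
    and x: "x \<in> simplices X m"
    and compat: "\<And>k \<theta> y. \<theta> \<in> Delta k m \<Longrightarrow> (k, pull k \<theta> s, y) \<in> G \<Longrightarrow> y = sact X k m \<theta> x"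
  shows "partial_map p n X (G \<union> {(k, pull k \<theta> s, sact X k m \<theta> x) | k \<theta>. \<theta> \<in> Delta k m})"
    (is "partial_map p n X (G \<union> ?N)")
proof (rule partial_mapI)
  have \<theta>eq: "\<theta> = \<theta>'" if "\<theta> \<in> Delta k m" "\<theta>' \<in> Delta k m" "pull k \<theta> s = pull k \<theta>' s" for k \<theta> \<theta>'
  proof (rule Delta_eqI[OF that(1,2)])
    fix i assume i: "i \<le> k"
    have "cmp k (fst s) \<theta> i = cmp k (fst s) \<theta>' i" "cmp k (snd s) \<theta> i = cmp k (snd s) \<theta>' i"
      using that(3) by (auto simp: pull_def)
    then show "\<theta> i = \<theta>' i"
      using inj_onD[OF inj, of "\<theta> i" "\<theta>' i"] i Delta_le[OF that(1) i] Delta_le[OF that(2) i] by simp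
  qed
  show "t \<in> Delta k p \<times> Delta k n" if "(k, t, y) \<in> G \<union> ?N" for k t y
    using that partial_map_dom[OF G] pull_closed[OF s] by blast
  show "y \<in> simplices X k" if "(k, t, y) \<in> G \<union> ?N" for k t y
    using that partial_map_val[OF G] x sset_closed[OF X] by blast
  show "(l, pull l \<eta> t, sact X l k \<eta> y) \<in> G \<union> ?N" if "(k, t, y) \<in> G \<union> ?N" and \<eta>: "\<eta> \<in> Delta l k" for k t y l \<eta>
    using that(1)
  proof
    assume "(k, t, y) \<in> ?N"
    then obtain \<theta> where "\<theta> \<in> Delta k m" "t = pull k \<theta> s" "y = sact X k m \<theta> x" by blast
    with \<eta> have "(l, pull l \<eta> t, sact X l k \<eta> y) \<in> ?N"
      using sset_comp[OF X \<eta> _ x] by (auto simp: pull_pull simp del: cmp_apply intro!: exI[of _ "cmp l \<theta> \<eta>"])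
    then show ?thesis ..
  qed (use partial_map_act[OF G _ \<eta>] in blast)
  fix k t y z assume 1: "(k, t, y) \<in> G \<union> ?N" and 2: "(k, t, z) \<in> G \<union> ?N"
  show "y = z"
    using 1
  proof
    assume y: "(k, t, y) \<in> G"
    show ?thesis using 2 y partial_map_unique[OF G y] compat by blast
  next
    assume "(k, t, y) \<in> ?N"
    then obtain \<theta> where \<theta>: "\<theta> \<in> Delta k m" "t = pull k \<theta> s" "y = sact X k m \<theta> x" by blast
    show ?thesis using 2 \<theta> compat \<theta>eq by blast
  qed
qed

text \<open>
  A simplex outside the domain and of least dimension has distinct vertices, since otherwise it
  would be a degeneracy of one of its faces.
\<close>

lemma partial_map_missing_simplex:
  assumes G: "partial_map p n X G" and s0: "s\<^sub>0 \<in> Delta m\<^sub>0 p \<times> Delta m\<^sub>0 n" "\<not> defined_on G m\<^sub>0 s\<^sub>0"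
  obtains m s where "s \<in> Delta m p \<times> Delta m n" "\<not> defined_on G m s"
    "inj_on (\<lambda>i. (fst s i, snd s i)) {..m}"
    "\<And>k \<theta>. \<theta> \<in> Delta k m \<Longrightarrow> \<theta> ` {..k} \<noteq> {..m} \<Longrightarrow> defined_on G k (pull k \<theta> s)"
proof -
  define m where "m = (LEAST m. \<exists>s. s \<in> Delta m p \<times> Delta m n \<and> \<not> defined_on G m s)"
  have "\<exists>s. s \<in> Delta m p \<times> Delta m n \<and> \<not> defined_on G m s"
    unfolding m_def by (rule LeastI) (use s0 in blast)
  then obtain s where s: "s \<in> Delta m p \<times> Delta m n" "\<not> defined_on G m s" by blast
  have small: "defined_on G k t" if "k < m" "t \<in> Delta k p \<times> Delta k n" for k t
    using not_less_Least[OF that(1)[unfolded m_def]] that(2) by blast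
  show thesis
  proof (rule that[OF s])
    fix k \<theta> assume \<theta>: "\<theta> \<in> Delta k m" "\<theta> ` {..k} \<noteq> {..m}"
    from factor_nonsurj[OF this] obtain q r \<theta>' where
      q: "m = Suc q" "r \<le> m" "\<theta>' \<in> Delta k q" "\<theta> = cmp k (coface q r) \<theta>'" by blast
    have "defined_on G q (pull q (coface q r) s)" using q s by (intro small) auto
    from defined_on_pull[OF G this q(3)] show "defined_on G k (pull k \<theta> s)"
      using q by (simp add: pull_pull)
  next
    have step: "(fst s i, snd s i) \<noteq> (fst s (Suc i), snd s (Suc i))" if i: "Suc i \<le> m" for i
    proof
      assume eq: "(fst s i, snd s i) = (fst s (Suc i), snd s (Suc i))"
      obtain q where q: "m = Suc q" using i by (cases m) auto
      have iq: "i \<le> q" using i q by simp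
      have d: "cmp m (coface q (Suc i)) (codegen q i) x = (if x = Suc i then i else x)" if "x \<le> m" for x
        using that q iq by (auto simp: coface_def codegen_def)
      have D: "codegen q i \<in> Delta m q" using iq q by auto
      \<comment> \<open>Deleting the second copy of a repeated vertex and repeating the first one gives \<open>s\<close> back.\<close>
      have "pull m (codegen q i) (pull q (coface q (Suc i)) s) = pull m (cmp m (coface q (Suc i)) (codegen q i)) s"
        by (rule pull_pull[OF D])
      also have "\<dots> = s"
      proof (rule prod_eqI)
        have a: "cmp m (coface q (Suc i)) (codegen q i) \<in> Delta m m"
          using D coface_Delta[of q "Suc i"] q by auto
        show "fst (pull m (cmp m (coface q (Suc i)) (codegen q i)) s) = fst s"
          using s a eq d by (intro Delta_eqI[of _ m p _ p]) (auto simp: pull_def mem_Times_iff simp del: cmp_apply, auto)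
        show "snd (pull m (cmp m (coface q (Suc i)) (codegen q i)) s) = snd s"
          using s a eq d by (intro Delta_eqI[of _ m n _ n]) (auto simp: pull_def mem_Times_iff simp del: cmp_apply, auto)
      qed
      finally have "pull m (codegen q i) (pull q (coface q (Suc i)) s) = s" .
      moreover have "defined_on G q (pull q (coface q (Suc i)) s)"
        using q s by (intro small) auto
      ultimately show False using defined_on_pull[OF G _ D] s(2) by metis
    qed
    have mono: "fst s i \<le> fst s j \<and> snd s i \<le> snd s j" if "i \<le> j" "j \<le> m" for i j
      using s(1) that Delta_mono by (auto simp: mem_Times_iff)
    have "(fst s i, snd s i) \<noteq> (fst s j, snd s j)" if "i < j" "j \<le> m" for i j
      using step[of i] mono[of i "Suc i"] mono[of "Suc i" j] that by auto
    then show "inj_on (\<lambda>i. (fst s i, snd s i)) {..m}"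
      by (metis (no_types, lifting) atMost_iff inj_onI linorder_neqE_nat)
  qed
qed

section \<open>Trivial fibrations\<close>

definition triv_fib :: "'x sset \<Rightarrow> 'y sset \<Rightarrow> (nat \<Rightarrow> 'x \<Rightarrow> 'y) \<Rightarrow> bool" where
  "triv_fib X Y f \<longleftrightarrow> simplicial_map X Y f \<and>
     (\<forall>n e y. simplicial_map (boundary n) X e \<longrightarrow> y \<in> simplices Y n \<longrightarrow>
        (\<forall>m. \<forall>u\<in>simplices (boundary n) m. f m (e m u) = sact Y m n u y) \<longrightarrow>
        (\<exists>x\<in>simplices X n. f n x = y \<and> (\<forall>m. \<forall>u\<in>simplices (boundary n) m. sact X m n u x = e m u)))"

lemma triv_fib_map: "triv_fib X Y f \<Longrightarrow> simplicial_map X Y f"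
  by (simp add: triv_fib_def)

lemma triv_fib_fill:
  assumes "triv_fib X Y f" "simplicial_map (boundary n) X e" "y \<in> simplices Y n"
    and "\<And>m u. u \<in> simplices (boundary n) m \<Longrightarrow> f m (e m u) = sact Y m n u y"
  obtains x where "x \<in> simplices X n" "f n x = y"
    "\<And>m u. u \<in> simplices (boundary n) m \<Longrightarrow> sact X m n u x = e m u"
proof -
  have "\<exists>x\<in>simplices X n. f n x = y \<and> (\<forall>m. \<forall>u\<in>simplices (boundary n) m. sact X m n u x = e m u)"
    using assms(1)[unfolded triv_fib_def, THEN conjunct2, rule_format, OF assms(2,3)] assms(4) by blast
  with that show thesis by blast
qed

text \<open>
  This turns adjoining a missing simplex \<open>s\<close> to the domain of a partial map into an extension
  problem from \<open>A\<close> to $\Delta^m$, where \<open>A\<close> records which faces of \<open>s\<close> are already in the domain.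
\<close>

lemma partial_map_around_simplex:
  assumes G: "partial_map p n X G"
    and A: "\<And>k u. u \<in> A k \<Longrightarrow> u \<in> Delta k m" "\<And>k l u \<theta>. u \<in> A k \<Longrightarrow> \<theta> \<in> Delta l k \<Longrightarrow> cmp l u \<theta> \<in> A l"
    and d: "\<And>k u. u \<in> A k \<Longrightarrow> defined_on G k (pull k u s)"
  obtains e where "simplicial_map (substd m A) X e" "\<And>k u. u \<in> A k \<Longrightarrow> (k, pull k u s, e k u) \<in> G"
proof -
  define e where "e k u = (THE x. (k, pull k u s, x) \<in> G)" for k u
  have eq: "e k u = x" if "(k, pull k u s, x) \<in> G" for k u x
    unfolding e_def using that partial_map_unique[OF G] by blast
  have mem: "(k, pull k u s, e k u) \<in> G" if "u \<in> A k" for k u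
    using d[OF that] unfolding defined_on_def by (metis eq)
  have "simplicial_map (substd m A) X e"
  proof (rule simplicial_mapI)
    show "e k u \<in> simplices X k" if "u \<in> simplices (substd m A) k" for k u
      using that partial_map_val[OF G mem] by simp
    show "e l (sact (substd m A) l k \<theta> u) = sact X l k \<theta> (e k u)"
      if \<theta>: "\<theta> \<in> Delta l k" and "u \<in> simplices (substd m A) k" for l k \<theta> u
      using partial_map_act[OF G mem \<theta>] that by (simp add: pull_pull eq)
  qed
  with mem that show thesis by blast
qed

text \<open>
  A maximal partial lift is total: a missing simplex of least dimension has its whole boundary in
  the domain, and the trivial fibration fills it.
\<close>

theorem triv_fib_lift:
  assumes X: "simplicial_set X" and Y: "simplicial_set Y" and f: "triv_fib X Y f"
    and C: "subcomplex p n C" and g: "simplicial_map (subprod p n C) X g"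
    and \<psi>: "simplicial_map (stdprod p n) Y \<psi>"
    and fg: "\<And>m s. s \<in> C m \<Longrightarrow> f m (g m s) = \<psi> m s"
  obtains \<phi> where "\<phi> \<in> sset_hom (stdprod p n) X" "\<And>m s. s \<in> C m \<Longrightarrow> \<phi> m s = g m s"
    "\<And>m s. s \<in> Delta m p \<times> Delta m n \<Longrightarrow> f m (\<phi> m s) = \<psi> m s"
proof -
  define G0 where "G0 = {(m, s, x). s \<in> C m \<and> x = g m s}"
  define A where "A = {G. partial_map p n X G \<and> G0 \<subseteq> G \<and> (\<forall>m s x. (m, s, x) \<in> G \<longrightarrow> f m x = \<psi> m s)}"
  have "G0 \<in> A" unfolding A_def using partial_map_graph[OF C g] fg by (auto simp: G0_def)
  have "\<exists>M\<in>A. \<forall>G\<in>A. M \<subseteq> G \<longrightarrow> G = M"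
  proof (rule subset_Zorn_nonempty)
    show "A \<noteq> {}" using \<open>G0 \<in> A\<close> by blast
    fix \<C> assume c: "\<C> \<noteq> {}" "subset.chain A \<C>"
    then have "subset.chain {G. partial_map p n X G} \<C>" by (auto simp: subset.chain_def A_def)
    from partial_map_chain[OF this] c show "\<Union>\<C> \<in> A" by (fastforce simp: subset.chain_def A_def)
  qed
  then obtain M where M: "M \<in> A" and max: "\<And>G. G \<in> A \<Longrightarrow> M \<subseteq> G \<Longrightarrow> G = M" by blast
  have pM: "partial_map p n X M" and fM: "\<And>m s x. (m, s, x) \<in> M \<Longrightarrow> f m x = \<psi> m s" and GM: "G0 \<subseteq> M"
    using M by (auto simp: A_def)
  have tot: "defined_on M m\<^sub>0 s\<^sub>0" if s0: "s\<^sub>0 \<in> Delta m\<^sub>0 p \<times> Delta m\<^sub>0 n" for m\<^sub>0 s\<^sub>0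
  proof (rule ccontr)
    assume nd: "\<not> defined_on M m\<^sub>0 s\<^sub>0"
    obtain m s where
      s: "s \<in> Delta m p \<times> Delta m n" "\<not> defined_on M m s" "inj_on (\<lambda>i. (fst s i, snd s i)) {..m}"
      and faces: "\<And>k \<theta>. \<theta> \<in> Delta k m \<Longrightarrow> \<theta> ` {..k} \<noteq> {..m} \<Longrightarrow> defined_on M k (pull k \<theta> s)"
      by (rule partial_map_missing_simplex[OF pM s0 nd]) (rule that, assumption, assumption, assumption, simp)
    let ?B = "\<lambda>k. {u \<in> Delta k m. u ` {..k} \<noteq> {..m}}"
    obtain e where e: "simplicial_map (boundary m) X e" "\<And>k u. u \<in> ?B k \<Longrightarrow> (k, pull k u s, e k u) \<in> M"
    proof (rule partial_map_around_simplex[OF pM, of ?B m s])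
      fix k l u \<theta> assume "u \<in> ?B k" "\<theta> \<in> Delta l k"
      then show "cmp l u \<theta> \<in> ?B l"
        using sset_closed[OF simplicial_boundary, of \<theta> l k u m] by (simp add: boundary_substd)
    qed (use faces that in \<open>auto simp: boundary_substd\<close>)
    obtain x where x: "x \<in> simplices X m" "f m x = \<psi> m s"
      "\<And>k u. u \<in> simplices (boundary m) k \<Longrightarrow> sact X k m u x = e k u"
    proof (rule triv_fib_fill[OF f e(1), of "\<psi> m s"])
      show "\<psi> m s \<in> simplices Y m" using smap_closed[OF \<psi>, of s m] s by simp
      fix k u assume "u \<in> simplices (boundary m) k"
      then have u: "u \<in> ?B k" by (simp add: boundary_substd)
      have "f k (e k u) = \<psi> k (pull k u s)" using fM e(2)[OF u] by blast
      also have "\<dots> = sact Y k m u (\<psi> m s)" using smap_nat[OF \<psi>, of u k m s] u s by simp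
      finally show "f k (e k u) = sact Y k m u (\<psi> m s)" .
    qed (use that in blast)
    let ?M = "M \<union> {(k, pull k \<theta> s, sact X k m \<theta> x) | k \<theta>. \<theta> \<in> Delta k m}"
    have "partial_map p n X ?M"
    proof (rule partial_map_attach[OF X pM s(1) s(3) x(1)])
      fix k \<theta> y assume \<theta>: "\<theta> \<in> Delta k m" and y: "(k, pull k \<theta> s, y) \<in> M"
      have "\<theta> ` {..k} \<noteq> {..m}"
      proof
        assume im: "\<theta> ` {..k} = {..m}"
        obtain \<eta> where \<eta>: "\<eta> \<in> Delta m k" "cmp m \<theta> \<eta> = idD m"
          by (rule section_over_image[OF idD_Delta_r \<theta>]) (use im in auto)
        have "defined_on M m (pull m \<eta> (pull k \<theta> s))"
          by (rule defined_on_pull[OF pM defined_onI[OF y] \<eta>(1)])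
        then show False using s by (simp add: pull_pull[OF \<eta>(1)] \<eta>(2) del: restrict_apply cmp_apply)
      qed
      with \<theta> have B: "\<theta> \<in> ?B k" by simp
      then show "y = sact X k m \<theta> x"
        using partial_map_unique[OF pM y e(2)[OF B]] x(3)[of \<theta> k] by (simp add: boundary_substd)
    qed
    moreover have "f k z = \<psi> k t" if "(k, t, z) \<in> ?M" for k t z
      using that
    proof
      assume "(k, t, z) \<in> {(k, pull k \<theta> s, sact X k m \<theta> x) | k \<theta>. \<theta> \<in> Delta k m}"
      then obtain \<theta> where \<theta>: "\<theta> \<in> Delta k m" "t = pull k \<theta> s" "z = sact X k m \<theta> x" by blast
      then show ?thesis
        using smap_nat[OF \<psi> \<theta>(1), of s] smap_nat[OF triv_fib_map[OF f] \<theta>(1) x(1)] s(1) x(2) by simp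
    qed (rule fM)
    ultimately have "?M \<in> A" using GM by (auto simp: A_def)
    then have "?M = M" by (rule max) blast
    then have "(m, pull m (idD m) s, sact X m m (idD m) x) \<in> M" using idD_Delta by blast
    then show False using s(2) pull_id[OF s(1)] by (auto dest: defined_onI simp del: restrict_apply)
  qed
  obtain \<phi> where \<phi>: "\<phi> \<in> sset_hom (stdprod p n) X"
    "\<And>m s x. (m, s, x) \<in> M \<Longrightarrow> \<phi> m s = x" "\<And>m s. s \<in> Delta m p \<times> Delta m n \<Longrightarrow> (m, s, \<phi> m s) \<in> M"
    by (rule partial_map_total_map[OF pM tot]) (assumption, rule that, assumption, blast, blast)
  show thesis
  proof (rule that[OF \<phi>(1)])
    show "\<phi> m s = g m s" if "s \<in> C m" for m s
    proof (rule \<phi>(2))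
      show "(m, s, g m s) \<in> M" using GM that unfolding G0_def by blast
    qed
    show "f m (\<phi> m s) = \<psi> m s" if "s \<in> Delta m p \<times> Delta m n" for m s
      using fM \<phi>(3)[OF that] by blast
  qed
qed


section \<open>Pushout-products with horns\<close>

text \<open>
  The subcomplex $\partial\Delta^p\times\Delta^n\cup\Delta^p\times\Lambda^n_k$.
\<close>

definition hornprod :: "nat \<Rightarrow> nat \<Rightarrow> nat \<Rightarrow> nat \<Rightarrow> ((nat \<Rightarrow> nat) \<times> (nat \<Rightarrow> nat)) set" where
  "hornprod p n k m = {(u, w). u \<in> Delta m p \<and> w \<in> Delta m n \<and>
     (u ` {..m} \<noteq> {..p} \<or> (\<exists>i\<le>n. i \<noteq> k \<and> i \<notin> w ` {..m}))}"

lemma hornprodI1: "u \<in> Delta m p \<Longrightarrow> w \<in> Delta m n \<Longrightarrow> i \<le> p \<Longrightarrow> i \<notin> u ` {..m} \<Longrightarrow> (u, w) \<in> hornprod p n k m"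
  by (auto simp: hornprod_def)

lemma hornprodI2: "u \<in> Delta m p \<Longrightarrow> w \<in> Delta m n \<Longrightarrow> i \<le> n \<Longrightarrow> i \<noteq> k \<Longrightarrow> i \<notin> w ` {..m} \<Longrightarrow> (u, w) \<in> hornprod p n k m"
  by (auto simp: hornprod_def)

lemma not_hornprod1: "(u, w) \<notin> hornprod p n k m \<Longrightarrow> u \<in> Delta m p \<Longrightarrow> w \<in> Delta m n \<Longrightarrow> i \<le> p \<Longrightarrow>
    \<exists>x\<le>m. u x = i"
  using hornprodI1[of u m p w n i k] by blast

lemma not_hornprod2: "(u, w) \<notin> hornprod p n k m \<Longrightarrow> u \<in> Delta m p \<Longrightarrow> w \<in> Delta m n \<Longrightarrow> i \<le> n \<Longrightarrow> i \<noteq> k \<Longrightarrow>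
    \<exists>x\<le>m. w x = i"
  using hornprodI2[of u m p w n i k] by blast

lemma subcomplex_hornprod: "subcomplex p n (hornprod p n k)"
proof -
  have "pull l \<theta> (u, w) \<in> hornprod p n k l" if uw: "(u, w) \<in> hornprod p n k m" and \<theta>: "\<theta> \<in> Delta l m" for u w l m \<theta>
  proof (rule ccontr)
    assume "pull l \<theta> (u, w) \<notin> hornprod p n k l"
    then have n: "(cmp l u \<theta>, cmp l w \<theta>) \<notin> hornprod p n k l" by simp
    have D: "u \<in> Delta m p" "w \<in> Delta m n" using uw by (auto simp: hornprod_def)
    have D': "cmp l u \<theta> \<in> Delta l p" "cmp l w \<theta> \<in> Delta l n" using D \<theta> by auto
    have "i \<in> u ` {..m}" if "i \<le> p" for i
      using not_hornprod1[OF n D' that] Delta_le[OF \<theta>] by auto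
    moreover have "i \<in> w ` {..m}" if "i \<le> n" "i \<noteq> k" for i
      using not_hornprod2[OF n D' that] Delta_le[OF \<theta>] by auto
    ultimately show False using uw Delta_le[OF D(1)] by (auto simp: hornprod_def)
  qed
  then show ?thesis by (auto simp: subcomplex_def hornprod_def)
qed

text \<open>Inserting a value at position \<open>r\<close>; a section of the operator deleting that position.\<close>

definition insert_value :: "nat \<Rightarrow> nat \<Rightarrow> nat \<Rightarrow> (nat \<Rightarrow> nat) \<Rightarrow> nat \<Rightarrow> nat" where
  "insert_value m r v \<theta> = (\<lambda>x\<in>{..Suc m}. if x < r then \<theta> x else if x = r then v else \<theta> (x - 1))"

lemma insert_value_Delta:
  assumes \<theta>: "\<theta> \<in> Delta m p" and r: "r \<le> Suc m" and v: "v \<le> p"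
    and lo: "\<And>x. x < r \<Longrightarrow> \<theta> x \<le> v" and hi: "\<And>x. r \<le> x \<Longrightarrow> x \<le> m \<Longrightarrow> v \<le> \<theta> x"
  shows "insert_value m r v \<theta> \<in> Delta (Suc m) p"
proof (rule DeltaI)
  fix i assume "i \<le> Suc m"
  then show "insert_value m r v \<theta> i \<le> p" using v Delta_le[OF \<theta>] r by (auto simp: insert_value_def)
next
  fix i j assume ij: "i \<le> j" "j \<le> Suc m"
  consider "j < r" | "j = r" "i < r" | "i = j" | "i < r" "r < j" | "i = r" "r < j" | "r < i" "r < j"
    using ij by linarith
  then show "insert_value m r v \<theta> i \<le> insert_value m r v \<theta> j"
  proof cases
    case 4
    then have "\<theta> i \<le> v" "v \<le> \<theta> (j - 1)" using lo[of i] hi[of "j - 1"] ij by auto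
    then show ?thesis using 4 ij by (simp add: insert_value_def)
  qed (use ij r lo hi Delta_mono[OF \<theta>] in \<open>auto simp: insert_value_def\<close>)
qed (simp add: insert_value_def)

lemma insert_value_coface: "\<theta> \<in> Delta m p \<Longrightarrow> r \<le> Suc m \<Longrightarrow> cmp m (insert_value m r v \<theta>) (coface m r) = \<theta>"
  by (auto simp: fun_eq_iff insert_value_def coface_def Delta_undefined)

text \<open>
  The simplices outside \<open>hornprod\<close> are paired: with \<open>k \<in> {c, c + 1}\<close>, let \<open>(i, c')\<close> be the vertex
  of a chain next to its step from level \<open>c\<close> to level \<open>c + 1\<close> on the side of the level \<open>c' \<noteq> k\<close>;
  a chain is paired with the chain that has \<open>(i, k)\<close> toggled. The larger members of the pairs
  are those that cross from \<open>c\<close> to \<open>c + 1\<close> vertically.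
\<close>

definition crossing :: "nat \<Rightarrow> nat \<Rightarrow> nat \<Rightarrow> nat \<Rightarrow> nat \<Rightarrow> nat \<Rightarrow> (nat \<Rightarrow> nat) \<Rightarrow> (nat \<Rightarrow> nat) \<Rightarrow> bool" where
  "crossing p n k c m j u w \<longleftrightarrow> u \<in> Delta m p \<and> w \<in> Delta m n \<and> inj_on (\<lambda>i. (u i, w i)) {..m} \<and>
     (u, w) \<notin> hornprod p n k m \<and> j < m \<and> u j = u (Suc j) \<and> w j = c \<and> w (Suc j) = Suc c"

definition toggled :: "nat \<Rightarrow> nat \<Rightarrow> nat \<Rightarrow> nat" where
  "toggled k c j = (if k = c then j else Suc j)"

text \<open>
  The domain contains both members of a pair or none. Without this, a larger member could have
  all its faces in the domain and its values prescribed on all of them.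
\<close>

definition saturated :: "nat \<Rightarrow> nat \<Rightarrow> nat \<Rightarrow> nat \<Rightarrow> 'x graph \<Rightarrow> bool" where
  "saturated p n k c G \<longleftrightarrow> (\<forall>m j u w. crossing p n k c m j u w \<longrightarrow>
     defined_on G (m - 1) (pull (m - 1) (coface (m - 1) (toggled k c j)) (u, w)) \<longrightarrow> defined_on G m (u, w))"

lemma pair_inj_cmp:
  assumes inj: "inj_on (\<lambda>i. (u i, w i)) {..m}" and \<delta>: "\<delta> \<in> Delta_r l m"
  shows "inj_on (\<lambda>i. (cmp l u \<delta> i, cmp l w \<delta> i)) {..l}"
proof (rule inj_onI)
  fix a b assume ab: "a \<in> {..l}" "b \<in> {..l}" "(cmp l u \<delta> a, cmp l w \<delta> a) = (cmp l u \<delta> b, cmp l w \<delta> b)"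
  then have "\<delta> a = \<delta> b"
    using inj_onD[OF inj, of "\<delta> a" "\<delta> b"] Delta_le[OF Delta_r_Delta[OF \<delta>]] by simp
  then show "a = b" using \<delta> ab by (auto simp: Delta_r_def inj_on_def)
qed

text \<open>
  The vertex \<open>(i, c')\<close> that remains covers the same element of $[p]$ as the deleted one, and the level
  \<open>k\<close> of the deleted vertex may be missed.
\<close>

lemma crossing_face_not_hornprod:
  assumes c: "crossing p n k c (Suc m) j u w" and k: "k = c \<or> k = Suc c"
  shows "pull m (coface m (toggled k c j)) (u, w) \<notin> hornprod p n k m"
proof -
  let ?r = "toggled k c j"
  have D: "u \<in> Delta (Suc m) p" "w \<in> Delta (Suc m) n" and nh: "(u, w) \<notin> hornprod p n k (Suc m)"
    and j: "j \<le> m" "u j = u (Suc j)" "w j = c" "w (Suc j) = Suc c" using c by (auto simp: crossing_def)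
  have r: "?r \<le> Suc m" "w ?r = k" using j k by (auto simp: toggled_def)
  have other: "\<exists>y\<le>Suc m. y \<noteq> ?r \<and> u y = u ?r"
    using j by (intro exI[of _ "if k = c then Suc j else j"]) (auto simp: toggled_def)
  have lift: "\<exists>x\<le>m. coface m ?r x = y" if "y \<le> Suc m" "y \<noteq> ?r" for y
  proof -
    have "y \<in> coface m ?r ` {..m}" using that by (simp add: coface_image[OF r(1)])
    then show ?thesis by blast
  qed
  have 1: "\<exists>x\<le>m. u (coface m ?r x) = i" if i: "i \<le> p" for i
  proof -
    obtain y where "y \<le> Suc m" "u y = i" using not_hornprod1[OF nh D i] by blast
    then obtain z where "z \<le> Suc m" "z \<noteq> ?r" "u z = i" using other by metis
    then show ?thesis using lift[of z] by blast
  qed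
  have 2: "\<exists>x\<le>m. w (coface m ?r x) = i" if i: "i \<le> n" "i \<noteq> k" for i
  proof -
    obtain y where "y \<le> Suc m" "w y = i" using not_hornprod2[OF nh D i] by blast
    then show ?thesis using lift[of y] r i by blast
  qed
  have "cmp m u (coface m ?r) ` {..m} = {..p}"
  proof
    show "cmp m u (coface m ?r) ` {..m} \<subseteq> {..p}"
      using Delta_le[OF Delta_cmp[OF coface_Delta D(1)], of _ ?r] by auto
    show "{..p} \<subseteq> cmp m u (coface m ?r) ` {..m}"
    proof
      fix i assume "i \<in> {..p}"
      then obtain x where "x \<le> m" "u (coface m ?r x) = i" using 1 by auto
      then show "i \<in> cmp m u (coface m ?r) ` {..m}" by (intro image_eqI[of _ _ x]) auto
    qed
  qed
  moreover have "i \<in> cmp m w (coface m ?r) ` {..m}" if "i \<le> n" "i \<noteq> k" for i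
  proof -
    from 2[OF that] obtain x where "x \<le> m" "w (coface m ?r x) = i" by blast
    then show ?thesis by (intro image_eqI[of _ _ x]) auto
  qed
  ultimately show ?thesis by (auto simp: hornprod_def simp del: cmp_apply)
qed

text \<open>
  Every face of a crossing chain other than the paired one lies in \<open>hornprod\<close> or in an earlier
  pair. Deleting a vertex away from the crossing keeps the crossing. Deleting the vertex
  \<open>(i, c')\<close> of the crossing moves the step to the next column, so that the face
  is the paired face of a chain of the same dimension that crosses there.
\<close>

lemma crossing_other_face:
  assumes c: "crossing p n k c (Suc m) j u w" and k: "k = c \<or> k = Suc c" and n: "Suc c \<le> n"
    and s: "s \<le> Suc m" "s \<noteq> toggled k c j"
  shows "pull m (coface m s) (u, w) \<in> hornprod p n k m \<or>
     (\<exists>j'. crossing p n k c m j' (cmp m u (coface m s)) (cmp m w (coface m s))) \<or>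
     (\<exists>j' u' w'. crossing p n k c (Suc m) j' u' w' \<and> (if k = c then j < j' else j' < j) \<and>
        pull m (coface m s) (u', w') = pull m (coface m s) (u, w))"
proof (cases "pull m (coface m s) (u, w) \<in> hornprod p n k m")
  case False
  let ?d = "coface m s"
  have D: "u \<in> Delta (Suc m) p" "w \<in> Delta (Suc m) n" and inj: "inj_on (\<lambda>i. (u i, w i)) {..Suc m}"
    and nh: "(u, w) \<notin> hornprod p n k (Suc m)"
    and j: "j \<le> m" "u j = u (Suc j)" "w j = c" "w (Suc j) = Suc c" using c by (auto simp: crossing_def)
  note mu = Delta_mono[OF D(1)] and mw = Delta_mono[OF D(2)]
  have nf: "(cmp m u ?d, cmp m w ?d) \<notin> hornprod p n k m" using False by simp
  have Df: "cmp m u ?d \<in> Delta m p" "cmp m w ?d \<in> Delta m n" using D by auto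
  have d_ne: "?d x \<noteq> s" "?d x \<le> Suc m" if "x \<le> m" for x using that by (auto simp: coface_def)
  have hit_u: "\<exists>y\<le>Suc m. y \<noteq> s \<and> u y = i" if "i \<le> p" for i
    using not_hornprod1[OF nf Df that] d_ne by (metis cmp_apply)
  have hit_w: "\<exists>y\<le>Suc m. y \<noteq> s \<and> w y = i" if "i \<le> n" "i \<noteq> k" for i
    using not_hornprod2[OF nf Df that] d_ne by (metis cmp_apply)
  consider "s \<noteq> j \<and> s \<noteq> Suc j" | "k = c" "s = Suc j" | "k = Suc c" "s = j"
    using k s unfolding toggled_def by (cases "s = j"; cases "s = Suc j") auto
  then show ?thesis
  proof cases
    case 1
    define j' where "j' = (if s < j then j - 1 else j)"
    have "j' < m" using 1 j s by (auto simp: j'_def)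
    moreover have "?d j' = j" "?d (Suc j') = Suc j" using 1 \<open>j' < m\<close> by (auto simp: j'_def coface_def)
    ultimately have "crossing p n k c m j' (cmp m u ?d) (cmp m w ?d)"
      using Df nf pair_inj_cmp[OF inj coface_Delta_r] j by (simp add: crossing_def)
    then show ?thesis by blast
  next
    case 2
    \<comment> \<open>The level \<open>c + 1\<close> and the next column must still be hit, which determines the vertex after the step.\<close>
    obtain y where y: "y \<le> Suc m" "y \<noteq> Suc j" "w y = Suc c" using hit_w[OF n] 2 by auto
    have "Suc j < y" using y mw[of y j] j by (cases "y \<le> j") auto
    then have jm: "Suc (Suc j) \<le> Suc m" using y by simp
    have w2: "w (Suc (Suc j)) = Suc c"
      using mw[of "Suc j" "Suc (Suc j)"] mw[of "Suc (Suc j)" y] j y \<open>Suc j < y\<close> by auto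
    have u2: "u (Suc j) < u (Suc (Suc j))"
    proof -
      have "u (Suc j) \<noteq> u (Suc (Suc j))"
        using inj_onD[OF inj, of "Suc j" "Suc (Suc j)"] jm j w2 by auto
      then show ?thesis using mu[of "Suc j" "Suc (Suc j)"] jm by simp
    qed
    have up: "u (Suc (Suc j)) \<le> p" using Delta_le[OF D(1) jm] .
    obtain z where z: "z \<le> Suc m" "z \<noteq> Suc j" "u z = Suc (u j)"
      using hit_u[of "Suc (u j)"] u2 up j 2 by auto
    have "Suc j < z" using z mu[of z j] j by (cases "z \<le> j") auto
    then have u3: "u (Suc (Suc j)) = Suc (u j)" using u2 j z mu[of "Suc (Suc j)" z] by auto
    define u' w' where "u' = u(Suc j := Suc (u j))" and "w' = w(Suc j := c)"
    have D': "u' \<in> Delta (Suc m) p"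
    proof (rule DeltaI)
      fix a b assume ab: "a \<le> b" "b \<le> Suc m"
      consider "b = Suc j" "a \<le> j" | "a = Suc j" "b = Suc j" | "a = Suc j" "Suc (Suc j) \<le> b" | "a \<noteq> Suc j" "b \<noteq> Suc j"
        using ab by linarith
      then show "u' a \<le> u' b"
        using mu[of a b] mu[of a j] mu[of "Suc (Suc j)" b] ab j u3 jm by cases (auto simp: u'_def)
    qed (use Delta_le[OF D(1)] Delta_undefined[OF D(1)] u3 up jm in \<open>auto simp: u'_def\<close>)
    have E': "w' \<in> Delta (Suc m) n"
    proof (rule DeltaI)
      fix a b assume ab: "a \<le> b" "b \<le> Suc m"
      consider "b = Suc j" "a \<le> j" | "a = Suc j" "b = Suc j" | "a = Suc j" "Suc (Suc j) \<le> b" | "a \<noteq> Suc j" "b \<noteq> Suc j"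
        using ab by linarith
      then show "w' a \<le> w' b"
        using mw[of a b] mw[of a j] mw[of "Suc (Suc j)" b] ab j w2 jm by cases (auto simp: w'_def)
    qed (use Delta_le[OF D(2)] Delta_undefined[OF D(2)] n jm in \<open>auto simp: w'_def\<close>)
    have new: "(u' x, w' x) \<noteq> (u' (Suc j), w' (Suc j))" if "x \<le> Suc m" "x \<noteq> Suc j" for x
    proof (cases "x \<le> j")
      case True
      then show ?thesis using mu[of x j] j by (auto simp: u'_def)
    next
      case False
      then show ?thesis using mw[of "Suc (Suc j)" x] that w2 by (auto simp: w'_def)
    qed
    have inj': "inj_on (\<lambda>i. (u' i, w' i)) {..Suc m}"
    proof (rule inj_onI)
      fix a b assume "a \<in> {..Suc m}" "b \<in> {..Suc m}" "(u' a, w' a) = (u' b, w' b)"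
      then show "a = b" using new[of a] new[of b] inj_onD[OF inj, of a b]
        by (cases "a = Suc j"; cases "b = Suc j") (auto simp: u'_def w'_def)
    qed
    have nh': "(u', w') \<notin> hornprod p n k (Suc m)"
    proof -
      have "\<exists>x\<le>Suc m. u' x = i" if "i \<le> p" for i
        using hit_u[OF that] 2 by (auto simp: u'_def)
      moreover have "\<exists>x\<le>Suc m. w' x = i" if "i \<le> n" "i \<noteq> k" for i
        using hit_w[OF that] 2 by (auto simp: w'_def)
      ultimately show ?thesis using Delta_le[OF D'] by (force simp: hornprod_def)
    qed
    have "crossing p n k c (Suc m) (Suc j) u' w'"
      unfolding crossing_def using D' E' inj' nh' jm u3 w2 by (auto simp: u'_def w'_def)
    moreover have "pull m ?d (u', w') = pull m ?d (u, w)"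
      using 2 by (auto simp: fun_eq_iff u'_def w'_def coface_def)
    ultimately show ?thesis using 2(1) by (intro disjI2 exI[of _ "Suc j"] exI[of _ u'] exI[of _ w']) simp
  next
    case 3
    \<comment> \<open>The mirror image: the vertex before the step is determined.\<close>
    obtain y where y: "y \<le> Suc m" "y \<noteq> j" "w y = c" using hit_w[of c] n 3 by auto
    have "y < j" using y mw[of "Suc j" y] j by (cases "Suc j \<le> y") auto
    then obtain i where i: "j = Suc i" by (cases j) auto
    have w2: "w i = c" using mw[of y i] mw[of i j] j y \<open>y < j\<close> i by auto
    have u2: "u i < u j"
    proof -
      have "u i \<noteq> u j" using inj_onD[OF inj, of i j] j w2 i by auto
      then show ?thesis using mu[of i j] i j by simp
    qed
    have up: "u j \<le> p" using Delta_le[OF D(1), of j] j by simp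
    have "u j - 1 \<le> p" using up by simp
    from hit_u[OF this] obtain z where z: "z \<le> Suc m" "z \<noteq> j" "u z = u j - 1" unfolding 3 by blast
    have "z < j" using z mu[of "Suc j" z] j u2 by (cases "Suc j \<le> z") auto
    then have u3: "Suc (u i) = u j" using u2 j z mu[of z i] i by auto
    define u' w' where "u' = u(j := u i)" and "w' = w(j := Suc c)"
    have D': "u' \<in> Delta (Suc m) p"
    proof (rule DeltaI)
      fix a b assume ab: "a \<le> b" "b \<le> Suc m"
      consider "b = j" "a \<le> i" | "a = j" "b = j" | "a = j" "Suc j \<le> b" | "a \<noteq> j" "b \<noteq> j"
        using ab i by linarith
      then show "u' a \<le> u' b"
        using mu[of a b] mu[of a i] mu[of i b] ab j i by cases (auto simp: u'_def)
    qed (use Delta_le[OF D(1)] Delta_undefined[OF D(1)] less_le_trans[OF u2 up] j in \<open>auto simp: u'_def\<close>)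
    have E': "w' \<in> Delta (Suc m) n"
    proof (rule DeltaI)
      fix a b assume ab: "a \<le> b" "b \<le> Suc m"
      consider "b = j" "a \<le> i" | "a = j" "b = j" | "a = j" "Suc j \<le> b" | "a \<noteq> j" "b \<noteq> j"
        using ab i by linarith
      then show "w' a \<le> w' b"
        using mw[of a b] mw[of a i] mw[of "Suc j" b] ab j w2 i by cases (auto simp: w'_def)
    qed (use Delta_le[OF D(2)] Delta_undefined[OF D(2)] n j in \<open>auto simp: w'_def\<close>)
    have new: "(u' x, w' x) \<noteq> (u' j, w' j)" if "x \<le> Suc m" "x \<noteq> j" for x
    proof (cases "x \<le> i")
      case True
      then show ?thesis using mw[of x i] j i w2 by (auto simp: w'_def)
    next
      case False
      then show ?thesis using mu[of "Suc j" x] that j u2 i by (auto simp: u'_def)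
    qed
    have inj': "inj_on (\<lambda>i. (u' i, w' i)) {..Suc m}"
    proof (rule inj_onI)
      fix a b assume "a \<in> {..Suc m}" "b \<in> {..Suc m}" "(u' a, w' a) = (u' b, w' b)"
      then show "a = b" using new[of a] new[of b] inj_onD[OF inj, of a b]
        by (cases "a = j"; cases "b = j") (auto simp: u'_def w'_def)
    qed
    have nh': "(u', w') \<notin> hornprod p n k (Suc m)"
    proof -
      have "\<exists>x\<le>Suc m. u' x = l" if "l \<le> p" for l
        using hit_u[OF that] 3 by (auto simp: u'_def)
      moreover have "\<exists>x\<le>Suc m. w' x = l" if "l \<le> n" "l \<noteq> k" for l
        using hit_w[OF that] 3 by (auto simp: w'_def)
      ultimately show ?thesis using Delta_le[OF D'] by (force simp: hornprod_def)
    qed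
    have "crossing p n k c (Suc m) i u' w'"
      unfolding crossing_def using D' E' inj' nh' j i w2 by (auto simp: u'_def w'_def)
    moreover have "pull m ?d (u', w') = pull m ?d (u, w)"
      using 3 by (auto simp: fun_eq_iff u'_def w'_def coface_def)
    ultimately show ?thesis using 3(1) i by (intro disjI2 exI[of _ i] exI[of _ u'] exI[of _ w']) simp
  qed
qed simp


text \<open>
  Every chain outside \<open>hornprod\<close> belongs to a pair: either it crosses vertically already, or the
  vertex \<open>(i, k)\<close> can be inserted next to the step.
\<close>

lemma crossing_above:
  assumes D: "u \<in> Delta m p" "w \<in> Delta m n" and inj: "inj_on (\<lambda>i. (u i, w i)) {..m}"
    and nh: "(u, w) \<notin> hornprod p n k m" and k: "k = c \<or> k = Suc c" and n: "Suc c \<le> n"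
  shows "(\<exists>j. crossing p n k c m j u w) \<or>
    (\<exists>j u' w'. crossing p n k c (Suc m) j u' w' \<and> pull m (coface m (toggled k c j)) (u', w') = (u, w))"
proof -
  note mu = Delta_mono[OF D(1)] and mw = Delta_mono[OF D(2)]
  have insert_value_new: "crossing p n k c (Suc m) j (insert_value m r a u) (insert_value m r b w) \<and>
      pull m (coface m (toggled k c j)) (insert_value m r a u, insert_value m r b w) = (u, w)"
    if r: "r \<le> Suc m" "r = toggled k c j" and j: "j < Suc m" "insert_value m r a u j = insert_value m r a u (Suc j)"
      "insert_value m r b w j = c" "insert_value m r b w (Suc j) = Suc c"
      and Du: "insert_value m r a u \<in> Delta (Suc m) p" and Dw: "insert_value m r b w \<in> Delta (Suc m) n"
      and new: "\<And>x. x \<le> m \<Longrightarrow> (u x, w x) \<noteq> (a, b)" for r a b j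
  proof -
    have val: "(insert_value m r a u x, insert_value m r b w x) = (if x < r then (u x, w x) else if x = r then (a, b) else (u (x - 1), w (x - 1)))"
      if "x \<le> Suc m" for x using that by (simp add: insert_value_def)
    have "inj_on (\<lambda>i. (insert_value m r a u i, insert_value m r b w i)) {..Suc m}"
    proof (rule linorder_inj_onI')
      fix x y assume "x \<in> {..Suc m}" "y \<in> {..Suc m}" "x < y"
      then have xy: "x \<le> Suc m" "y \<le> Suc m" "x < y" "y - 1 \<le> m" by auto
      have neq: "(u x', w x') \<noteq> (u y', w y')" if "x' < y'" "y' \<le> m" for x' y'
        using inj_onD[OF inj, of x' y'] that by auto
      show "(insert_value m r a u x, insert_value m r b w x) \<noteq> (insert_value m r a u y, insert_value m r b w y)"
        unfolding val[OF xy(1)] val[OF xy(2)]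
        using xy r(1) neq[of x y] neq[of x "y - 1"] neq[of "x - 1" "y - 1"] new[of x] new[of "y - 1"]
        by (auto split: if_splits)
    qed
    moreover have "(insert_value m r a u, insert_value m r b w) \<notin> hornprod p n k (Suc m)"
    proof
      assume "(insert_value m r a u, insert_value m r b w) \<in> hornprod p n k (Suc m)"
      then have "pull m (coface m r) (insert_value m r a u, insert_value m r b w) \<in> hornprod p n k m"
        using subcomplex_hornprod[of p n k] coface_Delta[of m r] unfolding subcomplex_def by blast
      then show False
        using nh by (simp add: insert_value_coface[OF D(1) r(1)] insert_value_coface[OF D(2) r(1)] del: cmp_apply)
    qed
    ultimately show ?thesis
      using Du Dw j r(1) unfolding r(2)[symmetric]
      by (simp add: crossing_def insert_value_coface[OF D(1) r(1)] insert_value_coface[OF D(2) r(1)] del: cmp_apply)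
  qed
  from k show ?thesis
  proof
    assume k: "k = c"
    have ex: "\<exists>x. x \<le> m \<and> w x = Suc c" using not_hornprod2[OF nh D n] k by auto
    define f where "f = (LEAST x. x \<le> m \<and> w x = Suc c)"
    have f: "f \<le> m" "w f = Suc c" using LeastI_ex[OF ex] by (auto simp: f_def)
    have below: "w x \<le> c" if "x < f" for x
    proof -
      have "w x \<noteq> Suc c" using not_less_Least[OF that[unfolded f_def]] that f by auto
      then show ?thesis using mw[of x f] that f by simp
    qed
    show ?thesis
    proof (cases "\<exists>j. f = Suc j \<and> u j = u f \<and> w j = c")
      case True
      then show ?thesis using D inj nh f by (auto simp: crossing_def)
    next
      case False
      have new: "(u x, w x) \<noteq> (u f, c)" if "x \<le> m" for x
      proof
        assume x: "(u x, w x) = (u f, c)"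
        have "x < f" using mw[of f x] f x that by (cases "f \<le> x") auto
        then obtain j where j: "f = Suc j" "x \<le> j" by (cases f) auto
        have "u j = u f" using mu[of x j] mu[of j f] j f x by auto
        moreover have "w j = c" using mw[of x j] below[of j] j f x by auto
        ultimately show False using False j by blast
      qed
      have "insert_value m f (u f) u \<in> Delta (Suc m) p"
        using f D by (intro insert_value_Delta) (auto intro: mu Delta_le)
      moreover have "insert_value m f c w \<in> Delta (Suc m) n"
        using f D n below by (intro insert_value_Delta) (auto dest: mw)
      ultimately show ?thesis
        using insert_value_new[of f f "u f" c] f k new by (auto simp: toggled_def insert_value_def)
    qed
  next
    assume k: "k = Suc c"
    have ex: "\<exists>x. x \<le> m \<and> w x = c" using not_hornprod2[OF nh D, of c] n k by auto
    define f where "f = (GREATEST x. x \<le> m \<and> w x = c)"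
    have f: "f \<le> m" "w f = c" using GreatestI_ex_nat[OF ex, of m] by (auto simp: f_def)
    have above: "Suc c \<le> w x" if "f < x" "x \<le> m" for x
    proof -
      have "w x \<noteq> c" using Greatest_le_nat[of "\<lambda>x. x \<le> m \<and> w x = c" x m] that by (auto simp: f_def)
      then show ?thesis using mw[of f x] that f by simp
    qed
    show ?thesis
    proof (cases "Suc f \<le> m \<and> u (Suc f) = u f \<and> w (Suc f) = Suc c")
      case True
      then have "crossing p n k c m f u w" using D inj nh f by (auto simp: crossing_def)
      then show ?thesis by blast
    next
      case False
      have new: "(u x, w x) \<noteq> (u f, Suc c)" if "x \<le> m" for x
      proof
        assume x: "(u x, w x) = (u f, Suc c)"
        have fx: "f < x" using mw[of x f] f x by (cases "x \<le> f") auto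
        have "u (Suc f) = u f" using mu[of "Suc f" x] mu[of f "Suc f"] fx x that by auto
        moreover have "w (Suc f) = Suc c" using mw[of "Suc f" x] above[of "Suc f"] fx x that by auto
        ultimately show False using False fx that by auto
      qed
      have "insert_value m (Suc f) (u f) u \<in> Delta (Suc m) p"
        using f D by (intro insert_value_Delta) (auto intro: mu Delta_le)
      moreover have "insert_value m (Suc f) (Suc c) w \<in> Delta (Suc m) n"
      proof (rule insert_value_Delta[OF D(2)])
        show "w x \<le> Suc c" if "x < Suc f" for x using mw[of x f] f that by simp
      qed (use f n above in auto)
      ultimately have "crossing p n k c (Suc m) f (insert_value m (Suc f) (u f) u) (insert_value m (Suc f) (Suc c) w) \<and>
          pull m (coface m (toggled k c f)) (insert_value m (Suc f) (u f) u, insert_value m (Suc f) (Suc c) w) = (u, w)"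
        by (rule insert_value_new[rotated 6]) (use f k new in \<open>auto simp: toggled_def insert_value_def\<close>)
      then show ?thesis by blast
    qed
  qed
qed

text \<open>
  If the paired face of a crossing chain is a degeneracy of a face of another one, then the two
  chains have the same vertices up to repetition: both the vertex of level \<open>c'\<close> at the step and
  the toggled vertex agree. So adjoining a crossing chain never adds half of another pair.
\<close>

lemma saturated_attach:
  assumes sat: "saturated p n k c M" and k: "k = c \<or> k = Suc c"
    and cr0: "crossing p n k c m0 j0 u0 w0"
    and faces: "\<And>l \<theta> i. \<theta> \<in> Delta l m0 \<Longrightarrow> i \<le> m0 \<Longrightarrow> i \<noteq> toggled k c j0 \<Longrightarrow> i \<notin> \<theta> ` {..l} \<Longrightarrow>
      defined_on M l (pull l \<theta> (u0, w0))"
  shows "saturated p n k c (M \<union> {(l, pull l \<theta> (u0, w0), v l \<theta>) | l \<theta>. \<theta> \<in> Delta l m0})"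
    (is "saturated p n k c ?M")
  unfolding saturated_def
proof (intro allI impI)
  fix m j u w
  assume cr: "crossing p n k c m j u w"
    and face: "defined_on ?M (m - 1) (pull (m - 1) (coface (m - 1) (toggled k c j)) (u, w))"
  obtain q where q: "m = Suc q" using cr by (cases m) (auto simp: crossing_def)
  let ?r = "toggled k c j" and ?s = "toggled k c j0"
  show "defined_on ?M m (u, w)"
  proof (cases "defined_on M (m - 1) (pull (m - 1) (coface (m - 1) ?r) (u, w))")
    case True
    then have "defined_on M m (u, w)" using sat cr unfolding saturated_def by blast
    then show ?thesis unfolding defined_on_def by blast
  next
    case False
    then obtain \<theta> where \<theta>: "\<theta> \<in> Delta q m0" "pull q (coface q ?r) (u, w) = pull q \<theta> (u0, w0)"
      using face q unfolding defined_on_def by auto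
    have im: "i \<in> \<theta> ` {..q}" if "i \<le> m0" "i \<noteq> ?s" for i
      using faces[OF \<theta>(1) that] False \<theta>(2) q by force
    have D: "u \<in> Delta (Suc q) p" "w \<in> Delta (Suc q) n" and j: "j \<le> q" "u j = u (Suc j)" "w j = c" "w (Suc j) = Suc c"
      using cr q by (auto simp: crossing_def)
    have D0: "u0 \<in> Delta m0 p" "w0 \<in> Delta m0 n" and j0: "j0 < m0" "u0 j0 = u0 (Suc j0)" "w0 j0 = c" "w0 (Suc j0) = Suc c"
      using cr0 by (auto simp: crossing_def)
    note mw = Delta_mono[OF D(2)] and mw0 = Delta_mono[OF D0(2)]
    have r: "?r \<le> Suc q" "?s \<le> m0" "w ?r = k" "w0 ?s = k" "u ?r = u j" "u0 ?s = u0 j0"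
      using j j0 k by (auto simp: toggled_def)
    have e: "u (coface q ?r x) = u0 (\<theta> x)" "w (coface q ?r x) = w0 (\<theta> x)" if "x \<le> q" for x
      using \<theta>(2) that by (auto simp: pull_def dest!: fun_cong[of _ _ x])
    have lo: "u x = u0 (\<theta> x)" "w x = w0 (\<theta> x)" if "x < ?r" "x \<le> q" for x
      using e[OF that(2)] that by (auto simp: coface_def)
    have hi: "u (Suc x) = u0 (\<theta> x)" "w (Suc x) = w0 (\<theta> x)" if "?r \<le> x" "x \<le> q" for x
      using e[OF that(2)] that by (auto simp: coface_def)
    have \<theta>le: "\<theta> x \<le> m0" if "x \<le> q" for x using Delta_le[OF \<theta>(1) that] .
    have key: "(\<forall>x<?r. x \<le> q \<longrightarrow> \<theta> x \<le> ?s) \<and> (\<forall>x. ?r \<le> x \<longrightarrow> x \<le> q \<longrightarrow> ?s \<le> \<theta> x) \<and> u j = u0 j0"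
    proof (cases "k = c")
      case True
      then have [simp]: "?r = j" "?s = j0" by (auto simp: toggled_def)
      have a: "\<theta> x \<le> j0" if "x < j" for x
      proof (rule ccontr)
        assume "\<not> \<theta> x \<le> j0"
        then have "Suc c \<le> w0 (\<theta> x)" using mw0[of "Suc j0" "\<theta> x"] \<theta>le[of x] that j j0 by auto
        then show False using lo(2)[of x] mw[of x j] that j by auto
      qed
      have b: "Suc j0 \<le> \<theta> x" if "j \<le> x" "x \<le> q" for x
      proof (rule ccontr)
        assume "\<not> Suc j0 \<le> \<theta> x"
        then have "w0 (\<theta> x) \<le> c" using mw0[of "\<theta> x" j0] j0 by auto
        then show False using hi(2)[of x] mw[of "Suc j" "Suc x"] that j by auto
      qed
      obtain x where x: "x \<le> q" "\<theta> x = Suc j0" using im[of "Suc j0"] j0 by auto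
      have "j \<le> x" using a[of x] x by (cases "x < j") auto
      then have "\<theta> j = Suc j0" using Delta_mono[OF \<theta>(1), of j x] b[of j] x j by auto
      then show ?thesis using a b hi(1)[of j] j j0 by (auto simp: Suc_le_eq less_imp_le)
    next
      case False
      with k have kc: "k = Suc c" by simp
      then have [simp]: "?r = Suc j" "?s = Suc j0" by (auto simp: toggled_def)
      have a: "\<theta> x \<le> j0" if "x \<le> j" for x
      proof (rule ccontr)
        assume "\<not> \<theta> x \<le> j0"
        then have "Suc c \<le> w0 (\<theta> x)" using mw0[of "Suc j0" "\<theta> x"] \<theta>le[of x] that j j0 by auto
        then show False using lo(2)[of x] mw[of x j] that j by auto
      qed
      have b: "Suc j0 \<le> \<theta> x" if "Suc j \<le> x" "x \<le> q" for x
      proof (rule ccontr)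
        assume "\<not> Suc j0 \<le> \<theta> x"
        then have "w0 (\<theta> x) \<le> c" using mw0[of "\<theta> x" j0] j0 by auto
        then show False using hi(2)[of x] mw[of "Suc j" "Suc x"] that j by auto
      qed
      obtain x where x: "x \<le> q" "\<theta> x = j0" using im[of j0] j0 by auto
      have "x \<le> j" using b[of x] x by (cases "Suc j \<le> x") auto
      then have "\<theta> j = j0" using Delta_mono[OF \<theta>(1), of x j] a[of j] x j by auto
      then show ?thesis using a b lo(1)[of j] j j0 by (auto simp: less_Suc_eq_le le_SucI)
    qed
    define \<theta>' where "\<theta>' = insert_value q ?r ?s \<theta>"
    have \<theta>': "\<theta>' \<in> Delta m m0" unfolding \<theta>'_def q
    proof (rule insert_value_Delta[OF \<theta>(1) r(1,2)])
      show "\<theta> x \<le> ?s" if "x < ?r" for x using key that r(1) by auto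
    qed (use key in blast)
    have "pull m \<theta>' (u0, w0) = (u, w)"
    proof -
      have val: "u0 (\<theta>' x) = u x \<and> w0 (\<theta>' x) = w x" if "x \<le> Suc q" for x
      proof -
        consider "x < ?r" | "x = ?r" | y where "x = Suc y" "?r \<le> y" by (cases x) (auto simp: not_less less_Suc_eq_le, linarith)
        then show ?thesis
        proof cases
          case 1
          then show ?thesis using lo[of x] r(1) that by (simp add: \<theta>'_def insert_value_def)
        next
          case 2
          then show ?thesis using r key that by (simp add: \<theta>'_def insert_value_def)
        next
          case 3
          then show ?thesis using hi[of y] that by (simp add: \<theta>'_def insert_value_def)
        qed
      qed
      have "cmp m u0 \<theta>' = u" "cmp m w0 \<theta>' = w"
        using D val q by (auto simp: fun_eq_iff Delta_undefined)
      then show ?thesis by simp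
    qed
    then have "(m, (u, w), v m \<theta>') \<in> ?M" using \<theta>' by (intro UnI2 CollectI exI[of _ m] exI[of _ \<theta>']) auto
    then show ?thesis by (rule defined_onI)
  qed
qed


text \<open>
  The pushout-product of a boundary inclusion and a horn inclusion is anodyne. Starting from
  \<open>hornprod\<close>, the pairs are adjoined one by one, each by filling the horn that lacks the smaller
  member. Pairs of smaller dimension come first; within a dimension the order is by the position
  of the crossing, from right to left for \<open>k = c\<close> and from left to right for \<open>k = c + 1\<close>, because
  \<open>crossing_other_face\<close> moves the crossing to the right or to the left.
\<close>

theorem kan_extend:
  assumes X: "kan_complex X" and nk: "1 \<le> n" "k \<le> n"
    and g: "simplicial_map (subprod p n (hornprod p n k)) X g"
  obtains \<phi> where "\<phi> \<in> sset_hom (stdprod p n) X" "\<And>m s. s \<in> hornprod p n k m \<Longrightarrow> \<phi> m s = g m s"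
proof -
  \<comment> \<open>Either neighbour of the level \<open>k\<close> can serve as the other side of the crossing; at the ends there is only one.\<close>
  define c where "c = (if k < n then k else k - 1)"
  have c: "k = c \<or> k = Suc c" "Suc c \<le> n" using nk by (auto simp: c_def)
  have SX: "simplicial_set X" by (rule kan_simplicial[OF X])
  define G0 where "G0 = {(m, s, x). s \<in> hornprod p n k m \<and> x = g m s}"
  define A where "A = {G. partial_map p n X G \<and> G0 \<subseteq> G \<and> saturated p n k c G}"
  have "defined_on G0 m s \<longleftrightarrow> s \<in> hornprod p n k m" for m s by (auto simp: defined_on_def G0_def)
  then have "saturated p n k c G0"
    unfolding saturated_def using crossing_face_not_hornprod[OF _ c(1)]
    by (metis Suc_pred' crossing_def gr_zeroI not_less_zero)
  then have "G0 \<in> A" using partial_map_graph[OF subcomplex_hornprod g] by (simp add: A_def G0_def)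
  have "\<exists>M\<in>A. \<forall>G\<in>A. M \<subseteq> G \<longrightarrow> G = M"
  proof (rule subset_Zorn_nonempty)
    show "A \<noteq> {}" using \<open>G0 \<in> A\<close> by blast
    fix \<C> assume ch: "\<C> \<noteq> {}" "subset.chain A \<C>"
    then have CA: "G \<in> A" if "G \<in> \<C>" for G using that by (auto simp: subset.chain_def)
    have "subset.chain {G. partial_map p n X G} \<C>" using ch by (auto simp: subset.chain_def A_def)
    from partial_map_chain[OF this] have "partial_map p n X (\<Union>\<C>)" .
    moreover have "G0 \<subseteq> \<Union>\<C>" using ch(1) CA by (auto simp: A_def)
    moreover have "saturated p n k c (\<Union>\<C>)"
      unfolding saturated_def
    proof (intro allI impI)
      fix m j u w assume cr: "crossing p n k c m j u w"
        and d: "defined_on (\<Union>\<C>) (m - 1) (pull (m - 1) (coface (m - 1) (toggled k c j)) (u, w))"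
      then obtain G where G: "G \<in> \<C>" "defined_on G (m - 1) (pull (m - 1) (coface (m - 1) (toggled k c j)) (u, w))"
        unfolding defined_on_def by blast
      have "saturated p n k c G" using CA[OF G(1)] by (simp add: A_def)
      then have "defined_on G m (u, w)" using cr G(2) unfolding saturated_def by blast
      then show "defined_on (\<Union>\<C>) m (u, w)" using G(1) unfolding defined_on_def by blast
    qed
    ultimately show "\<Union>\<C> \<in> A" by (simp add: A_def)
  qed
  then obtain M where M: "M \<in> A" and max: "\<And>G. G \<in> A \<Longrightarrow> M \<subseteq> G \<Longrightarrow> G = M" by blast
  have pM: "partial_map p n X M" and sat: "saturated p n k c M" and GM: "G0 \<subseteq> M" using M by (simp_all add: A_def)
  have horn: "defined_on M m s" if "s \<in> hornprod p n k m" for m s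
  proof (rule defined_onI)
    show "(m, s, g m s) \<in> M" using GM that unfolding G0_def by blast
  qed
  have attach: "defined_on M (Suc m) (u, w)"
    if cr: "crossing p n k c (Suc m) j u w"
      and other: "\<And>s. s \<le> Suc m \<Longrightarrow> s \<noteq> toggled k c j \<Longrightarrow> defined_on M m (pull m (coface m s) (u, w))" for m j u w
  proof (rule ccontr)
    assume nd: "\<not> defined_on M (Suc m) (u, w)"
    let ?r = "toggled k c j"
    have r: "?r \<le> Suc m" using cr by (auto simp: crossing_def toggled_def)
    have uw: "(u, w) \<in> Delta (Suc m) p \<times> Delta (Suc m) n" and inj: "inj_on (\<lambda>i. (fst (u, w) i, snd (u, w) i)) {..Suc m}"
      using cr by (auto simp: crossing_def)
    have nd': "\<not> defined_on M m (pull m (coface m ?r) (u, w))"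
      using sat cr nd unfolding saturated_def by fastforce
    have faces: "defined_on M l (pull l \<theta> (u, w))"
      if \<theta>: "\<theta> \<in> Delta l (Suc m)" and i: "i \<le> Suc m" "i \<noteq> ?r" "i \<notin> \<theta> ` {..l}" for l \<theta> i
    proof -
      obtain \<theta>' where \<theta>': "\<theta>' \<in> Delta l m" "\<theta> = cmp l (coface m i) \<theta>'"
        by (rule factor_coface[OF \<theta> i(1) i(3)])
      from defined_on_pull[OF pM other[OF i(1,2)] \<theta>'(1)] show ?thesis
        unfolding pull_pull[OF \<theta>'(1)] \<theta>'(2) .
    qed
    let ?A = "\<lambda>l. {\<theta> \<in> Delta l (Suc m). \<exists>i\<le>Suc m. i \<noteq> ?r \<and> i \<notin> \<theta> ` {..l}}"
    obtain h where h: "simplicial_map (horn (Suc m) ?r) X h"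
      "\<And>l \<theta>. \<theta> \<in> ?A l \<Longrightarrow> (l, pull l \<theta> (u, w), h l \<theta>) \<in> M"
    proof (rule partial_map_around_simplex[OF pM, of ?A "Suc m" "(u, w)"])
      fix l l' \<theta> \<eta> assume "\<theta> \<in> ?A l" "\<eta> \<in> Delta l' l"
      then show "cmp l' \<theta> \<eta> \<in> ?A l'"
        using sset_closed[OF simplicial_horn, of \<eta> l' l \<theta> "Suc m" ?r] by (simp add: horn_substd)
    next
      show "defined_on M l (pull l \<theta> (u, w))" if "\<theta> \<in> ?A l" for l \<theta> using that faces by blast
    qed (use that in \<open>auto simp: horn_substd\<close>)
    obtain x where x: "x \<in> simplices X (Suc m)"
      "\<And>l \<theta>. \<theta> \<in> simplices (horn (Suc m) ?r) l \<Longrightarrow> sact X l (Suc m) \<theta> x = h l \<theta>"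
      by (rule kan_fill[OF X _ r h(1)]) (simp, rule that, assumption, blast)
    let ?M = "M \<union> {(l, pull l \<theta> (u, w), sact X l (Suc m) \<theta> x) | l \<theta>. \<theta> \<in> Delta l (Suc m)}"
    have "partial_map p n X ?M"
    proof (rule partial_map_attach[OF SX pM uw inj x(1)])
      fix l \<theta> y assume \<theta>: "\<theta> \<in> Delta l (Suc m)" and y: "(l, pull l \<theta> (u, w), y) \<in> M"
      have "\<theta> \<in> ?A l"
      proof (rule ccontr)
        assume "\<theta> \<notin> ?A l"
        then have im: "coface m ?r ` {..m} \<subseteq> \<theta> ` {..l}" using \<theta> by (auto simp: coface_image[OF r])
        obtain \<eta> where \<eta>: "\<eta> \<in> Delta m l" "cmp m \<theta> \<eta> = coface m ?r"
          by (rule section_over_image[OF coface_Delta_r \<theta> im])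
        have "defined_on M m (pull m \<eta> (pull l \<theta> (u, w)))"
          by (rule defined_on_pull[OF pM defined_onI[OF y] \<eta>(1)])
        then show False using nd' unfolding pull_pull[OF \<eta>(1)] \<eta>(2) by blast
      qed
      then show "y = sact X l (Suc m) \<theta> x"
        using partial_map_unique[OF pM y h(2)] x(2)[of \<theta> l] by (simp add: horn_substd)
    qed
    moreover have "saturated p n k c ?M"
      by (rule saturated_attach[OF sat c(1) cr faces])
    ultimately have "?M \<in> A" using GM by (auto simp: A_def)
    then have "?M = M" by (rule max) blast
    then have "(Suc m, pull (Suc m) (idD (Suc m)) (u, w), sact X (Suc m) (Suc m) (idD (Suc m)) x) \<in> M"
      using idD_Delta by blast
    then show False using nd pull_id[OF uw] by (auto dest: defined_onI simp del: restrict_apply pull_Pair)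
  qed
  have all: "\<forall>j u w. crossing p n k c m j u w \<longrightarrow> defined_on M m (u, w)" for m
  proof (induction m rule: less_induct)
    case (less m)
    have "crossing p n k c m j u w \<longrightarrow> defined_on M m (u, w)"
      if "d = (if k = c then m - j else j)" for d j u w
      using that
    proof (induction d arbitrary: j u w rule: less_induct)
      case less_d: (less d)
      show ?case
      proof
        assume cr: "crossing p n k c m j u w"
        obtain q where q: "m = Suc q" using cr by (cases m) (auto simp: crossing_def)
        have "defined_on M (Suc q) (u, w)"
        proof (rule attach[OF cr[unfolded q]])
          fix s assume s: "s \<le> Suc q" "s \<noteq> toggled k c j"
          consider "pull q (coface q s) (u, w) \<in> hornprod p n k q"
            | j' where "crossing p n k c q j' (cmp q u (coface q s)) (cmp q w (coface q s))"
            | j' u' w' where "crossing p n k c (Suc q) j' u' w'" "if k = c then j < j' else j' < j"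
              "pull q (coface q s) (u', w') = pull q (coface q s) (u, w)"
            using crossing_other_face[OF cr[unfolded q] c s] by blast
          then show "defined_on M q (pull q (coface q s) (u, w))"
          proof cases
            case 1
            then show ?thesis by (rule horn)
          next
            case 2
            then show ?thesis using less.IH[of q] q by (simp del: cmp_apply)
          next
            case 3
            have "(if k = c then m - j' else j') < d"
              using 3 less_d.prems cr by (auto simp: crossing_def q)
            from less_d.IH[OF this refl, of u' w'] 3(1) q have "defined_on M (Suc q) (u', w')" by simp
            from defined_on_pull[OF pM this coface_Delta] show ?thesis unfolding 3(3)[symmetric] .
          qed
        qed
        then show "defined_on M m (u, w)" by (simp add: q)
      qed
    qed
    then show ?case by blast
  qed
  have tot: "defined_on M m\<^sub>0 s\<^sub>0" if s0: "s\<^sub>0 \<in> Delta m\<^sub>0 p \<times> Delta m\<^sub>0 n" for m\<^sub>0 s\<^sub>0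
  proof (rule ccontr)
    assume nd: "\<not> defined_on M m\<^sub>0 s\<^sub>0"
    obtain m s where
      s: "s \<in> Delta m p \<times> Delta m n" "\<not> defined_on M m s" "inj_on (\<lambda>i. (fst s i, snd s i)) {..m}"
      by (rule partial_map_missing_simplex[OF pM s0 nd]) (rule that, assumption, assumption, assumption)
    obtain u w where uw: "s = (u, w)" by (cases s)
    have D: "u \<in> Delta m p" "w \<in> Delta m n" using s(1) uw by auto
    have inj: "inj_on (\<lambda>i. (u i, w i)) {..m}" using s(3) uw by simp
    have nh: "(u, w) \<notin> hornprod p n k m" using s(2) horn uw by blast
    from crossing_above[OF D inj nh c] show False
    proof (elim disjE exE conjE)
      fix j assume "crossing p n k c m j u w"
      then show False using all s(2) uw by blast
    next
      fix j u' w' assume "crossing p n k c (Suc m) j u' w'"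
        and eq: "pull m (coface m (toggled k c j)) (u', w') = (u, w)"
      then have "defined_on M (Suc m) (u', w')" using all by blast
      from defined_on_pull[OF pM this coface_Delta] show False using s(2) unfolding eq[symmetric] uw by blast
    qed
  qed
  obtain \<phi> where \<phi>: "\<phi> \<in> sset_hom (stdprod p n) X" "\<And>m s x. (m, s, x) \<in> M \<Longrightarrow> \<phi> m s = x"
    by (rule partial_map_total_map[OF pM tot]) (assumption, rule that, assumption, blast)
  show thesis
  proof (rule that[OF \<phi>(1)])
    fix m s assume "s \<in> hornprod p n k m"
    then show "\<phi> m s = g m s" using GM by (intro \<phi>(2)) (auto simp: G0_def)
  qed
qed


section \<open>Restricted totalizations\<close>

text \<open>
  A functor from $\mathbb{\Delta}_r$ to simplicial sets.
\<close>

locale rcosimp =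
  fixes X :: "'x cosimp_sset"
  assumes lev: "simplicial_set (xlevel X p)"
    and map: "\<delta> \<in> Delta_r p q \<Longrightarrow> simplicial_map (xlevel X p) (xlevel X q) (xact X p q \<delta>)"
    and ident: "x \<in> simplices (xlevel X p) k \<Longrightarrow> xact X p p (idD p) k x = x"
    and comp: "\<delta> \<in> Delta_r p q \<Longrightarrow> \<epsilon> \<in> Delta_r q r \<Longrightarrow> x \<in> simplices (xlevel X p) k \<Longrightarrow>
      xact X q r \<epsilon> k (xact X p q \<delta> k x) = xact X p r (cmp p \<epsilon> \<delta>) k x"

locale rcosimp_map = X: rcosimp X + Y: rcosimp Y
  for X :: "'x cosimp_sset" and Y :: "'y cosimp_sset" +
  fixes f :: "nat \<Rightarrow> nat \<Rightarrow> 'x \<Rightarrow> 'y"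
  assumes lev: "simplicial_map (xlevel X p) (xlevel Y p) (f p)"
    and nat: "\<delta> \<in> Delta_r p q \<Longrightarrow> x \<in> simplices (xlevel X p) k \<Longrightarrow>
      f q k (xact X p q \<delta> k x) = xact Y p q \<delta> k (f p k x)"

lemma Tot_map: "t \<in> simplices (Tot_r X) n \<Longrightarrow> simplicial_map (stdprod p n) (xlevel X p) (t p)"
  by (simp add: Tot_r_def sset_hom_def)

lemma Tot_hom: "t \<in> simplices (Tot_r X) n \<Longrightarrow> t p \<in> sset_hom (stdprod p n) (xlevel X p)"
  by (simp add: Tot_r_def)

lemma Tot_val: "t \<in> simplices (Tot_r X) n \<Longrightarrow> u \<in> Delta k p \<Longrightarrow> w \<in> Delta k n \<Longrightarrow>
    t p k (u, w) \<in> simplices (xlevel X p) k"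
  using smap_closed[OF Tot_map, of t X n "(u, w)" p k] by simp

lemma Tot_act: "t \<in> simplices (Tot_r X) n \<Longrightarrow> u \<in> Delta k p \<Longrightarrow> w \<in> Delta k n \<Longrightarrow> \<alpha> \<in> Delta l k \<Longrightarrow>
    t p l (cmp l u \<alpha>, cmp l w \<alpha>) = sact (xlevel X p) l k \<alpha> (t p k (u, w))"
  using smap_nat[OF Tot_map, of t X n \<alpha> l k "(u, w)" p] by simp

lemma Tot_coact: "t \<in> simplices (Tot_r X) n \<Longrightarrow> \<delta> \<in> Delta_r p q \<Longrightarrow> u \<in> Delta k p \<Longrightarrow> w \<in> Delta k n \<Longrightarrow>
    t q k (cmp k \<delta> u, w) = xact X p q \<delta> k (t p k (u, w))"
  by (simp add: Tot_r_def)

lemma TotI: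
  assumes "\<And>p. t p \<in> sset_hom (stdprod p n) (xlevel X p)"
    and "\<And>p q \<delta> k u w. \<delta> \<in> Delta_r p q \<Longrightarrow> u \<in> Delta k p \<Longrightarrow> w \<in> Delta k n \<Longrightarrow>
      t q k (cmp k \<delta> u, w) = xact X p q \<delta> k (t p k (u, w))"
  shows "t \<in> simplices (Tot_r X) n"
  using assms by (simp add: Tot_r_def)

lemma Tot_eqI:
  assumes "t \<in> simplices (Tot_r X) n" "t' \<in> simplices (Tot_r X) n"
    and "\<And>p k u w. u \<in> Delta k p \<Longrightarrow> w \<in> Delta k n \<Longrightarrow> t p k (u, w) = t' p k (u, w)"
  shows "t = t'"
proof
  fix p
  show "t p = t' p"
    by (rule sset_hom_eqI[OF Tot_hom[OF assms(1)] Tot_hom[OF assms(2)]]) (use assms(3) in auto)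
qed

lemma sact_Tot: "u \<in> Delta k p \<Longrightarrow> w \<in> Delta k m \<Longrightarrow>
    sact (Tot_r X) m n \<theta> t p k (u, w) = t p k (u, cmp k \<theta> w)"
  by (simp add: Tot_r_def)

lemma Tot_sact_closed:
  assumes t: "t \<in> simplices (Tot_r X) n" and \<theta>: "\<theta> \<in> Delta m n"
  shows "sact (Tot_r X) m n \<theta> t \<in> simplices (Tot_r X) m"
proof (rule TotI)
  fix p
  have "simplicial_map (stdprod p m) (xlevel X p) (\<lambda>k s. t p k (fst s, cmp k \<theta> (snd s)))"
  proof (rule simplicial_mapI)
    fix k s assume "s \<in> simplices (stdprod p m) k"
    then show "t p k (fst s, cmp k \<theta> (snd s)) \<in> simplices (xlevel X p) k"
      using Tot_val[OF t] Delta_cmp[OF _ \<theta>] by auto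
  next
    fix l k \<alpha> s assume \<alpha>: "\<alpha> \<in> Delta l k" and s: "s \<in> simplices (stdprod p m) k"
    then have "cmp l \<theta> (cmp l (snd s) \<alpha>) = cmp l (cmp k \<theta> (snd s)) \<alpha>" by (simp add: cmp_assoc)
    then show "t p l (fst (sact (stdprod p m) l k \<alpha> s), cmp l \<theta> (snd (sact (stdprod p m) l k \<alpha> s)))
        = sact (xlevel X p) l k \<alpha> (t p k (fst s, cmp k \<theta> (snd s)))"
      using Tot_act[OF t _ Delta_cmp[OF _ \<theta>] \<alpha>, of "fst s" p "snd s"] s by (simp add: pull_def mem_Times_iff)
  qed
  from sset_hom_restrict[OF simplicial_stdprod this]
  have "(\<lambda>k. \<lambda>s\<in>Delta k p \<times> Delta k m. t p k (fst s, cmp k \<theta> (snd s))) \<in> sset_hom (stdprod p m) (xlevel X p)"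
    by simp
  moreover have "sact (Tot_r X) m n \<theta> t p = (\<lambda>k. \<lambda>s\<in>Delta k p \<times> Delta k m. t p k (fst s, cmp k \<theta> (snd s)))"
    by (simp add: Tot_r_def case_prod_beta')
  ultimately show "sact (Tot_r X) m n \<theta> t p \<in> sset_hom (stdprod p m) (xlevel X p)" by simp
next
  fix p q \<delta> k u w assume "\<delta> \<in> Delta_r p q" "u \<in> Delta k p" "w \<in> Delta k m"
  then show "sact (Tot_r X) m n \<theta> t q k (cmp k \<delta> u, w) = xact X p q \<delta> k (sact (Tot_r X) m n \<theta> t p k (u, w))"
    using Tot_coact[OF t _ _ Delta_cmp[OF _ \<theta>]] Delta_cmp[OF _ Delta_r_Delta] by (simp add: sact_Tot del: cmp_apply)
qed

lemma simplicial_Tot: "simplicial_set (Tot_r X)"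
  unfolding simplicial_set_def
proof (intro conjI allI ballI)
  show "sact (Tot_r X) m n \<alpha> t \<in> simplices (Tot_r X) m" if "\<alpha> \<in> Delta m n" "t \<in> simplices (Tot_r X) n" for m n \<alpha> t
    using Tot_sact_closed that by blast
  show "sact (Tot_r X) n n (idD n) t = t" if t: "t \<in> simplices (Tot_r X) n" for n t
    by (rule Tot_eqI[OF Tot_sact_closed[OF t idD_Delta] t]) (simp add: sact_Tot)
  fix k m n \<alpha> \<beta> t assume a: "\<alpha> \<in> Delta k m" "\<beta> \<in> Delta m n" "t \<in> simplices (Tot_r X) n"
  show "sact (Tot_r X) k n (cmp k \<beta> \<alpha>) t = sact (Tot_r X) k m \<alpha> (sact (Tot_r X) m n \<beta> t)"
  proof (rule Tot_eqI)
    show "sact (Tot_r X) k n (cmp k \<beta> \<alpha>) t \<in> simplices (Tot_r X) k" using a Tot_sact_closed by blast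
    show "sact (Tot_r X) k m \<alpha> (sact (Tot_r X) m n \<beta> t) \<in> simplices (Tot_r X) k" using a Tot_sact_closed by blast
    fix p l u w assume "u \<in> Delta l p" "w \<in> Delta l k"
    then show "sact (Tot_r X) k n (cmp k \<beta> \<alpha>) t p l (u, w) = sact (Tot_r X) k m \<alpha> (sact (Tot_r X) m n \<beta> t) p l (u, w)"
      using a Delta_cmp[of w l k \<alpha> m] by (simp add: sact_Tot cmp_assoc del: cmp_apply)
  qed
qed

lemma Tot_r_map_apply: "u \<in> Delta k p \<Longrightarrow> w \<in> Delta k n \<Longrightarrow> Tot_r_map f n t p k (u, w) = f p k (t p k (u, w))"
  by (simp add: Tot_r_map_def compose_def)

context rcosimp_map
begin

lemma Tot_r_map_closed:
  assumes t: "t \<in> simplices (Tot_r X) n" shows "Tot_r_map f n t \<in> simplices (Tot_r Y) n"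
proof (rule TotI)
  fix p
  have "(\<lambda>k. \<lambda>s\<in>Delta k p \<times> Delta k n. f p k (t p k s)) \<in> sset_hom (stdprod p n) (xlevel Y p)"
    using sset_hom_restrict[OF simplicial_stdprod smap_comp[OF Tot_map[OF t] lev]] by simp
  moreover have "Tot_r_map f n t p = (\<lambda>k. \<lambda>s\<in>Delta k p \<times> Delta k n. f p k (t p k s))"
    by (simp add: fun_eq_iff Tot_r_map_def compose_def)
  ultimately show "Tot_r_map f n t p \<in> sset_hom (stdprod p n) (xlevel Y p)" by simp
next
  fix p q \<delta> k u w assume "\<delta> \<in> Delta_r p q" "u \<in> Delta k p" "w \<in> Delta k n"
  then show "Tot_r_map f n t q k (cmp k \<delta> u, w) = xact Y p q \<delta> k (Tot_r_map f n t p k (u, w))"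
    using Tot_coact[OF t] nat[OF _ Tot_val[OF t]] Delta_cmp[OF _ Delta_r_Delta]
    by (simp add: Tot_r_map_apply del: cmp_apply)
qed

lemma simplicial_Tot_r_map: "simplicial_map (Tot_r X) (Tot_r Y) (Tot_r_map f)"
proof (rule simplicial_mapI)
  fix m n \<alpha> t assume a: "\<alpha> \<in> Delta m n" "t \<in> simplices (Tot_r X) n"
  show "Tot_r_map f m (sact (Tot_r X) m n \<alpha> t) = sact (Tot_r Y) m n \<alpha> (Tot_r_map f n t)"
  proof (rule Tot_eqI)
    show "Tot_r_map f m (sact (Tot_r X) m n \<alpha> t) \<in> simplices (Tot_r Y) m"
      using a Tot_sact_closed Tot_r_map_closed by blast
    show "sact (Tot_r Y) m n \<alpha> (Tot_r_map f n t) \<in> simplices (Tot_r Y) m"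
      using a Tot_sact_closed Tot_r_map_closed by blast
  qed (use a in \<open>simp add: sact_Tot Tot_r_map_apply del: cmp_apply\<close>)
qed (rule Tot_r_map_closed)

end

text \<open>
  The subcomplex $\partial\Delta^p\times\Delta^n\cup\Delta^p\times A$.
\<close>

definition pushprod :: "nat \<Rightarrow> nat \<Rightarrow> (nat \<Rightarrow> (nat \<Rightarrow> nat) set) \<Rightarrow> nat \<Rightarrow> ((nat \<Rightarrow> nat) \<times> (nat \<Rightarrow> nat)) set" where
  "pushprod p n A m = {(u, w). u \<in> Delta m p \<and> w \<in> Delta m n \<and> (u ` {..m} \<noteq> {..p} \<or> w \<in> A m)}"

definition subcomplex1 :: "nat \<Rightarrow> (nat \<Rightarrow> (nat \<Rightarrow> nat) set) \<Rightarrow> bool" where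
  "subcomplex1 n A \<longleftrightarrow> (\<forall>m. A m \<subseteq> Delta m n) \<and> (\<forall>m k. \<forall>\<theta>\<in>Delta k m. \<forall>w\<in>A m. cmp k w \<theta> \<in> A k)"

lemma nonsurj_cmp:
  assumes "u \<in> Delta m p" "u ` {..m} \<noteq> {..p}" "\<theta> \<in> Delta k m" shows "cmp k u \<theta> ` {..k} \<noteq> {..p}"
  using sset_closed[OF simplicial_boundary, of \<theta> k m u p] assms by (simp add: boundary_substd)

lemma subcomplex_pushprod: "subcomplex1 n A \<Longrightarrow> subcomplex p n (pushprod p n A)"
  unfolding subcomplex_def
proof (intro conjI allI ballI)
  assume A: "subcomplex1 n A"
  show "pushprod p n A m \<subseteq> Delta m p \<times> Delta m n" for m by (auto simp: pushprod_def)
  fix m k \<theta> s assume \<theta>: "\<theta> \<in> Delta k m" and "s \<in> pushprod p n A m"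
  then obtain u w where s: "s = (u, w)" "u \<in> Delta m p" "w \<in> Delta m n" "u ` {..m} \<noteq> {..p} \<or> w \<in> A m"
    by (auto simp: pushprod_def)
  have "cmp k u \<theta> ` {..k} \<noteq> {..p} \<or> cmp k w \<theta> \<in> A k"
    using s(4) nonsurj_cmp[OF s(2) _ \<theta>] A \<theta> unfolding subcomplex1_def by blast
  then show "pull k \<theta> s \<in> pushprod p n A k"
    using s \<theta> by (simp add: pushprod_def del: cmp_apply)
qed

definition lifts :: "nat \<Rightarrow> nat \<Rightarrow> (nat \<Rightarrow> ((nat \<Rightarrow> nat) \<times> (nat \<Rightarrow> nat)) set) \<Rightarrow> 'x sset \<Rightarrow> 'y sset \<Rightarrow> (nat \<Rightarrow> 'x \<Rightarrow> 'y) \<Rightarrow> bool" where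
  "lifts p n C X Y f \<longleftrightarrow> (\<forall>g \<psi>. simplicial_map (subprod p n C) X g \<longrightarrow> simplicial_map (stdprod p n) Y \<psi> \<longrightarrow>
     (\<forall>m. \<forall>s\<in>C m. f m (g m s) = \<psi> m s) \<longrightarrow>
     (\<exists>\<phi>\<in>sset_hom (stdprod p n) X. (\<forall>m. \<forall>s\<in>C m. \<phi> m s = g m s) \<and>
        (\<forall>m. \<forall>s\<in>Delta m p \<times> Delta m n. f m (\<phi> m s) = \<psi> m s)))"

context rcosimp_map
begin

text \<open>
  A simplex \<open>t\<close> of the totalization is built one cosimplicial degree at a time: once \<open>t q\<close> is
  known for \<open>q < p\<close>, naturality prescribes \<open>t p\<close> on $\partial\Delta^p\times\Delta^n$, and the
  prescription is consistent because a map of ordinals factors uniquely into a surjection and an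
  injection. There are no codegeneracies to respect, which is why lifting against
  \<open>pushprod p n A\<close> in every degree is enough.
\<close>

theorem Tot_lift:
  assumes A: "subcomplex1 n A" and lp: "\<And>p. lifts p n (pushprod p n A) (xlevel X p) (xlevel Y p) (f p)"
    and e: "simplicial_map (substd n A) (Tot_r X) e" and y: "y \<in> simplices (Tot_r Y) n"
    and fe: "\<And>m w. w \<in> A m \<Longrightarrow> Tot_r_map f m (e m w) = sact (Tot_r Y) m n w y"
  shows "\<exists>t\<in>simplices (Tot_r X) n. Tot_r_map f n t = y \<and> (\<forall>m. \<forall>w\<in>A m. sact (Tot_r X) m n w t = e m w)"
proof -
  have Ad: "w \<in> Delta k n" if "w \<in> A k" for w k using A that by (auto simp: subcomplex1_def)
  have e_simp: "e k w \<in> simplices (Tot_r X) k" if "w \<in> A k" for k w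
    using smap_closed[OF e] that by simp
  have e_act: "e l (cmp l w \<alpha>) = sact (Tot_r X) l k \<alpha> (e k w)" if "w \<in> A k" "\<alpha> \<in> Delta l k" for k l w \<alpha>
    using smap_nat[OF e that(2)] that(1) by simp
  define P where "P t p r \<longleftrightarrow> r \<in> sset_hom (stdprod p n) (xlevel X p) \<and>
      (\<forall>k. \<forall>u\<in>Delta k p. \<forall>w\<in>Delta k n. f p k (r k (u, w)) = y p k (u, w)) \<and>
      (\<forall>k. \<forall>u\<in>Delta k p. \<forall>w\<in>A k. r k (u, w) = e k w p k (u, idD k)) \<and>
      (\<forall>q<p. \<forall>\<delta>\<in>Delta_r q p. \<forall>k. \<forall>u\<in>Delta k q. \<forall>w\<in>Delta k n.
         r k (cmp k \<delta> u, w) = xact X q p \<delta> k (t q k (u, w)))"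
    for t :: "nat \<Rightarrow> nat \<Rightarrow> (nat \<Rightarrow> nat) \<times> (nat \<Rightarrow> nat) \<Rightarrow> 'x" and p r
  have "\<exists>t. \<forall>p. P t p (t p)"
  proof (rule dependent_wf_choice[OF wf_less_than])
    show "P t p r = P t' p r" if "\<And>z. (z, p) \<in> less_than \<Longrightarrow> t z = t' z" for t t' p r
      using that by (simp add: P_def)
  next
    fix p t assume IH: "\<And>q. (q, p) \<in> less_than \<Longrightarrow> P t q (t q)"
    have tv: "t q k (v, w) \<in> simplices (xlevel X q) k" and
      ty: "f q k (t q k (v, w)) = y q k (v, w)" if "q < p" "v \<in> Delta k q" "w \<in> Delta k n" for q k v w
    proof -
      have "simplicial_map (stdprod q n) (xlevel X q) (t q)" using IH[of q] that by (simp add: P_def sset_hom_def)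
      from smap_closed[OF this, of "(v, w)" k] show "t q k (v, w) \<in> simplices (xlevel X q) k" using that by simp
      show "f q k (t q k (v, w)) = y q k (v, w)" using IH[of q] that by (simp add: P_def)
    qed
    have te: "t q k (v, w) = e k w q k (v, idD k)" if "q < p" "v \<in> Delta k q" "w \<in> A k" for q k v w
      using IH[of q] that by (simp add: P_def)
    have tact: "t q l (cmp l v \<alpha>, cmp l w \<alpha>) = sact (xlevel X q) l k \<alpha> (t q k (v, w))"
      if "q < p" "v \<in> Delta k q" "w \<in> Delta k n" "\<alpha> \<in> Delta l k" for q k l v w \<alpha>
    proof -
      have "simplicial_map (stdprod q n) (xlevel X q) (t q)" using IH[of q] that by (simp add: P_def sset_hom_def)
      from smap_nat[OF this that(4), of "(v, w)"] show ?thesis using that by simp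
    qed
    have tco: "t q k (cmp k \<epsilon> v, w) = xact X q' q \<epsilon> k (t q' k (v, w))"
      if "q < p" "\<epsilon> \<in> Delta_r q' q" "v \<in> Delta k q'" "w \<in> Delta k n" for q q' k \<epsilon> v w
    proof (cases "q' < q")
      case True
      then show ?thesis using IH[of q] that by (simp add: P_def)
    next
      case False
      then have "q' = q" using Delta_r_dim_le[OF that(2)] by simp
      then have "\<epsilon> = idD q" using Delta_r_same_dim that(2) by blast
      then show ?thesis using \<open>q' = q\<close> X.ident[OF tv[OF that(1)]] that by simp
    qed
    \<comment> \<open>On a non-surjective \<open>u\<close> the value comes from the factorization of \<open>u\<close>; \<open>g_co\<close> shows that any other factorization gives the same value.\<close>
    define R where "R k u w x \<longleftrightarrow> (\<exists>q \<delta> v. \<delta> \<in> Delta_r q p \<and> v \<in> Delta k q \<and> v ` {..k} = {..q} \<and>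
        u = cmp k \<delta> v \<and> x = xact X q p \<delta> k (t q k (v, w)))" for k u w x
    define g where "g k s = (case s of (u, w) \<Rightarrow>
        if u ` {..k} = {..p} then e k w p k (u, idD k) else (THE x. R k u w x))" for k s
    have g_co: "g k (cmp k \<delta> v, w) = xact X q p \<delta> k (t q k (v, w))"
      if \<delta>: "\<delta> \<in> Delta_r q p" and q: "q < p" and v: "v \<in> Delta k q" and w: "w \<in> Delta k n" for q \<delta> k v w
    proof -
      obtain q' \<epsilon> v' where em: "\<epsilon> \<in> Delta_r q' q" "v' \<in> Delta k q'" "v' ` {..k} = {..q'}" "v = cmp k \<epsilon> v'"
        by (rule epi_mono[OF v])
      have q': "q' < p" using Delta_r_dim_le[OF em(1)] q by simp
      have u: "cmp k \<delta> v = cmp k (cmp q' \<delta> \<epsilon>) v'" using em by (simp add: cmp_assoc)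
      have ns: "cmp k \<delta> v ` {..k} \<noteq> {..p}"
      proof
        assume "cmp k \<delta> v ` {..k} = {..p}"
        then have "{..p} = \<delta> ` (v ` {..k})" using cmp_image by metis
        then have "{..p} \<subseteq> \<delta> ` {..q}" using Delta_le[OF v] by auto
        then have "card {..p} \<le> card {..q}" by (meson card_image_le card_mono finite_atMost finite_imageI le_trans)
        then show False using q by simp
      qed
      have "(THE x. R k (cmp k \<delta> v) w x) = xact X q' p (cmp q' \<delta> \<epsilon>) k (t q' k (v', w))"
      proof (rule the_equality)
        show "R k (cmp k \<delta> v) w (xact X q' p (cmp q' \<delta> \<epsilon>) k (t q' k (v', w)))"
          unfolding R_def u using em \<delta> by blast
        fix x assume "R k (cmp k \<delta> v) w x"
        then obtain q2 \<delta>2 v2 where 2: "\<delta>2 \<in> Delta_r q2 p" "v2 \<in> Delta k q2" "v2 ` {..k} = {..q2}"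
          "cmp k \<delta> v = cmp k \<delta>2 v2" "x = xact X q2 p \<delta>2 k (t q2 k (v2, w))" unfolding R_def by blast
        have "q' = q2 \<and> cmp q' \<delta> \<epsilon> = \<delta>2 \<and> v' = v2"
          by (rule epi_mono_unique[OF Delta_r_cmp[OF em(1) \<delta>] em(2,3) 2(1-3)]) (use u 2(4) in simp)
        then have "q2 = q'" "\<delta>2 = cmp q' \<delta> \<epsilon>" "v2 = v'" by auto
        then show "x = xact X q' p (cmp q' \<delta> \<epsilon>) k (t q' k (v', w))" using 2(5) by simp
      qed
      also have "\<dots> = xact X q p \<delta> k (xact X q' q \<epsilon> k (t q' k (v', w)))"
        by (rule X.comp[OF em(1) \<delta> tv[OF q' em(2) w], symmetric])
      also have "\<dots> = xact X q p \<delta> k (t q k (v, w))" using tco[OF q em(1,2) w] em(4) by simp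
      finally show ?thesis using ns by (simp add: g_def)
    qed
    have decomp: "\<exists>q \<delta> v. q < p \<and> \<delta> \<in> Delta_r q p \<and> v \<in> Delta k q \<and> u = cmp k \<delta> v"
      if "u \<in> Delta k p" "u ` {..k} \<noteq> {..p}" for u k
      by (rule factor_nonsurj[OF that]) (metis coface_Delta_r lessI)
    have g_A: "g k (u, w) = e k w p k (u, idD k)" if u: "u \<in> Delta k p" and w: "w \<in> A k" for k u w
    proof (cases "u ` {..k} = {..p}")
      case False
      from decomp[OF u False] obtain q \<delta> v where q: "q < p" "\<delta> \<in> Delta_r q p" "v \<in> Delta k q" "u = cmp k \<delta> v" by blast
      then show ?thesis using g_co[OF q(2,1,3) Ad[OF w]] te[OF q(1,3) w] Tot_coact[OF e_simp[OF w] q(2,3)] by simp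
    qed (simp add: g_def)
    let ?C = "pushprod p n A"
    have "simplicial_map (subprod p n ?C) (xlevel X p) g"
    proof (rule simplicial_mapI)
      fix k s assume "s \<in> simplices (subprod p n ?C) k"
      then obtain u w where s: "s = (u, w)" "u \<in> Delta k p" "w \<in> Delta k n" "u ` {..k} \<noteq> {..p} \<or> w \<in> A k"
        by (auto simp: pushprod_def)
      show "g k s \<in> simplices (xlevel X p) k"
      proof (cases "w \<in> A k")
        case True
        then show ?thesis using g_A[OF s(2) True] s(1) Tot_val[OF e_simp[OF True] s(2) idD_Delta] by simp
      next
        case False
        from decomp[OF s(2)] False s(4) obtain q \<delta> v where
          q: "q < p" "\<delta> \<in> Delta_r q p" "v \<in> Delta k q" "u = cmp k \<delta> v" by blast
        then show ?thesis
          using g_co[OF q(2,1,3) s(3)] s(1) smap_closed[OF X.map[OF q(2)] tv[OF q(1,3) s(3)]] by simp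
      qed
    next
      fix l k \<alpha> s assume \<alpha>: "\<alpha> \<in> Delta l k" and "s \<in> simplices (subprod p n ?C) k"
      then obtain u w where s: "s = (u, w)" "u \<in> Delta k p" "w \<in> Delta k n" "u ` {..k} \<noteq> {..p} \<or> w \<in> A k"
        by (auto simp: pushprod_def)
      have "g l (cmp l u \<alpha>, cmp l w \<alpha>) = sact (xlevel X p) l k \<alpha> (g k (u, w))"
      proof (cases "w \<in> A k")
        case True
        have w': "cmp l w \<alpha> \<in> A l" using A \<alpha> True unfolding subcomplex1_def by blast
        have u': "cmp l u \<alpha> \<in> Delta l p" using s(2) \<alpha> by blast
        have "g l (cmp l u \<alpha>, cmp l w \<alpha>) = sact (Tot_r X) l k \<alpha> (e k w) p l (cmp l u \<alpha>, idD l)"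
          using g_A[OF u' w'] e_act[OF True \<alpha>] by simp
        also have "\<dots> = e k w p l (cmp l u \<alpha>, cmp l \<alpha> (idD l))" by (rule sact_Tot[OF u' idD_Delta])
        also have "\<dots> = e k w p l (cmp l u \<alpha>, cmp l (idD k) \<alpha>)" using \<alpha> by simp
        also have "\<dots> = sact (xlevel X p) l k \<alpha> (e k w p k (u, idD k))"
          by (rule Tot_act[OF e_simp[OF True] s(2) idD_Delta \<alpha>])
        finally show ?thesis using g_A[OF s(2) True] by simp
      next
        case False
        from decomp[OF s(2)] False s(4) obtain q \<delta> v where
          q: "q < p" "\<delta> \<in> Delta_r q p" "v \<in> Delta k q" "u = cmp k \<delta> v" by blast
        have "g l (cmp l u \<alpha>, cmp l w \<alpha>) = g l (cmp l \<delta> (cmp l v \<alpha>), cmp l w \<alpha>)"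
          using q(4) \<alpha> by (simp add: cmp_assoc)
        also have "\<dots> = xact X q p \<delta> l (t q l (cmp l v \<alpha>, cmp l w \<alpha>))"
          by (rule g_co[OF q(2,1) Delta_cmp[OF \<alpha> q(3)] Delta_cmp[OF \<alpha> s(3)]])
        also have "\<dots> = xact X q p \<delta> l (sact (xlevel X q) l k \<alpha> (t q k (v, w)))"
          using tact[OF q(1,3) s(3) \<alpha>] by simp
        also have "\<dots> = sact (xlevel X p) l k \<alpha> (xact X q p \<delta> k (t q k (v, w)))"
          by (rule smap_nat[OF X.map[OF q(2)] \<alpha> tv[OF q(1,3) s(3)]])
        finally show ?thesis using g_co[OF q(2,1,3) s(3)] q(4) by simp
      qed
      then show "g l (sact (subprod p n ?C) l k \<alpha> s) = sact (xlevel X p) l k \<alpha> (g k s)" using s(1) by simp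
    qed
    moreover have "f p k (g k s) = y p k s" if sC: "s \<in> ?C k" for k s
    proof -
      obtain u w where s: "s = (u, w)" "u \<in> Delta k p" "w \<in> Delta k n" "u ` {..k} \<noteq> {..p} \<or> w \<in> A k"
        using sC by (auto simp: pushprod_def)
      show ?thesis
      proof (cases "w \<in> A k")
        case True
        have "f p k (e k w p k (u, idD k)) = Tot_r_map f k (e k w) p k (u, idD k)"
          by (rule Tot_r_map_apply[OF s(2) idD_Delta, symmetric])
        also have "\<dots> = y p k (u, cmp k w (idD k))" unfolding fe[OF True] by (rule sact_Tot[OF s(2) idD_Delta])
        finally show ?thesis using g_A[OF s(2) True] s by simp
      next
        case False
        from decomp[OF s(2)] False s(4) obtain q \<delta> v where
          q: "q < p" "\<delta> \<in> Delta_r q p" "v \<in> Delta k q" "u = cmp k \<delta> v" by blast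
        show ?thesis
          using g_co[OF q(2,1,3) s(3)] nat[OF q(2) tv[OF q(1,3) s(3)]] ty[OF q(1,3) s(3)]
            Tot_coact[OF y q(2,3) s(3)] s(1) q(4) by simp
      qed
    qed
    ultimately obtain r where r: "r \<in> sset_hom (stdprod p n) (xlevel X p)"
      "\<forall>m. \<forall>s\<in>?C m. r m s = g m s" "\<forall>m. \<forall>s\<in>Delta m p \<times> Delta m n. f p m (r m s) = y p m s"
      using lp[of p] Tot_map[OF y, of p] unfolding lifts_def by blast
    have "P t p r"
      unfolding P_def
    proof (intro conjI allI ballI impI)
      show "r \<in> sset_hom (stdprod p n) (xlevel X p)" by (rule r(1))
      show "f p k (r k (u, w)) = y p k (u, w)" if "u \<in> Delta k p" "w \<in> Delta k n" for k u w
        using r(3) that by blast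
      show "r k (u, w) = e k w p k (u, idD k)" if "u \<in> Delta k p" "w \<in> A k" for k u w
      proof -
        have "(u, w) \<in> ?C k" using that Ad by (simp add: pushprod_def)
        then show ?thesis using r(2) g_A[OF that] by simp
      qed
      fix q \<delta> k u w assume q: "q < p" "\<delta> \<in> Delta_r q p" "u \<in> Delta k q" "w \<in> Delta k n"
      have "cmp k \<delta> u ` {..k} \<noteq> {..p}"
      proof
        assume "cmp k \<delta> u ` {..k} = {..p}"
        then have "{..p} = \<delta> ` (u ` {..k})" using cmp_image by metis
        then have "{..p} \<subseteq> \<delta> ` {..q}" using Delta_le[OF q(3)] by auto
        then have "card {..p} \<le> card {..q}" by (meson card_image_le card_mono finite_atMost finite_imageI le_trans)
        then show False using q by simp
      qed
      then have "(cmp k \<delta> u, w) \<in> ?C k" using q Delta_r_Delta by (auto simp: pushprod_def simp del: cmp_apply)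
      then show "r k (cmp k \<delta> u, w) = xact X q p \<delta> k (t q k (u, w))" using r(2) g_co[OF q(2,1,3,4)] by simp
    qed
    then show "\<exists>r. P t p r" by (rule exI[of "P t p"])
  qed
  then obtain t where t: "\<And>p. P t p (t p)" by blast
  have T: "t \<in> simplices (Tot_r X) n"
  proof (rule TotI)
    show "t p \<in> sset_hom (stdprod p n) (xlevel X p)" for p using t[of p] by (simp add: P_def)
    fix p q \<delta> k u w assume a: "\<delta> \<in> Delta_r p q" "u \<in> Delta k p" "w \<in> Delta k n"
    show "t q k (cmp k \<delta> u, w) = xact X p q \<delta> k (t p k (u, w))"
    proof (cases "p < q")
      case True
      then show ?thesis using t[of q] a by (simp add: P_def)
    next
      case False
      then have "p = q" using Delta_r_dim_le[OF a(1)] by simp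
      then have "\<delta> = idD p" using Delta_r_same_dim a(1) by blast
      moreover have "t p k (u, w) \<in> simplices (xlevel X p) k"
        using smap_closed[of "stdprod p n" "xlevel X p" "t p" "(u, w)" k] t[of p] a by (simp add: P_def sset_hom_def)
      ultimately show ?thesis using \<open>p = q\<close> X.ident a by simp
    qed
  qed
  show ?thesis
  proof (intro bexI[OF _ T] conjI allI ballI)
    show "Tot_r_map f n t = y"
      by (rule Tot_eqI[OF Tot_r_map_closed[OF T] y]) (use t in \<open>simp add: Tot_r_map_apply P_def\<close>)
    fix m w assume w: "w \<in> A m"
    show "sact (Tot_r X) m n w t = e m w"
    proof (rule Tot_eqI[OF Tot_sact_closed[OF T Ad[OF w]] e_simp[OF w]])
      fix p k u v assume u: "u \<in> Delta k p" and v: "v \<in> Delta k m"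
      have wv: "cmp k w v \<in> A k" using A w v unfolding subcomplex1_def by blast
      have "sact (Tot_r X) m n w t p k (u, v) = t p k (u, cmp k w v)" by (rule sact_Tot[OF u v])
      also have "\<dots> = e k (cmp k w v) p k (u, idD k)" using t[of p] u wv by (simp add: P_def)
      also have "\<dots> = e m w p k (u, cmp k v (idD k))"
        unfolding e_act[OF w v] by (rule sact_Tot[OF u idD_Delta])
      finally show "sact (Tot_r X) m n w t p k (u, v) = e m w p k (u, v)" using v by simp
    qed
  qed
qed

end

lemma lifts_triv_fib:
  assumes "simplicial_set X" "simplicial_set Y" "triv_fib X Y f" "subcomplex p n C"
  shows "lifts p n C X Y f"
  unfolding lifts_def
proof (intro allI impI)
  fix g \<psi> assume g: "simplicial_map (subprod p n C) X g" and \<psi>: "simplicial_map (stdprod p n) Y \<psi>"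
    and "\<forall>m. \<forall>s\<in>C m. f m (g m s) = \<psi> m s"
  then have fg: "f m (g m s) = \<psi> m s" if "s \<in> C m" for m s using that by blast
  show "\<exists>\<phi>\<in>sset_hom (stdprod p n) X. (\<forall>m. \<forall>s\<in>C m. \<phi> m s = g m s) \<and>
        (\<forall>m. \<forall>s\<in>Delta m p \<times> Delta m n. f m (\<phi> m s) = \<psi> m s)"
  proof (rule triv_fib_lift[OF assms g \<psi>])
    fix \<phi> assume "\<phi> \<in> sset_hom (stdprod p n) X" "\<And>m s. s \<in> C m \<Longrightarrow> \<phi> m s = g m s"
      "\<And>m s. s \<in> Delta m p \<times> Delta m n \<Longrightarrow> f m (\<phi> m s) = \<psi> m s"
    then show ?thesis by (intro bexI[of _ \<phi>] conjI allI ballI)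
  qed (rule fg)
qed

lemma subcomplex1_boundary: "subcomplex1 n (\<lambda>m. {u \<in> Delta m n. u ` {..m} \<noteq> {..n}})"
  unfolding subcomplex1_def
proof (intro conjI allI ballI)
  fix m k \<theta> w assume "\<theta> \<in> Delta k m" "w \<in> {u \<in> Delta m n. u ` {..m} \<noteq> {..n}}"
  then show "cmp k w \<theta> \<in> {u \<in> Delta k n. u ` {..k} \<noteq> {..n}}"
    using nonsurj_cmp[of w m n \<theta> k] by (simp del: cmp_apply)
qed blast

text \<open>
  The pushout-product of two boundary inclusions is an inclusion, and trivial fibrations lift
  against all of these.
\<close>

theorem (in rcosimp_map) triv_fib_Tot:
  assumes "\<And>p. triv_fib (xlevel X p) (xlevel Y p) (f p)"
  shows "triv_fib (Tot_r X) (Tot_r Y) (Tot_r_map f)"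
  unfolding triv_fib_def
proof (intro conjI allI impI simplicial_Tot_r_map)
  fix n e y assume "simplicial_map (boundary n) (Tot_r X) e" "y \<in> simplices (Tot_r Y) n"
    "\<forall>m. \<forall>u\<in>simplices (boundary n) m. Tot_r_map f m (e m u) = sact (Tot_r Y) m n u y"
  then show "\<exists>x\<in>simplices (Tot_r X) n. Tot_r_map f n x = y \<and>
      (\<forall>m. \<forall>u\<in>simplices (boundary n) m. sact (Tot_r X) m n u x = e m u)"
    using Tot_lift[OF subcomplex1_boundary[of n], of e y]
      lifts_triv_fib[OF X.lev Y.lev assms subcomplex_pushprod[OF subcomplex1_boundary[of n]]]
    unfolding boundary_substd by simp
qed

text \<open>Being a Kan complex is lifting against the terminal map, so \<open>Tot_lift\<close> applies to it.\<close>

definition point :: "unit sset" where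
  "point = \<lparr>simplices = (\<lambda>_. UNIV), sact = (\<lambda>_ _ _ _. ())\<rparr>"

definition cosimp_point :: "unit cosimp_sset" where
  "cosimp_point = \<lparr>xlevel = (\<lambda>_. point), xact = (\<lambda>_ _ _ _ _. ())\<rparr>"

lemma hornprod_pushprod: "hornprod p n k = pushprod p n (simplices (horn n k))"
proof
  show "hornprod p n k m = pushprod p n (simplices (horn n k)) m" for m
    unfolding hornprod_def pushprod_def horn_substd simplices_substd by blast
qed

lemma rcosimp_point: "rcosimp cosimp_point"
  by (rule rcosimp.intro) (simp_all add: simplicial_set_def simplicial_map_def cosimp_point_def point_def)

theorem (in rcosimp) kan_Tot:
  assumes kan: "\<And>p. kan_complex (xlevel X p)"
  shows "kan_complex (Tot_r X)"
  unfolding kan_complex_def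
proof (intro conjI allI impI ballI simplicial_Tot)
  interpret P: rcosimp_map X cosimp_point "\<lambda>_ _ _. ()"
  proof (intro rcosimp_map.intro rcosimp_map_axioms.intro)
    show "rcosimp X" by (rule rcosimp_axioms)
    show "rcosimp cosimp_point" by (rule rcosimp_point)
    show "simplicial_map (xlevel X p) (xlevel cosimp_point p) (\<lambda>_ _. ())" for p
      by (simp add: simplicial_map_def cosimp_point_def point_def)
  qed simp
  fix n k h assume nk: "1 \<le> (n::nat)" "k \<le> n" and h: "h \<in> sset_hom (horn n k) (Tot_r X)"
  let ?A = "simplices (horn n k)"
  have A: "subcomplex1 n ?A"
    using sset_closed[OF simplicial_horn, of _ _ _ _ n k]
    unfolding subcomplex1_def by (auto simp: horn_substd simp del: cmp_apply)
  have horn: "horn n k = substd n ?A" by (simp add: horn_substd)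
  have lp: "lifts p n (pushprod p n ?A) (xlevel X p) (xlevel cosimp_point p) (\<lambda>_ _. ())" for p
    unfolding lifts_def hornprod_pushprod[symmetric]
  proof (intro allI impI)
    fix g and \<psi> :: "nat \<Rightarrow> (nat \<Rightarrow> nat) \<times> (nat \<Rightarrow> nat) \<Rightarrow> unit"
    assume g: "simplicial_map (subprod p n (hornprod p n k)) (xlevel X p) g"
    show "\<exists>\<phi>\<in>sset_hom (stdprod p n) (xlevel X p). (\<forall>m. \<forall>s\<in>hornprod p n k m. \<phi> m s = g m s) \<and>
        (\<forall>m. \<forall>s\<in>Delta m p \<times> Delta m n. () = \<psi> m s)"
    proof (rule kan_extend[OF kan nk g])
      fix \<phi> assume "\<phi> \<in> sset_hom (stdprod p n) (xlevel X p)" "\<And>m s. s \<in> hornprod p n k m \<Longrightarrow> \<phi> m s = g m s"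
      then show ?thesis by (intro bexI[of _ \<phi>] conjI allI ballI) simp_all
    qed
  qed
  have h': "simplicial_map (substd n ?A) (Tot_r X) h"
    using sset_homD[OF h] by (simp only: horn[symmetric])
  note lift = P.Tot_lift[OF A lp h']
  have "(\<lambda>p k s. ()) \<in> simplices (Tot_r cosimp_point) n"
    by (simp add: Tot_r_def sset_hom_def simplicial_map_def cosimp_point_def point_def extensional_def)
  moreover have "Tot_r_map (\<lambda>_ _ _. ()) m (h m w) = sact (Tot_r cosimp_point) m n w (\<lambda>p k s. ())" for m w
    by (intro ext) simp
  ultimately
  have "\<exists>t\<in>simplices (Tot_r X) n. \<forall>m. \<forall>u\<in>?A m. sact (Tot_r X) m n u t = h m u"
    using lift by blast
  then obtain t where t: "t \<in> simplices (Tot_r X) n" "\<And>m u. u \<in> ?A m \<Longrightarrow> sact (Tot_r X) m n u t = h m u" by blast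
  show "\<exists>t\<in>sset_hom (std_simplex n) (Tot_r X). \<forall>m. \<forall>u\<in>?A m. t m u = h m u"
  proof (intro bexI[OF _ yoneda_hom[OF simplicial_Tot t(1)]] allI ballI)
    fix m u assume "u \<in> ?A m"
    then show "(\<lambda>u\<in>Delta m n. sact (Tot_r X) m n u t) u = h m u" using t(2) by (simp add: horn_substd)
  qed
qed


section \<open>Homotopies in Kan complexes\<close>

declare atMost_0 [simp del] One_nat_def [simp del]

text \<open>
  The subcomplex $\partial\Delta^p\times\Delta^n$.
\<close>

definition bdprod :: "nat \<Rightarrow> nat \<Rightarrow> nat \<Rightarrow> ((nat \<Rightarrow> nat) \<times> (nat \<Rightarrow> nat)) set" where
  "bdprod p n m = {(u, w). u \<in> Delta m p \<and> w \<in> Delta m n \<and> u ` {..m} \<noteq> {..p}}"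

lemma subprod_mapI:
  assumes "\<And>m u w. (u, w) \<in> C m \<Longrightarrow> g m (u, w) \<in> simplices X m"
    and "\<And>k m \<theta> u w. \<theta> \<in> Delta k m \<Longrightarrow> (u, w) \<in> C m \<Longrightarrow> g k (cmp k u \<theta>, cmp k w \<theta>) = sact X k m \<theta> (g m (u, w))"
  shows "simplicial_map (subprod p n C) X g"
  by (rule simplicial_mapI) (use assms in force)+

lemma stdprod_mapI:
  assumes "\<And>m u w. u \<in> Delta m p \<Longrightarrow> w \<in> Delta m n \<Longrightarrow> g m (u, w) \<in> simplices X m"
    and "\<And>k m \<theta> u w. \<theta> \<in> Delta k m \<Longrightarrow> u \<in> Delta m p \<Longrightarrow> w \<in> Delta m n \<Longrightarrow>
      g k (cmp k u \<theta>, cmp k w \<theta>) = sact X k m \<theta> (g m (u, w))"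
  shows "simplicial_map (stdprod p n) X g"
  by (rule simplicial_mapI) (use assms in force)+

lemma stdprod_val: "simplicial_map (stdprod p n) X h \<Longrightarrow> u \<in> Delta m p \<Longrightarrow> w \<in> Delta m n \<Longrightarrow>
    h m (u, w) \<in> simplices X m"
  using smap_closed[of "stdprod p n" X h "(u, w)" m] by simp

lemma stdprod_act: "simplicial_map (stdprod p n) X h \<Longrightarrow> u \<in> Delta m p \<Longrightarrow> w \<in> Delta m n \<Longrightarrow> \<theta> \<in> Delta k m \<Longrightarrow>
    h k (cmp k u \<theta>, cmp k w \<theta>) = sact X k m \<theta> (h m (u, w))"
  using smap_nat[of "stdprod p n" X h \<theta> k m "(u, w)"] by simp

lemma subprod_val: "simplicial_map (subprod p n C) X h \<Longrightarrow> (u, w) \<in> C m \<Longrightarrow> h m (u, w) \<in> simplices X m"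
  using smap_closed[of "subprod p n C" X h "(u, w)" m] by simp

lemma subprod_act: "simplicial_map (subprod p n C) X h \<Longrightarrow> (u, w) \<in> C m \<Longrightarrow> \<theta> \<in> Delta k m \<Longrightarrow>
    h k (cmp k u \<theta>, cmp k w \<theta>) = sact X k m \<theta> (h m (u, w))"
  using smap_nat[of "subprod p n C" X h \<theta> k m "(u, w)"] by simp

lemma stdprod_map_comp2:
  assumes h: "simplicial_map (stdprod p n) X h" and \<iota>: "\<iota> \<in> Delta l n"
  shows "simplicial_map (stdprod p l) X (\<lambda>m s. h m (fst s, cmp m \<iota> (snd s)))"
proof (rule stdprod_mapI)
  fix m u w assume "u \<in> Delta m p" "w \<in> Delta m l"
  then show "h m (fst (u, w), cmp m \<iota> (snd (u, w))) \<in> simplices X m"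
    using stdprod_val[OF h _ Delta_cmp[OF _ \<iota>]] by simp
next
  fix k m \<theta> u w assume a: "\<theta> \<in> Delta k m" "u \<in> Delta m p" "w \<in> Delta m l"
  then show "h k (fst (cmp k u \<theta>, cmp k w \<theta>), cmp k \<iota> (snd (cmp k u \<theta>, cmp k w \<theta>))) =
      sact X k m \<theta> (h m (fst (u, w), cmp m \<iota> (snd (u, w))))"
    using stdprod_act[OF h a(2) Delta_cmp[OF a(3) \<iota>] a(1)] by (simp add: cmp_assoc[OF a(1)] del: cmp_apply)
qed

lemma missed_cmp: "\<theta> \<in> Delta k m \<Longrightarrow> i \<notin> w ` {..m} \<Longrightarrow> i \<notin> cmp k w \<theta> ` {..k}"
  using Delta_le by auto

text \<open>
  Two homotopies \<open>h\<^sub>1 : a \<rightarrow> b\<close> and \<open>h\<^sub>2 : a \<rightarrow> c\<close> form a horn $\Lambda^2_0$; its filler gives a homotopy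
  \<open>b \<rightarrow> c\<close>. On the boundary of $\Delta^p$ the filler may be prescribed.
\<close>

lemma kan_compose:
  assumes X: "kan_complex X" and h1: "simplicial_map (stdprod p 1) X h1" and h2: "simplicial_map (stdprod p 1) X h2"
    and b: "simplicial_map (subprod p 2 (bdprod p 2)) X b"
    and h12: "\<And>m u. u \<in> Delta m p \<Longrightarrow> h1 m (u, constD m 0) = h2 m (u, constD m 0)"
    and b1: "\<And>m u w. (u, w) \<in> bdprod p 2 m \<Longrightarrow> 2 \<notin> w ` {..m} \<Longrightarrow> b m (u, w) = h1 m (u, cmp m (\<lambda>i\<in>{..2}. min i 1) w)"
    and b2: "\<And>m u w. (u, w) \<in> bdprod p 2 m \<Longrightarrow> 1 \<notin> w ` {..m} \<Longrightarrow> b m (u, w) = h2 m (u, cmp m (\<lambda>i\<in>{..2}. min i 1) w)"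
  obtains h3 where "h3 \<in> sset_hom (stdprod p 1) X"
    "\<And>m u. u \<in> Delta m p \<Longrightarrow> h3 m (u, constD m 0) = h1 m (u, constD m 1)"
    "\<And>m u. u \<in> Delta m p \<Longrightarrow> h3 m (u, constD m 1) = h2 m (u, constD m 1)"
    "\<And>m u w. (u, w) \<in> bdprod p 1 m \<Longrightarrow> h3 m (u, w) = b m (u, cmp m (\<lambda>i\<in>{..1}. Suc i) w)"
proof -
  \<comment> \<open>\<open>\<mu>\<close> identifies both edges at the vertex 0 of $\Delta^2$ with $\Delta^1$, and \<open>\<iota>\<close> is the edge opposite to it.\<close>
  define \<mu> where "\<mu> = (\<lambda>i\<in>{..2::nat}. min i (1::nat))"
  define \<iota> where "\<iota> = (\<lambda>i\<in>{..1::nat}. Suc i)"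
  have \<mu>: "\<mu> \<in> Delta 2 1" by (rule DeltaI) (auto simp: \<mu>_def)
  have \<iota>: "\<iota> \<in> Delta 1 2" by (rule DeltaI) (auto simp: \<iota>_def)
  define g where "g m s = (case s of (u, w) \<Rightarrow> if u ` {..m} \<noteq> {..p} then b m (u, w)
      else if 2 \<notin> w ` {..m} then h1 m (u, cmp m \<mu> w) else h2 m (u, cmp m \<mu> w))" for m s
  have g1: "g m (u, w) = h1 m (u, cmp m \<mu> w)" if "u \<in> Delta m p" "w \<in> Delta m 2" "2 \<notin> w ` {..m}" for m u w
    using that b1[of u w m] by (auto simp: g_def bdprod_def \<mu>_def simp del: cmp_apply)
  have g2: "g m (u, w) = h2 m (u, cmp m \<mu> w)" if uw: "u \<in> Delta m p" "w \<in> Delta m 2" "1 \<notin> w ` {..m}" for m u w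
  proof (cases "2 \<in> w ` {..m} \<or> u ` {..m} \<noteq> {..p}")
    case True
    then show ?thesis using that b2[of u w m] by (auto simp: g_def bdprod_def \<mu>_def simp del: cmp_apply)
  next
    case False
    have "w = constD m 0"
    proof (rule Delta_eqI[OF uw(2)])
      show "constD m 0 \<in> Delta m 2" by (rule constD_Delta) simp
      fix i assume i: "i \<le> m"
      then have "w i \<noteq> 1" "w i \<noteq> 2" "w i \<le> 2" using uw(3) False Delta_le[OF uw(2)] by force+
      then show "w i = constD m 0 i" using i by auto
    qed
    then have "cmp m \<mu> w = constD m 0" by (simp add: \<mu>_def)
    then show ?thesis using False h12[OF uw(1)] by (simp add: g_def)
  qed
  have g3: "g m (u, w) = b m (u, w)" if "(u, w) \<in> bdprod p 2 m" for m u w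
    using that by (simp add: g_def bdprod_def)
  have C: "u \<in> Delta m p \<and> w \<in> Delta m 2 \<and> (2 \<notin> w ` {..m} \<or> 1 \<notin> w ` {..m} \<or> (u, w) \<in> bdprod p 2 m)"
    if "(u, w) \<in> hornprod p 2 0 m" for u w m
  proof -
    have "i = 1 \<or> i = 2" if "i \<le> 2" "i \<noteq> 0" for i :: nat using that by auto
    then show ?thesis using that unfolding hornprod_def bdprod_def by blast
  qed
  have gm: "simplicial_map (subprod p 2 (hornprod p 2 0)) X g"
  proof (rule subprod_mapI)
    fix m u w assume "(u, w) \<in> hornprod p 2 0 m"
    from C[OF this] have uw: "u \<in> Delta m p" "w \<in> Delta m 2"
      and "2 \<notin> w ` {..m} \<or> 1 \<notin> w ` {..m} \<or> (u, w) \<in> bdprod p 2 m" by auto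
    then show "g m (u, w) \<in> simplices X m"
      using g1[OF uw] g2[OF uw] g3 stdprod_val[OF h1 uw(1) Delta_cmp[OF uw(2) \<mu>]]
        stdprod_val[OF h2 uw(1) Delta_cmp[OF uw(2) \<mu>]] subprod_val[OF b] by metis
  next
    fix k m \<theta> u w assume \<theta>: "\<theta> \<in> Delta k m" and "(u, w) \<in> hornprod p 2 0 m"
    from C[OF this(2)] have uw: "u \<in> Delta m p" "w \<in> Delta m 2"
      and c: "2 \<notin> w ` {..m} \<or> 1 \<notin> w ` {..m} \<or> (u, w) \<in> bdprod p 2 m" by auto
    have uw': "cmp k u \<theta> \<in> Delta k p" "cmp k w \<theta> \<in> Delta k 2" using uw \<theta> by auto
    have \<mu>w: "cmp k \<mu> (cmp k w \<theta>) = cmp k (cmp m \<mu> w) \<theta>" by (rule cmp_assoc[OF \<theta>, symmetric])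
    from c show "g k (cmp k u \<theta>, cmp k w \<theta>) = sact X k m \<theta> (g m (u, w))"
    proof (elim disjE)
      assume w: "2 \<notin> w ` {..m}"
      show ?thesis
        unfolding g1[OF uw w] g1[OF uw' missed_cmp[OF \<theta> w]] \<mu>w
        by (rule stdprod_act[OF h1 uw(1) Delta_cmp[OF uw(2) \<mu>] \<theta>])
    next
      assume w: "1 \<notin> w ` {..m}"
      show ?thesis
        unfolding g2[OF uw w] g2[OF uw' missed_cmp[OF \<theta> w]] \<mu>w
        by (rule stdprod_act[OF h2 uw(1) Delta_cmp[OF uw(2) \<mu>] \<theta>])
    next
      assume w: "(u, w) \<in> bdprod p 2 m"
      then have w': "(cmp k u \<theta>, cmp k w \<theta>) \<in> bdprod p 2 k"
        using uw' nonsurj_cmp[OF uw(1) _ \<theta>] by (simp add: bdprod_def del: cmp_apply)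
      show ?thesis unfolding g3[OF w] g3[OF w'] by (rule subprod_act[OF b w \<theta>])
    qed
  qed
  obtain \<phi> where \<phi>: "\<phi> \<in> sset_hom (stdprod p 2) X" "\<And>m s. s \<in> hornprod p 2 0 m \<Longrightarrow> \<phi> m s = g m s"
    by (rule kan_extend[OF X _ _ gm]) (simp, simp, rule that, assumption, blast)
  define h3 where "h3 m s = \<phi> m (fst s, cmp m \<iota> (snd s))" for m s
  have "simplicial_map (stdprod p 1) X h3"
    unfolding h3_def by (rule stdprod_map_comp2[OF sset_homD[OF \<phi>(1)] \<iota>])
  from sset_hom_restrict[OF simplicial_stdprod this]
  have hom: "(\<lambda>m. \<lambda>s\<in>Delta m p \<times> Delta m 1. h3 m s) \<in> sset_hom (stdprod p 1) X" by simp
  have D: "constD m (0::nat) \<in> Delta m 1" "constD m (1::nat) \<in> Delta m 1"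
    "constD m (1::nat) \<in> Delta m 2" "constD m (2::nat) \<in> Delta m 2" for m by (rule constD_Delta, simp)+
  show thesis
  proof (rule that[OF hom])
    fix m u assume u: "u \<in> Delta m p"
    have i: "cmp m \<iota> (constD m 0) = constD m 1" "cmp m \<iota> (constD m 1) = constD m 2" by (auto simp: \<iota>_def fun_eq_iff)
    have m: "cmp m \<mu> (constD m 1) = constD m 1" "cmp m \<mu> (constD m 2) = constD m 1" by (auto simp: \<mu>_def fun_eq_iff)
    have c1: "2 \<notin> constD m 1 ` {..m}" "1 \<notin> constD m 2 ` {..m}" by auto
    have "(u, constD m 1) \<in> hornprod p 2 0 m" "(u, constD m 2) \<in> hornprod p 2 0 m"
      using hornprodI2[OF u D(3) _ _ c1(1)] hornprodI2[OF u D(4) _ _ c1(2)] by auto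
    from this[THEN \<phi>(2)]
    show "(\<lambda>s\<in>Delta m p \<times> Delta m 1. h3 m s) (u, constD m 0) = h1 m (u, constD m 1)"
      "(\<lambda>s\<in>Delta m p \<times> Delta m 1. h3 m s) (u, constD m 1) = h2 m (u, constD m 1)"
      using u D g1[OF u D(3) c1(1)] g2[OF u D(4) c1(2)] i m by (simp_all add: h3_def del: cmp_apply)
  next
    fix m u w assume uw: "(u, w) \<in> bdprod p 1 m"
    then have D: "u \<in> Delta m p" "w \<in> Delta m 1" by (auto simp: bdprod_def)
    have bd: "(u, cmp m \<iota> w) \<in> bdprod p 2 m" using uw \<iota> by (auto simp: bdprod_def simp del: cmp_apply)
    then have "(u, cmp m \<iota> w) \<in> hornprod p 2 0 m" by (auto simp: bdprod_def hornprod_def simp del: cmp_apply)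
    from \<phi>(2)[OF this] g3[OF bd] D
    show "(\<lambda>s\<in>Delta m p \<times> Delta m 1. h3 m s) (u, w) = b m (u, cmp m (\<lambda>i\<in>{..1}. Suc i) w)"
      by (simp add: h3_def \<iota>_def del: cmp_apply)
  qed
qed

section \<open>Homotopy classes\<close>

lemma const_at_closed: "simplicial_set X \<Longrightarrow> v \<in> simplices X 0 \<Longrightarrow> const_at X v m \<in> simplices X m"
  unfolding const_at_def by (rule sset_closed[OF _ constD_Delta[OF order_refl]])

lemma const_at_act: "simplicial_set X \<Longrightarrow> v \<in> simplices X 0 \<Longrightarrow> \<theta> \<in> Delta k m \<Longrightarrow>
    sact X k m \<theta> (const_at X v m) = const_at X v k"
  unfolding const_at_def using sset_comp[OF _ _ constD_Delta[OF order_refl]] by simp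

lemma const_at_map: "simplicial_map X Y f \<Longrightarrow> v \<in> simplices X 0 \<Longrightarrow> f m (const_at X v m) = const_at Y (f 0 v) m"
  unfolding const_at_def by (rule smap_nat[OF _ constD_Delta[OF order_refl]])

text \<open>
  Paths are homotopies of maps out of $\Delta^0$, so that paths and homotopies of spheres can be
  treated by the same lemmas.
\<close>

lemma path_rel_iff:
  assumes X: "simplicial_set X"
  shows "(x, y) \<in> path_rel X \<longleftrightarrow> (\<exists>h. simplicial_map (stdprod 0 1) X h \<and>
     h 0 (constD 0 0, constD 0 0) = x \<and> h 0 (constD 0 0, constD 0 1) = y)"
proof
  assume "(x, y) \<in> path_rel X"
  then obtain e where e: "e \<in> simplices X 1" "sact X 0 1 (constD 0 0) e = x" "sact X 0 1 (constD 0 1) e = y"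
    unfolding path_rel_def by blast
  have "simplicial_map (stdprod 0 1) X (\<lambda>m s. sact X m 1 (snd s) e)"
    by (rule stdprod_mapI) (auto intro: sset_closed[OF X _ e(1)] simp: sset_comp[OF X _ _ e(1)] simp del: cmp_apply)
  with e show "\<exists>h. simplicial_map (stdprod 0 1) X h \<and>
     h 0 (constD 0 0, constD 0 0) = x \<and> h 0 (constD 0 0, constD 0 1) = y" by fastforce
next
  assume "\<exists>h. simplicial_map (stdprod 0 1) X h \<and>
     h 0 (constD 0 0, constD 0 0) = x \<and> h 0 (constD 0 0, constD 0 1) = y"
  then obtain h where h: "simplicial_map (stdprod 0 1) X h"
    "h 0 (constD 0 0, constD 0 0) = x" "h 0 (constD 0 0, constD 0 1) = y" by blast
  have D: "constD 1 0 \<in> Delta 1 0" "idD 1 \<in> Delta 1 1" by (auto intro: constD_Delta)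
  have "sact X 0 1 (constD 0 i) (h 1 (constD 1 0, idD 1)) = h 0 (constD 0 0, constD 0 i)" if "i \<le> 1" for i
  proof -
    have i: "constD 0 i \<in> Delta 0 1" using that by (rule constD_Delta)
    have "cmp 0 (constD 1 0) (constD 0 i) = constD 0 0" "cmp 0 (idD 1) (constD 0 i) = constD 0 i"
      using that by (simp_all add: fun_eq_iff)
    then show ?thesis using stdprod_act[OF h(1) D i] by simp
  qed
  from this[of 0] this[of 1] show "(x, y) \<in> path_rel X"
    unfolding path_rel_def using h stdprod_val[OF h(1) D] by auto
qed

lemma no_bdprod_0: "(u, w) \<notin> bdprod 0 n m"
  by (auto simp: bdprod_def Delta_0 atMost_0)

text \<open>
  Reflexivity and the Euclidean law suffice, and the latter is what \<open>kan_compose\<close> provides.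
\<close>

lemma path_rel_equiv:
  assumes X: "kan_complex X" shows "equiv (simplices X 0) (path_rel X)"
proof -
  have SX: "simplicial_set X" by (rule kan_simplicial[OF X])
  have sub: "path_rel X \<subseteq> simplices X 0 \<times> simplices X 0"
    unfolding path_rel_def by (auto intro!: sset_closed[OF SX] constD_Delta)
  have refl: "(x, x) \<in> path_rel X" if x: "x \<in> simplices X 0" for x
  proof -
    have D: "constD 1 0 \<in> Delta 1 0" by (auto intro: constD_Delta)
    have "sact X 0 1 (constD 0 i) (sact X 1 0 (constD 1 0) x) = x" if "i \<le> 1" for i
    proof -
      have "cmp 0 (constD 1 0) (constD 0 i) = idD 0" using that by (auto simp: fun_eq_iff)
      then show ?thesis using sset_comp[OF SX constD_Delta[OF that] D x] sset_id[OF SX x] by simp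
    qed
    from this[of 0] this[of 1] show ?thesis
      unfolding path_rel_def using sset_closed[OF SX D x] by auto
  qed
  have eucl: "(y, z) \<in> path_rel X" if xy: "(x, y) \<in> path_rel X" and xz: "(x, z) \<in> path_rel X" for x y z
  proof -
    obtain h1 where h1: "simplicial_map (stdprod 0 1) X h1"
      "h1 0 (constD 0 0, constD 0 0) = x" "h1 0 (constD 0 0, constD 0 1) = y"
      using xy unfolding path_rel_iff[OF SX] by blast
    obtain h2 where h2: "simplicial_map (stdprod 0 1) X h2"
      "h2 0 (constD 0 0, constD 0 0) = x" "h2 0 (constD 0 0, constD 0 1) = z"
      using xz unfolding path_rel_iff[OF SX] by blast
    have b: "simplicial_map (subprod 0 2 (bdprod 0 2)) X (\<lambda>_ _. undefined)"
      by (rule subprod_mapI) (simp_all add: no_bdprod_0)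
    have const: "h m (u, constD m 0) = sact X m 0 (constD m 0) (h 0 (constD 0 0, constD 0 0))"
      if h: "simplicial_map (stdprod 0 1) X h" and u: "u \<in> Delta m 0" for h m u
    proof -
      have D: "constD 0 0 \<in> Delta 0 0" "constD 0 0 \<in> Delta 0 1" "constD m 0 \<in> Delta m 0" by (auto intro: constD_Delta)
      have "cmp m (constD 0 0) (constD m 0) = constD m 0" by simp
      then show ?thesis using stdprod_act[OF h D] u by (simp only: Delta_0)
    qed
    obtain h3 where h3: "h3 \<in> sset_hom (stdprod 0 1) X"
      "\<And>m u. u \<in> Delta m 0 \<Longrightarrow> h3 m (u, constD m 0) = h1 m (u, constD m 1)"
      "\<And>m u. u \<in> Delta m 0 \<Longrightarrow> h3 m (u, constD m 1) = h2 m (u, constD m 1)"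
    proof (rule kan_compose[OF X h1(1) h2(1) b])
      show "h1 m (u, constD m 0) = h2 m (u, constD m 0)" if "u \<in> Delta m 0" for m u
        using const[OF h1(1) that] const[OF h2(1) that] h1(2) h2(2) by simp
    qed (use no_bdprod_0 that in blast)+
    have "constD 0 0 \<in> Delta 0 0" by (auto intro: constD_Delta)
    from h3(2)[OF this] h3(3)[OF this] show ?thesis
      unfolding path_rel_iff[OF SX] using sset_homD[OF h3(1)] h1 h2 by metis
  qed
  show ?thesis
  proof (rule equivI)
    show "path_rel X \<subseteq> simplices X 0 \<times> simplices X 0" by (rule sub)
    show "refl_on (simplices X 0) (path_rel X)" using refl by (auto intro!: refl_onI)
    show sym: "sym (path_rel X)" by (rule symI) (use eucl refl sub in blast)
    show "trans (path_rel X)" by (rule transI) (use eucl sym[THEN symD] in blast)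
  qed
qed

lemma sphere_hom: "\<alpha> \<in> spheres X n v \<Longrightarrow> \<alpha> \<in> sset_hom (std_simplex n) X"
  by (simp add: spheres_def)

lemma sphere_bd: "\<alpha> \<in> spheres X n v \<Longrightarrow> u \<in> simplices (boundary n) m \<Longrightarrow> \<alpha> m u = const_at X v m"
  by (simp add: spheres_def)

lemma boundary_iff: "u \<in> simplices (boundary n) m \<longleftrightarrow> u \<in> Delta m n \<and> u ` {..m} \<noteq> {..n}"
  by (simp add: boundary_substd)

lemma bdprod_boundary: "(u, w) \<in> bdprod p n m \<longleftrightarrow> u \<in> simplices (boundary p) m \<and> w \<in> Delta m n"
  by (auto simp: bdprod_def boundary_iff)

lemma sphere_htpyI:
  assumes "\<alpha> \<in> spheres X n v" "\<beta> \<in> spheres X n v" "simplicial_map (stdprod n 1) X h"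
    and "\<And>m u. u \<in> Delta m n \<Longrightarrow> h m (u, constD m 0) = \<alpha> m u"
    and "\<And>m u. u \<in> Delta m n \<Longrightarrow> h m (u, constD m 1) = \<beta> m u"
    and "\<And>m u w. u \<in> simplices (boundary n) m \<Longrightarrow> w \<in> Delta m 1 \<Longrightarrow> h m (u, w) = const_at X v m"
  shows "(\<alpha>, \<beta>) \<in> sphere_htpy X n v"
proof -
  let ?h = "\<lambda>m. \<lambda>s\<in>Delta m n \<times> Delta m 1. h m s"
  have "?h \<in> sset_hom (stdprod n 1) X" using sset_hom_restrict[OF simplicial_stdprod assms(3)] by simp
  moreover have "?h m (u, constD m 0) = \<alpha> m u \<and> ?h m (u, constD m 1) = \<beta> m u" if "u \<in> Delta m n" for m u
    using assms(4,5)[OF that] that constD_Delta[of 0 1 m] constD_Delta[of 1 1 m] by simp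
  moreover have "?h m (u, w) = const_at X v m" if "u \<in> simplices (boundary n) m" "w \<in> Delta m 1" for m u w
    using assms(6)[OF that] that by (simp add: boundary_iff)
  ultimately have "\<exists>h\<in>sset_hom (stdprod n 1) X.
         \<forall>m. (\<forall>u\<in>Delta m n. h m (u, constD m 0) = \<alpha> m u \<and> h m (u, constD m 1) = \<beta> m u) \<and>
             (\<forall>u\<in>simplices (boundary n) m. \<forall>w\<in>Delta m 1. h m (u, w) = const_at X v m)"
    by (intro bexI[of _ ?h]) blast
  with assms(1,2) show ?thesis unfolding sphere_htpy_def by blast
qed

lemma sphere_htpyE:
  assumes "(\<alpha>, \<beta>) \<in> sphere_htpy X n v"
  obtains h where "\<alpha> \<in> spheres X n v" "\<beta> \<in> spheres X n v" "simplicial_map (stdprod n 1) X h"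
    "\<And>m u. u \<in> Delta m n \<Longrightarrow> h m (u, constD m 0) = \<alpha> m u"
    "\<And>m u. u \<in> Delta m n \<Longrightarrow> h m (u, constD m 1) = \<beta> m u"
    "\<And>m u w. u \<in> simplices (boundary n) m \<Longrightarrow> w \<in> Delta m 1 \<Longrightarrow> h m (u, w) = const_at X v m"
proof -
  have ab: "\<alpha> \<in> spheres X n v" "\<beta> \<in> spheres X n v" using assms by (simp_all add: sphere_htpy_def)
  obtain h where "h \<in> sset_hom (stdprod n 1) X"
    and h: "\<forall>m. (\<forall>u\<in>Delta m n. h m (u, constD m 0) = \<alpha> m u \<and> h m (u, constD m 1) = \<beta> m u) \<and>
             (\<forall>u\<in>simplices (boundary n) m. \<forall>w\<in>Delta m 1. h m (u, w) = const_at X v m)"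
    using assms unfolding sphere_htpy_def by blast
  show thesis
    by (rule that[OF ab sset_homD[OF \<open>h \<in> sset_hom (stdprod n 1) X\<close>]]) (use h in blast)+
qed

text \<open>
  As for paths, with the constant filler prescribed on the boundary.
\<close>

lemma sphere_htpy_equiv:
  assumes X: "kan_complex X" and v: "v \<in> simplices X 0"
  shows "equiv (spheres X n v) (sphere_htpy X n v)"
proof -
  have SX: "simplicial_set X" by (rule kan_simplicial[OF X])
  have sub: "sphere_htpy X n v \<subseteq> spheres X n v \<times> spheres X n v" by (auto simp: sphere_htpy_def)
  have refl: "(\<alpha>, \<alpha>) \<in> sphere_htpy X n v" if a: "\<alpha> \<in> spheres X n v" for \<alpha>
  proof (rule sphere_htpyI[OF a a])
    note m = sset_homD[OF sphere_hom[OF a]]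
    show "simplicial_map (stdprod n 1) X (\<lambda>m s. \<alpha> m (fst s))"
      by (rule stdprod_mapI) (use smap_closed[OF m] smap_nat[OF m] in \<open>simp_all del: cmp_apply\<close>)
  qed (use sphere_bd[OF a] in simp_all)
  have eucl: "(\<beta>, \<gamma>) \<in> sphere_htpy X n v"
    if ab: "(\<alpha>, \<beta>) \<in> sphere_htpy X n v" and ac: "(\<alpha>, \<gamma>) \<in> sphere_htpy X n v" for \<alpha> \<beta> \<gamma>
  proof -
    obtain h1 where h1: "\<alpha> \<in> spheres X n v" "\<beta> \<in> spheres X n v" "simplicial_map (stdprod n 1) X h1"
      "\<And>m u. u \<in> Delta m n \<Longrightarrow> h1 m (u, constD m 0) = \<alpha> m u"
      "\<And>m u. u \<in> Delta m n \<Longrightarrow> h1 m (u, constD m 1) = \<beta> m u"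
      "\<And>m u w. u \<in> simplices (boundary n) m \<Longrightarrow> w \<in> Delta m 1 \<Longrightarrow> h1 m (u, w) = const_at X v m"
      by (rule sphere_htpyE[OF ab]) (rule that, assumption, assumption, assumption, blast, blast, blast)
    obtain h2 where h2: "\<alpha> \<in> spheres X n v" "\<gamma> \<in> spheres X n v" "simplicial_map (stdprod n 1) X h2"
      "\<And>m u. u \<in> Delta m n \<Longrightarrow> h2 m (u, constD m 0) = \<alpha> m u"
      "\<And>m u. u \<in> Delta m n \<Longrightarrow> h2 m (u, constD m 1) = \<gamma> m u"
      "\<And>m u w. u \<in> simplices (boundary n) m \<Longrightarrow> w \<in> Delta m 1 \<Longrightarrow> h2 m (u, w) = const_at X v m"
      by (rule sphere_htpyE[OF ac]) (rule that, assumption, assumption, assumption, blast, blast, blast)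
    have b: "simplicial_map (subprod n 2 (bdprod n 2)) X (\<lambda>m _. const_at X v m)"
      by (rule subprod_mapI) (simp_all add: const_at_closed[OF SX v] const_at_act[OF SX v])
    have \<mu>: "cmp m (\<lambda>i\<in>{..2}. min i 1) w \<in> Delta m 1" if "w \<in> Delta m 2" for m w
      using that by (rule Delta_cmp) (rule DeltaI, auto)
    have bd: "u \<in> simplices (boundary n) m" "w \<in> Delta m k" if "(u, w) \<in> bdprod n k m" for u w k m
      using that by (auto simp: bdprod_boundary)
    obtain h3 where h3: "h3 \<in> sset_hom (stdprod n 1) X"
      "\<And>m u. u \<in> Delta m n \<Longrightarrow> h3 m (u, constD m 0) = h1 m (u, constD m 1)"
      "\<And>m u. u \<in> Delta m n \<Longrightarrow> h3 m (u, constD m 1) = h2 m (u, constD m 1)"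
      "\<And>m u w. (u, w) \<in> bdprod n 1 m \<Longrightarrow> h3 m (u, w) = const_at X v m"
    proof (rule kan_compose[OF X h1(3) h2(3) b])
      show "h1 m (u, constD m 0) = h2 m (u, constD m 0)" if "u \<in> Delta m n" for m u
        using h1(4)[OF that] h2(4)[OF that] by simp
      show "const_at X v m = h1 m (u, cmp m (\<lambda>i\<in>{..2}. min i 1) w)" if "(u, w) \<in> bdprod n 2 m" for m u w
        by (rule h1(6)[OF bd(1)[OF that] \<mu>[OF bd(2)[OF that]], symmetric])
      show "const_at X v m = h2 m (u, cmp m (\<lambda>i\<in>{..2}. min i 1) w)" if "(u, w) \<in> bdprod n 2 m" for m u w
        by (rule h2(6)[OF bd(1)[OF that] \<mu>[OF bd(2)[OF that]], symmetric])
    qed (use that in blast)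
    show ?thesis
      by (rule sphere_htpyI[OF h1(2) h2(2) sset_homD[OF h3(1)]])
        (use h3(2-4) h1(5) h2(5) in \<open>simp_all add: bdprod_boundary\<close>)
  qed
  show ?thesis
  proof (rule equivI)
    show "sphere_htpy X n v \<subseteq> spheres X n v \<times> spheres X n v" by (rule sub)
    show "refl_on (spheres X n v) (sphere_htpy X n v)" using refl by (auto intro!: refl_onI)
    show sym: "sym (sphere_htpy X n v)" by (rule symI) (use eucl refl sub in blast)
    show "trans (sphere_htpy X n v)" by (rule transI) (use eucl sym[THEN symD] in blast)
  qed
qed


section \<open>Maps on homotopy classes\<close>

text \<open>
  The maps induced on $\pi_0$ and $\pi_n$ send a class to the class of its image. The next lemmas
  translate between their bijectivity and statements about representatives.
\<close>

lemma quotient_map_class: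
  assumes r: "equiv A r" and r': "equiv B r'" and pres: "\<And>x y. (x, y) \<in> r \<Longrightarrow> (F x, F y) \<in> r'" and a: "a \<in> A"
  shows "r' `` (F ` (r `` {a})) = r' `` {F a}"
proof
  show "r' `` {F a} \<subseteq> r' `` (F ` (r `` {a}))"
    using equiv_class_self[OF r a] by blast
  show "r' `` (F ` (r `` {a})) \<subseteq> r' `` {F a}"
    using pres r' unfolding equiv_def by (blast dest: transD)
qed

lemma bij_quotientI:
  assumes r: "equiv A r" and r': "equiv B r'" and pres: "\<And>x y. (x, y) \<in> r \<Longrightarrow> (F x, F y) \<in> r'"
    and F: "\<And>x. x \<in> A \<Longrightarrow> F x \<in> B"
    and inj: "\<And>x y. x \<in> A \<Longrightarrow> y \<in> A \<Longrightarrow> (F x, F y) \<in> r' \<Longrightarrow> (x, y) \<in> r"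
    and surj: "\<And>b. b \<in> B \<Longrightarrow> \<exists>a\<in>A. (F a, b) \<in> r'"
  shows "bij_betw (\<lambda>C. r' `` (F ` C)) (A // r) (B // r')"
proof (rule bij_betw_imageI)
  note cl = quotient_map_class[OF r r' pres]
  show "inj_on (\<lambda>C. r' `` (F ` C)) (A // r)"
  proof (rule inj_onI)
    fix C D assume "C \<in> A // r" "D \<in> A // r" and eq: "r' `` (F ` C) = r' `` (F ` D)"
    then obtain x y where xy: "x \<in> A" "C = r `` {x}" "y \<in> A" "D = r `` {y}" by (auto elim!: quotientE)
    have "r' `` {F x} = r' `` {F y}" using eq cl[OF _ xy(1)] cl[OF _ xy(3)] xy(2,4) by simp
    then have "(F x, F y) \<in> r'" using eq_equiv_class_iff[OF r' F[OF xy(1)] F[OF xy(3)]] by simp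
    then show "C = D" using inj[OF xy(1,3)] xy(2,4) equiv_class_eq[OF r] by simp
  qed
  show "(\<lambda>C. r' `` (F ` C)) ` (A // r) = B // r'"
  proof (intro equalityI subsetI)
    fix E assume "E \<in> (\<lambda>C. r' `` (F ` C)) ` (A // r)"
    then obtain x where x: "x \<in> A" "E = r' `` (F ` (r `` {x}))" by (auto elim!: quotientE)
    then show "E \<in> B // r'" using cl[OF _ x(1)] quotientI[OF F[OF x(1)], of r'] by simp
  next
    fix E assume "E \<in> B // r'"
    then obtain b where b: "b \<in> B" "E = r' `` {b}" by (rule quotientE)
    obtain a where a: "a \<in> A" "(F a, b) \<in> r'" using surj[OF b(1)] by blast
    have "E = r' `` (F ` (r `` {a}))" using cl[OF _ a(1)] equiv_class_eq[OF r' a(2)] b(2) by simp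
    then show "E \<in> (\<lambda>C. r' `` (F ` C)) ` (A // r)" using quotientI[OF a(1)] by blast
  qed
qed

lemma bij_quotient_inj:
  assumes r: "equiv A r" and r': "equiv B r'" and pres: "\<And>x y. (x, y) \<in> r \<Longrightarrow> (F x, F y) \<in> r'"
    and bij: "bij_betw (\<lambda>C. r' `` (F ` C)) (A // r) (B // r')"
    and xy: "x \<in> A" "y \<in> A" "(F x, F y) \<in> r'"
  shows "(x, y) \<in> r"
proof -
  note cl = quotient_map_class[OF r r' pres]
  have "r' `` (F ` (r `` {x})) = r' `` (F ` (r `` {y}))"
    using cl[OF _ xy(1)] cl[OF _ xy(2)] equiv_class_eq[OF r' xy(3)] by simp
  then have "r `` {x} = r `` {y}"
    using bij quotientI[OF xy(1)] quotientI[OF xy(2)] by (auto simp: bij_betw_def inj_on_def)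
  then show ?thesis using eq_equiv_class_iff[OF r xy(1,2)] by simp
qed

lemma bij_quotient_surj:
  assumes r: "equiv A r" and r': "equiv B r'" and pres: "\<And>x y. (x, y) \<in> r \<Longrightarrow> (F x, F y) \<in> r'"
    and bij: "bij_betw (\<lambda>C. r' `` (F ` C)) (A // r) (B // r')" and b: "b \<in> B"
  shows "\<exists>a\<in>A. (F a, b) \<in> r'"
proof -
  note cl = quotient_map_class[OF r r' pres]
  have "r' `` {b} \<in> (\<lambda>C. r' `` (F ` C)) ` (A // r)"
    using bij quotientI[OF b] by (simp add: bij_betw_def)
  then obtain a where a: "a \<in> A" "r' `` {b} = r' `` (F ` (r `` {a}))" by (auto elim!: quotientE)
  then have "b \<in> r' `` {F a}" using cl[OF _ a(1)] equiv_class_self[OF r' b] by simp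
  then show ?thesis using a(1) by blast
qed

lemma path_rel_map: "simplicial_map X Y f \<Longrightarrow> (x, y) \<in> path_rel X \<Longrightarrow> (f 0 x, f 0 y) \<in> path_rel Y"
proof -
  assume f: "simplicial_map X Y f" and "(x, y) \<in> path_rel X"
  then obtain e where e: "e \<in> simplices X 1" "sact X 0 1 (constD 0 0) e = x" "sact X 0 1 (constD 0 1) e = y"
    unfolding path_rel_def by blast
  have "constD 0 0 \<in> Delta 0 1" "constD 0 1 \<in> Delta 0 1" by (rule constD_Delta, simp)+
  then have "sact Y 0 1 (constD 0 0) (f 1 e) = f 0 x" "sact Y 0 1 (constD 0 1) (f 1 e) = f 0 y"
    using smap_nat[OF f _ e(1)] e(2,3) by metis+
  with smap_closed[OF f e(1)] show ?thesis unfolding path_rel_def by blast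
qed

definition sphere_map :: "(nat \<Rightarrow> 'x \<Rightarrow> 'y) \<Rightarrow> nat \<Rightarrow> (nat \<Rightarrow> (nat \<Rightarrow> nat) \<Rightarrow> 'x) \<Rightarrow> nat \<Rightarrow> (nat \<Rightarrow> nat) \<Rightarrow> 'y" where
  "sphere_map f n \<alpha> = (\<lambda>m. compose (Delta m n) (f m) (\<alpha> m))"

lemma sphere_map_apply: "u \<in> Delta m n \<Longrightarrow> sphere_map f n \<alpha> m u = f m (\<alpha> m u)"
  by (simp add: sphere_map_def compose_def)

lemma homotopy_group_map_alt:
  "homotopy_group_map X Y f n v = (\<lambda>C. sphere_htpy Y n (f 0 v) `` (sphere_map f n ` C))"
  by (simp add: fun_eq_iff homotopy_group_map_def sphere_map_def)

lemma sphere_map_closed: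
  assumes f: "simplicial_map X Y f" and v: "v \<in> simplices X 0" and a: "\<alpha> \<in> spheres X n v"
  shows "sphere_map f n \<alpha> \<in> spheres Y n (f 0 v)"
proof -
  have "(\<lambda>m. \<lambda>u\<in>Delta m n. f m (\<alpha> m u)) \<in> sset_hom (std_simplex n) Y"
    using sset_hom_restrict[OF simplicial_std smap_comp[OF sset_homD[OF sphere_hom[OF a]] f]] by simp
  moreover have "sphere_map f n \<alpha> = (\<lambda>m. \<lambda>u\<in>Delta m n. f m (\<alpha> m u))"
    by (simp add: fun_eq_iff sphere_map_def compose_def)
  moreover have "sphere_map f n \<alpha> m u = const_at Y (f 0 v) m" if u: "u \<in> simplices (boundary n) m" for m u
    using sphere_bd[OF a u] const_at_map[OF f v] u by (simp add: boundary_iff sphere_map_apply)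
  ultimately show ?thesis by (simp add: spheres_def)
qed

lemma sphere_htpy_map:
  assumes f: "simplicial_map X Y f" and v: "v \<in> simplices X 0" and ab: "(\<alpha>, \<beta>) \<in> sphere_htpy X n v"
  shows "(sphere_map f n \<alpha>, sphere_map f n \<beta>) \<in> sphere_htpy Y n (f 0 v)"
proof (rule sphere_htpyE[OF ab])
  fix h assume h: "\<alpha> \<in> spheres X n v" "\<beta> \<in> spheres X n v" "simplicial_map (stdprod n 1) X h"
    "\<And>m u. u \<in> Delta m n \<Longrightarrow> h m (u, constD m 0) = \<alpha> m u"
    "\<And>m u. u \<in> Delta m n \<Longrightarrow> h m (u, constD m 1) = \<beta> m u"
    "\<And>m u w. u \<in> simplices (boundary n) m \<Longrightarrow> w \<in> Delta m 1 \<Longrightarrow> h m (u, w) = const_at X v m"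
  show ?thesis
    by (rule sphere_htpyI[OF sphere_map_closed[OF f v h(1)] sphere_map_closed[OF f v h(2)] smap_comp[OF h(3) f]])
      (simp_all add: h(4-6) sphere_map_apply const_at_map[OF f v])
qed

section \<open>Weak equivalences from spans of trivial fibrations\<close>

text \<open>
  Lifting a homotopy whose two ends, and whose values on the boundary, are already lifted; this
  is lifting against $\partial\Delta^n\times\Delta^1\cup\Delta^n\times\partial\Delta^1$.
\<close>

lemma triv_fib_rel_lift:
  assumes U: "simplicial_set U" and W: "simplicial_set W" and r: "triv_fib U W r"
    and a0: "simplicial_map (std_simplex n) U a0" and a1: "simplicial_map (std_simplex n) U a1"
    and \<psi>: "simplicial_map (stdprod n 1) W \<psi>"
    and \<psi>0: "\<And>m u. u \<in> Delta m n \<Longrightarrow> \<psi> m (u, constD m 0) = r m (a0 m u)"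
    and \<psi>1: "\<And>m u. u \<in> Delta m n \<Longrightarrow> \<psi> m (u, constD m 1) = r m (a1 m u)"
    and v: "v \<in> simplices U 0"
    and bd: "\<And>m u. u \<in> simplices (boundary n) m \<Longrightarrow> a0 m u = const_at U v m \<and> a1 m u = const_at U v m"
    and \<psi>b: "\<And>m u w. u \<in> simplices (boundary n) m \<Longrightarrow> w \<in> Delta m 1 \<Longrightarrow> \<psi> m (u, w) = r m (const_at U v m)"
  obtains \<phi> where "simplicial_map (stdprod n 1) U \<phi>"
    "\<And>m u. u \<in> Delta m n \<Longrightarrow> \<phi> m (u, constD m 0) = a0 m u"
    "\<And>m u. u \<in> Delta m n \<Longrightarrow> \<phi> m (u, constD m 1) = a1 m u"
    "\<And>m u w. u \<in> simplices (boundary n) m \<Longrightarrow> w \<in> Delta m 1 \<Longrightarrow> \<phi> m (u, w) = const_at U v m"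
    "\<And>m u w. u \<in> Delta m n \<Longrightarrow> w \<in> Delta m 1 \<Longrightarrow> r m (\<phi> m (u, w)) = \<psi> m (u, w)"
proof -
  let ?A = "\<lambda>m. {w \<in> Delta m 1. w ` {..m} \<noteq> {..1}}"
  let ?C = "pushprod n 1 ?A"
  have Aconst: "w = constD m 0 \<or> w = constD m 1" if w: "w \<in> Delta m 1" "w ` {..m} \<noteq> {..1}" for w m
  proof -
    have "\<exists>i\<le>1. i \<notin> w ` {..m}" using w Delta_le[OF w(1)] by blast
    then obtain i where "i \<le> 1" "i \<notin> w ` {..m}" by blast
    then have "w x = 1 - i" if "x \<le> m" for x using Delta_le[OF w(1) that] that by (cases i) (force, force)
    then have "w = constD m (1 - i)"
      using w by (intro Delta_eqI[OF w(1) constD_Delta[of _ 1]]) auto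
    then show ?thesis using \<open>i \<le> 1\<close> by (cases i) auto
  qed
  have cne: "constD m 0 \<noteq> constD m (1::nat)" for m
  proof
    assume "constD m 0 = constD m (1::nat)"
    from fun_cong[OF this, of 0] show False by simp
  qed
  define g where "g m s = (case s of (u, w) \<Rightarrow> if w = constD m 0 then a0 m u else if w = constD m 1 then a1 m u
      else const_at U v m)" for m s
  have g0: "g m (u, constD m 0) = a0 m u" for m u by (simp add: g_def)
  have g1: "g m (u, constD m 1) = a1 m u" for m u using cne[of m] by (simp add: g_def del: restrict_apply)
  have gb: "g m (u, w) = const_at U v m" if "u \<in> simplices (boundary n) m" for m u w
    using bd[OF that] by (simp add: g_def)
  have C: "w = constD m 0 \<or> w = constD m 1 \<or> u \<in> simplices (boundary n) m" "u \<in> Delta m n" "w \<in> Delta m 1"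
    if "(u, w) \<in> ?C m" for u w m
    using that Aconst[of w m] by (auto simp: pushprod_def boundary_iff)
  have gm: "simplicial_map (subprod n 1 ?C) U g"
  proof (rule subprod_mapI)
    fix m u w assume "(u, w) \<in> ?C m"
    note uw = C[OF this]
    from uw(1) show "g m (u, w) \<in> simplices U m"
      using g0 g1 gb smap_closed[OF a0, of u m] smap_closed[OF a1, of u m] const_at_closed[OF U v] uw(2)
      by (elim disjE) simp_all
  next
    fix k m \<theta> u w assume \<theta>: "\<theta> \<in> Delta k m" and "(u, w) \<in> ?C m"
    note uw = C[OF this(2)]
    from uw(1) show "g k (cmp k u \<theta>, cmp k w \<theta>) = sact U k m \<theta> (g m (u, w))"
    proof (elim disjE)
      assume w: "w = constD m 0"
      have "cmp k w \<theta> = constD k 0" unfolding w by (rule cmp_constD_left[OF \<theta>])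
      then show ?thesis using smap_nat[OF a0 \<theta>, of u] uw(2) w g0 by simp
    next
      assume w: "w = constD m 1"
      have "cmp k w \<theta> = constD k 1" unfolding w by (rule cmp_constD_left[OF \<theta>])
      then show ?thesis using smap_nat[OF a1 \<theta>, of u] uw(2) w g1 by simp
    next
      assume u: "u \<in> simplices (boundary n) m"
      then have "cmp k u \<theta> \<in> simplices (boundary n) k"
        using sset_closed[OF simplicial_boundary \<theta> u] by (simp add: boundary_substd)
      then show ?thesis using gb u const_at_act[OF U v \<theta>] by simp
    qed
  qed
  have rg: "r m (g m s) = \<psi> m s" if sC: "s \<in> ?C m" for m s
  proof -
    obtain u w where s: "s = (u, w)" by (cases s)
    note uw = C[OF sC[unfolded s]]
    from uw(1) show ?thesis unfolding s
      using g0 g1 gb \<psi>0[OF uw(2)] \<psi>1[OF uw(2)] \<psi>b[OF _ uw(3)] by (elim disjE) simp_all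
  qed
  obtain \<phi> where \<phi>: "\<phi> \<in> sset_hom (stdprod n 1) U" "\<And>m s. s \<in> ?C m \<Longrightarrow> \<phi> m s = g m s"
    "\<And>m s. s \<in> Delta m n \<times> Delta m 1 \<Longrightarrow> r m (\<phi> m s) = \<psi> m s"
    by (rule triv_fib_lift[OF U W r subcomplex_pushprod[OF subcomplex1_boundary[of 1]] gm \<psi> rg])
      (assumption, rule that, assumption, blast, blast)
  have D: "constD m (0::nat) \<in> Delta m 1" "constD m (1::nat) \<in> Delta m 1" for m by (rule constD_Delta, simp)+
  show thesis
  proof (rule that[OF sset_homD[OF \<phi>(1)]])
    fix m u assume u: "u \<in> Delta m n"
    have "0 \<in> {..1::nat}" "1 \<in> {..1::nat}" by simp_all
    then have ne: "{0} \<noteq> {..1::nat}" "{1} \<noteq> {..1::nat}" by (metis singletonD zero_neq_one)+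
    have "(u, constD m 0) \<in> ?C m" "(u, constD m 1) \<in> ?C m"
      using u D[of m] ne by (auto simp: pushprod_def image_constant_conv)
    from this[THEN \<phi>(2)] show "\<phi> m (u, constD m 0) = a0 m u" "\<phi> m (u, constD m 1) = a1 m u"
      using g0 g1 by simp_all
  next
    fix m u w assume "u \<in> simplices (boundary n) m" "w \<in> Delta m 1"
    then show "\<phi> m (u, w) = const_at U v m" using \<phi>(2)[of "(u, w)" m] gb by (simp add: pushprod_def boundary_iff)
  qed (use \<phi>(3) in blast)
qed

text \<open>
  The map \<open>f\<close> is a section \<open>s\<close> of one trivial fibration followed by another one. To lift a homotopy
  from \<open>V\<close> to \<open>T\<close>, lift it along \<open>p\<close> and project by \<open>q\<close>. To hit a sphere of \<open>V\<close> up to homotopy, lift it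
  along \<open>p\<close> to \<open>z\<close> and project to \<open>q z\<close>; both \<open>z\<close> and \<open>s (q z)\<close> lie over \<open>q z\<close>, so they are homotopic
  in \<open>U\<close>, and \<open>p\<close> maps the homotopy to one between \<open>f (q z)\<close> and the sphere.
\<close>

theorem weak_equivalence_of_span:
  assumes T: "kan_complex T" and V: "kan_complex V" and U: "simplicial_set U"
    and q: "triv_fib U T q" and p: "triv_fib U V p" and s: "simplicial_map T U s" and f: "simplicial_map T V f"
    and qs: "\<And>n x. x \<in> simplices T n \<Longrightarrow> q n (s n x) = x"
    and ps: "\<And>n x. x \<in> simplices T n \<Longrightarrow> p n (s n x) = f n x"
  shows "weak_equivalence T V f"
proof -
  note ST = kan_simplicial[OF T] and SV = kan_simplicial[OF V]
  note mq = triv_fib_map[OF q] and mp = triv_fib_map[OF p]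
  have D: "constD 0 (0::nat) \<in> Delta 0 0" "constD 0 0 \<in> Delta 0 1" "constD 0 1 \<in> Delta 0 1" by (rule constD_Delta, simp)+
  have nb0: "u \<notin> simplices (boundary 0) m" for u m
    by (auto simp: boundary_iff Delta_0 atMost_0)
  have point: "simplicial_map (std_simplex 0) U (\<lambda>m u. const_at U x m)" if "x \<in> simplices U 0" for x
    by (rule simplicial_mapI) (simp_all add: const_at_closed[OF U that] const_at_act[OF U that])
  have const0: "const_at X x 0 = x" if "simplicial_set X" "x \<in> simplices X 0" for X :: "'z sset" and x
  proof -
    have "constD 0 0 = idD 0" by (simp add: fun_eq_iff)
    then show ?thesis using sset_id[OF that] unfolding const_at_def by simp
  qed
  have pi0: "bij_betw (pi0_map T V f) (pi0 T) (pi0 V)"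
    unfolding pi0_map_def[abs_def] pi0_def
  proof (rule bij_quotientI[OF path_rel_equiv[OF T] path_rel_equiv[OF V] path_rel_map[OF f]])
    show "f 0 x \<in> simplices V 0" if "x \<in> simplices T 0" for x using smap_closed[OF f that] .
  next
    fix x y assume xy: "x \<in> simplices T 0" "y \<in> simplices T 0" and "(f 0 x, f 0 y) \<in> path_rel V"
    then obtain h where h: "simplicial_map (stdprod 0 1) V h"
      "h 0 (constD 0 0, constD 0 0) = f 0 x" "h 0 (constD 0 0, constD 0 1) = f 0 y"
      unfolding path_rel_iff[OF SV] by blast
    note sx = smap_closed[OF s xy(1)] and sy = smap_closed[OF s xy(2)]
    have hc: "h m (u, constD m i) = const_at V (h 0 (constD 0 0, constD 0 i)) m" if "u \<in> Delta m 0" "i \<le> 1" for m u i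
    proof -
      have "constD m 0 \<in> Delta m 0" "constD 0 i \<in> Delta 0 1" using that(2) by (auto intro: constD_Delta)
      then show ?thesis using stdprod_act[OF h(1) D(1), of "constD 0 i" "constD m 0" m] that(1)
        unfolding const_at_def Delta_0 by simp
    qed
    obtain \<phi> where \<phi>: "simplicial_map (stdprod 0 1) U \<phi>"
      "\<And>m u. u \<in> Delta m 0 \<Longrightarrow> \<phi> m (u, constD m 0) = const_at U (s 0 x) m"
      "\<And>m u. u \<in> Delta m 0 \<Longrightarrow> \<phi> m (u, constD m 1) = const_at U (s 0 y) m"
    proof (rule triv_fib_rel_lift[OF U SV p point[OF sx] point[OF sy] h(1) _ _ sx])
      show "h m (u, constD m 0) = p m (const_at U (s 0 x) m)" if "u \<in> Delta m 0" for m u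
        using hc[OF that, of 0] h(2) const_at_map[OF mp sx] ps[OF xy(1)] by simp
      show "h m (u, constD m 1) = p m (const_at U (s 0 y) m)" if "u \<in> Delta m 0" for m u
        using hc[OF that, of 1] h(3) const_at_map[OF mp sy] ps[OF xy(2)] by simp
    qed (use nb0 that in blast)+
    have "(s 0 x, s 0 y) \<in> path_rel U"
      unfolding path_rel_iff[OF U] using \<phi>(1) \<phi>(2,3)[OF D(1)] const0[OF U sx] const0[OF U sy] by metis
    from path_rel_map[OF mq this] show "(x, y) \<in> path_rel T" using qs xy by simp
  next
    fix y assume y: "y \<in> simplices V 0"
    have e: "simplicial_map (boundary 0) U (\<lambda>_ _. undefined)"
      by (rule simplicial_mapI) (simp_all add: nb0)
    obtain z where z: "z \<in> simplices U 0" "p 0 z = y"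
      by (rule triv_fib_fill[OF p e y]) (use nb0 that in blast)+
    let ?x = "q 0 z"
    have x: "?x \<in> simplices T 0" using smap_closed[OF mq z(1)] .
    note sx = smap_closed[OF s x]
    obtain \<phi> where \<phi>: "simplicial_map (stdprod 0 1) U \<phi>"
      "\<And>m u. u \<in> Delta m 0 \<Longrightarrow> \<phi> m (u, constD m 0) = const_at U (s 0 ?x) m"
      "\<And>m u. u \<in> Delta m 0 \<Longrightarrow> \<phi> m (u, constD m 1) = const_at U z m"
    proof (rule triv_fib_rel_lift[OF U ST q point[OF sx] point[OF z(1)] _ _ _ sx])
      show "simplicial_map (stdprod 0 1) T (\<lambda>m s. const_at T ?x m)"
        by (rule stdprod_mapI) (simp_all add: const_at_closed[OF ST x] const_at_act[OF ST x])
    qed (use nb0 that in \<open>simp_all add: const_at_map[OF mq sx] const_at_map[OF mq z(1)] qs[OF x]\<close>)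
    have "(s 0 ?x, z) \<in> path_rel U"
      unfolding path_rel_iff[OF U] using \<phi>(1) \<phi>(2,3)[OF D(1)] const0[OF U sx] const0[OF U z(1)] by metis
    from path_rel_map[OF mp this] show "\<exists>x\<in>simplices T 0. (f 0 x, y) \<in> path_rel V" using ps x z(2) by auto
  qed
  have pin: "bij_betw (homotopy_group_map T V f n v) (homotopy_group T n v) (homotopy_group V n (f 0 v))"
    if v: "v \<in> simplices T 0" for n v
    unfolding homotopy_group_map_alt homotopy_group_def
  proof (rule bij_quotientI[OF sphere_htpy_equiv[OF T v] sphere_htpy_equiv[OF V smap_closed[OF f v]] sphere_htpy_map[OF f v]])
    show "sphere_map f n \<alpha> \<in> spheres V n (f 0 v)" if "\<alpha> \<in> spheres T n v" for \<alpha>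
      by (rule sphere_map_closed[OF f v that])
  next
    note sv = smap_closed[OF s v]
    have qsv: "q m (const_at U (s 0 v) m) = const_at T v m" and psv: "p m (const_at U (s 0 v) m) = const_at V (f 0 v) m" for m
      using const_at_map[OF mq sv] const_at_map[OF mp sv] qs[OF v] ps[OF v] by simp_all
    fix \<alpha> \<beta> assume a: "\<alpha> \<in> spheres T n v" and b: "\<beta> \<in> spheres T n v"
      and "(sphere_map f n \<alpha>, sphere_map f n \<beta>) \<in> sphere_htpy V n (f 0 v)"
    then show "(\<alpha>, \<beta>) \<in> sphere_htpy T n v"
    proof (elim sphere_htpyE)
      fix h assume h: "simplicial_map (stdprod n 1) V h"
        "\<And>m u. u \<in> Delta m n \<Longrightarrow> h m (u, constD m 0) = sphere_map f n \<alpha> m u"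
        "\<And>m u. u \<in> Delta m n \<Longrightarrow> h m (u, constD m 1) = sphere_map f n \<beta> m u"
        "\<And>m u w. u \<in> simplices (boundary n) m \<Longrightarrow> w \<in> Delta m 1 \<Longrightarrow> h m (u, w) = const_at V (f 0 v) m"
      note ma = sset_homD[OF sphere_hom[OF a]] and mb = sset_homD[OF sphere_hom[OF b]]
      have va: "\<alpha> m u \<in> simplices T m" "\<beta> m u \<in> simplices T m" if "u \<in> Delta m n" for m u
        using smap_closed[OF ma, of u m] smap_closed[OF mb, of u m] that by simp_all
      show ?thesis
      proof (rule triv_fib_rel_lift[OF U SV p smap_comp[OF ma s] smap_comp[OF mb s] h(1) _ _ sv])
        fix \<phi> assume \<phi>: "simplicial_map (stdprod n 1) U \<phi>"
          "\<And>m u. u \<in> Delta m n \<Longrightarrow> \<phi> m (u, constD m 0) = s m (\<alpha> m u)"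
          "\<And>m u. u \<in> Delta m n \<Longrightarrow> \<phi> m (u, constD m 1) = s m (\<beta> m u)"
          "\<And>m u w. u \<in> simplices (boundary n) m \<Longrightarrow> w \<in> Delta m 1 \<Longrightarrow> \<phi> m (u, w) = const_at U (s 0 v) m"
        show ?thesis
          by (rule sphere_htpyI[OF a b smap_comp[OF \<phi>(1) mq]]) (simp_all add: \<phi>(2-4) qs va qsv)
      qed (simp_all add: h(2-4) sphere_map_apply ps va psv sphere_bd[OF a] sphere_bd[OF b] const_at_map[OF s v])
    qed
  next
    note sv = smap_closed[OF s v]
    have qsv: "q m (const_at U (s 0 v) m) = const_at T v m" and psv: "p m (const_at U (s 0 v) m) = const_at V (f 0 v) m" for m
      using const_at_map[OF mq sv] const_at_map[OF mp sv] qs[OF v] ps[OF v] by simp_all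
    fix \<beta> assume b: "\<beta> \<in> spheres V n (f 0 v)"
    note mb = sset_homD[OF sphere_hom[OF b]]
    have bn: "\<beta> n (idD n) \<in> simplices V n" using smap_closed[OF mb, of "idD n" n] by (simp del: restrict_apply)
    have bu: "\<beta> m u = sact V m n u (\<beta> n (idD n))" if "u \<in> Delta m n" for m u
      by (rule map_std_simplex[OF mb that])
    have e: "simplicial_map (boundary n) U (\<lambda>m u. const_at U (s 0 v) m)"
      by (rule simplicial_mapI) (simp_all add: const_at_closed[OF U sv] const_at_act[OF U sv])
    obtain z where z: "z \<in> simplices U n" "p n z = \<beta> n (idD n)"
      "\<And>m u. u \<in> simplices (boundary n) m \<Longrightarrow> sact U m n u z = const_at U (s 0 v) m"
    proof (rule triv_fib_fill[OF p e bn])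
      fix m u assume u: "u \<in> simplices (boundary n) m"
      then have "u \<in> Delta m n" by (simp add: boundary_iff)
      then show "p m (const_at U (s 0 v) m) = sact V m n u (\<beta> n (idD n))"
        using sphere_bd[OF b u] bu[of u m] psv by simp
    qed (use that in blast)
    define \<alpha> where "\<alpha> = (\<lambda>m. \<lambda>u\<in>Delta m n. sact T m n u (q n z))"
    note qz = smap_closed[OF mq z(1)]
    have au: "\<alpha> m u = q m (sact U m n u z)" if "u \<in> Delta m n" for m u
      using smap_nat[OF mq that z(1)] that by (simp add: \<alpha>_def)
    have a: "\<alpha> \<in> spheres T n v"
    proof -
      have "\<alpha> \<in> sset_hom (std_simplex n) T" unfolding \<alpha>_def by (rule yoneda_hom[OF ST qz])
      then show ?thesis using au z(3) qsv by (simp add: spheres_def boundary_iff)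
    qed
    note ma = sset_homD[OF sphere_hom[OF a]]
    have va: "\<alpha> m u \<in> simplices T m" if "u \<in> Delta m n" for m u using smap_closed[OF ma, of u m] that by simp
    have pz: "p m (sact U m n u z) = \<beta> m u" if "u \<in> Delta m n" for m u
      using smap_nat[OF mp that z(1)] z(2) bu[OF that] by metis
    have "(sphere_map f n \<alpha>, \<beta>) \<in> sphere_htpy V n (f 0 v)"
    proof (rule triv_fib_rel_lift[OF U ST q smap_comp[OF ma s] yoneda_map[OF U z(1)] _ _ _ sv])
      show "simplicial_map (stdprod n 1) T (\<lambda>m s. \<alpha> m (fst s))"
        by (rule stdprod_mapI) (use smap_closed[OF ma] smap_nat[OF ma] in \<open>simp_all del: cmp_apply\<close>)
      fix \<phi> assume \<phi>: "simplicial_map (stdprod n 1) U \<phi>"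
        "\<And>m u. u \<in> Delta m n \<Longrightarrow> \<phi> m (u, constD m 0) = s m (\<alpha> m u)"
        "\<And>m u. u \<in> Delta m n \<Longrightarrow> \<phi> m (u, constD m 1) = sact U m n u z"
        "\<And>m u w. u \<in> simplices (boundary n) m \<Longrightarrow> w \<in> Delta m 1 \<Longrightarrow> \<phi> m (u, w) = const_at U (s 0 v) m"
      show ?thesis
        by (rule sphere_htpyI[OF sphere_map_closed[OF f v a] b smap_comp[OF \<phi>(1) mp]])
          (simp_all add: \<phi>(2-4) ps va psv sphere_map_apply pz)
    qed (simp_all add: qs va qsv au[symmetric] z(3) sphere_bd[OF a] const_at_map[OF s v] boundary_iff)
    then show "\<exists>\<alpha>\<in>spheres T n v. (sphere_map f n \<alpha>, \<beta>) \<in> sphere_htpy V n (f 0 v)" using a by blast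
  qed
  show ?thesis
    unfolding weak_equivalence_def using T V f pi0 pin by blast
qed


section \<open>Mapping path spaces\<close>

text \<open>
  Homotopy extension from either end: $\Lambda^1_i$ is a vertex of $\Delta^1$.
\<close>

lemma kan_htpy_ext:
  assumes X: "kan_complex X" and a: "simplicial_map (std_simplex n) X a"
    and b: "simplicial_map (subprod n 1 (bdprod n 1)) X b" and i: "i \<le> 1"
    and ab: "\<And>m u. u \<in> simplices (boundary n) m \<Longrightarrow> b m (u, constD m i) = a m u"
  obtains h where "h \<in> sset_hom (stdprod n 1) X"
    "\<And>m u. u \<in> Delta m n \<Longrightarrow> h m (u, constD m i) = a m u"
    "\<And>m u w. u \<in> simplices (boundary n) m \<Longrightarrow> w \<in> Delta m 1 \<Longrightarrow> h m (u, w) = b m (u, w)"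
proof -
  define g where "g m s = (case s of (u, w) \<Rightarrow> if w = constD m i then a m u else b m (u, w))" for m s
  have gi: "g m (u, constD m i) = a m u" for m u by (simp add: g_def)
  have gb: "g m (u, w) = b m (u, w)" if "u \<in> simplices (boundary n) m" for m u w
    using ab[OF that] by (simp add: g_def)
  have C: "u \<in> Delta m n" "w \<in> Delta m 1" "w = constD m i \<or> u \<in> simplices (boundary n) m"
    if uwh: "(u, w) \<in> hornprod n 1 i m" for u w m
  proof -
    show uw: "u \<in> Delta m n" "w \<in> Delta m 1" using uwh by (simp_all add: hornprod_def)
    show "w = constD m i \<or> u \<in> simplices (boundary n) m"
    proof (cases "u ` {..m} = {..n}")
      case True
      then obtain j where j: "j \<le> 1" "j \<noteq> i" "j \<notin> w ` {..m}" using uwh by (auto simp: hornprod_def)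
      have "w = constD m i"
      proof (rule Delta_eqI[OF uw(2) constD_Delta[OF i]])
        fix x assume x: "x \<le> m"
        then have "w x \<noteq> j" "w x \<le> 1" using j Delta_le[OF uw(2)] by auto
        then show "w x = constD m i x" using i j x by auto
      qed
      then show ?thesis ..
    qed (simp add: boundary_iff uw)
  qed
  have gm: "simplicial_map (subprod n 1 (hornprod n 1 i)) X g"
  proof (rule subprod_mapI)
    fix m u w assume "(u, w) \<in> hornprod n 1 i m"
    note uw = C[OF this]
    from uw(3) show "g m (u, w) \<in> simplices X m"
      using gi gb smap_closed[OF a, of u m] subprod_val[OF b, of u w m] uw(1,2)
      by (elim disjE) (simp_all add: bdprod_boundary)
  next
    fix k m \<theta> u w assume \<theta>: "\<theta> \<in> Delta k m" and "(u, w) \<in> hornprod n 1 i m"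
    note uw = C[OF this(2)]
    from uw(3) show "g k (cmp k u \<theta>, cmp k w \<theta>) = sact X k m \<theta> (g m (u, w))"
    proof
      assume w: "w = constD m i"
      have "cmp k w \<theta> = constD k i" unfolding w by (rule cmp_constD_left[OF \<theta>])
      then show ?thesis using smap_nat[OF a \<theta>, of u] uw(1) w gi by simp
    next
      assume u: "u \<in> simplices (boundary n) m"
      then have "cmp k u \<theta> \<in> simplices (boundary n) k"
        using sset_closed[OF simplicial_boundary \<theta> u] by (simp add: boundary_substd)
      then show ?thesis using gb u subprod_act[OF b _ \<theta>, of u w] uw(2) by (simp add: bdprod_boundary)
    qed
  qed
  obtain \<phi> where \<phi>: "\<phi> \<in> sset_hom (stdprod n 1) X" "\<And>m s. s \<in> hornprod n 1 i m \<Longrightarrow> \<phi> m s = g m s"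
    by (rule kan_extend[OF X order_refl i gm]) (rule that, assumption, blast)
  show thesis
  proof (rule that[OF \<phi>(1)])
    fix m u assume u: "u \<in> Delta m n"
    have "1 - i \<noteq> i" using i by (cases i) (auto simp: One_nat_def)
    then have "1 - i \<notin> constD m i ` {..m}" by auto
    from hornprodI2[OF u constD_Delta[OF i] _ \<open>1 - i \<noteq> i\<close> this]
    show "\<phi> m (u, constD m i) = a m u" using \<phi>(2) gi by simp
  next
    fix m u w assume "u \<in> simplices (boundary n) m" "w \<in> Delta m 1"
    then show "\<phi> m (u, w) = b m (u, w)" using \<phi>(2)[of "(u, w)" m] gb by (simp add: hornprod_def boundary_iff)
  qed
qed

text \<open>
  The mapping path space $X\times_Y Y^{\Delta^1}$: a simplex of \<open>X\<close> and a homotopy that starts at its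
  image.
\<close>

definition map_path :: "'x sset \<Rightarrow> 'y sset \<Rightarrow> (nat \<Rightarrow> 'x \<Rightarrow> 'y) \<Rightarrow>
    ('x \<times> (nat \<Rightarrow> (nat \<Rightarrow> nat) \<times> (nat \<Rightarrow> nat) \<Rightarrow> 'y)) sset" where
  "map_path X Y f = \<lparr>simplices = (\<lambda>n. {(x, h). x \<in> simplices X n \<and> h \<in> sset_hom (stdprod n 1) Y \<and>
       (\<forall>k. \<forall>u\<in>Delta k n. h k (u, constD k 0) = f k (sact X k n u x))}),
     sact = (\<lambda>m n \<alpha> (x, h). (sact X m n \<alpha> x, \<lambda>k. \<lambda>s\<in>Delta k m \<times> Delta k 1. h k (cmp k \<alpha> (fst s), snd s)))\<rparr>"

lemma map_path_simplices: "(x, h) \<in> simplices (map_path X Y f) n \<longleftrightarrow>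
    x \<in> simplices X n \<and> h \<in> sset_hom (stdprod n 1) Y \<and> (\<forall>k. \<forall>u\<in>Delta k n. h k (u, constD k 0) = f k (sact X k n u x))"
  by (simp add: map_path_def)

lemma map_path_sact: "sact (map_path X Y f) m n \<alpha> (x, h) =
    (sact X m n \<alpha> x, \<lambda>k. \<lambda>s\<in>Delta k m \<times> Delta k 1. h k (cmp k \<alpha> (fst s), snd s))"
  by (simp add: map_path_def)

lemma stdprod_map_comp1:
  assumes h: "simplicial_map (stdprod n l) X h" and \<alpha>: "\<alpha> \<in> Delta m n"
  shows "simplicial_map (stdprod m l) X (\<lambda>k s. h k (cmp k \<alpha> (fst s), snd s))"
proof (rule stdprod_mapI)
  fix k u w assume "u \<in> Delta k m" "w \<in> Delta k l"
  then show "h k (cmp k \<alpha> (fst (u, w)), snd (u, w)) \<in> simplices X k"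
    using stdprod_val[OF h Delta_cmp[OF _ \<alpha>]] by simp
next
  fix k' k \<theta> u w assume a: "\<theta> \<in> Delta k' k" "u \<in> Delta k m" "w \<in> Delta k l"
  then show "h k' (cmp k' \<alpha> (fst (cmp k' u \<theta>, cmp k' w \<theta>)), snd (cmp k' u \<theta>, cmp k' w \<theta>)) =
      sact X k' k \<theta> (h k (cmp k \<alpha> (fst (u, w)), snd (u, w)))"
    using stdprod_act[OF h Delta_cmp[OF a(2) \<alpha>] a(3,1)] by (simp add: cmp_assoc[OF a(1)] del: cmp_apply)
qed

lemma restrict_family_eqI:
  "(\<And>k s. s \<in> A k \<Longrightarrow> F k s = G k s) \<Longrightarrow> (\<lambda>k. restrict (F k) (A k)) = (\<lambda>k. restrict (G k) (A k))"
  by (simp add: fun_eq_iff restrict_def)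

lemma simplicial_map_path:
  assumes X: "simplicial_set X" shows "simplicial_set (map_path X Y f)"
  unfolding simplicial_set_def
proof (intro conjI allI ballI)
  fix m n \<alpha> z assume \<alpha>: "\<alpha> \<in> Delta m n" and "z \<in> simplices (map_path X Y f) n"
  then obtain x h where z: "z = (x, h)" "x \<in> simplices X n" "h \<in> sset_hom (stdprod n 1) Y"
    "\<And>k u. u \<in> Delta k n \<Longrightarrow> h k (u, constD k 0) = f k (sact X k n u x)"
    by (cases z) (auto simp: map_path_simplices)
  have "(\<lambda>k. \<lambda>s\<in>Delta k m \<times> Delta k 1. h k (cmp k \<alpha> (fst s), snd s)) \<in> sset_hom (stdprod m 1) Y"
    using sset_hom_restrict[OF simplicial_stdprod stdprod_map_comp1[OF sset_homD[OF z(3)] \<alpha>]] by simp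
  moreover have "(\<lambda>s\<in>Delta k m \<times> Delta k 1. h k (cmp k \<alpha> (fst s), snd s)) (u, constD k 0) = f k (sact X k m u (sact X m n \<alpha> x))"
    if u: "u \<in> Delta k m" for k u
    using u constD_Delta[of 0 1 k] z(4)[OF Delta_cmp[OF u \<alpha>]] sset_comp[OF X u \<alpha> z(2)] by simp
  ultimately show "sact (map_path X Y f) m n \<alpha> z \<in> simplices (map_path X Y f) m"
    using sset_closed[OF X \<alpha> z(2)] by (simp add: z(1) map_path_sact map_path_simplices)
next
  fix n z assume "z \<in> simplices (map_path X Y f) n"
  then obtain x h where z: "z = (x, h)" "x \<in> simplices X n" "h \<in> sset_hom (stdprod n 1) Y"
    by (cases z) (auto simp: map_path_simplices)
  have "(\<lambda>s\<in>Delta k n \<times> Delta k 1. h k (cmp k (idD n) (fst s), snd s)) = h k" for k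
  proof
    show "(\<lambda>s\<in>Delta k n \<times> Delta k 1. h k (cmp k (idD n) (fst s), snd s)) s = h k s" for s
      using sset_hom_ext[OF z(3), of s k] by (cases "s \<in> Delta k n \<times> Delta k 1") auto
  qed
  then show "sact (map_path X Y f) n n (idD n) z = z" using sset_id[OF X z(2)] by (simp add: z(1) map_path_sact)
next
  fix k m n \<alpha> \<beta> z assume \<alpha>: "\<alpha> \<in> Delta k m" and \<beta>: "\<beta> \<in> Delta m n" and "z \<in> simplices (map_path X Y f) n"
  then obtain x h where z: "z = (x, h)" "x \<in> simplices X n" "h \<in> sset_hom (stdprod n 1) Y"
    by (cases z) (auto simp: map_path_simplices)
  show "sact (map_path X Y f) k n (cmp k \<beta> \<alpha>) z = sact (map_path X Y f) k m \<alpha> (sact (map_path X Y f) m n \<beta> z)"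
    unfolding z(1) map_path_sact
  proof (intro prod_eqI)
    show "fst (sact X k n (cmp k \<beta> \<alpha>) x, \<lambda>l. \<lambda>s\<in>Delta l k \<times> Delta l 1. h l (cmp l (cmp k \<beta> \<alpha>) (fst s), snd s)) =
      fst (sact X k m \<alpha> (sact X m n \<beta> x), \<lambda>l. \<lambda>s\<in>Delta l k \<times> Delta l 1.
         (\<lambda>s\<in>Delta l m \<times> Delta l 1. h l (cmp l \<beta> (fst s), snd s)) (cmp l \<alpha> (fst s), snd s))"
      using sset_comp[OF X \<alpha> \<beta> z(2)] by simp
    have "h l (cmp l (cmp k \<beta> \<alpha>) (fst s), snd s) =
        (\<lambda>s\<in>Delta l m \<times> Delta l 1. h l (cmp l \<beta> (fst s), snd s)) (cmp l \<alpha> (fst s), snd s)"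
      if "s \<in> Delta l k \<times> Delta l 1" for l s
      using that \<alpha> by (auto simp: cmp_assoc simp del: cmp_apply)
    note eq = restrict_family_eqI[OF this]
    show "snd (sact X k n (cmp k \<beta> \<alpha>) x, \<lambda>l. \<lambda>s\<in>Delta l k \<times> Delta l 1. h l (cmp l (cmp k \<beta> \<alpha>) (fst s), snd s)) =
      snd (sact X k m \<alpha> (sact X m n \<beta> x), \<lambda>l. \<lambda>s\<in>Delta l k \<times> Delta l 1.
         (\<lambda>s\<in>Delta l m \<times> Delta l 1. h l (cmp l \<beta> (fst s), snd s)) (cmp l \<alpha> (fst s), snd s))"
      unfolding snd_conv by (rule eq)
  qed
qed

definition path_source :: "nat \<Rightarrow> 'x \<times> (nat \<Rightarrow> (nat \<Rightarrow> nat) \<times> (nat \<Rightarrow> nat) \<Rightarrow> 'y) \<Rightarrow> 'x" where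
  "path_source n z = fst z"

definition path_target :: "nat \<Rightarrow> 'x \<times> (nat \<Rightarrow> (nat \<Rightarrow> nat) \<times> (nat \<Rightarrow> nat) \<Rightarrow> 'y) \<Rightarrow> 'y" where
  "path_target n z = snd z n (idD n, constD n 1)"

definition const_path :: "'x sset \<Rightarrow> (nat \<Rightarrow> 'x \<Rightarrow> 'y) \<Rightarrow> nat \<Rightarrow> 'x \<Rightarrow>
    'x \<times> (nat \<Rightarrow> (nat \<Rightarrow> nat) \<times> (nat \<Rightarrow> nat) \<Rightarrow> 'y)" where
  "const_path X f n x = (x, \<lambda>k. \<lambda>s\<in>Delta k n \<times> Delta k 1. f k (sact X k n (fst s) x))"

lemma D01: "constD m (0::nat) \<in> Delta m 1" "constD m (1::nat) \<in> Delta m 1"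
  by (rule constD_Delta, simp)+

lemma path_source_map: "simplicial_map (map_path X Y f) X path_source"
proof (rule simplicial_mapI)
  fix n z assume "z \<in> simplices (map_path X Y f) n"
  then show "path_source n z \<in> simplices X n" by (cases z) (simp add: map_path_simplices path_source_def)
next
  fix m n \<alpha> z show "path_source m (sact (map_path X Y f) m n \<alpha> z) = sact X m n \<alpha> (path_source n z)"
    by (cases z) (simp add: map_path_sact path_source_def)
qed

lemma map_path_val: "(x, h) \<in> simplices (map_path X Y f) n \<Longrightarrow> u \<in> Delta m n \<Longrightarrow> w \<in> Delta m 1 \<Longrightarrow>
    snd (sact (map_path X Y f) m n u (x, h)) m (idD m, w) = h m (u, w)"
  by (simp add: map_path_sact)

lemma path_target_map: "simplicial_map (map_path X Y f) Y path_target"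
proof (rule simplicial_mapI)
  fix n z assume "z \<in> simplices (map_path X Y f) n"
  then show "path_target n z \<in> simplices Y n"
    using stdprod_val[OF sset_homD, of "snd z" n 1 Y "idD n" n "constD n 1"] D01
    by (cases z) (simp add: map_path_simplices path_target_def del: restrict_apply)
next
  fix m n \<alpha> z assume \<alpha>: "\<alpha> \<in> Delta m n" and z: "z \<in> simplices (map_path X Y f) n"
  obtain x h where xh: "z = (x, h)" by (cases z)
  have h: "simplicial_map (stdprod n 1) Y h" using z xh by (simp add: map_path_simplices sset_hom_def)
  have "cmp m (idD n) \<alpha> = \<alpha>" "cmp m (constD n 1) \<alpha> = constD m 1" using \<alpha> by simp_all
  then show "path_target m (sact (map_path X Y f) m n \<alpha> z) = sact Y m n \<alpha> (path_target n z)"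
    using map_path_val[OF z[unfolded xh] \<alpha> D01(2)] stdprod_act[OF h idD_Delta D01(2) \<alpha>]
    by (simp add: path_target_def xh)
qed

lemma const_path_map:
  assumes X: "simplicial_set X" and f: "simplicial_map X Y f"
  shows "simplicial_map X (map_path X Y f) (const_path X f)"
proof (rule simplicial_mapI)
  fix n x assume x: "x \<in> simplices X n"
  have "simplicial_map (stdprod n 1) Y (\<lambda>k s. f k (sact X k n (fst s) x))"
    by (rule stdprod_mapI)
      (simp_all add: smap_closed[OF f] sset_closed[OF X _ x] smap_nat[OF f, symmetric] sset_comp[OF X _ _ x] del: cmp_apply)
  from sset_hom_restrict[OF simplicial_stdprod this]
  have "(\<lambda>k. \<lambda>s\<in>Delta k n \<times> Delta k 1. f k (sact X k n (fst s) x)) \<in> sset_hom (stdprod n 1) Y" by simp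
  then show "const_path X f n x \<in> simplices (map_path X Y f) n"
    using x D01 by (simp add: const_path_def map_path_simplices)
next
  fix m n \<alpha> x assume \<alpha>: "\<alpha> \<in> Delta m n" and x: "x \<in> simplices X n"
  have "f k (sact X k m (fst s) (sact X m n \<alpha> x)) =
      (\<lambda>s\<in>Delta k n \<times> Delta k 1. f k (sact X k n (fst s) x)) (cmp k \<alpha> (fst s), snd s)"
    if "s \<in> Delta k m \<times> Delta k 1" for k s
    using that \<alpha> sset_comp[OF X _ \<alpha> x] by (auto simp del: cmp_apply)
  note eq = restrict_family_eqI[OF this]
  show "const_path X f m (sact X m n \<alpha> x) = sact (map_path X Y f) m n \<alpha> (const_path X f n x)"
    unfolding const_path_def map_path_sact by (rule arg_cong[OF eq])
qed

lemma path_source_const[simp]: "path_source n (const_path X f n x) = x"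
  by (simp add: path_source_def const_path_def)

lemma path_target_const: "simplicial_set X \<Longrightarrow> x \<in> simplices X n \<Longrightarrow> path_target n (const_path X f n x) = f n x"
  using D01(2)[of n] by (simp add: path_target_def const_path_def sset_id)

text \<open>
  A map \<open>e\<close> from the boundary of $\Delta^n$ to the mapping path space is a map from the boundary
  to \<open>X\<close> together with the homotopy \<open>b\<close> given here.
\<close>

lemma map_path_boundary:
  assumes e: "simplicial_map (boundary n) (map_path X Y f) e"
  defines "b \<equiv> \<lambda>m s. snd (e m (fst s)) m (idD m, snd s)"
  shows "simplicial_map (subprod n 1 (bdprod n 1)) Y b"
    and "u \<in> simplices (boundary n) m \<Longrightarrow> b m (u, constD m 0) = f m (sact X m m (idD m) (path_source m (e m u)))"
    and "u \<in> simplices (boundary n) m \<Longrightarrow> b m (u, constD m 1) = path_target m (e m u)"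
    and "u \<in> simplices (boundary n) m \<Longrightarrow> v \<in> Delta k m \<Longrightarrow> w \<in> Delta k 1 \<Longrightarrow>
      b k (cmp k u v, w) = snd (e m u) k (v, w)"
proof -
  have em: "e m u \<in> simplices (map_path X Y f) m" if "u \<in> simplices (boundary n) m" for m u
    using smap_closed[OF e that] .
  have hom: "simplicial_map (stdprod m 1) Y (snd (e m u))" if "u \<in> simplices (boundary n) m" for m u
    using em[OF that] by (cases "e m u") (simp add: map_path_simplices sset_hom_def)
  have val: "b k (cmp k u v, w) = snd (e m u) k (v, w)"
    if u: "u \<in> simplices (boundary n) m" and v: "v \<in> Delta k m" and w: "w \<in> Delta k 1" for u v w k m
  proof -
    have "e k (cmp k u v) = sact (map_path X Y f) k m v (e m u)"
      using smap_nat[OF e v u] by (simp add: boundary_substd)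
    then show ?thesis using map_path_val[of "fst (e m u)" "snd (e m u)" X Y f m v k w] em[OF u] v w by (simp add: b_def)
  qed
  then show "u \<in> simplices (boundary n) m \<Longrightarrow> v \<in> Delta k m \<Longrightarrow> w \<in> Delta k 1 \<Longrightarrow>
      b k (cmp k u v, w) = snd (e m u) k (v, w)" .
  show "simplicial_map (subprod n 1 (bdprod n 1)) Y b"
  proof (rule subprod_mapI)
    fix m u w assume "(u, w) \<in> bdprod n 1 m"
    then have "u \<in> simplices (boundary n) m" "w \<in> Delta m 1" by (simp_all add: bdprod_boundary)
    then show "b m (u, w) \<in> simplices Y m" using stdprod_val[OF hom idD_Delta] by (simp add: b_def del: restrict_apply)
  next
    fix k m \<theta> u w assume \<theta>: "\<theta> \<in> Delta k m" and "(u, w) \<in> bdprod n 1 m"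
    then have u: "u \<in> simplices (boundary n) m" and w: "w \<in> Delta m 1" by (simp_all add: bdprod_boundary)
    have "b k (cmp k u \<theta>, cmp k w \<theta>) = snd (e m u) k (cmp k (idD m) \<theta>, cmp k w \<theta>)"
      using val[OF u \<theta> Delta_cmp[OF \<theta> w]] \<theta> by simp
    also have "\<dots> = sact Y k m \<theta> (b m (u, w))"
      unfolding b_def fst_conv snd_conv by (rule stdprod_act[OF hom[OF u] idD_Delta w \<theta>])
    finally show "b k (cmp k u \<theta>, cmp k w \<theta>) = sact Y k m \<theta> (b m (u, w))" .
  qed
  assume u: "u \<in> simplices (boundary n) m"
  show "b m (u, constD m 0) = f m (sact X m m (idD m) (path_source m (e m u)))"
    using em[OF u] by (cases "e m u") (simp add: map_path_simplices b_def path_source_def del: restrict_apply)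
  show "b m (u, constD m 1) = path_target m (e m u)" by (simp add: b_def path_target_def)
qed

lemma map_path_eqI:
  assumes "z \<in> simplices (map_path X Y f) m" "z' \<in> simplices (map_path X Y f) m" "fst z = fst z'"
    and "\<And>k v w. v \<in> Delta k m \<Longrightarrow> w \<in> Delta k 1 \<Longrightarrow> snd z k (v, w) = snd z' k (v, w)"
  shows "z = z'"
proof (rule prod_eqI[OF assms(3)])
  have "snd z \<in> sset_hom (stdprod m 1) Y" "snd z' \<in> sset_hom (stdprod m 1) Y"
    using assms(1,2) by (cases z; cases z'; simp add: map_path_simplices)+
  then show "snd z = snd z'" by (rule sset_hom_eqI) (use assms(4) in auto)
qed

text \<open>
  Conversely, a filler in the mapping path space consists of a filler in \<open>X\<close> and an extension of the
  homotopy; only the values over the identity operator have to be compared.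
\<close>

lemma map_path_fill:
  assumes X: "simplicial_set X" and e: "simplicial_map (boundary n) (map_path X Y f) e"
    and x: "x \<in> simplices X n" and xe: "\<And>m u. u \<in> simplices (boundary n) m \<Longrightarrow> sact X m n u x = path_source m (e m u)"
    and h: "h \<in> sset_hom (stdprod n 1) Y" and h0: "\<And>m u. u \<in> Delta m n \<Longrightarrow> h m (u, constD m 0) = f m (sact X m n u x)"
    and hb: "\<And>m u w. u \<in> simplices (boundary n) m \<Longrightarrow> w \<in> Delta m 1 \<Longrightarrow> h m (u, w) = snd (e m u) m (idD m, w)"
  shows "(x, h) \<in> simplices (map_path X Y f) n"
    and "u \<in> simplices (boundary n) m \<Longrightarrow> sact (map_path X Y f) m n u (x, h) = e m u"
proof -
  show xh: "(x, h) \<in> simplices (map_path X Y f) n" using x h h0 by (simp add: map_path_simplices)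
  assume u: "u \<in> simplices (boundary n) m"
  then have uD: "u \<in> Delta m n" by (simp add: boundary_iff)
  show "sact (map_path X Y f) m n u (x, h) = e m u"
  proof (rule map_path_eqI[OF sset_closed[OF simplicial_map_path[OF X] uD xh] smap_closed[OF e u]])
    show "fst (sact (map_path X Y f) m n u (x, h)) = fst (e m u)"
      using xe[OF u] by (simp add: map_path_sact path_source_def)
    fix k v w assume v: "v \<in> Delta k m" and w: "w \<in> Delta k 1"
    have uv: "cmp k u v \<in> simplices (boundary n) k"
      using sset_closed[OF simplicial_boundary v u] by (simp add: boundary_substd)
    have "snd (sact (map_path X Y f) m n u (x, h)) k (v, w) = h k (cmp k u v, w)"
      using v w by (simp add: map_path_sact)
    also have "\<dots> = snd (e k (cmp k u v)) k (idD k, w)" by (rule hb[OF uv w])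
    also have "\<dots> = snd (e m u) k (v, w)" using map_path_boundary(4)[OF e u v w] by simp
    finally show "snd (sact (map_path X Y f) m n u (x, h)) k (v, w) = snd (e m u) k (v, w)" .
  qed
qed

text \<open>
  Once the simplex of \<open>X\<close> is chosen, the homotopy is found by homotopy extension in \<open>Y\<close>.
\<close>

theorem path_source_triv_fib:
  assumes X: "simplicial_set X" and Y: "kan_complex Y" and f: "simplicial_map X Y f"
  shows "triv_fib (map_path X Y f) X path_source"
  unfolding triv_fib_def
proof (intro conjI allI impI path_source_map)
  fix n e x assume e: "simplicial_map (boundary n) (map_path X Y f) e" and x: "x \<in> simplices X n"
    and "\<forall>m. \<forall>u\<in>simplices (boundary n) m. path_source m (e m u) = sact X m n u x"
  then have xe: "path_source m (e m u) = sact X m n u x" if "u \<in> simplices (boundary n) m" for m u using that by blast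
  note b = map_path_boundary[OF e]
  have xm: "sact X m n u x \<in> simplices X m" if "u \<in> simplices (boundary n) m" for m u
    using sset_closed[OF X _ x] that by (simp add: boundary_iff)
  have a: "simplicial_map (std_simplex n) Y (\<lambda>m u. f m (sact X m n u x))"
    by (rule smap_comp[OF yoneda_map[OF X x] f])
  obtain h where h: "h \<in> sset_hom (stdprod n 1) Y"
    "\<And>m u. u \<in> Delta m n \<Longrightarrow> h m (u, constD m 0) = f m (sact X m n u x)"
    "\<And>m u w. u \<in> simplices (boundary n) m \<Longrightarrow> w \<in> Delta m 1 \<Longrightarrow> h m (u, w) = snd (e m u) m (idD m, w)"
  proof (rule kan_htpy_ext[OF Y a b(1), of 0])
    fix m u assume u: "u \<in> simplices (boundary n) m"
    show "snd (e m (fst (u, constD m 0))) m (idD m, snd (u, constD m 0)) = f m (sact X m n u x)"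
      using b(2)[OF u] xe[OF u] sset_id[OF X xm[OF u]] by simp
  qed (use that in simp_all)
  note fill = map_path_fill[OF X e x _ h]
  show "\<exists>z\<in>simplices (map_path X Y f) n. path_source n z = x \<and>
      (\<forall>m. \<forall>u\<in>simplices (boundary n) m. sact (map_path X Y f) m n u z = e m u)"
    by (rule bexI[OF _ fill(1)]) (use xe fill(2) in \<open>auto simp: path_source_def\<close>)
qed

text \<open>
  Between Kan complexes this is equivalent to being a weak equivalence. In contrast to homotopy
  groups it involves neither a base point nor a choice of group structure, and it is the only
  property of \<open>f\<close> from which totalizations will be treated. The homotopy starts at \<open>y\<close>, as
  \<open>kan_compose\<close> requires.
\<close>

definition lifts_up_to_homotopy :: "'x sset \<Rightarrow> 'y sset \<Rightarrow> (nat \<Rightarrow> 'x \<Rightarrow> 'y) \<Rightarrow> bool" where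
  "lifts_up_to_homotopy X Y f \<longleftrightarrow>
     (\<forall>n e y. simplicial_map (boundary n) X e \<longrightarrow> y \<in> simplices Y n \<longrightarrow>
        (\<forall>m. \<forall>u\<in>simplices (boundary n) m. f m (e m u) = sact Y m n u y) \<longrightarrow>
        (\<exists>x\<in>simplices X n. (\<forall>m. \<forall>u\<in>simplices (boundary n) m. sact X m n u x = e m u) \<and>
           (\<exists>h. simplicial_map (stdprod n 1) Y h \<and>
              (\<forall>m. \<forall>u\<in>Delta m n. h m (u, constD m 0) = sact Y m n u y \<and> h m (u, constD m 1) = f m (sact X m n u x)) \<and>
              (\<forall>m. \<forall>u\<in>simplices (boundary n) m. \<forall>w\<in>Delta m 1. h m (u, w) = sact Y m n u y))))"

text \<open>
  A lifting problem consists of a simplex \<open>y\<close> and a lift of its boundary up to a homotopy that need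
  not be constant; homotopy extension reduces it to a lift on the nose.
\<close>

theorem path_target_triv_fib:
  assumes X: "simplicial_set X" and Y: "kan_complex Y" and f: "simplicial_map X Y f"
    and lift: "lifts_up_to_homotopy X Y f"
  shows "triv_fib (map_path X Y f) Y path_target"
  unfolding triv_fib_def
proof (intro conjI allI impI path_target_map)
  note SY = kan_simplicial[OF Y]
  fix n e y assume e: "simplicial_map (boundary n) (map_path X Y f) e" and y: "y \<in> simplices Y n"
    and "\<forall>m. \<forall>u\<in>simplices (boundary n) m. path_target m (e m u) = sact Y m n u y"
  then have ye: "path_target m (e m u) = sact Y m n u y" if "u \<in> simplices (boundary n) m" for m u using that by blast
  note b = map_path_boundary[OF e]
  let ?b = "\<lambda>m s. snd (e m (fst s)) m (idD m, snd s)"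
  have bD: "u \<in> Delta m n" if "u \<in> simplices (boundary n) m" for u m using that by (simp add: boundary_iff)
  \<comment> \<open>Move \<open>y\<close> along the given homotopy to a simplex \<open>y'\<close> whose boundary is lifted on the nose.\<close>
  obtain k where k: "k \<in> sset_hom (stdprod n 1) Y"
    "\<And>m u. u \<in> Delta m n \<Longrightarrow> k m (u, constD m 1) = sact Y m n u y"
    "\<And>m u w. u \<in> simplices (boundary n) m \<Longrightarrow> w \<in> Delta m 1 \<Longrightarrow> k m (u, w) = ?b m (u, w)"
  proof (rule kan_htpy_ext[OF Y yoneda_map[OF SY y] b(1), of 1])
    show "?b m (u, constD m 1) = sact Y m n u y" if "u \<in> simplices (boundary n) m" for m u
      using b(3)[OF that] ye[OF that] by simp
  qed (use that in simp_all)
  note mk = sset_homD[OF k(1)]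
  define y' where "y' = k n (idD n, constD n 0)"
  have y': "y' \<in> simplices Y n" unfolding y'_def by (rule stdprod_val[OF mk idD_Delta D01(1)])
  have k0: "k m (u, constD m 0) = sact Y m n u y'" if u: "u \<in> Delta m n" for m u
    using stdprod_act[OF mk idD_Delta D01(1) u] u unfolding y'_def by simp
  have e': "simplicial_map (boundary n) X (\<lambda>m u. path_source m (e m u))"
    by (rule smap_comp[OF e path_source_map])
  have fe': "f m (path_source m (e m u)) = sact Y m n u y'" if u: "u \<in> simplices (boundary n) m" for m u
  proof -
    have "path_source m (e m u) \<in> simplices X m" using smap_closed[OF e' u] .
    then show ?thesis using b(2)[OF u] k(3)[OF u D01(1)] k0[OF bD[OF u]] sset_id[OF X] by simp
  qed
  have "\<exists>x\<in>simplices X n. (\<forall>m. \<forall>u\<in>simplices (boundary n) m. sact X m n u x = path_source m (e m u)) \<and>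
           (\<exists>h. simplicial_map (stdprod n 1) Y h \<and>
              (\<forall>m. \<forall>u\<in>Delta m n. h m (u, constD m 0) = sact Y m n u y' \<and> h m (u, constD m 1) = f m (sact X m n u x)) \<and>
              (\<forall>m. \<forall>u\<in>simplices (boundary n) m. \<forall>w\<in>Delta m 1. h m (u, w) = sact Y m n u y'))"
    using lift[unfolded lifts_up_to_homotopy_def, rule_format, OF e' y'] fe' by blast
  then obtain x h where x: "x \<in> simplices X n" "\<And>m u. u \<in> simplices (boundary n) m \<Longrightarrow> sact X m n u x = path_source m (e m u)"
    and h: "simplicial_map (stdprod n 1) Y h"
      "\<And>m u. u \<in> Delta m n \<Longrightarrow> h m (u, constD m 0) = sact Y m n u y'"
      "\<And>m u. u \<in> Delta m n \<Longrightarrow> h m (u, constD m 1) = f m (sact X m n u x)"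
      "\<And>m u w. u \<in> simplices (boundary n) m \<Longrightarrow> w \<in> Delta m 1 \<Longrightarrow> h m (u, w) = sact Y m n u y'" by blast
  \<comment> \<open>Compose the two homotopies out of \<open>y'\<close>; the first one is constant on the boundary.\<close>
  \<comment> \<open>The operator \<open>\<nu>\<close> contracts the edge from 0 to 1, on which the first homotopy lives.\<close>
  define \<nu> where "\<nu> = (\<lambda>i\<in>{..2::nat}. i - (1::nat))"
  have \<nu>: "\<nu> \<in> Delta 2 1" by (rule DeltaI) (auto simp: \<nu>_def)
  have bm: "simplicial_map (subprod n 2 (bdprod n 2)) Y (\<lambda>m s. ?b m (fst s, cmp m \<nu> (snd s)))"
  proof (rule subprod_mapI)
    fix m u w assume "(u, w) \<in> bdprod n 2 m"
    then have "(u, cmp m \<nu> w) \<in> bdprod n 1 m" using Delta_cmp[OF _ \<nu>] by (simp add: bdprod_boundary del: cmp_apply)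
    from subprod_val[OF b(1) this] show "?b m (fst (u, w), cmp m \<nu> (snd (u, w))) \<in> simplices Y m"
      by (simp del: cmp_apply)
  next
    fix k m \<theta> u w assume \<theta>: "\<theta> \<in> Delta k m" and "(u, w) \<in> bdprod n 2 m"
    then have "(u, cmp m \<nu> w) \<in> bdprod n 1 m" using Delta_cmp[OF _ \<nu>] by (simp add: bdprod_boundary del: cmp_apply)
    from subprod_act[OF b(1) this \<theta>]
    show "?b k (fst (cmp k u \<theta>, cmp k w \<theta>), cmp k \<nu> (snd (cmp k u \<theta>, cmp k w \<theta>))) =
        sact Y k m \<theta> (?b m (fst (u, w), cmp m \<nu> (snd (u, w))))" by (simp add: cmp_assoc[OF \<theta>] del: cmp_apply)
  qed
  let ?\<mu> = "\<lambda>i\<in>{..2::nat}. min i (1::nat)"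
  have \<mu>: "?\<mu> \<in> Delta 2 1" by (rule DeltaI) auto
  obtain h3 where h3: "h3 \<in> sset_hom (stdprod n 1) Y"
    "\<And>m u. u \<in> Delta m n \<Longrightarrow> h3 m (u, constD m 0) = h m (u, constD m 1)"
    "\<And>m u. u \<in> Delta m n \<Longrightarrow> h3 m (u, constD m 1) = k m (u, constD m 1)"
    "\<And>m u w. (u, w) \<in> bdprod n 1 m \<Longrightarrow> h3 m (u, w) = ?b m (fst (u, cmp m (\<lambda>i\<in>{..1}. Suc i) w), cmp m \<nu> (snd (u, cmp m (\<lambda>i\<in>{..1}. Suc i) w)))"
  proof (rule kan_compose[OF Y h(1) mk bm])
    show "h m (u, constD m 0) = k m (u, constD m 0)" if "u \<in> Delta m n" for m u
      using h(2)[OF that] k0[OF that] by simp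
  next
    fix m u w assume "(u, w) \<in> bdprod n 2 m" and w2: "2 \<notin> w ` {..m}"
    then have u: "u \<in> simplices (boundary n) m" and w: "w \<in> Delta m 2" by (simp_all add: bdprod_boundary)
    have "cmp m \<nu> w = constD m 0"
    proof (rule Delta_eqI[OF Delta_cmp[OF w \<nu>] D01(1)])
      fix i assume i: "i \<le> m"
      then have "w i \<le> 2" "w i \<noteq> 2" using w2 Delta_le[OF w] by auto
      then show "cmp m \<nu> w i = constD m 0 i" using i by (simp add: \<nu>_def)
    qed
    then show "?b m (fst (u, w), cmp m \<nu> (snd (u, w))) = h m (u, cmp m ?\<mu> w)"
      using h(4)[OF u Delta_cmp[OF w \<mu>]] k(3)[OF u D01(1)] k0[OF bD[OF u]] by simp
  next
    fix m u w assume "(u, w) \<in> bdprod n 2 m" and w1: "1 \<notin> w ` {..m}"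
    then have u: "u \<in> simplices (boundary n) m" and w: "w \<in> Delta m 2" by (simp_all add: bdprod_boundary)
    have "cmp m \<nu> w = cmp m ?\<mu> w"
    proof (rule Delta_eqI[OF Delta_cmp[OF w \<nu>] Delta_cmp[OF w \<mu>]])
      fix i assume i: "i \<le> m"
      then have "w i \<le> 2" "w i \<noteq> 1" using w1 Delta_le[OF w] by auto
      then have "w i = 0 \<or> w i = 2" by auto
      then show "cmp m \<nu> w i = cmp m ?\<mu> w i" using i by (auto simp: \<nu>_def)
    qed
    then show "?b m (fst (u, w), cmp m \<nu> (snd (u, w))) = k m (u, cmp m ?\<mu> w)"
      using k(3)[OF u Delta_cmp[OF w \<mu>]] by simp
  qed (use that in blast)
  have h3b: "h3 m (u, w) = snd (e m u) m (idD m, w)" if u: "u \<in> simplices (boundary n) m" and w: "w \<in> Delta m 1" for m u w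
  proof -
    have "cmp m \<nu> (cmp m (\<lambda>i\<in>{..1}. Suc i) w) = w"
      using Delta_le[OF w] Delta_undefined[OF w] by (auto simp: fun_eq_iff \<nu>_def One_nat_def numeral_2_eq_2)
    then show ?thesis using h3(4)[of u w m] u w by (simp add: bdprod_boundary del: cmp_apply)
  qed
  have h30: "h3 m (u, constD m 0) = f m (sact X m n u x)" if "u \<in> Delta m n" for m u
    using h3(2)[OF that] h(3)[OF that] by simp
  note fill = map_path_fill[OF X e x h3(1) h30 h3b]
  show "\<exists>z\<in>simplices (map_path X Y f) n. path_target n z = y \<and>
      (\<forall>m. \<forall>u\<in>simplices (boundary n) m. sact (map_path X Y f) m n u z = e m u)"
  proof (rule bexI[OF _ fill(1)])
    have "path_target n (x, h3) = y"
      using h3(3)[OF idD_Delta] k(2)[OF idD_Delta] sset_id[OF SY y] by (simp add: path_target_def del: restrict_apply)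
    then show "path_target n (x, h3) = y \<and> (\<forall>m. \<forall>u\<in>simplices (boundary n) m. sact (map_path X Y f) m n u (x, h3) = e m u)"
      using fill(2) by blast
  qed
qed


section \<open>Weak equivalences of totalizations\<close>

definition cosimp_map_path :: "'x cosimp_sset \<Rightarrow> 'y cosimp_sset \<Rightarrow> (nat \<Rightarrow> nat \<Rightarrow> 'x \<Rightarrow> 'y) \<Rightarrow>
    ('x \<times> (nat \<Rightarrow> (nat \<Rightarrow> nat) \<times> (nat \<Rightarrow> nat) \<Rightarrow> 'y)) cosimp_sset" where
  "cosimp_map_path X Y f = \<lparr>xlevel = (\<lambda>p. map_path (xlevel X p) (xlevel Y p) (f p)),
     xact = (\<lambda>p q \<delta> k (x, h). (xact X p q \<delta> k x, \<lambda>l. \<lambda>s\<in>Delta l k \<times> Delta l 1. xact Y p q \<delta> l (h l s)))\<rparr>"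

lemma cosimp_map_path_level[simp]: "xlevel (cosimp_map_path X Y f) p = map_path (xlevel X p) (xlevel Y p) (f p)"
  by (simp add: cosimp_map_path_def)

lemma cosimp_map_path_act: "xact (cosimp_map_path X Y f) p q \<delta> k (x, h) =
    (xact X p q \<delta> k x, \<lambda>l. \<lambda>s\<in>Delta l k \<times> Delta l 1. xact Y p q \<delta> l (h l s))"
  by (simp add: cosimp_map_path_def)

context rcosimp_map
begin

lemma rcosimp_map_path: "rcosimp (cosimp_map_path X Y f)"
proof (rule rcosimp.intro)
  show "simplicial_set (xlevel (cosimp_map_path X Y f) p)" for p
    by (simp add: simplicial_map_path X.lev)
next
  fix \<delta> p q assume \<delta>: "\<delta> \<in> Delta_r p q"
  show "simplicial_map (xlevel (cosimp_map_path X Y f) p) (xlevel (cosimp_map_path X Y f) q) (xact (cosimp_map_path X Y f) p q \<delta>)"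
  proof (rule simplicial_mapI)
    fix n z assume "z \<in> simplices (xlevel (cosimp_map_path X Y f) p) n"
    then obtain x h where z: "z = (x, h)" "x \<in> simplices (xlevel X p) n" "h \<in> sset_hom (stdprod n 1) (xlevel Y p)"
      "\<And>k u. u \<in> Delta k n \<Longrightarrow> h k (u, constD k 0) = f p k (sact (xlevel X p) k n u x)"
      by (cases z) (auto simp: map_path_simplices)
    have "(\<lambda>l. \<lambda>s\<in>Delta l n \<times> Delta l 1. xact Y p q \<delta> l (h l s)) \<in> sset_hom (stdprod n 1) (xlevel Y q)"
      using sset_hom_restrict[OF simplicial_stdprod smap_comp[OF sset_homD[OF z(3)] Y.map[OF \<delta>]]] by simp
    moreover have "xact Y p q \<delta> k (h k (u, constD k 0)) = f q k (sact (xlevel X q) k n u (xact X p q \<delta> n x))"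
      if u: "u \<in> Delta k n" for k u
      using z(4)[OF u] nat[OF \<delta> sset_closed[OF X.lev u z(2)]] smap_nat[OF X.map[OF \<delta>] u z(2)] by simp
    ultimately show "xact (cosimp_map_path X Y f) p q \<delta> n z \<in> simplices (xlevel (cosimp_map_path X Y f) q) n"
      using smap_closed[OF X.map[OF \<delta>] z(2)] D01 by (simp add: z(1) cosimp_map_path_act map_path_simplices)
  next
    fix m n \<alpha> z assume \<alpha>: "\<alpha> \<in> Delta m n" and "z \<in> simplices (xlevel (cosimp_map_path X Y f) p) n"
    then obtain x h where z: "z = (x, h)" "x \<in> simplices (xlevel X p) n" by (cases z) (auto simp: map_path_simplices)
    have "xact Y p q \<delta> l ((\<lambda>s\<in>Delta l m \<times> Delta l 1. h l (cmp l \<alpha> (fst s), snd s)) s) =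
        (\<lambda>s\<in>Delta l n \<times> Delta l 1. xact Y p q \<delta> l (h l s)) (cmp l \<alpha> (fst s), snd s)"
      if "s \<in> Delta l m \<times> Delta l 1" for l s
      using that \<alpha> by (auto simp del: cmp_apply)
    note eq = restrict_family_eqI[OF this]
    show "xact (cosimp_map_path X Y f) p q \<delta> m (sact (xlevel (cosimp_map_path X Y f) p) m n \<alpha> z) =
        sact (xlevel (cosimp_map_path X Y f) q) m n \<alpha> (xact (cosimp_map_path X Y f) p q \<delta> n z)"
      unfolding z(1) cosimp_map_path_level map_path_sact cosimp_map_path_act smap_nat[OF X.map[OF \<delta>] \<alpha> z(2)]
      by (rule arg_cong[OF eq])
  qed
next
  fix p k z assume "z \<in> simplices (xlevel (cosimp_map_path X Y f) p) k"
  then obtain x h where z: "z = (x, h)" "x \<in> simplices (xlevel X p) k" "h \<in> sset_hom (stdprod k 1) (xlevel Y p)"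
    by (cases z) (auto simp: map_path_simplices)
  have "(\<lambda>s\<in>Delta l k \<times> Delta l 1. xact Y p p (idD p) l (h l s)) = h l" for l
  proof
    show "(\<lambda>s\<in>Delta l k \<times> Delta l 1. xact Y p p (idD p) l (h l s)) s = h l s" for s
      using sset_hom_ext[OF z(3), of s l] smap_closed[OF sset_homD[OF z(3)], of s l] Y.ident
      by (cases "s \<in> Delta l k \<times> Delta l 1") simp_all
  qed
  then show "xact (cosimp_map_path X Y f) p p (idD p) k z = z"
    using X.ident[OF z(2)] by (simp add: z(1) cosimp_map_path_act)
next
  fix p q r \<delta> \<epsilon> k z assume \<delta>: "\<delta> \<in> Delta_r p q" and \<epsilon>: "\<epsilon> \<in> Delta_r q r"
    and "z \<in> simplices (xlevel (cosimp_map_path X Y f) p) k"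
  then obtain x h where z: "z = (x, h)" "x \<in> simplices (xlevel X p) k" "h \<in> sset_hom (stdprod k 1) (xlevel Y p)"
    by (cases z) (auto simp: map_path_simplices)
  have "xact Y q r \<epsilon> l ((\<lambda>s\<in>Delta l k \<times> Delta l 1. xact Y p q \<delta> l (h l s)) s) = xact Y p r (cmp p \<epsilon> \<delta>) l (h l s)"
    if s: "s \<in> Delta l k \<times> Delta l 1" for l s
    using s Y.comp[OF \<delta> \<epsilon>] smap_closed[OF sset_homD[OF z(3)], of s l] by simp
  note eq = restrict_family_eqI[OF this]
  show "xact (cosimp_map_path X Y f) q r \<epsilon> k (xact (cosimp_map_path X Y f) p q \<delta> k z) =
      xact (cosimp_map_path X Y f) p r (cmp p \<epsilon> \<delta>) k z"
    unfolding z(1) cosimp_map_path_act X.comp[OF \<delta> \<epsilon> z(2)] by (rule arg_cong[OF eq])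
qed

lemma rcosimp_map_source: "rcosimp_map (cosimp_map_path X Y f) X (\<lambda>p. path_source)"
proof (intro rcosimp_map.intro rcosimp_map_axioms.intro rcosimp_map_path X.rcosimp_axioms)
  show "simplicial_map (xlevel (cosimp_map_path X Y f) p) (xlevel X p) path_source" for p
    by (simp add: path_source_map)
  show "path_source k (xact (cosimp_map_path X Y f) p q \<delta> k z) = xact X p q \<delta> k (path_source k z)" for p q \<delta> k z
    by (cases z) (simp add: cosimp_map_path_act path_source_def)
qed

lemma rcosimp_map_target: "rcosimp_map (cosimp_map_path X Y f) Y (\<lambda>p. path_target)"
proof (intro rcosimp_map.intro rcosimp_map_axioms.intro rcosimp_map_path Y.rcosimp_axioms)
  show "simplicial_map (xlevel (cosimp_map_path X Y f) p) (xlevel Y p) path_target" for p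
    by (simp add: path_target_map)
  show "path_target k (xact (cosimp_map_path X Y f) p q \<delta> k z) = xact Y p q \<delta> k (path_target k z)" for p q \<delta> k z
    using D01(2)[of k] by (cases z) (simp add: cosimp_map_path_act path_target_def)
qed

lemma rcosimp_map_const: "rcosimp_map X (cosimp_map_path X Y f) (\<lambda>p. const_path (xlevel X p) (f p))"
proof (intro rcosimp_map.intro rcosimp_map_axioms.intro rcosimp_map_path X.rcosimp_axioms)
  show "simplicial_map (xlevel X p) (xlevel (cosimp_map_path X Y f) p) (const_path (xlevel X p) (f p))" for p
    by (simp add: const_path_map X.lev lev)
  fix \<delta> p q x k assume \<delta>: "\<delta> \<in> Delta_r p q" and x: "x \<in> simplices (xlevel X p) k"
  have "f q l (sact (xlevel X q) l k (fst s) (xact X p q \<delta> k x)) =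
      xact Y p q \<delta> l ((\<lambda>s\<in>Delta l k \<times> Delta l 1. f p l (sact (xlevel X p) l k (fst s) x)) s)"
    if s: "s \<in> Delta l k \<times> Delta l 1" for l s
  proof -
    have u: "fst s \<in> Delta l k" using s by auto
    show ?thesis using s smap_nat[OF X.map[OF \<delta>] u x] nat[OF \<delta> sset_closed[OF X.lev u x]] by simp
  qed
  note eq = restrict_family_eqI[OF this]
  show "const_path (xlevel X q) (f q) k (xact X p q \<delta> k x) = xact (cosimp_map_path X Y f) p q \<delta> k (const_path (xlevel X p) (f p) k x)"
    unfolding const_path_def cosimp_map_path_act by (rule arg_cong[OF eq])
qed

text \<open>
  The span from \<open>X\<close> to \<open>Y\<close> through the mapping path space is natural, so it exists in the
  cosimplicial setting, and its legs remain trivial fibrations after totalization.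
\<close>

theorem weak_equivalence_Tot:
  assumes kX: "\<And>p. kan_complex (xlevel X p)" and kY: "\<And>p. kan_complex (xlevel Y p)"
    and lift: "\<And>p. lifts_up_to_homotopy (xlevel X p) (xlevel Y p) (f p)"
  shows "weak_equivalence (Tot_r X) (Tot_r Y) (Tot_r_map f)"
proof (rule weak_equivalence_of_span)
  let ?P = "cosimp_map_path X Y f"
  interpret S: rcosimp_map ?P X "\<lambda>p. path_source" by (rule rcosimp_map_source)
  interpret T: rcosimp_map ?P Y "\<lambda>p. path_target" by (rule rcosimp_map_target)
  interpret C: rcosimp_map X ?P "\<lambda>p. const_path (xlevel X p) (f p)" by (rule rcosimp_map_const)
  show "kan_complex (Tot_r X)" by (rule X.kan_Tot[OF kX])
  show "kan_complex (Tot_r Y)" by (rule Y.kan_Tot[OF kY])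
  show "simplicial_set (Tot_r ?P)" by (rule simplicial_Tot)
  show "triv_fib (Tot_r ?P) (Tot_r X) (Tot_r_map (\<lambda>p. path_source))"
    by (rule S.triv_fib_Tot) (simp add: path_source_triv_fib[OF X.lev kY lev])
  show "triv_fib (Tot_r ?P) (Tot_r Y) (Tot_r_map (\<lambda>p. path_target))"
    by (rule T.triv_fib_Tot) (simp add: path_target_triv_fib[OF X.lev kY lev lift])
  show "simplicial_map (Tot_r X) (Tot_r ?P) (Tot_r_map (\<lambda>p. const_path (xlevel X p) (f p)))"
    by (rule C.simplicial_Tot_r_map)
  show "simplicial_map (Tot_r X) (Tot_r Y) (Tot_r_map f)" by (rule simplicial_Tot_r_map)
  fix n t assume t: "t \<in> simplices (Tot_r X) n"
  note ct = C.Tot_r_map_closed[OF t]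
  show "Tot_r_map (\<lambda>p. path_source) n (Tot_r_map (\<lambda>p. const_path (xlevel X p) (f p)) n t) = t"
    by (rule Tot_eqI[OF S.Tot_r_map_closed[OF ct] t]) (simp add: Tot_r_map_apply)
  show "Tot_r_map (\<lambda>p. path_target) n (Tot_r_map (\<lambda>p. const_path (xlevel X p) (f p)) n t) = Tot_r_map f n t"
    by (rule Tot_eqI[OF T.Tot_r_map_closed[OF ct] Tot_r_map_closed[OF t]])
      (simp add: Tot_r_map_apply path_target_const[OF X.lev Tot_val[OF t]])
qed

end


section \<open>The nerve of a 2-groupoid\<close>

definition vert :: "('o, 'm, 'c) nerve_simplex \<Rightarrow> nat \<Rightarrow> 'o" where "vert s i = fst s i"
definition edg :: "('o, 'm, 'c) nerve_simplex \<Rightarrow> nat \<Rightarrow> nat \<Rightarrow> 'm" where "edg s i j = fst (snd s) (i, j)"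
definition tri :: "('o, 'm, 'c) nerve_simplex \<Rightarrow> nat \<Rightarrow> nat \<Rightarrow> nat \<Rightarrow> 'c" where "tri s i j k = snd (snd s) (i, j, k)"

text \<open>
  The curried form of a simplex of the nerve; every simplex arises in this way from its components.
\<close>

definition mk_simplex :: "nat \<Rightarrow> (nat \<Rightarrow> 'o) \<Rightarrow> (nat \<Rightarrow> nat \<Rightarrow> 'm) \<Rightarrow> (nat \<Rightarrow> nat \<Rightarrow> nat \<Rightarrow> 'c) \<Rightarrow> ('o, 'm, 'c) nerve_simplex" where
  "mk_simplex n x g a = (\<lambda>i\<in>{..n}. x i, \<lambda>(i, j)\<in>pairs n. g i j, \<lambda>(i, j, k)\<in>triples n. a i j k)"

lemma vert_mk_simplex[simp]: "i \<le> n \<Longrightarrow> vert (mk_simplex n x g a) i = x i"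
  and edg_mk_simplex[simp]: "i < j \<Longrightarrow> j \<le> n \<Longrightarrow> edg (mk_simplex n x g a) i j = g i j"
  and tri_mk_simplex[simp]: "i < j \<Longrightarrow> j < k \<Longrightarrow> k \<le> n \<Longrightarrow> tri (mk_simplex n x g a) i j k = a i j k"
  by (simp_all add: vert_def edg_def tri_def mk_simplex_def pairs_def triples_def)

lemma edge_alt: "edge \<G> s i j = (if i = j then unit1 \<G> (vert s i) else edg s i j)"
  by (cases s) (simp add: edge_def vert_def edg_def)

lemma triangle_alt: "triangle \<G> s i j k = (if i = j \<or> j = k then unit2 \<G> (edge \<G> s i k) else tri s i j k)"
  by (cases s) (simp add: triangle_def tri_def)

lemma nerve_sact: "sact (nerve \<G>) m n \<alpha> s =
    mk_simplex m (\<lambda>i. vert s (\<alpha> i)) (\<lambda>i j. edge \<G> s (\<alpha> i) (\<alpha> j)) (\<lambda>i j k. triangle \<G> s (\<alpha> i) (\<alpha> j) (\<alpha> k))"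
  by (simp add: nerve_def mk_simplex_def vert_def)

lemma nerve_map_mk_simplex: "nerve_map F n s =
    mk_simplex n (\<lambda>i. on_obj F (vert s i)) (\<lambda>i j. on_mor F (edg s i j)) (\<lambda>i j k. on_cell F (tri s i j k))"
  by (cases s) (simp add: nerve_map_def mk_simplex_def compose_def vert_def edg_def tri_def restrict_def fun_eq_iff)

definition tetra :: "('o, 'm, 'c) two_cat \<Rightarrow> ('o, 'm, 'c) nerve_simplex \<Rightarrow> nat \<Rightarrow> nat \<Rightarrow> nat \<Rightarrow> nat \<Rightarrow> bool" where
  "tetra \<G> s i j k l \<longleftrightarrow>
     vcomp \<G> (hcomp \<G> (unit2 \<G> (edg s k l)) (tri s i j k)) (tri s i k l) =
     vcomp \<G> (hcomp \<G> (tri s j k l) (unit2 \<G> (edg s i j))) (tri s i j l)"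

lemma simplices_nerve[simp]: "simplices (nerve \<G>) n = nerve_simplices \<G> n"
  by (simp add: nerve_def)

lemma nerve_vert: "s \<in> nerve_simplices \<G> n \<Longrightarrow> i \<le> n \<Longrightarrow> vert s i \<in> Obj \<G>"
  by (auto simp: nerve_simplices_def vert_def)

lemma nerve_edg: "s \<in> nerve_simplices \<G> n \<Longrightarrow> i < j \<Longrightarrow> j \<le> n \<Longrightarrow> edg s i j \<in> hom1 \<G> (vert s i) (vert s j)"
  by (fastforce simp: nerve_simplices_def vert_def edg_def pairs_def PiE_def Pi_def)

lemma nerve_tri: "s \<in> nerve_simplices \<G> n \<Longrightarrow> i < j \<Longrightarrow> j < k \<Longrightarrow> k \<le> n \<Longrightarrow>
    tri s i j k \<in> hom2 \<G> (edg s i k) (comp1 \<G> (edg s j k) (edg s i j))"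
  by (fastforce simp: nerve_simplices_def edg_def tri_def triples_def PiE_def Pi_def)

lemma nerve_tetra: "s \<in> nerve_simplices \<G> n \<Longrightarrow> i < j \<Longrightarrow> j < k \<Longrightarrow> k < l \<Longrightarrow> l \<le> n \<Longrightarrow> tetra \<G> s i j k l"
  by (auto simp: nerve_simplices_def tetra_def edg_def tri_def)

lemma nerve_ext: "s \<in> nerve_simplices \<G> n \<Longrightarrow> mk_simplex n (vert s) (edg s) (tri s) = s"
  by (cases s) (auto simp: nerve_simplices_def mk_simplex_def vert_def edg_def tri_def fun_eq_iff PiE_def extensional_def)

lemma mk_simplex_cong:
  assumes "\<And>i. i \<le> n \<Longrightarrow> x i = x' i" "\<And>i j. i < j \<Longrightarrow> j \<le> n \<Longrightarrow> g i j = g' i j"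
    and "\<And>i j k. i < j \<Longrightarrow> j < k \<Longrightarrow> k \<le> n \<Longrightarrow> a i j k = a' i j k"
  shows "mk_simplex n x g a = mk_simplex n x' g' a'"
  using assms by (auto simp: mk_simplex_def fun_eq_iff restrict_def pairs_def triples_def)

lemma nerve_eqI:
  assumes "s \<in> nerve_simplices \<G> n" "s' \<in> nerve_simplices \<G> n"
    and "\<And>i. i \<le> n \<Longrightarrow> vert s i = vert s' i" "\<And>i j. i < j \<Longrightarrow> j \<le> n \<Longrightarrow> edg s i j = edg s' i j"
    and "\<And>i j k. i < j \<Longrightarrow> j < k \<Longrightarrow> k \<le> n \<Longrightarrow> tri s i j k = tri s' i j k"
  shows "s = s'"
proof -
  have "mk_simplex n (vert s) (edg s) (tri s) = mk_simplex n (vert s') (edg s') (tri s')"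
    by (rule mk_simplex_cong) (simp_all add: assms(3-5))
  then show ?thesis unfolding nerve_ext[OF assms(1)] nerve_ext[OF assms(2)] .
qed

lemma mk_simplex_nerveI:
  assumes "\<And>i. i \<le> n \<Longrightarrow> x i \<in> Obj \<G>" "\<And>i j. i < j \<Longrightarrow> j \<le> n \<Longrightarrow> g i j \<in> hom1 \<G> (x i) (x j)"
    and "\<And>i j k. i < j \<Longrightarrow> j < k \<Longrightarrow> k \<le> n \<Longrightarrow> a i j k \<in> hom2 \<G> (g i k) (comp1 \<G> (g j k) (g i j))"
    and "\<And>i j k l. i < j \<Longrightarrow> j < k \<Longrightarrow> k < l \<Longrightarrow> l \<le> n \<Longrightarrow> tetra \<G> (mk_simplex n x g a) i j k l"
  shows "mk_simplex n x g a \<in> nerve_simplices \<G> n"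
proof -
  have "(\<lambda>(i, j)\<in>pairs n. g i j) \<in> (\<Pi>\<^sub>E (i, j)\<in>pairs n. hom1 \<G> ((\<lambda>i\<in>{..n}. x i) i) ((\<lambda>i\<in>{..n}. x i) j))"
    using assms(2) by (intro PiE_I) (auto simp: pairs_def)
  moreover have "(\<lambda>(i, j, k)\<in>triples n. a i j k) \<in> (\<Pi>\<^sub>E (i, j, k)\<in>triples n.
      hom2 \<G> ((\<lambda>(i, j)\<in>pairs n. g i j) (i, k)) (comp1 \<G> ((\<lambda>(i, j)\<in>pairs n. g i j) (j, k)) ((\<lambda>(i, j)\<in>pairs n. g i j) (i, j))))"
    using assms(3) by (intro PiE_I) (auto simp: pairs_def triples_def)
  moreover have "(\<lambda>i\<in>{..n}. x i) \<in> {..n} \<rightarrow>\<^sub>E Obj \<G>" using assms(1) by auto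
  moreover have "\<forall>i j k l. i < j \<and> j < k \<and> k < l \<and> l \<le> n \<longrightarrow> tetra \<G> (mk_simplex n x g a) i j k l" using assms(4) by blast
  ultimately show ?thesis unfolding nerve_simplices_def mk_simplex_def tetra_def edg_def tri_def by simp
qed

context two_groupoid
begin

lemma hom1_src: "f \<in> hom1 \<G> x y \<Longrightarrow> x \<in> Obj \<G>" and hom1_tgt: "f \<in> hom1 \<G> x y \<Longrightarrow> y \<in> Obj \<G>"
  and hom1_Mor: "f \<in> hom1 \<G> x y \<Longrightarrow> f \<in> Mor \<G>"
  by (auto simp: hom1_def src1_obj tgt1_obj)

lemma edge_hom: "s \<in> nerve_simplices \<G> n \<Longrightarrow> i \<le> j \<Longrightarrow> j \<le> n \<Longrightarrow> edge \<G> s i j \<in> hom1 \<G> (vert s i) (vert s j)"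
  using nerve_edg[of s \<G> n i j] unit1_hom[OF nerve_vert[of s \<G> n i]] by (auto simp: edge_alt)

end

lemma two_functorD:
  assumes "two_functor \<G> \<H> F"
  shows "x \<in> Obj \<G> \<Longrightarrow> on_obj F x \<in> Obj \<H>"
    and "f \<in> hom1 \<G> x y \<Longrightarrow> on_mor F f \<in> hom1 \<H> (on_obj F x) (on_obj F y)"
    and "a \<in> hom2 \<G> f g \<Longrightarrow> on_cell F a \<in> hom2 \<H> (on_mor F f) (on_mor F g)"
    and "x \<in> Obj \<G> \<Longrightarrow> on_mor F (unit1 \<G> x) = unit1 \<H> (on_obj F x)"
    and "f \<in> hom1 \<G> x y \<Longrightarrow> g \<in> hom1 \<G> y z \<Longrightarrow> on_mor F (comp1 \<G> g f) = comp1 \<H> (on_mor F g) (on_mor F f)"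
    and "f \<in> Mor \<G> \<Longrightarrow> on_cell F (unit2 \<G> f) = unit2 \<H> (on_mor F f)"
    and "a \<in> hom2 \<G> f g \<Longrightarrow> b \<in> hom2 \<G> g h \<Longrightarrow> on_cell F (vcomp \<G> b a) = vcomp \<H> (on_cell F b) (on_cell F a)"
    and "f \<in> hom1 \<G> x y \<Longrightarrow> g \<in> hom1 \<G> y z \<Longrightarrow> a \<in> hom2 \<G> f f' \<Longrightarrow> b \<in> hom2 \<G> g g' \<Longrightarrow>
      on_cell F (hcomp \<G> b a) = hcomp \<H> (on_cell F b) (on_cell F a)"
  using assms unfolding two_functor_def hom1_def hom2_def by auto

context two_groupoid
begin

text \<open>
  Stated for families of edges and triangles, since it serves to deduce the tetrahedron identity
  of \<open>s\<close> from the identity for the image of \<open>s\<close>.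
\<close>

lemma functor_tetra:
  assumes F: "two_functor \<G> \<H> F" and e: "\<And>i j. i < j \<Longrightarrow> j \<le> n \<Longrightarrow> edg s i j \<in> hom1 \<G> (vert s i) (vert s j)"
    and t: "\<And>i j k. i < j \<Longrightarrow> j < k \<Longrightarrow> k \<le> n \<Longrightarrow> tri s i j k \<in> hom2 \<G> (edg s i k) (comp1 \<G> (edg s j k) (edg s i j))"
    and ijkl: "i < j" "j < k" "k < l" "l \<le> n"
  defines "L \<equiv> vcomp \<G> (hcomp \<G> (unit2 \<G> (edg s k l)) (tri s i j k)) (tri s i k l)"
    and "R \<equiv> vcomp \<G> (hcomp \<G> (tri s j k l) (unit2 \<G> (edg s i j))) (tri s i j l)"
  shows "L \<in> hom2 \<G> (edg s i l) (comp1 \<G> (edg s k l) (comp1 \<G> (edg s j k) (edg s i j)))"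
    and "R \<in> hom2 \<G> (edg s i l) (comp1 \<G> (edg s k l) (comp1 \<G> (edg s j k) (edg s i j)))"
    and "on_cell F L = vcomp \<H> (hcomp \<H> (unit2 \<H> (on_mor F (edg s k l))) (on_cell F (tri s i j k))) (on_cell F (tri s i k l))"
    and "on_cell F R = vcomp \<H> (hcomp \<H> (on_cell F (tri s j k l)) (unit2 \<H> (on_mor F (edg s i j)))) (on_cell F (tri s i j l))"
proof -
  note F = two_functorD[OF F]
  have E: "edg s i j \<in> hom1 \<G> (vert s i) (vert s j)" "edg s j k \<in> hom1 \<G> (vert s j) (vert s k)"
    "edg s k l \<in> hom1 \<G> (vert s k) (vert s l)" "edg s i k \<in> hom1 \<G> (vert s i) (vert s k)"
    "edg s j l \<in> hom1 \<G> (vert s j) (vert s l)" using e ijkl by auto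
  have T: "tri s i j k \<in> hom2 \<G> (edg s i k) (comp1 \<G> (edg s j k) (edg s i j))"
    "tri s i k l \<in> hom2 \<G> (edg s i l) (comp1 \<G> (edg s k l) (edg s i k))"
    "tri s j k l \<in> hom2 \<G> (edg s j l) (comp1 \<G> (edg s k l) (edg s j k))"
    "tri s i j l \<in> hom2 \<G> (edg s i l) (comp1 \<G> (edg s j l) (edg s i j))" using t ijkl by auto
  note u = unit2_hom[OF hom1_Mor[OF E(3)]] unit2_hom[OF hom1_Mor[OF E(1)]]
  note h1 = hcomp_hom[OF E(4,3) T(1) u(1)]
  note h2 = hcomp_hom[OF E(1,5) u(2) T(3), folded comp1_assoc[OF E(1-3)]]
  show "L \<in> hom2 \<G> (edg s i l) (comp1 \<G> (edg s k l) (comp1 \<G> (edg s j k) (edg s i j)))"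
    unfolding L_def by (rule vcomp_hom[OF T(2) h1])
  show "R \<in> hom2 \<G> (edg s i l) (comp1 \<G> (edg s k l) (comp1 \<G> (edg s j k) (edg s i j)))"
    unfolding R_def by (rule vcomp_hom[OF T(4) h2])
  show "on_cell F L = vcomp \<H> (hcomp \<H> (unit2 \<H> (on_mor F (edg s k l))) (on_cell F (tri s i j k))) (on_cell F (tri s i k l))"
    unfolding L_def F(7)[OF T(2) h1] F(8)[OF E(4,3) T(1) u(1)] F(6)[OF hom1_Mor[OF E(3)]] ..
  show "on_cell F R = vcomp \<H> (hcomp \<H> (on_cell F (tri s j k l)) (unit2 \<H> (on_mor F (edg s i j)))) (on_cell F (tri s i j l))"
    unfolding R_def F(7)[OF T(4) h2] F(8)[OF E(1,5) u(2) T(3)] F(6)[OF hom1_Mor[OF E(1)]] ..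
qed

lemma nerve_map_simplicial:
  assumes F: "two_functor \<G> \<H> F"
  shows "simplicial_map (nerve \<G>) (nerve \<H>) (nerve_map F)"
proof (rule simplicial_mapI)
  note FD = two_functorD[OF F]
  fix n s assume "s \<in> simplices (nerve \<G>) n"
  then have s: "s \<in> nerve_simplices \<G> n" by simp
  have "mk_simplex n (\<lambda>i. on_obj F (vert s i)) (\<lambda>i j. on_mor F (edg s i j)) (\<lambda>i j k. on_cell F (tri s i j k)) \<in> nerve_simplices \<H> n"
  proof (rule mk_simplex_nerveI)
    fix i j k assume ijk: "i < j" "j < k" "k \<le> n"
    show "on_cell F (tri s i j k) \<in> hom2 \<H> (on_mor F (edg s i k)) (comp1 \<H> (on_mor F (edg s j k)) (on_mor F (edg s i j)))"
      using FD(3)[OF nerve_tri[OF s ijk]] FD(5)[OF nerve_edg[OF s, of i j] nerve_edg[OF s, of j k]] ijk by simp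
  next
    fix i j k l assume ijkl: "i < j" "j < k" "k < l" "l \<le> n"
    note t = functor_tetra[OF F nerve_edg[OF s] nerve_tri[OF s] ijkl]
    show "tetra \<H> (mk_simplex n (\<lambda>i. on_obj F (vert s i)) (\<lambda>i j. on_mor F (edg s i j)) (\<lambda>i j k. on_cell F (tri s i j k))) i j k l"
      using nerve_tetra[OF s ijkl] t(3,4) ijkl unfolding tetra_def by simp
  qed (use FD(1)[OF nerve_vert[OF s]] FD(2)[OF nerve_edg[OF s]] in auto)
  then show "nerve_map F n s \<in> simplices (nerve \<H>) n" by (simp add: nerve_map_mk_simplex)
next
  note FD = two_functorD[OF F]
  fix m n \<alpha> s assume \<alpha>: "\<alpha> \<in> Delta m n" and "s \<in> simplices (nerve \<G>) n"
  then have s: "s \<in> nerve_simplices \<G> n" by simp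
  let ?Fs = "mk_simplex n (\<lambda>i. on_obj F (vert s i)) (\<lambda>i j. on_mor F (edg s i j)) (\<lambda>i j k. on_cell F (tri s i j k))"
  have E: "on_mor F (edge \<G> s i j) = edge \<H> ?Fs i j" if "i \<le> j" "j \<le> n" for i j
    using that FD(4)[OF nerve_vert[OF s]] by (auto simp: edge_alt)
  have T: "on_cell F (triangle \<G> s i j k) = triangle \<H> ?Fs i j k" if "i \<le> j" "j \<le> k" "k \<le> n" for i j k
    using that FD(6)[OF hom1_Mor[OF edge_hom[OF s, of i k]]] E[of i k] by (auto simp: triangle_alt)
  show "nerve_map F m (sact (nerve \<G>) m n \<alpha> s) = sact (nerve \<H>) m n \<alpha> (nerve_map F n s)"
    unfolding nerve_sact nerve_map_mk_simplex
  proof (rule mk_simplex_cong)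
    fix i j k assume ijk: "i < j" "j < k" "k \<le> m"
    then show "on_cell F (tri (mk_simplex m (\<lambda>i. vert s (\<alpha> i)) (\<lambda>i j. edge \<G> s (\<alpha> i) (\<alpha> j)) (\<lambda>i j k. triangle \<G> s (\<alpha> i) (\<alpha> j) (\<alpha> k))) i j k) =
       triangle \<H> ?Fs (\<alpha> i) (\<alpha> j) (\<alpha> k)"
      using T[of "\<alpha> i" "\<alpha> j" "\<alpha> k"] Delta_mono[OF \<alpha>, of i j] Delta_mono[OF \<alpha>, of j k] Delta_le[OF \<alpha>, of k] by simp
  next
    fix i j assume "i < j" "j \<le> m"
    then show "on_mor F (edg (mk_simplex m (\<lambda>i. vert s (\<alpha> i)) (\<lambda>i j. edge \<G> s (\<alpha> i) (\<alpha> j)) (\<lambda>i j k. triangle \<G> s (\<alpha> i) (\<alpha> j) (\<alpha> k))) i j) =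
       edge \<H> ?Fs (\<alpha> i) (\<alpha> j)"
      using E[of "\<alpha> i" "\<alpha> j"] Delta_mono[OF \<alpha>, of i j] Delta_le[OF \<alpha>, of j] by simp
  qed (use Delta_le[OF \<alpha>] in simp)
qed

end

lemma two_fun_eq_nerve:
  assumes G: "two_groupoid \<G>" and eq: "two_fun_eq \<G> F F'" and s: "s \<in> nerve_simplices \<G> n"
  shows "nerve_map F n s = nerve_map F' n s"
  unfolding nerve_map_mk_simplex
proof (rule mk_simplex_cong)
  show "on_obj F (vert s i) = on_obj F' (vert s i)" if "i \<le> n" for i
    using eq nerve_vert[OF s that] by (simp add: two_fun_eq_def)
  show "on_mor F (edg s i j) = on_mor F' (edg s i j)" if "i < j" "j \<le> n" for i j
    using eq nerve_edg[OF s that] by (simp add: two_fun_eq_def hom1_def)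
  show "on_cell F (tri s i j k) = on_cell F' (tri s i j k)" if "i < j" "j < k" "k \<le> n" for i j k
    using eq nerve_tri[OF s that] by (simp add: two_fun_eq_def hom2_def)
qed

lemma nerve_map_id: "s \<in> nerve_simplices \<G> n \<Longrightarrow> nerve_map two_fun_id n s = s"
  using nerve_ext[of s \<G> n] by (simp add: nerve_map_mk_simplex two_fun_id_def)

lemma nerve_map_comp: "nerve_map (two_fun_comp K F) n s = nerve_map K n (nerve_map F n s)"
  unfolding nerve_map_mk_simplex by (rule mk_simplex_cong) (simp_all add: two_fun_comp_def)


section \<open>Low-dimensional simplices and spheres of the nerve\<close>

text \<open>
  Operators $[k]\to[n]$ given by the list of their values.
\<close>

definition seq_map :: "nat list \<Rightarrow> nat \<Rightarrow> nat" where
  "seq_map xs = (\<lambda>i\<in>{..length xs - 1}. xs ! i)"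

lemma le_numerals: "i \<le> (1::nat) \<longleftrightarrow> i = 0 \<or> i = 1" "i \<le> (2::nat) \<longleftrightarrow> i = 0 \<or> i = 1 \<or> i = 2"
  "i \<le> (3::nat) \<longleftrightarrow> i = 0 \<or> i = 1 \<or> i = 2 \<or> i = 3"
  by auto

lemma seq_map_simps[simp]:
  "seq_map [a] 0 = a" "seq_map [a, b] 0 = a" "seq_map [a, b] 1 = b" "seq_map [a, b, c] 0 = a" "seq_map [a, b, c] 1 = b" "seq_map [a, b, c] 2 = c"
  "seq_map [a, b, c, d] 0 = a" "seq_map [a, b, c, d] 1 = b" "seq_map [a, b, c, d] 2 = c" "seq_map [a, b, c, d] 3 = d"
  by (simp_all add: seq_map_def numeral_2_eq_2 numeral_3_eq_3 One_nat_def)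

lemma seq_map_undefined: "0 < i \<Longrightarrow> seq_map [a] i = undefined" "1 < i \<Longrightarrow> seq_map [a, b] i = undefined"
  "2 < i \<Longrightarrow> seq_map [a, b, c] i = undefined" "3 < i \<Longrightarrow> seq_map [a, b, c, d] i = undefined"
  by (simp_all add: seq_map_def One_nat_def)

lemma seq_map_Delta:
  "a \<le> n \<Longrightarrow> seq_map [a] \<in> Delta 0 n"
  "a \<le> b \<Longrightarrow> b \<le> n \<Longrightarrow> seq_map [a, b] \<in> Delta 1 n"
  "a \<le> b \<Longrightarrow> b \<le> c \<Longrightarrow> c \<le> n \<Longrightarrow> seq_map [a, b, c] \<in> Delta 2 n"
  "a \<le> b \<Longrightarrow> b \<le> c \<Longrightarrow> c \<le> d \<Longrightarrow> d \<le> n \<Longrightarrow> seq_map [a, b, c, d] \<in> Delta 3 n"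
  by (rule DeltaI; auto simp: le_numerals seq_map_undefined)+

lemma cmp_seq_map[simp]:
  "cmp 0 \<alpha> (seq_map [a]) = seq_map [\<alpha> a]" "cmp 1 \<alpha> (seq_map [a, b]) = seq_map [\<alpha> a, \<alpha> b]"
  "cmp 2 \<alpha> (seq_map [a, b, c]) = seq_map [\<alpha> a, \<alpha> b, \<alpha> c]" "cmp 3 \<alpha> (seq_map [a, b, c, d]) = seq_map [\<alpha> a, \<alpha> b, \<alpha> c, \<alpha> d]"
proof -
  show "cmp 0 \<alpha> (seq_map [a]) = seq_map [\<alpha> a]" by (auto simp: fun_eq_iff seq_map_undefined)
  have "cmp 1 \<alpha> (seq_map [a, b]) i = seq_map [\<alpha> a, \<alpha> b] i" for i
    by (cases "i \<le> 1") (auto simp: le_numerals seq_map_undefined)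
  then show "cmp 1 \<alpha> (seq_map [a, b]) = seq_map [\<alpha> a, \<alpha> b]" ..
  have "cmp 2 \<alpha> (seq_map [a, b, c]) i = seq_map [\<alpha> a, \<alpha> b, \<alpha> c] i" for i
    by (cases "i \<le> 2") (auto simp: le_numerals seq_map_undefined)
  then show "cmp 2 \<alpha> (seq_map [a, b, c]) = seq_map [\<alpha> a, \<alpha> b, \<alpha> c]" ..
  have "cmp 3 \<alpha> (seq_map [a, b, c, d]) i = seq_map [\<alpha> a, \<alpha> b, \<alpha> c, \<alpha> d] i" for i
    by (cases "i \<le> 3") (auto simp: le_numerals seq_map_undefined)
  then show "cmp 3 \<alpha> (seq_map [a, b, c, d]) = seq_map [\<alpha> a, \<alpha> b, \<alpha> c, \<alpha> d]" ..
qed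

lemma seq_map_const: "constD 0 c = seq_map [c]" "constD 1 c = seq_map [c, c]" "constD 2 c = seq_map [c, c, c]"
  and seq_map_id: "idD 0 = seq_map [0]" "idD 1 = seq_map [0, 1]" "idD 2 = seq_map [0, 1, 2]"
proof -
  show "constD 0 c = seq_map [c]" "idD 0 = seq_map [0]" by (auto simp: fun_eq_iff seq_map_undefined)
  have "constD 1 c i = seq_map [c, c] i" "idD 1 i = seq_map [0, 1] i" for i
    by (cases "i \<le> 1"; auto simp: le_numerals seq_map_undefined)+
  then show "constD 1 c = seq_map [c, c]" "idD 1 = seq_map [0, 1]" by blast+
  have "constD 2 c i = seq_map [c, c, c] i" "idD 2 i = seq_map [0, 1, 2] i" for i
    by (cases "i \<le> 2"; auto simp: le_numerals seq_map_undefined)+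
  then show "constD 2 c = seq_map [c, c, c]" "idD 2 = seq_map [0, 1, 2]" by blast+
qed

lemma boundary_card:
  assumes "u \<in> Delta m n" "card (u ` {..m}) \<le> n" shows "u \<in> simplices (boundary n) m"
proof -
  have "u ` {..m} \<noteq> {..n}" using assms(2) by (metis card_atMost not_less_eq_eq order_refl)
  then show ?thesis using assms(1) by (simp add: boundary_iff)
qed

lemma seq_map_image: "seq_map [a] ` {..0} = {a}" "seq_map [a, b] ` {..1} = {a, b}" "seq_map [a, b, c] ` {..2} = {a, b, c}"
proof -
  have "{..0::nat} = {0}" "{..1::nat} = {0, 1}" "{..2::nat} = {0, 1, 2}" by (auto simp: le_numerals)
  then show "seq_map [a] ` {..0} = {a}" "seq_map [a, b] ` {..1} = {a, b}" "seq_map [a, b, c] ` {..2} = {a, b, c}" by simp_all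
qed

lemma seq_map_boundary:
  "a \<le> n \<Longrightarrow> 1 \<le> n \<Longrightarrow> seq_map [a] \<in> simplices (boundary n) 0"
  "a \<le> b \<Longrightarrow> b \<le> n \<Longrightarrow> 2 \<le> n \<or> a = b \<and> 1 \<le> n \<Longrightarrow> seq_map [a, b] \<in> simplices (boundary n) 1"
  "a \<le> b \<Longrightarrow> b \<le> c \<Longrightarrow> c \<le> n \<Longrightarrow> 3 \<le> n \<or> (a = b \<or> b = c) \<and> 2 \<le> n \<Longrightarrow> seq_map [a, b, c] \<in> simplices (boundary n) 2"
proof -
  show "seq_map [a] \<in> simplices (boundary n) 0" if "a \<le> n" "1 \<le> n"
    by (rule boundary_card[OF seq_map_Delta(1)[OF that(1)]]) (simp only: seq_map_image, use that in simp)
  show "seq_map [a, b] \<in> simplices (boundary n) 1" if "a \<le> b" "b \<le> n" "2 \<le> n \<or> a = b \<and> 1 \<le> n"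
    by (rule boundary_card[OF seq_map_Delta(2)[OF that(1,2)]])
      (simp only: seq_map_image, use that(3) in \<open>auto simp: card_insert_if\<close>)
  show "seq_map [a, b, c] \<in> simplices (boundary n) 2"
    if "a \<le> b" "b \<le> c" "c \<le> n" "3 \<le> n \<or> (a = b \<or> b = c) \<and> 2 \<le> n"
    by (rule boundary_card[OF seq_map_Delta(3)[OF that(1-3)]])
      (simp only: seq_map_image, use that(4) in \<open>auto simp: card_insert_if\<close>)
qed

lemma nerve_sact_vert[simp]: "i \<le> m \<Longrightarrow> vert (sact (nerve \<G>) m n \<alpha> s) i = vert s (\<alpha> i)"
  and nerve_sact_edg[simp]: "i < j \<Longrightarrow> j \<le> m \<Longrightarrow> edg (sact (nerve \<G>) m n \<alpha> s) i j = edge \<G> s (\<alpha> i) (\<alpha> j)"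
  and nerve_sact_tri[simp]: "i < j \<Longrightarrow> j < k \<Longrightarrow> k \<le> m \<Longrightarrow>
    tri (sact (nerve \<G>) m n \<alpha> s) i j k = triangle \<G> s (\<alpha> i) (\<alpha> j) (\<alpha> k)"
  by (simp_all add: nerve_sact)

text \<open>
  The components of the value of a map into a nerve on a simplex can be computed one edge or
  triangle at a time.
\<close>

lemma nerve_map_probe:
  assumes h: "simplicial_map (stdprod p q) (nerve \<G>) h" and u: "u \<in> Delta m p" and w: "w \<in> Delta m q"
  shows "i \<le> m \<Longrightarrow> vert (h m (u, w)) i = vert (h 0 (seq_map [u i], seq_map [w i])) 0"
    and "i < j \<Longrightarrow> j \<le> m \<Longrightarrow> edg (h m (u, w)) i j = edg (h 1 (seq_map [u i, u j], seq_map [w i, w j])) 0 1"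
    and "i < j \<Longrightarrow> j < k \<Longrightarrow> k \<le> m \<Longrightarrow>
      tri (h m (u, w)) i j k = tri (h 2 (seq_map [u i, u j, u k], seq_map [w i, w j, w k])) 0 1 2"
proof -
  note act = stdprod_act[OF h u w]
  show "vert (h m (u, w)) i = vert (h 0 (seq_map [u i], seq_map [w i])) 0" if "i \<le> m"
    using arg_cong[OF act[OF seq_map_Delta(1)[OF that]], of "\<lambda>s. vert s 0"] by simp
  show "edg (h m (u, w)) i j = edg (h 1 (seq_map [u i, u j], seq_map [w i, w j])) 0 1" if "i < j" "j \<le> m"
  proof -
    have "seq_map [i, j] \<in> Delta 1 m" using that by (intro seq_map_Delta) auto
    from arg_cong[OF act[OF this], of "\<lambda>s. edg s 0 1"] that show ?thesis by (simp add: edge_alt)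
  qed
  show "tri (h m (u, w)) i j k = tri (h 2 (seq_map [u i, u j, u k], seq_map [w i, w j, w k])) 0 1 2" if "i < j" "j < k" "k \<le> m"
  proof -
    have "seq_map [i, j, k] \<in> Delta 2 m" using that by (intro seq_map_Delta) auto
    from arg_cong[OF act[OF this], of "\<lambda>s. tri s 0 1 2"] that show ?thesis by (simp add: triangle_alt)
  qed
qed

lemma const_at_nerve:
  "i \<le> m \<Longrightarrow> vert (const_at (nerve \<G>) v m) i = vert v 0"
  "i < j \<Longrightarrow> j \<le> m \<Longrightarrow> edg (const_at (nerve \<G>) v m) i j = unit1 \<G> (vert v 0)"
  "i < j \<Longrightarrow> j < k \<Longrightarrow> k \<le> m \<Longrightarrow> tri (const_at (nerve \<G>) v m) i j k = unit2 \<G> (unit1 \<G> (vert v 0))"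
  unfolding const_at_def by (simp_all add: edge_alt triangle_alt)

definition vertex_simplex :: "'o \<Rightarrow> ('o, 'm, 'c) nerve_simplex" where
  "vertex_simplex x = mk_simplex 0 (\<lambda>_. x) (\<lambda>_ _. undefined) (\<lambda>_ _ _. undefined)"

definition edge_simplex :: "('o, 'm, 'c) two_cat \<Rightarrow> 'm \<Rightarrow> ('o, 'm, 'c) nerve_simplex" where
  "edge_simplex \<G> f = mk_simplex 1 (\<lambda>i. if i = 0 then src1 \<G> f else tgt1 \<G> f) (\<lambda>_ _. f) (\<lambda>_ _ _. undefined)"

lemma vert_vertex_simplex[simp]: "vert (vertex_simplex x) 0 = x"
  by (simp add: vertex_simplex_def)

lemma vertex_simplex_vert: "s \<in> nerve_simplices \<G> 0 \<Longrightarrow> vertex_simplex (vert s 0) = s"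
  by (subst nerve_ext[of s \<G> 0, symmetric]) (auto simp: vertex_simplex_def intro: mk_simplex_cong)

lemma edge_simplex_edg: "s \<in> nerve_simplices \<G> 1 \<Longrightarrow> edge_simplex \<G> (edg s 0 1) = s"
proof -
  assume s: "s \<in> nerve_simplices \<G> 1"
  have e: "edg s 0 1 \<in> hom1 \<G> (vert s 0) (vert s 1)" by (rule nerve_edg[OF s]) auto
  have "edge_simplex \<G> (edg s 0 1) = mk_simplex 1 (vert s) (edg s) (tri s)"
    unfolding edge_simplex_def by (rule mk_simplex_cong) (use e in \<open>auto simp: hom1_def le_numerals\<close>)
  then show ?thesis using nerve_ext[OF s] by simp
qed

context two_groupoid
begin

lemma vertex_simplex_nerve: "x \<in> Obj \<G> \<Longrightarrow> vertex_simplex x \<in> nerve_simplices \<G> 0"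
  unfolding vertex_simplex_def by (rule mk_simplex_nerveI) auto

lemma edge_simplex_nerve: "f \<in> hom1 \<G> x y \<Longrightarrow> edge_simplex \<G> f \<in> nerve_simplices \<G> 1"
  unfolding edge_simplex_def by (rule mk_simplex_nerveI) (auto simp: hom1_def src1_obj tgt1_obj le_numerals)

lemma edge_simplex_simps: "f \<in> hom1 \<G> x y \<Longrightarrow> vert (edge_simplex \<G> f) 0 = x" "f \<in> hom1 \<G> x y \<Longrightarrow> vert (edge_simplex \<G> f) 1 = y"
  "f \<in> hom1 \<G> x y \<Longrightarrow> edg (edge_simplex \<G> f) 0 1 = f"
  by (auto simp: edge_simplex_def hom1_def)

lemma path_rel_nerve:
  assumes S: "simplicial_set (nerve \<G>)"
  shows "(vertex_simplex x, vertex_simplex y) \<in> path_rel (nerve \<G>) \<longleftrightarrow> (\<exists>f. f \<in> hom1 \<G> x y)"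
proof
  assume "(vertex_simplex x, vertex_simplex y) \<in> path_rel (nerve \<G>)"
  then obtain e where e: "e \<in> nerve_simplices \<G> 1" "sact (nerve \<G>) 0 1 (constD 0 0) e = vertex_simplex x"
    "sact (nerve \<G>) 0 1 (constD 0 1) e = vertex_simplex y" unfolding path_rel_def by auto
  have "vert e 0 = x" "vert e 1 = y"
    using arg_cong[OF e(2), of "\<lambda>s. vert s 0"] arg_cong[OF e(3), of "\<lambda>s. vert s 0"] by simp_all
  then have "edg e 0 1 \<in> hom1 \<G> x y" using nerve_edg[OF e(1), of 0 1] by simp
  then show "\<exists>f. f \<in> hom1 \<G> x y" ..
next
  assume "\<exists>f. f \<in> hom1 \<G> x y"
  then obtain f where f: "f \<in> hom1 \<G> x y" ..
  have "sact (nerve \<G>) 0 1 (constD 0 0) (edge_simplex \<G> f) = vertex_simplex x" "sact (nerve \<G>) 0 1 (constD 0 1) (edge_simplex \<G> f) = vertex_simplex y"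
    unfolding nerve_sact vertex_simplex_def by (rule mk_simplex_cong; simp add: edge_simplex_simps[OF f])+
  then show "(vertex_simplex x, vertex_simplex y) \<in> path_rel (nerve \<G>)"
    unfolding path_rel_def using edge_simplex_nerve[OF f] by auto
qed

text \<open>
  A 2-morphism \<open>b : g \<Rightarrow> g'\<close> is a triangle with edges \<open>g\<close>, \<open>g'\<close> and an identity; collapsing one side
  of a square onto a vertex of the triangle makes it a homotopy from \<open>g\<close> to \<open>g'\<close> rel endpoints.
\<close>

lemma cell_homotopy:
  assumes S: "simplicial_set (nerve \<G>)" and g: "g \<in> hom1 \<G> x y" and g': "g' \<in> hom1 \<G> x y" and b: "b \<in> hom2 \<G> g g'"
  obtains h where "simplicial_map (stdprod 1 1) (nerve \<G>) h"
    "\<And>m u. u \<in> Delta m 1 \<Longrightarrow> h m (u, constD m 0) = sact (nerve \<G>) m 1 u (edge_simplex \<G> g)"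
    "\<And>m u. u \<in> Delta m 1 \<Longrightarrow> h m (u, constD m 1) = sact (nerve \<G>) m 1 u (edge_simplex \<G> g')"
    "\<And>m u w. u \<in> simplices (boundary 1) m \<Longrightarrow> w \<in> Delta m 1 \<Longrightarrow> h m (u, w) = sact (nerve \<G>) m 1 u (edge_simplex \<G> g)"
proof -
  have xy: "x \<in> Obj \<G>" "y \<in> Obj \<G>" using hom1_src[OF g] hom1_tgt[OF g] .
  define T where "T = mk_simplex 2 (\<lambda>i. if i = 2 then y else x) (\<lambda>i j. if j = 1 then unit1 \<G> x else if i = 0 then g else g') (\<lambda>_ _ _. b)"
  have T: "T \<in> nerve_simplices \<G> 2"
    unfolding T_def
  proof (rule mk_simplex_nerveI)
    fix i j k :: nat assume "i < j" "j < k" "k \<le> 2"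
    then have [simp]: "i = 0" "j = 1" "k = 2" by auto
    show "b \<in> hom2 \<G> (if k = 1 then unit1 \<G> x else if i = 0 then g else g')
       (comp1 \<G> (if k = 1 then unit1 \<G> x else if j = 0 then g else g') (if j = 1 then unit1 \<G> x else if i = 0 then g else g'))"
      using b comp1_unit_right[OF g'] by simp
  next
    fix i j :: nat assume "i < j" "j \<le> 2"
    then have "i = 0 \<and> j = 1 \<or> i = 0 \<and> j = 2 \<or> i = 1 \<and> j = 2" by auto
    then show "(if j = 1 then unit1 \<G> x else if i = 0 then g else g') \<in> hom1 \<G> (if i = 2 then y else x) (if j = 2 then y else x)"
      using g g' unit1_hom[OF xy(1)] by auto
  qed (use xy in auto)
  have Tv: "vert T 0 = x" "vert T 1 = x" "vert T 2 = y" and Te: "edg T 0 1 = unit1 \<G> x" "edg T 0 2 = g" "edg T 1 2 = g'"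
    by (simp_all add: T_def)
  \<comment> \<open>The triangle has its vertices 0 and 1 over the first vertex of the edge, and 2 over the second one.\<close>
  define \<rho> where "\<rho> m s = (\<lambda>i\<in>{..m}. if fst s i = 0 then snd s i else (2::nat))" for m and s :: "(nat \<Rightarrow> nat) \<times> (nat \<Rightarrow> nat)"
  have \<rho>: "\<rho> m (u, w) \<in> Delta m 2" if u: "u \<in> Delta m 1" and w: "w \<in> Delta m 1" for m u w
  proof (rule DeltaI)
    show "\<rho> m (u, w) i \<le> 2" if "i \<le> m" for i using Delta_le[OF w that] that by (simp add: \<rho>_def)
    show "\<rho> m (u, w) i \<le> \<rho> m (u, w) j" if "i \<le> j" "j \<le> m" for i j
      using Delta_le[OF w, of i] Delta_mono[OF w that] Delta_mono[OF u that] that by (auto simp: \<rho>_def)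
  qed (simp add: \<rho>_def)
  define h where "h m s = sact (nerve \<G>) m 2 (\<rho> m s) T" for m s
  have hm: "simplicial_map (stdprod 1 1) (nerve \<G>) h"
  proof (rule stdprod_mapI)
    show "h m (u, w) \<in> simplices (nerve \<G>) m" if "u \<in> Delta m 1" "w \<in> Delta m 1" for m u w
      unfolding h_def by (rule sset_closed[OF S \<rho>[OF that]]) (simp add: T)
    fix k m \<theta> u w assume \<theta>: "\<theta> \<in> Delta k m" and uw: "u \<in> Delta m 1" "w \<in> Delta m 1"
    have "\<rho> k (cmp k u \<theta>, cmp k w \<theta>) = cmp k (\<rho> m (u, w)) \<theta>"
      using Delta_le[OF \<theta>] by (auto simp: \<rho>_def fun_eq_iff)
    then show "h k (cmp k u \<theta>, cmp k w \<theta>) = sact (nerve \<G>) k m \<theta> (h m (u, w))"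
      unfolding h_def using sset_comp[OF S \<theta> \<rho>[OF uw], of T] T by simp
  qed
  have L: "seq_map [0, 2] \<in> Delta 1 2" "seq_map [1, 2] \<in> Delta 1 2" by (intro seq_map_Delta; simp)+
  have T02: "sact (nerve \<G>) 1 2 (seq_map [0, 2]) T = edge_simplex \<G> g"
    unfolding nerve_sact edge_simplex_def by (rule mk_simplex_cong) (use g in \<open>auto simp: le_numerals Tv Te edge_alt hom1_def\<close>)
  have T12: "sact (nerve \<G>) 1 2 (seq_map [1, 2]) T = edge_simplex \<G> g'"
    unfolding nerve_sact edge_simplex_def by (rule mk_simplex_cong) (use g' in \<open>auto simp: le_numerals Tv Te edge_alt hom1_def\<close>)
  have TS: "T \<in> simplices (nerve \<G>) 2" using T by simp
  show thesis
  proof (rule that[OF hm])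
    fix m u assume u: "u \<in> Delta m 1"
    have "\<rho> m (u, constD m 0) = cmp m (seq_map [0, 2]) u" "\<rho> m (u, constD m 1) = cmp m (seq_map [1, 2]) u"
    proof -
      have "\<rho> m (u, constD m 0) i = cmp m (seq_map [0, 2]) u i \<and> \<rho> m (u, constD m 1) i = cmp m (seq_map [1, 2]) u i" for i
      proof (cases "i \<le> m")
        case True
        then have "u i = 0 \<or> u i = 1" using Delta_le[OF u True] by (simp add: le_numerals)
        then show ?thesis using True by (elim disjE) (simp_all add: \<rho>_def)
      qed (simp add: \<rho>_def)
      then show "\<rho> m (u, constD m 0) = cmp m (seq_map [0, 2]) u" "\<rho> m (u, constD m 1) = cmp m (seq_map [1, 2]) u" by blast+
    qed
    then show "h m (u, constD m 0) = sact (nerve \<G>) m 1 u (edge_simplex \<G> g)" "h m (u, constD m 1) = sact (nerve \<G>) m 1 u (edge_simplex \<G> g')"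
      unfolding h_def T02[symmetric] T12[symmetric] using sset_comp[OF S u L(1) TS] sset_comp[OF S u L(2) TS] by simp_all
  next
    fix m u w assume u: "u \<in> simplices (boundary 1) m" and w: "w \<in> Delta m 1"
    have uD: "u \<in> Delta m 1" using u by (simp add: boundary_iff)
    have uc: "(\<forall>i\<le>m. u i = 0) \<or> (\<forall>i\<le>m. u i = 1)"
    proof -
      have "\<not> {..1} \<subseteq> u ` {..m}" using u Delta_le[OF uD] by (auto simp: boundary_iff)
      then have "0 \<notin> u ` {..m} \<or> 1 \<notin> u ` {..m}" by (auto simp: le_numerals)
      moreover have "u i = 0 \<or> u i = 1" if "i \<le> m" for i using Delta_le[OF uD that] by (simp add: le_numerals)
      ultimately show ?thesis by force
    qed
    have wc: "w i = 0 \<or> w i = 1" if "i \<le> m" for i using Delta_le[OF w that] by (simp add: le_numerals)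
    have v: "vert T (\<rho> m (u, w) i) = vert (edge_simplex \<G> g) (u i)" if "i \<le> m" for i
      using uc wc[OF that] that by (auto simp: \<rho>_def Tv edge_simplex_simps[OF g])
    have E: "edge \<G> T (\<rho> m (u, w) i) (\<rho> m (u, w) j) = edge \<G> (edge_simplex \<G> g) (u i) (u j)" if "i \<le> j" "j \<le> m" for i j
      using uc wc[of i] wc[of j] that Delta_mono[OF w that] by (auto simp: \<rho>_def Tv Te edge_simplex_simps[OF g] edge_alt)
    have t: "triangle \<G> T (\<rho> m (u, w) i) (\<rho> m (u, w) j) (\<rho> m (u, w) k) = triangle \<G> (edge_simplex \<G> g) (u i) (u j) (u k)"
      if "i \<le> j" "j \<le> k" "k \<le> m" for i j k
    proof -
      have "\<rho> m (u, w) i = \<rho> m (u, w) j \<or> \<rho> m (u, w) j = \<rho> m (u, w) k"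
        using uc wc[of i] wc[of j] wc[of k] that Delta_mono[OF w, of i j] Delta_mono[OF w, of j k] by (auto simp: \<rho>_def)
      moreover have "u i = u j" using uc that by auto
      ultimately show ?thesis using E[of i k] that by (simp add: triangle_alt)
    qed
    show "h m (u, w) = sact (nerve \<G>) m 1 u (edge_simplex \<G> g)"
      unfolding h_def nerve_sact by (rule mk_simplex_cong) (use v E t in auto)
  qed
qed

definition loop :: "'m \<Rightarrow> nat \<Rightarrow> (nat \<Rightarrow> nat) \<Rightarrow> ('o, 'm, 'c) nerve_simplex" where
  "loop l = (\<lambda>m. \<lambda>u\<in>Delta m 1. sact (nerve \<G>) m 1 u (edge_simplex \<G> l))"

lemma loop_sphere:
  assumes S: "simplicial_set (nerve \<G>)" and l: "l \<in> hom1 \<G> x x"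
  shows "loop l \<in> spheres (nerve \<G>) 1 (vertex_simplex x)"
proof -
  have "loop l \<in> sset_hom (std_simplex 1) (nerve \<G>)"
    unfolding loop_def by (rule yoneda_hom[OF S]) (simp add: edge_simplex_nerve[OF l])
  moreover have "loop l m u = const_at (nerve \<G>) (vertex_simplex x) m" if u: "u \<in> simplices (boundary 1) m" for m u
  proof -
    have uD: "u \<in> Delta m 1" using u by (simp add: boundary_iff)
    have "\<not> {..1} \<subseteq> u ` {..m}" using u Delta_le[OF uD] by (auto simp: boundary_iff)
    then have "0 \<notin> u ` {..m} \<or> 1 \<notin> u ` {..m}" by (auto simp: le_numerals)
    moreover have "u i = 0 \<or> u i = 1" if "i \<le> m" for i using Delta_le[OF uD that] by (simp add: le_numerals)
    ultimately have uc: "(\<forall>i\<le>m. u i = 0) \<or> (\<forall>i\<le>m. u i = 1)" by force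
    have "sact (nerve \<G>) m 1 u (edge_simplex \<G> l) = sact (nerve \<G>) m 0 (constD m 0) (vertex_simplex x)"
      unfolding nerve_sact by (rule mk_simplex_cong) (use uc in \<open>auto simp: edge_simplex_simps[OF l] edge_alt triangle_alt\<close>)
    then show ?thesis using uD by (simp add: loop_def const_at_def)
  qed
  ultimately show ?thesis by (simp add: spheres_def)
qed

lemma sphere_top: "\<alpha> \<in> spheres (nerve \<G>) n v \<Longrightarrow> \<alpha> n (idD n) \<in> nerve_simplices \<G> n"
  using smap_closed[OF sset_homD[OF sphere_hom], of \<alpha> "nerve \<G>" n v "idD n" n] by (simp del: restrict_apply)

lemma loop_top: "l \<in> hom1 \<G> x x \<Longrightarrow> simplicial_set (nerve \<G>) \<Longrightarrow> loop l 1 (idD 1) = edge_simplex \<G> l"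
  using sset_id[of "nerve \<G>" "edge_simplex \<G> l" 1] edge_simplex_nerve[of l x x] by (simp add: loop_def)

lemma loop_hom:
  assumes g: "\<gamma> \<in> spheres (nerve \<G>) 1 (vertex_simplex x)" shows "edg (\<gamma> 1 (idD 1)) 0 1 \<in> hom1 \<G> x x"
proof -
  note t = sphere_top[OF g] and m = sset_homD[OF sphere_hom[OF g]]
  have "vert (\<gamma> 1 (idD 1)) c = x" if c: "c \<le> 1" for c
  proof -
    have lc: "seq_map [c] \<in> simplices (boundary 1) 0" using seq_map_boundary(1)[OF c] by simp
    have "vert (\<gamma> 0 (seq_map [c])) 0 = vert (\<gamma> 1 (idD 1)) c"
      using map_std_simplex[OF m seq_map_Delta(1)[OF c]] by simp
    then show ?thesis using sphere_bd[OF g lc] const_at_nerve(1)[of 0 0 \<G> "vertex_simplex x"] by simp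
  qed
  then show ?thesis using nerve_edg[OF t, of 0 1] by simp
qed

text \<open>
  The square of a homotopy is cut by its diagonal into two triangles. Their sides on the boundary
  are identities, so that they are 2-morphisms from the diagonal to the two loops.
\<close>

lemma loop_homotopy_cell:
  assumes ab: "(\<alpha>, \<beta>) \<in> sphere_htpy (nerve \<G>) 1 (vertex_simplex x)"
  shows "\<exists>a. a \<in> hom2 \<G> (edg (\<alpha> 1 (idD 1)) 0 1) (edg (\<beta> 1 (idD 1)) 0 1)"
proof (rule sphere_htpyE[OF ab])
  fix h assume \<alpha>: "\<alpha> \<in> spheres (nerve \<G>) 1 (vertex_simplex x)" and \<beta>: "\<beta> \<in> spheres (nerve \<G>) 1 (vertex_simplex x)"
    and h: "simplicial_map (stdprod 1 1) (nerve \<G>) h"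
      "\<And>m u. u \<in> Delta m 1 \<Longrightarrow> h m (u, constD m 0) = \<alpha> m u"
      "\<And>m u. u \<in> Delta m 1 \<Longrightarrow> h m (u, constD m 1) = \<beta> m u"
      "\<And>m u w. u \<in> simplices (boundary 1) m \<Longrightarrow> w \<in> Delta m 1 \<Longrightarrow> h m (u, w) = const_at (nerve \<G>) (vertex_simplex x) m"
  let ?l = "edg (\<alpha> 1 (idD 1)) 0 1" and ?k = "edg (\<beta> 1 (idD 1)) 0 1" and ?d = "edg (h 1 (seq_map [0, 1], seq_map [0, 1])) 0 1"
  have L: "seq_map [0, 1] \<in> Delta 1 1" "seq_map [0, 0] \<in> Delta 1 1" "seq_map [1, 1] \<in> Delta 1 1" "seq_map [0, 1, 1] \<in> Delta 2 1" "seq_map [0, 0, 1] \<in> Delta 2 1"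
    by (intro seq_map_Delta; simp)+
  have bd: "seq_map [c, c] \<in> simplices (boundary 1) 1" if "c \<le> 1" for c
    using seq_map_boundary(2)[of c c 1] that by simp
  have e: "edg (h 1 (seq_map [0, 1], seq_map [0, 0])) 0 1 = ?l" "edg (h 1 (seq_map [0, 1], seq_map [1, 1])) 0 1 = ?k"
    using h(2)[OF L(1)] h(3)[OF L(1)] by (simp_all add: seq_map_const seq_map_id)
  have ec: "edg (h 1 (seq_map [c, c], seq_map [0, 1])) 0 1 = unit1 \<G> x" if "c \<le> 1" for c
    using h(4)[OF bd[OF that] L(1)] const_at_nerve(2)[of 0 1 1 \<G> "vertex_simplex x"] by simp
  have t1: "h 2 (seq_map [0, 1, 1], seq_map [0, 0, 1]) \<in> nerve_simplices \<G> 2" and t2: "h 2 (seq_map [0, 0, 1], seq_map [0, 1, 1]) \<in> nerve_simplices \<G> 2"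
    using stdprod_val[OF h(1) L(4,5)] stdprod_val[OF h(1) L(5,4)] by simp_all
  note p1 = nerve_map_probe(2)[OF h(1) L(4,5)] and p2 = nerve_map_probe(2)[OF h(1) L(5,4)]
  let ?a1 = "tri (h 2 (seq_map [0, 1, 1], seq_map [0, 0, 1])) 0 1 2" and ?a2 = "tri (h 2 (seq_map [0, 0, 1], seq_map [0, 1, 1])) 0 1 2"
  have a1: "?a1 \<in> hom2 \<G> ?d (comp1 \<G> (unit1 \<G> x) ?l)"
    using nerve_tri[OF t1, of 0 1 2] p1[of 0 1] p1[of 1 2] p1[of 0 2] e ec[of 1] by simp
  have a2: "?a2 \<in> hom2 \<G> ?d (comp1 \<G> ?k (unit1 \<G> x))"
    using nerve_tri[OF t2, of 0 1 2] p2[of 0 1] p2[of 1 2] p2[of 0 2] e ec[of 0] by simp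
  have a1': "?a1 \<in> hom2 \<G> ?d ?l" using a1 comp1_unit_left[OF loop_hom[OF \<alpha>]] by simp
  have a2': "?a2 \<in> hom2 \<G> ?d ?k" using a2 comp1_unit_right[OF loop_hom[OF \<beta>]] by simp
  from inverse2[OF a1'] obtain b where "b \<in> hom2 \<G> ?l ?d" by blast
  from vcomp_hom[OF this a2'] show ?thesis by blast
qed

lemma cell_loop_homotopy:
  assumes S: "simplicial_set (nerve \<G>)" and l: "l \<in> hom1 \<G> x x" and l': "l' \<in> hom1 \<G> x x" and b: "b \<in> hom2 \<G> l l'"
  shows "(loop l, loop l') \<in> sphere_htpy (nerve \<G>) 1 (vertex_simplex x)"
proof (rule cell_homotopy[OF S l l' b])
  fix h assume h: "simplicial_map (stdprod 1 1) (nerve \<G>) h"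
    "\<And>m u. u \<in> Delta m 1 \<Longrightarrow> h m (u, constD m 0) = sact (nerve \<G>) m 1 u (edge_simplex \<G> l)"
    "\<And>m u. u \<in> Delta m 1 \<Longrightarrow> h m (u, constD m 1) = sact (nerve \<G>) m 1 u (edge_simplex \<G> l')"
    "\<And>m u w. u \<in> simplices (boundary 1) m \<Longrightarrow> w \<in> Delta m 1 \<Longrightarrow> h m (u, w) = sact (nerve \<G>) m 1 u (edge_simplex \<G> l)"
  show ?thesis
  proof (rule sphere_htpyI[OF loop_sphere[OF S l] loop_sphere[OF S l'] h(1)])
    show "h m (u, constD m 0) = loop l m u" "h m (u, constD m 1) = loop l' m u" if "u \<in> Delta m 1" for m u
      using h(2,3)[OF that] that by (simp_all add: loop_def)
    show "h m (u, w) = const_at (nerve \<G>) (vertex_simplex x) m" if "u \<in> simplices (boundary 1) m" "w \<in> Delta m 1" for m u w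
      using h(4)[OF that] sphere_bd[OF loop_sphere[OF S l] that(1)] that(1) by (simp add: loop_def boundary_iff)
  qed
qed

text \<open>
  An automorphism of an identity 1-morphism, as a 2-simplex all of whose faces are degenerate.
\<close>

definition cell2 :: "'o \<Rightarrow> 'c \<Rightarrow> ('o, 'm, 'c) nerve_simplex" where
  "cell2 x c = mk_simplex 2 (\<lambda>_. x) (\<lambda>_ _. unit1 \<G> x) (\<lambda>_ _ _. c)"

definition sphere2 :: "'o \<Rightarrow> 'c \<Rightarrow> nat \<Rightarrow> (nat \<Rightarrow> nat) \<Rightarrow> ('o, 'm, 'c) nerve_simplex" where
  "sphere2 x c = (\<lambda>m. \<lambda>u\<in>Delta m 2. sact (nerve \<G>) m 2 u (cell2 x c))"

lemma cell2_nerve: "x \<in> Obj \<G> \<Longrightarrow> c \<in> hom2 \<G> (unit1 \<G> x) (unit1 \<G> x) \<Longrightarrow> cell2 x c \<in> nerve_simplices \<G> 2"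
  unfolding cell2_def by (rule mk_simplex_nerveI) (auto simp: comp1_unit_left[OF unit1_hom] unit1_hom)

lemma sphere2_sphere:
  assumes S: "simplicial_set (nerve \<G>)" and x: "x \<in> Obj \<G>" and c: "c \<in> hom2 \<G> (unit1 \<G> x) (unit1 \<G> x)"
  shows "sphere2 x c \<in> spheres (nerve \<G>) 2 (vertex_simplex x)"
proof -
  have "sphere2 x c \<in> sset_hom (std_simplex 2) (nerve \<G>)"
    unfolding sphere2_def by (rule yoneda_hom[OF S]) (simp add: cell2_nerve[OF x c])
  moreover have "sphere2 x c m u = const_at (nerve \<G>) (vertex_simplex x) m" if u: "u \<in> simplices (boundary 2) m" for m u
  proof -
    have uD: "u \<in> Delta m 2" using u by (simp add: boundary_iff)
    have E: "edge \<G> (cell2 x c) i j = unit1 \<G> x" if "i \<le> j" "j \<le> 2" for i j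
      using that by (auto simp: edge_alt cell2_def)
    have "\<exists>i\<le>2. i \<notin> u ` {..m}" using u Delta_le[OF uD] by (auto simp: boundary_iff)
    then obtain p where p: "p \<le> 2" "\<And>i. i \<le> m \<Longrightarrow> u i \<noteq> p" by auto
    have t: "triangle \<G> (cell2 x c) (u i) (u j) (u k) = unit2 \<G> (unit1 \<G> x)" if "i \<le> j" "j \<le> k" "k \<le> m" for i j k
    proof -
      have "u i \<le> u j" "u j \<le> u k" "u k \<le> 2" using Delta_mono[OF uD, of i j] Delta_mono[OF uD, of j k] Delta_le[OF uD, of k] that by auto
      moreover from this have "u i = u j \<or> u j = u k" using p(2)[of i] p(2)[of j] p(2)[of k] that p(1) by auto
      ultimately show ?thesis using E[of "u i" "u k"] by (auto simp: triangle_alt)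
    qed
    have "sact (nerve \<G>) m 2 u (cell2 x c) = sact (nerve \<G>) m 0 (constD m 0) (vertex_simplex x)"
      unfolding nerve_sact
    proof (rule mk_simplex_cong)
      show "vert (cell2 x c) (u i) = vert (vertex_simplex x) (constD m 0 i)" if "i \<le> m" for i
        using Delta_le[OF uD that] that by (simp add: cell2_def)
      show "edge \<G> (cell2 x c) (u i) (u j) = edge \<G> (vertex_simplex x) (constD m 0 i) (constD m 0 j)" if "i < j" "j \<le> m" for i j
        using E[of "u i" "u j"] Delta_mono[OF uD, of i j] Delta_le[OF uD, of j] that by (simp add: edge_alt)
      show "triangle \<G> (cell2 x c) (u i) (u j) (u k) = triangle \<G> (vertex_simplex x) (constD m 0 i) (constD m 0 j) (constD m 0 k)"
        if "i < j" "j < k" "k \<le> m" for i j k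
        using t[of i j k] that by (simp add: edge_alt triangle_alt)
    qed
    then show ?thesis using uD by (simp add: sphere2_def const_at_def)
  qed
  ultimately show ?thesis by (simp add: spheres_def)
qed

lemma sphere2_top:
  assumes S: "simplicial_set (nerve \<G>)" and x: "x \<in> Obj \<G>" and c: "c \<in> hom2 \<G> (unit1 \<G> x) (unit1 \<G> x)"
  shows "sphere2 x c 2 (idD 2) = cell2 x c"
  using sset_id[OF S, of "cell2 x c" 2] cell2_nerve[OF x c] by (simp add: sphere2_def)

lemma sphere2_cell:
  assumes x: "x \<in> Obj \<G>" and a: "\<alpha> \<in> spheres (nerve \<G>) 2 (vertex_simplex x)"
  shows "tri (\<alpha> 2 (idD 2)) 0 1 2 \<in> hom2 \<G> (unit1 \<G> x) (unit1 \<G> x)"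
proof -
  note t = sphere_top[OF a] and m = sset_homD[OF sphere_hom[OF a]]
  have e: "edg (\<alpha> 2 (idD 2)) i j = unit1 \<G> x" if ij: "i < j" "j \<le> 2" for i j
  proof -
    have D: "seq_map [i, j] \<in> Delta 1 2" using ij by (intro seq_map_Delta) auto
    have "seq_map [i, j] \<in> simplices (boundary 2) 1" using ij by (intro seq_map_boundary) auto
    from sphere_bd[OF a this] have "edg (\<alpha> 1 (seq_map [i, j])) 0 1 = unit1 \<G> x"
      using const_at_nerve(2)[of 0 1 1 \<G> "vertex_simplex x"] by simp
    then show ?thesis using map_std_simplex[OF m D] ij by (simp add: edge_alt)
  qed
  show ?thesis using nerve_tri[OF t, of 0 1 2] e comp1_unit_left[OF unit1_hom[OF x]] by simp
qed

text \<open>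
  A homotopy of 2-spheres divides the prism into three tetrahedra, all of whose edges are
  identities; their identities equate the two 2-morphisms.
\<close>

lemma sphere2_homotopy_eq:
  assumes x: "x \<in> Obj \<G>" and ab: "(\<alpha>, \<beta>) \<in> sphere_htpy (nerve \<G>) 2 (vertex_simplex x)"
  shows "tri (\<alpha> 2 (idD 2)) 0 1 2 = tri (\<beta> 2 (idD 2)) 0 1 2"
proof (rule sphere_htpyE[OF ab])
  fix h assume \<alpha>: "\<alpha> \<in> spheres (nerve \<G>) 2 (vertex_simplex x)" and \<beta>: "\<beta> \<in> spheres (nerve \<G>) 2 (vertex_simplex x)"
    and h: "simplicial_map (stdprod 2 1) (nerve \<G>) h"
      "\<And>m u. u \<in> Delta m 2 \<Longrightarrow> h m (u, constD m 0) = \<alpha> m u"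
      "\<And>m u. u \<in> Delta m 2 \<Longrightarrow> h m (u, constD m 1) = \<beta> m u"
      "\<And>m u w. u \<in> simplices (boundary 2) m \<Longrightarrow> w \<in> Delta m 1 \<Longrightarrow> h m (u, w) = const_at (nerve \<G>) (vertex_simplex x) m"
  let ?I = "unit1 \<G> x"
  have one: "?I \<in> hom1 \<G> x x" "?I \<in> Mor \<G>" using unit1_hom[OF x] hom1_Mor by auto
  have u2: "unit2 \<G> ?I \<in> hom2 \<G> ?I ?I" by (rule unit2_hom[OF one(2)])
  have bd: "seq_map [a, b] \<in> simplices (boundary 2) 1" if "a \<le> b" "b \<le> 2" for a b
    using that by (intro seq_map_boundary) auto
  have bd2: "seq_map [a, b, c] \<in> simplices (boundary 2) 2" if "a \<le> b" "b \<le> c" "c \<le> 2" "a = b \<or> b = c" for a b c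
    using that by (intro seq_map_boundary) auto
  have e: "edg (h 1 (seq_map [a, b], seq_map [c, d])) 0 1 = ?I" if "a \<le> b" "b \<le> 2" "c \<le> d" "d \<le> 1" for a b c d
    using h(4)[OF bd[OF that(1,2)] seq_map_Delta(2)[OF that(3,4)]] const_at_nerve(2)[of 0 1 1 \<G> "vertex_simplex x"] by simp
  \<comment> \<open>The four triangles of the prism that project onto $\Delta^2$; consecutive ones bound a tetrahedron.\<close>
  define T where "T a b c = tri (h 2 (seq_map [0, 1, 2], seq_map [a, b, c])) 0 1 2" for a b c
  have t: "tri (h 2 (seq_map [a, b, c], seq_map [a', b', c'])) 0 1 2 = unit2 \<G> ?I"
    if "a \<le> b" "b \<le> c" "c \<le> 2" "a = b \<or> b = c" "a' \<le> b'" "b' \<le> c'" "c' \<le> 1" for a b c a' b' c'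
    using h(4)[OF bd2[OF that(1-4)] seq_map_Delta(3)[OF that(5-7)]] const_at_nerve(3)[of 0 1 2 2 \<G> "vertex_simplex x"] by simp
  have Thom: "T a b c \<in> hom2 \<G> ?I ?I" if abc: "a \<le> b" "b \<le> c" "c \<le> 1" for a b c
  proof -
    have L: "seq_map [0, 1, 2] \<in> Delta 2 2" "seq_map [a, b, c] \<in> Delta 2 1" using abc by (intro seq_map_Delta; simp)+
    have s: "h 2 (seq_map [0, 1, 2], seq_map [a, b, c]) \<in> nerve_simplices \<G> 2" using stdprod_val[OF h(1) L] by simp
    note p = nerve_map_probe(2)[OF h(1) L]
    show ?thesis
      using nerve_tri[OF s, of 0 1 2] p[of 0 1] p[of 1 2] p[of 0 2] e abc comp1_unit_left[OF one(1)]
      by (simp add: T_def)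
  qed
  have unitor: "vcomp \<G> (hcomp \<G> (unit2 \<G> ?I) c) (unit2 \<G> ?I) = c" "vcomp \<G> (hcomp \<G> c (unit2 \<G> ?I)) (unit2 \<G> ?I) = c"
    "vcomp \<G> (hcomp \<G> (unit2 \<G> ?I) (unit2 \<G> ?I)) c = c" if c: "c \<in> hom2 \<G> ?I ?I" for c
    using hcomp_unit_left[OF one(1) c] hcomp_unit_right[OF one(1) c] hcomp_unit_left[OF one(1) u2]
      vcomp_unit_right[OF c] vcomp_unit_left[OF c] by simp_all
  have tet: "vcomp \<G> (hcomp \<G> (unit2 \<G> ?I) (tri (h 2 (seq_map [a, b, c], seq_map [a', b', c'])) 0 1 2)) (tri (h 2 (seq_map [a, c, d], seq_map [a', c', d'])) 0 1 2) =
      vcomp \<G> (hcomp \<G> (tri (h 2 (seq_map [b, c, d], seq_map [b', c', d'])) 0 1 2) (unit2 \<G> ?I)) (tri (h 2 (seq_map [a, b, d], seq_map [a', b', d'])) 0 1 2)"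
    if l: "a \<le> b" "b \<le> c" "c \<le> d" "d \<le> 2" "a' \<le> b'" "b' \<le> c'" "c' \<le> d'" "d' \<le> 1" for a b c d a' b' c' d'
  proof -
    have L: "seq_map [a, b, c, d] \<in> Delta 3 2" "seq_map [a', b', c', d'] \<in> Delta 3 1" using l by (intro seq_map_Delta; simp)+
    have s: "h 3 (seq_map [a, b, c, d], seq_map [a', b', c', d']) \<in> nerve_simplices \<G> 3" using stdprod_val[OF h(1) L] by simp
    note p = nerve_map_probe(2)[OF h(1) L] and q = nerve_map_probe(3)[OF h(1) L]
    show ?thesis
      using nerve_tetra[OF s, of 0 1 2 3] p[of 2 3] p[of 0 1] q[of 0 1 2] q[of 0 2 3] q[of 1 2 3] q[of 0 1 3] e l
      unfolding tetra_def by simp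
  qed
  have "T 0 0 0 = T 0 0 1"
    using tet[of 0 1 2 2 0 0 0 1] t[of 0 2 2 0 0 1] t[of 1 2 2 0 0 1] unitor(1)[OF Thom, of 0 0 0] unitor(3)[OF Thom, of 0 0 1]
    by (simp add: T_def)
  moreover have "T 0 1 1 = T 0 0 1"
    using tet[of 0 1 1 2 0 0 1 1] t[of 0 1 1 0 0 1] t[of 1 1 2 0 1 1] unitor(3)[OF Thom, of 0 1 1] unitor(3)[OF Thom, of 0 0 1]
    by (simp add: T_def)
  moreover have "T 0 1 1 = T 1 1 1"
    using tet[of 0 0 1 2 0 1 1 1] t[of 0 0 1 0 1 1] t[of 0 0 2 0 1 1] unitor(3)[OF Thom, of 0 1 1] unitor(2)[OF Thom, of 1 1 1]
    by (simp add: T_def)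
  moreover have "T 0 0 0 = tri (\<alpha> 2 (idD 2)) 0 1 2" "T 1 1 1 = tri (\<beta> 2 (idD 2)) 0 1 2"
    using h(2)[OF idD_Delta] h(3)[OF idD_Delta] by (simp_all add: T_def seq_map_const seq_map_id)
  ultimately show ?thesis by simp
qed

end


section \<open>Weak equivalences of 2-groupoids\<close>

context two_groupoid
begin

lemma whisker_cancel:
  assumes f: "f \<in> hom1 \<G> x y" and k: "k \<in> hom1 \<G> y x" and fk: "comp1 \<G> f k = unit1 \<G> y"
    and g: "g \<in> hom1 \<G> z y" and d: "d \<in> hom2 \<G> g g'"
  shows "hcomp \<G> (unit2 \<G> f) (hcomp \<G> (unit2 \<G> k) d) = d"
proof -
  have "hcomp \<G> (unit2 \<G> f) (hcomp \<G> (unit2 \<G> k) d) = hcomp \<G> (hcomp \<G> (unit2 \<G> f) (unit2 \<G> k)) d"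
    by (rule hcomp_assoc[OF g k f d unit2_hom[OF hom1_Mor[OF k]] unit2_hom[OF hom1_Mor[OF f]]])
  also have "\<dots> = d" unfolding hcomp_unit2[OF k f] fk by (rule hcomp_unit_left[OF g d])
  finally show ?thesis .
qed

lemma whisker_hom:
  assumes k: "k \<in> hom1 \<G> y z" and g: "g \<in> hom1 \<G> x y" and d: "d \<in> hom2 \<G> g g'"
  shows "hcomp \<G> (unit2 \<G> k) d \<in> hom2 \<G> (comp1 \<G> k g) (comp1 \<G> k g')"
  by (rule hcomp_hom[OF g k d unit2_hom[OF hom1_Mor[OF k]]])

end

locale nerve_equivalence = G: two_groupoid \<G> + H: two_groupoid \<H>
  for \<G> :: "('o, 'm, 'c) two_cat" and \<H> :: "('p, 'q, 'd) two_cat" +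
  fixes F :: "('o, 'm, 'c, 'p, 'q, 'd) two_fun"
  assumes F: "two_functor \<G> \<H> F" and W: "weak_equivalence (nerve \<G>) (nerve \<H>) (nerve_map F)"
begin

lemmas FD = two_functorD[OF F]

lemma kan_G: "kan_complex (nerve \<G>)" and kan_H: "kan_complex (nerve \<H>)"
  and F_map: "simplicial_map (nerve \<G>) (nerve \<H>) (nerve_map F)"
  using W by (simp_all add: weak_equivalence_def)

lemmas SG = kan_simplicial[OF kan_G] and SH = kan_simplicial[OF kan_H]

lemma nerve_map_vert[simp]: "i \<le> n \<Longrightarrow> vert (nerve_map F n s) i = on_obj F (vert s i)"
  and nerve_map_edg[simp]: "i < j \<Longrightarrow> j \<le> n \<Longrightarrow> edg (nerve_map F n s) i j = on_mor F (edg s i j)"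
  and nerve_map_tri[simp]: "i < j \<Longrightarrow> j < k \<Longrightarrow> k \<le> n \<Longrightarrow> tri (nerve_map F n s) i j k = on_cell F (tri s i j k)"
  by (simp_all add: nerve_map_mk_simplex)

lemma nerve_map_vertex_simplex: "nerve_map F 0 (vertex_simplex x) = vertex_simplex (on_obj F x)"
  unfolding nerve_map_mk_simplex by (subst (2) vertex_simplex_def) (rule mk_simplex_cong, simp_all)

lemma nerve_map_edge_simplex: "f \<in> hom1 \<G> x y \<Longrightarrow> nerve_map F 1 (edge_simplex \<G> f) = edge_simplex \<H> (on_mor F f)"
proof -
  assume f: "f \<in> hom1 \<G> x y"
  have Ff: "on_mor F f \<in> hom1 \<H> (on_obj F x) (on_obj F y)" by (rule FD(2)[OF f])
  show ?thesis unfolding nerve_map_mk_simplex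
    by (subst (4) edge_simplex_def, rule mk_simplex_cong) (use f Ff in \<open>auto simp: le_numerals G.edge_simplex_simps[OF f] hom1_def\<close>)
qed

lemma nerve_map_cell2: "x \<in> Obj \<G> \<Longrightarrow> nerve_map F 2 (G.cell2 x c) = H.cell2 (on_obj F x) (on_cell F c)"
  unfolding nerve_map_mk_simplex H.cell2_def by (rule mk_simplex_cong) (simp_all add: G.cell2_def FD(4))

lemma sphere_map_yoneda:
  assumes s: "s \<in> nerve_simplices \<G> n"
  shows "sphere_map (nerve_map F) n (\<lambda>m. \<lambda>u\<in>Delta m n. sact (nerve \<G>) m n u s) =
    (\<lambda>m. \<lambda>u\<in>Delta m n. sact (nerve \<H>) m n u (nerve_map F n s))"
proof (intro ext)
  fix m u
  show "sphere_map (nerve_map F) n (\<lambda>m. \<lambda>u\<in>Delta m n. sact (nerve \<G>) m n u s) m u =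
    (\<lambda>u\<in>Delta m n. sact (nerve \<H>) m n u (nerve_map F n s)) u"
    using smap_nat[OF F_map, of u m n s] s by (cases "u \<in> Delta m n") (simp_all add: sphere_map_def compose_def)
qed

lemma sphere_map_loop: "l \<in> hom1 \<G> x x \<Longrightarrow> sphere_map (nerve_map F) 1 (G.loop l) = H.loop (on_mor F l)"
  unfolding G.loop_def H.loop_def using sphere_map_yoneda[OF G.edge_simplex_nerve[of l x x]] nerve_map_edge_simplex[of l x x] by simp

lemma sphere_map_sphere2: "x \<in> Obj \<G> \<Longrightarrow> c \<in> hom2 \<G> (unit1 \<G> x) (unit1 \<G> x) \<Longrightarrow>
    sphere_map (nerve_map F) 2 (G.sphere2 x c) = H.sphere2 (on_obj F x) (on_cell F c)"
  unfolding G.sphere2_def H.sphere2_def using sphere_map_yoneda[OF G.cell2_nerve[of x c]] nerve_map_cell2[of x c] by simp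

text \<open>What bijectivity on homotopy classes says for objects, loops and 2-morphisms of identities.\<close>

lemma pi0_bij: "bij_betw (\<lambda>C. path_rel (nerve \<H>) `` (nerve_map F 0 ` C))
    (simplices (nerve \<G>) 0 // path_rel (nerve \<G>)) (simplices (nerve \<H>) 0 // path_rel (nerve \<H>))"
  using W unfolding weak_equivalence_def pi0_map_def[abs_def] pi0_def by blast

lemma pin_bij: "n \<ge> 1 \<Longrightarrow> x \<in> Obj \<G> \<Longrightarrow>
    bij_betw (\<lambda>C. sphere_htpy (nerve \<H>) n (vertex_simplex (on_obj F x)) `` (sphere_map (nerve_map F) n ` C))
     (spheres (nerve \<G>) n (vertex_simplex x) // sphere_htpy (nerve \<G>) n (vertex_simplex x))
     (spheres (nerve \<H>) n (vertex_simplex (on_obj F x)) // sphere_htpy (nerve \<H>) n (vertex_simplex (on_obj F x)))"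
proof -
  assume n: "n \<ge> 1" and x: "x \<in> Obj \<G>"
  have "vertex_simplex x \<in> simplices (nerve \<G>) 0" using G.vertex_simplex_nerve[OF x] by simp
  then have "bij_betw (homotopy_group_map (nerve \<G>) (nerve \<H>) (nerve_map F) n (vertex_simplex x))
      (homotopy_group (nerve \<G>) n (vertex_simplex x)) (homotopy_group (nerve \<H>) n (nerve_map F 0 (vertex_simplex x)))"
    using W n unfolding weak_equivalence_def by blast
  then show ?thesis unfolding homotopy_group_map_alt homotopy_group_def nerve_map_vertex_simplex .
qed

lemma vertex_simplex_simplex: "x \<in> Obj \<G> \<Longrightarrow> vertex_simplex x \<in> simplices (nerve \<G>) 0" "y \<in> Obj \<H> \<Longrightarrow> vertex_simplex y \<in> simplices (nerve \<H>) 0"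
  by (simp_all add: G.vertex_simplex_nerve H.vertex_simplex_nerve)

lemma pin_map:
  assumes x: "x \<in> Obj \<G>" and h: "(\<alpha>, \<beta>) \<in> sphere_htpy (nerve \<G>) n (vertex_simplex x)"
  shows "(sphere_map (nerve_map F) n \<alpha>, sphere_map (nerve_map F) n \<beta>) \<in> sphere_htpy (nerve \<H>) n (vertex_simplex (on_obj F x))"
  using sphere_htpy_map[OF F_map vertex_simplex_simplex(1)[OF x] h] by (simp only: nerve_map_vertex_simplex)

lemma pin_inj:
  assumes n: "n \<ge> 1" and x: "x \<in> Obj \<G>" and ab: "\<alpha> \<in> spheres (nerve \<G>) n (vertex_simplex x)" "\<beta> \<in> spheres (nerve \<G>) n (vertex_simplex x)"
    and h: "(sphere_map (nerve_map F) n \<alpha>, sphere_map (nerve_map F) n \<beta>) \<in> sphere_htpy (nerve \<H>) n (vertex_simplex (on_obj F x))"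
  shows "(\<alpha>, \<beta>) \<in> sphere_htpy (nerve \<G>) n (vertex_simplex x)"
  by (rule bij_quotient_inj[where F = "sphere_map (nerve_map F) n", OF sphere_htpy_equiv[OF kan_G vertex_simplex_simplex(1)[OF x]]
      sphere_htpy_equiv[OF kan_H vertex_simplex_simplex(2)[OF FD(1)[OF x]]] pin_map[OF x, where n = n] pin_bij[OF n x] ab h])

lemma pin_surj:
  assumes n: "n \<ge> 1" and x: "x \<in> Obj \<G>" and b: "\<beta> \<in> spheres (nerve \<H>) n (vertex_simplex (on_obj F x))"
  shows "\<exists>\<alpha>\<in>spheres (nerve \<G>) n (vertex_simplex x). (sphere_map (nerve_map F) n \<alpha>, \<beta>) \<in> sphere_htpy (nerve \<H>) n (vertex_simplex (on_obj F x))"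
  by (rule bij_quotient_surj[where F = "sphere_map (nerve_map F) n", OF sphere_htpy_equiv[OF kan_G vertex_simplex_simplex(1)[OF x]]
      sphere_htpy_equiv[OF kan_H vertex_simplex_simplex(2)[OF FD(1)[OF x]]] pin_map[OF x, where n = n] pin_bij[OF n x] b])

lemma object_lift:
  assumes y: "y \<in> Obj \<H>" shows "\<exists>x\<in>Obj \<G>. \<exists>f. f \<in> hom1 \<H> y (on_obj F x)"
proof -
  obtain s where s: "s \<in> nerve_simplices \<G> 0" "(nerve_map F 0 s, vertex_simplex y) \<in> path_rel (nerve \<H>)"
    using bij_quotient_surj[OF path_rel_equiv[OF kan_G] path_rel_equiv[OF kan_H] path_rel_map[OF F_map] pi0_bij vertex_simplex_simplex(2)[OF y]]
    by auto
  have "(vertex_simplex (on_obj F (vert s 0)), vertex_simplex y) \<in> path_rel (nerve \<H>)"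
    using s(2) unfolding nerve_map_vertex_simplex[symmetric] vertex_simplex_vert[OF s(1)] .
  then obtain f where "f \<in> hom1 \<H> (on_obj F (vert s 0)) y" using H.path_rel_nerve[OF SH] by blast
  from H.inverse1[OF this] nerve_vert[OF s(1), of 0] show ?thesis by auto
qed

lemma connected_lift:
  assumes x: "x \<in> Obj \<G>" "x' \<in> Obj \<G>" and g: "g \<in> hom1 \<H> (on_obj F x) (on_obj F x')"
  shows "\<exists>f. f \<in> hom1 \<G> x x'"
proof -
  have "(nerve_map F 0 (vertex_simplex x), nerve_map F 0 (vertex_simplex x')) \<in> path_rel (nerve \<H>)"
    unfolding nerve_map_vertex_simplex H.path_rel_nerve[OF SH] using g by blast
  from bij_quotient_inj[OF path_rel_equiv[OF kan_G] path_rel_equiv[OF kan_H] path_rel_map[OF F_map] pi0_bij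
      vertex_simplex_simplex(1)[OF x(1)] vertex_simplex_simplex(1)[OF x(2)] this]
  show ?thesis using G.path_rel_nerve[OF SG] by blast
qed

lemma loop_lift:
  assumes x: "x \<in> Obj \<G>" and l: "l \<in> hom1 \<H> (on_obj F x) (on_obj F x)"
  shows "\<exists>k b. k \<in> hom1 \<G> x x \<and> b \<in> hom2 \<H> (on_mor F k) l"
proof -
  obtain \<alpha> where \<alpha>: "\<alpha> \<in> spheres (nerve \<G>) 1 (vertex_simplex x)"
    "(sphere_map (nerve_map F) 1 \<alpha>, H.loop l) \<in> sphere_htpy (nerve \<H>) 1 (vertex_simplex (on_obj F x))"
    using pin_surj[OF order_refl x H.loop_sphere[OF SH l]] by blast
  from H.loop_homotopy_cell[OF \<alpha>(2)] obtain b where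
    "b \<in> hom2 \<H> (on_mor F (edg (\<alpha> 1 (idD 1)) 0 1)) l"
    using H.loop_top[OF l SH] H.edge_simplex_simps(3)[OF l] by (auto simp: sphere_map_apply simp del: restrict_apply)
  with G.loop_hom[OF \<alpha>(1)] show ?thesis by blast
qed

lemma loop_cell_lift:
  assumes l: "l \<in> hom1 \<G> x x" "l' \<in> hom1 \<G> x x" and b: "b \<in> hom2 \<H> (on_mor F l) (on_mor F l')"
  shows "\<exists>a. a \<in> hom2 \<G> l l'"
proof -
  have x: "x \<in> Obj \<G>" using G.hom1_src[OF l(1)] .
  have "(sphere_map (nerve_map F) 1 (G.loop l), sphere_map (nerve_map F) 1 (G.loop l')) \<in> sphere_htpy (nerve \<H>) 1 (vertex_simplex (on_obj F x))"
    unfolding sphere_map_loop[OF l(1)] sphere_map_loop[OF l(2)]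
    by (rule H.cell_loop_homotopy[OF SH FD(2)[OF l(1)] FD(2)[OF l(2)] b])
  from G.loop_homotopy_cell[OF pin_inj[OF order_refl x G.loop_sphere[OF SG l(1)] G.loop_sphere[OF SG l(2)] this]]
  show ?thesis using G.loop_top[OF l(1) SG] G.loop_top[OF l(2) SG] G.edge_simplex_simps(3)[OF l(1)] G.edge_simplex_simps(3)[OF l(2)] by simp
qed

lemma identity_cell_lift:
  assumes x: "x \<in> Obj \<G>" and c: "c \<in> hom2 \<H> (unit1 \<H> (on_obj F x)) (unit1 \<H> (on_obj F x))"
  shows "\<exists>c'\<in>hom2 \<G> (unit1 \<G> x) (unit1 \<G> x). on_cell F c' = c"
proof -
  have Fx: "on_obj F x \<in> Obj \<H>" by (rule FD(1)[OF x])
  have "1 \<le> (2::nat)" by simp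
  from pin_surj[OF this x H.sphere2_sphere[OF SH Fx c]] obtain \<alpha> where \<alpha>: "\<alpha> \<in> spheres (nerve \<G>) 2 (vertex_simplex x)"
    "(sphere_map (nerve_map F) 2 \<alpha>, H.sphere2 (on_obj F x) c) \<in> sphere_htpy (nerve \<H>) 2 (vertex_simplex (on_obj F x))" by blast
  have "on_cell F (tri (\<alpha> 2 (idD 2)) 0 1 2) = c"
    using H.sphere2_homotopy_eq[OF Fx \<alpha>(2)] H.sphere2_top[OF SH Fx c]
    by (simp add: sphere_map_apply H.cell2_def del: restrict_apply)
  with G.sphere2_cell[OF x \<alpha>(1)] show ?thesis by blast
qed

lemma identity_cell_inj:
  assumes x: "x \<in> Obj \<G>" and c: "c \<in> hom2 \<G> (unit1 \<G> x) (unit1 \<G> x)" "c' \<in> hom2 \<G> (unit1 \<G> x) (unit1 \<G> x)"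
    and eq: "on_cell F c = on_cell F c'"
  shows "c = c'"
proof -
  have Fx: "on_obj F x \<in> Obj \<H>" by (rule FD(1)[OF x])
  have Fc: "on_cell F c \<in> hom2 \<H> (unit1 \<H> (on_obj F x)) (unit1 \<H> (on_obj F x))"
    using FD(3)[OF c(1)] FD(4)[OF x] by simp
  have "(sphere_map (nerve_map F) 2 (G.sphere2 x c), sphere_map (nerve_map F) 2 (G.sphere2 x c')) \<in> sphere_htpy (nerve \<H>) 2 (vertex_simplex (on_obj F x))"
    unfolding sphere_map_sphere2[OF x c(1)] sphere_map_sphere2[OF x c(2)] eq[symmetric]
    using sphere_htpy_equiv[OF kan_H vertex_simplex_simplex(2)[OF Fx], of 2] H.sphere2_sphere[OF SH Fx Fc]
    by (auto simp: equiv_def refl_on_def)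
  moreover have "1 \<le> (2::nat)" by simp
  ultimately have "(G.sphere2 x c, G.sphere2 x c') \<in> sphere_htpy (nerve \<G>) 2 (vertex_simplex x)"
    using pin_inj[OF _ x G.sphere2_sphere[OF SG x c(1)] G.sphere2_sphere[OF SG x c(2)]] by blast
  from G.sphere2_homotopy_eq[OF x this] show ?thesis
    using G.sphere2_top[OF SG x c(1)] G.sphere2_top[OF SG x c(2)] by (simp add: G.cell2_def)
qed

text \<open>
  Translating by inverse 1-morphisms moves these statements from identities to arbitrary
  1-morphisms: \<open>F\<close> is locally essentially surjective, and full and faithful on 2-morphisms.
\<close>

lemma mor_lift:
  assumes x: "x \<in> Obj \<G>" "x' \<in> Obj \<G>" and g: "g \<in> hom1 \<H> (on_obj F x) (on_obj F x')"
  shows "\<exists>f b. f \<in> hom1 \<G> x x' \<and> b \<in> hom2 \<H> g (on_mor F f)"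
proof -
  obtain f0 where f0: "f0 \<in> hom1 \<G> x x'" using connected_lift[OF x g] by blast
  note Ff0 = FD(2)[OF f0]
  obtain k where k: "k \<in> hom1 \<H> (on_obj F x') (on_obj F x)" "comp1 \<H> (on_mor F f0) k = unit1 \<H> (on_obj F x')"
    using H.inverse1[OF Ff0] by blast
  note kg = H.comp1_hom[OF g k(1)]
  obtain l b where l: "l \<in> hom1 \<G> x x" "b \<in> hom2 \<H> (on_mor F l) (comp1 \<H> k g)"
    using loop_lift[OF x(1) kg] by blast
  have "hcomp \<H> (unit2 \<H> (on_mor F f0)) b \<in> hom2 \<H> (comp1 \<H> (on_mor F f0) (on_mor F l)) (comp1 \<H> (on_mor F f0) (comp1 \<H> k g))"
    by (rule H.whisker_hom[OF Ff0 FD(2)[OF l(1)] l(2)])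
  moreover have "comp1 \<H> (on_mor F f0) (comp1 \<H> k g) = g"
    using H.comp1_assoc[OF g k(1) Ff0] k(2) H.comp1_unit_left[OF g] by simp
  ultimately have "hcomp \<H> (unit2 \<H> (on_mor F f0)) b \<in> hom2 \<H> (on_mor F (comp1 \<G> f0 l)) g"
    using FD(5)[OF l(1) f0] by simp
  from H.inverse2[OF this] G.comp1_hom[OF l(1) f0] show ?thesis by blast
qed

lemma cell_lift:
  assumes f: "f \<in> hom1 \<G> x x'" and f': "f' \<in> hom1 \<G> x x'" and b: "b \<in> hom2 \<H> (on_mor F f) (on_mor F f')"
  shows "\<exists>a\<in>hom2 \<G> f f'. on_cell F a = b"
proof -
  have x: "x \<in> Obj \<G>" using G.hom1_src[OF f] .
  obtain k where k: "k \<in> hom1 \<G> x' x" "comp1 \<G> k f' = unit1 \<G> x" "comp1 \<G> f' k = unit1 \<G> x'"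
    using G.inverse1[OF f'] by blast
  note Ff = FD(2)[OF f] and Ff' = FD(2)[OF f'] and Fk = FD(2)[OF k(1)]
  have Fkf': "comp1 \<H> (on_mor F k) (on_mor F f') = unit1 \<H> (on_obj F x)"
    using FD(5)[OF f' k(1)] k(2) FD(4)[OF x] by simp
  have Ff'k: "comp1 \<H> (on_mor F f') (on_mor F k) = unit1 \<H> (on_obj F x')"
    using FD(5)[OF k(1) f'] k(3) FD(4)[OF G.hom1_tgt[OF f]] by simp
  have "hcomp \<H> (unit2 \<H> (on_mor F k)) b \<in> hom2 \<H> (on_mor F (comp1 \<G> k f)) (on_mor F (unit1 \<G> x))"
    using H.whisker_hom[OF Fk Ff b] Fkf' FD(5)[OF f k(1)] FD(4)[OF x] by simp
  from loop_cell_lift[OF G.comp1_hom[OF f k(1)] G.unit1_hom[OF x] this]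
  obtain a1 where a1: "a1 \<in> hom2 \<G> (comp1 \<G> k f) (unit1 \<G> x)" by blast
  define a0 where "a0 = hcomp \<G> (unit2 \<G> f') a1"
  have a0: "a0 \<in> hom2 \<G> f f'"
    using G.whisker_hom[OF f' G.comp1_hom[OF f k(1)] a1] G.comp1_assoc[OF f k(1) f'] k(3)
      G.comp1_unit_left[OF f] G.comp1_unit_right[OF f'] by (simp add: a0_def)
  obtain a0' where a0': "a0' \<in> hom2 \<G> f' f" "vcomp \<G> a0' a0 = unit2 \<G> f" using G.inverse2[OF a0] by blast
  \<comment> \<open>\<open>d\<close> measures by how much \<open>F a0\<close> fails to be \<open>b\<close>.\<close>
  define d where "d = vcomp \<H> b (on_cell F a0')"
  have d: "d \<in> hom2 \<H> (on_mor F f') (on_mor F f')" unfolding d_def by (rule H.vcomp_hom[OF FD(3)[OF a0'(1)] b])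
  have "hcomp \<H> (unit2 \<H> (on_mor F k)) d \<in> hom2 \<H> (unit1 \<H> (on_obj F x)) (unit1 \<H> (on_obj F x))"
    using H.whisker_hom[OF Fk Ff' d] Fkf' by simp
  from identity_cell_lift[OF x this] obtain c where
    c: "c \<in> hom2 \<G> (unit1 \<G> x) (unit1 \<G> x)" "on_cell F c = hcomp \<H> (unit2 \<H> (on_mor F k)) d" by blast
  note 1 = G.unit1_hom[OF x]
  have w: "hcomp \<G> (unit2 \<G> f') c \<in> hom2 \<G> f' f'"
    using G.whisker_hom[OF f' 1 c(1)] G.comp1_unit_right[OF f'] by simp
  have "on_cell F (hcomp \<G> (unit2 \<G> f') c) = hcomp \<H> (unit2 \<H> (on_mor F f')) (on_cell F c)"
    using FD(8)[OF 1 f' c(1) G.unit2_hom[OF G.hom1_Mor[OF f']]] FD(6)[OF G.hom1_Mor[OF f']] by simp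
  also have "\<dots> = d" unfolding c(2) by (rule H.whisker_cancel[OF Ff' Fk Ff'k Ff' d])
  finally have "on_cell F (vcomp \<G> (hcomp \<G> (unit2 \<G> f') c) a0) = vcomp \<H> d (on_cell F a0)"
    using FD(7)[OF a0 w] by simp
  also have "\<dots> = vcomp \<H> b (vcomp \<H> (on_cell F a0') (on_cell F a0))"
    unfolding d_def by (rule H.vcomp_assoc[OF FD(3)[OF a0] FD(3)[OF a0'(1)] b, symmetric])
  also have "vcomp \<H> (on_cell F a0') (on_cell F a0) = unit2 \<H> (on_mor F f)"
    using FD(7)[OF a0 a0'(1)] a0'(2) FD(6)[OF G.hom1_Mor[OF f]] by simp
  also have "vcomp \<H> b (unit2 \<H> (on_mor F f)) = b" by (rule H.vcomp_unit_right[OF b])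
  finally show ?thesis using G.vcomp_hom[OF a0 w] by blast
qed

lemma cell_inj:
  assumes f: "f \<in> hom1 \<G> x x'" and a: "a \<in> hom2 \<G> f f'" and a': "a' \<in> hom2 \<G> f f'" and eq: "on_cell F a = on_cell F a'"
  shows "a = a'"
proof -
  have x: "x \<in> Obj \<G>" using G.hom1_src[OF f] .
  obtain k where k: "k \<in> hom1 \<G> x' x" "comp1 \<G> k f = unit1 \<G> x" "comp1 \<G> f k = unit1 \<G> x'"
    using G.inverse1[OF f] by blast
  obtain ai where ai: "ai \<in> hom2 \<G> f' f" "vcomp \<G> ai a = unit2 \<G> f" "vcomp \<G> a ai = unit2 \<G> f'"
    using G.inverse2[OF a] by blast
  define c where "c = vcomp \<G> ai a'"
  have c: "c \<in> hom2 \<G> f f" unfolding c_def by (rule G.vcomp_hom[OF a' ai(1)])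
  note uf = G.unit2_hom[OF G.hom1_Mor[OF f]] and uk = G.unit2_hom[OF G.hom1_Mor[OF k(1)]]
  have Fc: "on_cell F c = on_cell F (unit2 \<G> f)"
    unfolding c_def ai(2)[symmetric] using FD(7)[OF a' ai(1)] FD(7)[OF a ai(1)] eq by simp
  have d: "hcomp \<G> (unit2 \<G> k) c \<in> hom2 \<G> (unit1 \<G> x) (unit1 \<G> x)"
    using G.whisker_hom[OF k(1) f c] k(2) by simp
  have 1: "unit1 \<G> x \<in> hom1 \<G> x x" by (rule G.unit1_hom[OF x])
  have "on_cell F (hcomp \<G> (unit2 \<G> k) c) = on_cell F (hcomp \<G> (unit2 \<G> k) (unit2 \<G> f))"
    using FD(8)[OF f k(1) c uk] FD(8)[OF f k(1) uf uk] Fc by simp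
  also have "hcomp \<G> (unit2 \<G> k) (unit2 \<G> f) = unit2 \<G> (unit1 \<G> x)" using G.hcomp_unit2[OF f k(1)] k(2) by simp
  finally have "hcomp \<G> (unit2 \<G> k) c = unit2 \<G> (unit1 \<G> x)"
    by (rule identity_cell_inj[OF x d G.unit2_hom[OF G.hom1_Mor[OF 1]]])
  then have "c = unit2 \<G> f"
    using G.whisker_cancel[OF f k(1) k(3) f c] G.hcomp_unit_right[OF f uf] by simp
  then have "vcomp \<G> a (vcomp \<G> ai a') = a" using G.vcomp_unit_right[OF a] by (simp add: c_def)
  moreover have "vcomp \<G> a (vcomp \<G> ai a') = a'"
    using G.vcomp_assoc[OF a' ai(1) a] ai(3) G.vcomp_unit_left[OF a'] by simp
  ultimately show ?thesis by simp
qed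

section \<open>Lifting simplices of the nerve\<close>

lemma lift_dim0:
  assumes y: "y \<in> nerve_simplices \<H> 0"
  shows "\<exists>x\<in>nerve_simplices \<G> 0. \<exists>h. simplicial_map (stdprod 0 1) (nerve \<H>) h \<and>
     (\<forall>m. \<forall>u\<in>Delta m 0. h m (u, constD m 0) = sact (nerve \<H>) m 0 u y \<and>
        h m (u, constD m 1) = nerve_map F m (sact (nerve \<G>) m 0 u x))"
proof -
  obtain x f where x: "x \<in> Obj \<G>" and f: "f \<in> hom1 \<H> (vert y 0) (on_obj F x)"
    using object_lift[OF nerve_vert[OF y, of 0]] by auto
  have e: "edge_simplex \<H> f \<in> simplices (nerve \<H>) 1" using H.edge_simplex_nerve[OF f] by simp
  have hm: "simplicial_map (stdprod 0 1) (nerve \<H>) (\<lambda>m s. sact (nerve \<H>) m 1 (snd s) (edge_simplex \<H> f))"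
    by (rule stdprod_mapI) (simp_all add: sset_closed[OF SH _ e, simplified] sset_comp[OF SH _ _ e] del: cmp_apply)
  have c: "sact (nerve \<H>) m 1 (constD m 0) (edge_simplex \<H> f) = sact (nerve \<H>) m 0 u y"
    "sact (nerve \<H>) m 1 (constD m 1) (edge_simplex \<H> f) = nerve_map F m (sact (nerve \<G>) m 0 u (vertex_simplex x))" if u: "u \<in> Delta m 0" for m u
  proof -
    have ui: "u i = 0" if "i \<le> m" for i using Delta_le[OF u that] by simp
    show "sact (nerve \<H>) m 1 (constD m 0) (edge_simplex \<H> f) = sact (nerve \<H>) m 0 u y"
      unfolding nerve_sact by (rule mk_simplex_cong) (simp_all add: ui H.edge_simplex_simps[OF f] edge_alt triangle_alt)
    have "nerve_map F m (sact (nerve \<G>) m 0 u (vertex_simplex x)) = sact (nerve \<H>) m 0 u (vertex_simplex (on_obj F x))"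
      using smap_nat[OF F_map u, of "vertex_simplex x"] G.vertex_simplex_nerve[OF x] nerve_map_vertex_simplex by simp
    then show "sact (nerve \<H>) m 1 (constD m 1) (edge_simplex \<H> f) = nerve_map F m (sact (nerve \<G>) m 0 u (vertex_simplex x))"
      by (simp only:, unfold nerve_sact) (rule mk_simplex_cong; simp add: ui H.edge_simplex_simps[OF f] edge_alt triangle_alt)
  qed
  show ?thesis
    by (rule bexI[OF _ G.vertex_simplex_nerve[OF x]], rule exI, rule conjI[OF hm]) (use c in simp)
qed

lemma boundary1_const:
  assumes u: "u \<in> simplices (boundary 1) m"
  obtains c where "c \<le> 1" "u = cmp m (seq_map [c]) (constD m 0)"
proof -
  have uD: "u \<in> Delta m 1" using u by (simp add: boundary_iff)
  have "\<not> {..1} \<subseteq> u ` {..m}" using u Delta_le[OF uD] by (auto simp: boundary_iff)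
  then have "0 \<notin> u ` {..m} \<or> 1 \<notin> u ` {..m}" by (auto simp: le_numerals)
  moreover have "u i = 0 \<or> u i = 1" if "i \<le> m" for i using Delta_le[OF uD that] by (simp add: le_numerals)
  ultimately have "(\<forall>i\<le>m. u i = 0) \<or> (\<forall>i\<le>m. u i = 1)" by force
  then obtain c where c: "c \<le> 1" "\<And>i. i \<le> m \<Longrightarrow> u i = c" by (metis le_numerals(1))
  have "u = constD m c" by (rule Delta_eqI[OF uD constD_Delta[OF c(1)]]) (use c(2) in simp)
  then have "u = cmp m (seq_map [c]) (constD m 0)" by simp
  with c(1) that show thesis by blast
qed

lemma lift_dim1:
  assumes e: "simplicial_map (boundary 1) (nerve \<G>) e" and y: "y \<in> nerve_simplices \<H> 1"
    and ey: "\<And>m u. u \<in> simplices (boundary 1) m \<Longrightarrow> nerve_map F m (e m u) = sact (nerve \<H>) m 1 u y"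
  shows "\<exists>x\<in>nerve_simplices \<G> 1. (\<forall>m. \<forall>u\<in>simplices (boundary 1) m. sact (nerve \<G>) m 1 u x = e m u) \<and>
     (\<exists>h. simplicial_map (stdprod 1 1) (nerve \<H>) h \<and>
        (\<forall>m. \<forall>u\<in>Delta m 1. h m (u, constD m 0) = sact (nerve \<H>) m 1 u y \<and>
           h m (u, constD m 1) = nerve_map F m (sact (nerve \<G>) m 1 u x)) \<and>
        (\<forall>m. \<forall>u\<in>simplices (boundary 1) m. \<forall>w\<in>Delta m 1. h m (u, w) = sact (nerve \<H>) m 1 u y))"
proof -
  define p where "p c = vert (e 0 (seq_map [c])) 0" for c
  have lb: "seq_map [c] \<in> simplices (boundary 1) 0" if "c \<le> 1" for c using seq_map_boundary(1)[OF that] by simp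
  have e0: "e 0 (seq_map [c]) \<in> nerve_simplices \<G> 0" if "c \<le> 1" for c using smap_closed[OF e lb[OF that]] by simp
  have p: "p c \<in> Obj \<G>" if "c \<le> 1" for c unfolding p_def by (rule nerve_vert[OF e0[OF that]]) simp
  have Fp: "vert y c = on_obj F (p c)" if "c \<le> 1" for c
    using arg_cong[OF ey[OF lb[OF that]], of "\<lambda>s. vert s 0"] by (simp add: p_def)
  have g: "edg y 0 1 \<in> hom1 \<H> (on_obj F (p 0)) (on_obj F (p 1))" using nerve_edg[OF y, of 0 1] Fp by simp
  have p01: "p 0 \<in> Obj \<G>" "p 1 \<in> Obj \<G>" by (simp_all add: p)
  obtain f b where f: "f \<in> hom1 \<G> (p 0) (p 1)" and b: "b \<in> hom2 \<H> (edg y 0 1) (on_mor F f)"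
    using mor_lift[OF p01 g] by blast
  have x: "edge_simplex \<G> f \<in> simplices (nerve \<G>) 1" using G.edge_simplex_nerve[OF f] by simp
  have bd: "sact (nerve \<G>) m 1 u (edge_simplex \<G> f) = e m u" if u: "u \<in> simplices (boundary 1) m" for m u
  proof -
    obtain c where c: "c \<le> 1" "u = cmp m (seq_map [c]) (constD m 0)" using boundary1_const[OF u] .
    have D: "constD m 0 \<in> Delta m 0" by (rule constD_Delta) simp
    have "sact (nerve \<G>) 0 1 (seq_map [c]) (edge_simplex \<G> f) = e 0 (seq_map [c])"
    proof (rule nerve_eqI)
      show "sact (nerve \<G>) 0 1 (seq_map [c]) (edge_simplex \<G> f) \<in> nerve_simplices \<G> 0"
        using sset_closed[OF SG seq_map_Delta(1)[OF c(1)] x] by simp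
      show "vert (sact (nerve \<G>) 0 1 (seq_map [c]) (edge_simplex \<G> f)) i = vert (e 0 (seq_map [c])) i" if "i \<le> 0" for i
        using that c(1) G.edge_simplex_simps[OF f] by (auto simp: le_numerals p_def)
    qed (use e0[OF c(1)] in auto)
    moreover have "e m u = sact (nerve \<G>) m 0 (constD m 0) (e 0 (seq_map [c]))"
      using smap_nat[OF e D lb[OF c(1)]] by (simp only: boundary_substd sact_substd c(2))
    moreover have "sact (nerve \<G>) m 1 u (edge_simplex \<G> f) = sact (nerve \<G>) m 0 (constD m 0) (sact (nerve \<G>) 0 1 (seq_map [c]) (edge_simplex \<G> f))"
      unfolding c(2) by (rule sset_comp[OF SG D seq_map_Delta(1)[OF c(1)] x, symmetric])
    ultimately show ?thesis by simp
  qed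
  note yed = edge_simplex_edg[OF y]
  have Fx: "nerve_map F m (sact (nerve \<G>) m 1 u (edge_simplex \<G> f)) = sact (nerve \<H>) m 1 u (edge_simplex \<H> (on_mor F f))" if "u \<in> Delta m 1" for m u
    using smap_nat[OF F_map that x] nerve_map_edge_simplex[OF f] by simp
  show ?thesis
  proof (rule H.cell_homotopy[OF SH g FD(2)[OF f] b])
    fix h assume h: "simplicial_map (stdprod 1 1) (nerve \<H>) h"
      "\<And>m u. u \<in> Delta m 1 \<Longrightarrow> h m (u, constD m 0) = sact (nerve \<H>) m 1 u (edge_simplex \<H> (edg y 0 1))"
      "\<And>m u. u \<in> Delta m 1 \<Longrightarrow> h m (u, constD m 1) = sact (nerve \<H>) m 1 u (edge_simplex \<H> (on_mor F f))"
      "\<And>m u w. u \<in> simplices (boundary 1) m \<Longrightarrow> w \<in> Delta m 1 \<Longrightarrow> h m (u, w) = sact (nerve \<H>) m 1 u (edge_simplex \<H> (edg y 0 1))"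
    show ?thesis
    proof (rule bexI[OF _ G.edge_simplex_nerve[OF f]], intro conjI exI[of _ h] allI ballI)
      show "sact (nerve \<G>) m 1 u (edge_simplex \<G> f) = e m u" if "u \<in> simplices (boundary 1) m" for m u by (rule bd[OF that])
      show "simplicial_map (stdprod 1 1) (nerve \<H>) h" by (rule h(1))
      show "h m (u, constD m 0) = sact (nerve \<H>) m 1 u y" if "u \<in> Delta m 1" for m u using h(2)[OF that] yed by simp
      show "h m (u, constD m 1) = nerve_map F m (sact (nerve \<G>) m 1 u (edge_simplex \<G> f))" if "u \<in> Delta m 1" for m u
        using h(3)[OF that] Fx[OF that] by simp
      show "h m (u, w) = sact (nerve \<H>) m 1 u y" if "u \<in> simplices (boundary 1) m" "w \<in> Delta m 1" for m u w
        using h(4)[OF that] yed by simp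
    qed
  qed
qed

text \<open>
  From dimension 2 on, lifts exist on the nose: the edges of the simplex are already given on the
  boundary, its triangles are given or found by fullness, and faithfulness turns the tetrahedron
  identities of \<open>y\<close> into those of the lift.
\<close>

lemma lift_dim_ge2:
  assumes n: "2 \<le> n" and e: "simplicial_map (boundary n) (nerve \<G>) e" and y: "y \<in> nerve_simplices \<H> n"
    and ey: "\<And>m u. u \<in> simplices (boundary n) m \<Longrightarrow> nerve_map F m (e m u) = sact (nerve \<H>) m n u y"
  shows "\<exists>x\<in>nerve_simplices \<G> n. nerve_map F n x = y \<and>
     (\<forall>m. \<forall>u\<in>simplices (boundary n) m. sact (nerve \<G>) m n u x = e m u)"
proof -
  define p where "p i = vert (e 0 (seq_map [i])) 0" for i
  define g where "g i j = edg (e 1 (seq_map [i, j])) 0 1" for i j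
  have em: "e m u \<in> nerve_simplices \<G> m" if "u \<in> simplices (boundary n) m" for m u
    using smap_closed[OF e that] by simp
  have act: "e k (cmp k u \<theta>) = sact (nerve \<G>) k m \<theta> (e m u)" if "u \<in> simplices (boundary n) m" "\<theta> \<in> Delta k m" for k m u \<theta>
    using smap_nat[OF e that(2,1)] by (simp only: boundary_substd sact_substd)
  have b1: "seq_map [i] \<in> simplices (boundary n) 0" if "i \<le> n" for i using seq_map_boundary(1)[OF that] n by simp
  have b2: "seq_map [i, j] \<in> simplices (boundary n) 1" if "i \<le> j" "j \<le> n" for i j using seq_map_boundary(2)[OF that] n by simp
  have pv: "vert (e m u) i = p (u i)" if u: "u \<in> simplices (boundary n) m" and i: "i \<le> m" for m u i
    using arg_cong[OF act[OF u seq_map_Delta(1)[OF i]], of "\<lambda>s. vert s 0"] by (simp add: p_def)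
  have ge: "edge \<G> (e m u) i j = g (u i) (u j)" if u: "u \<in> simplices (boundary n) m" and ij: "i \<le> j" "j \<le> m" for m u i j
    using arg_cong[OF act[OF u seq_map_Delta(2)[OF ij]], of "\<lambda>s. edg s 0 1"] by (simp add: g_def)
  have gid: "g i i = unit1 \<G> (p i)" if "i \<le> n" for i
    using ge[OF b1[OF that], of 0 0] by (simp add: edge_alt p_def)
  have p: "p i \<in> Obj \<G>" if "i \<le> n" for i unfolding p_def by (rule nerve_vert[OF em[OF b1[OF that]]]) simp
  have gh: "g i j \<in> hom1 \<G> (p i) (p j)" if "i \<le> j" "j \<le> n" for i j
    using nerve_edg[OF em[OF b2[OF that]], of 0 1] pv[OF b2[OF that], of 0] pv[OF b2[OF that], of 1] by (simp add: g_def)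
  have Fp: "on_obj F (p i) = vert y i" if "i \<le> n" for i
    using arg_cong[OF ey[OF b1[OF that]], of "\<lambda>s. vert s 0"] by (simp add: p_def)
  have Fg: "on_mor F (g i j) = edg y i j" if "i < j" "j \<le> n" for i j
    using arg_cong[OF ey[OF b2[of i j]], of "\<lambda>s. edg s 0 1"] that by (simp add: g_def edge_alt)
  have Fcomp: "comp1 \<H> (edg y j k) (edg y i j) = on_mor F (comp1 \<G> (g j k) (g i j))" if "i < j" "j < k" "k \<le> n" for i j k
    using FD(5)[OF gh[of i j] gh[of j k]] Fg[of i j] Fg[of j k] that by simp
  have "\<exists>a. \<forall>i j k. i < j \<longrightarrow> j < k \<longrightarrow> k \<le> n \<longrightarrow>
      a i j k \<in> hom2 \<G> (g i k) (comp1 \<G> (g j k) (g i j)) \<and> on_cell F (a i j k) = tri y i j k \<and>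
      (seq_map [i, j, k] \<in> simplices (boundary n) 2 \<longrightarrow> a i j k = tri (e 2 (seq_map [i, j, k])) 0 1 2)"
  proof -
    have "\<exists>a. a \<in> hom2 \<G> (g i k) (comp1 \<G> (g j k) (g i j)) \<and> on_cell F a = tri y i j k \<and>
        (seq_map [i, j, k] \<in> simplices (boundary n) 2 \<longrightarrow> a = tri (e 2 (seq_map [i, j, k])) 0 1 2)"
      if ijk: "i < j" "j < k" "k \<le> n" for i j k
    proof (cases "seq_map [i, j, k] \<in> simplices (boundary n) 2")
      case True
      note E = ge[OF True]
      have "tri (e 2 (seq_map [i, j, k])) 0 1 2 \<in> hom2 \<G> (g i k) (comp1 \<G> (g j k) (g i j))"
        using nerve_tri[OF em[OF True], of 0 1 2] E[of 0 1] E[of 1 2] E[of 0 2] by (simp add: edge_alt)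
      moreover have "on_cell F (tri (e 2 (seq_map [i, j, k])) 0 1 2) = tri y i j k"
        using arg_cong[OF ey[OF True], of "\<lambda>s. tri s 0 1 2"] ijk by (simp add: triangle_alt)
      ultimately show ?thesis by blast
    next
      case False
      have t: "tri y i j k \<in> hom2 \<H> (on_mor F (g i k)) (on_mor F (comp1 \<G> (g j k) (g i j)))"
        using nerve_tri[OF y ijk] Fg[of i k] Fcomp[OF ijk] ijk by simp
      have "g i k \<in> hom1 \<G> (p i) (p k)" "comp1 \<G> (g j k) (g i j) \<in> hom1 \<G> (p i) (p k)"
        using ijk G.comp1_hom[OF gh[of i j] gh[of j k]] by (auto intro: gh)
      from cell_lift[OF this t] False show ?thesis by blast
    qed
    then show ?thesis by metis
  qed
  then obtain a where a_all: "\<forall>i j k. i < j \<longrightarrow> j < k \<longrightarrow> k \<le> n \<longrightarrow>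
      a i j k \<in> hom2 \<G> (g i k) (comp1 \<G> (g j k) (g i j)) \<and> on_cell F (a i j k) = tri y i j k \<and>
      (seq_map [i, j, k] \<in> simplices (boundary n) 2 \<longrightarrow> a i j k = tri (e 2 (seq_map [i, j, k])) 0 1 2)" ..
  have a: "a i j k \<in> hom2 \<G> (g i k) (comp1 \<G> (g j k) (g i j))" and Fa: "on_cell F (a i j k) = tri y i j k"
    and ae: "seq_map [i, j, k] \<in> simplices (boundary n) 2 \<Longrightarrow> a i j k = tri (e 2 (seq_map [i, j, k])) 0 1 2"
    if "i < j" "j < k" "k \<le> n" for i j k
    using a_all that by blast+
  define x where "x = mk_simplex n p g a"
  have xe: "edg x i j \<in> hom1 \<G> (vert x i) (vert x j)" if "i < j" "j \<le> n" for i j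
    using that gh[of i j] by (simp add: x_def)
  have xt: "tri x i j k \<in> hom2 \<G> (edg x i k) (comp1 \<G> (edg x j k) (edg x i j))" if "i < j" "j < k" "k \<le> n" for i j k
    using that a[OF that] by (simp add: x_def)
  have x: "x \<in> nerve_simplices \<G> n"
    unfolding x_def
  proof (rule mk_simplex_nerveI)
    fix i j k l assume ijkl: "i < j" "j < k" "k < l" "l \<le> n"
    note t = G.functor_tetra[OF F xe xt ijkl]
    have il: "edg x i l \<in> hom1 \<G> (vert x i) (vert x l)" using xe[of i l] ijkl by simp
    show "tetra \<G> (mk_simplex n p g a) i j k l"
      unfolding tetra_def x_def[symmetric]
    proof (rule cell_inj[OF il t(1,2)])
      note t(3)
      also have "vcomp \<H> (hcomp \<H> (unit2 \<H> (on_mor F (edg x k l))) (on_cell F (tri x i j k))) (on_cell F (tri x i k l)) =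
          vcomp \<H> (hcomp \<H> (on_cell F (tri x j k l)) (unit2 \<H> (on_mor F (edg x i j)))) (on_cell F (tri x i j l))"
        using nerve_tetra[OF y ijkl] ijkl unfolding tetra_def by (simp add: x_def Fg Fa)
      also note t(4)[symmetric]
      finally show "on_cell F (vcomp \<G> (hcomp \<G> (unit2 \<G> (edg x k l)) (tri x i j k)) (tri x i k l)) =
          on_cell F (vcomp \<G> (hcomp \<G> (tri x j k l) (unit2 \<G> (edg x i j))) (tri x i j l))" .
    qed
  qed (use p gh a in auto)
  have "nerve_map F n x = y"
  proof (rule nerve_eqI[OF _ y])
    show "nerve_map F n x \<in> nerve_simplices \<H> n" using smap_closed[OF F_map, of x n] x by simp
  qed (simp_all add: x_def Fp Fg Fa)
  moreover have "sact (nerve \<G>) m n u x = e m u" if u: "u \<in> simplices (boundary n) m" for m u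
  proof -
    have uD: "u \<in> Delta m n" using u by (simp add: boundary_iff)
    have E: "edge \<G> x i j = g i j" if "i \<le> j" "j \<le> n" for i j
      using that gid[of i] by (auto simp: edge_alt x_def)
    show ?thesis
    proof (rule nerve_eqI[OF _ em[OF u]])
      show "sact (nerve \<G>) m n u x \<in> nerve_simplices \<G> m" using sset_closed[OF SG uD, of x] x by simp
      show "vert (sact (nerve \<G>) m n u x) i = vert (e m u) i" if i: "i \<le> m" for i
        using pv[OF u i] Delta_le[OF uD i] i by (simp add: x_def)
      show "edg (sact (nerve \<G>) m n u x) i j = edg (e m u) i j" if "i < j" "j \<le> m" for i j
        using ge[OF u, of i j] E[of "u i" "u j"] Delta_mono[OF uD, of i j] Delta_le[OF uD, of j] that by (simp add: edge_alt)
      fix i j k assume ijk: "i < j" "j < k" "k \<le> m"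
      have D: "seq_map [i, j, k] \<in> Delta 2 m" using ijk by (intro seq_map_Delta) auto
      have uijk: "u i \<le> u j" "u j \<le> u k" "u k \<le> n"
        using Delta_mono[OF uD, of i j] Delta_mono[OF uD, of j k] Delta_le[OF uD, of k] ijk by auto
      have bd: "seq_map [u i, u j, u k] \<in> simplices (boundary n) 2"
        using sset_closed[OF simplicial_boundary D u] by (simp add: boundary_substd)
      have te: "tri (e m u) i j k = tri (e 2 (seq_map [u i, u j, u k])) 0 1 2"
        using arg_cong[OF act[OF u D], of "\<lambda>s. tri s 0 1 2"] ijk by (simp add: triangle_alt)
      have "triangle \<G> x (u i) (u j) (u k) = tri (e 2 (seq_map [u i, u j, u k])) 0 1 2"
      proof (cases "u i < u j \<and> u j < u k")
        case True
        then show ?thesis using ae[of "u i" "u j" "u k"] bd uijk by (simp add: triangle_alt x_def)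
      next
        case False
        have deg: "tri (e 2 (seq_map [a, b, c])) 0 1 2 = unit2 \<G> (g a c)" if abc: "a \<le> b" "b \<le> c" "c \<le> n" "a = b \<or> b = c" for a b c
        proof -
          have ac: "seq_map [a, c] \<in> simplices (boundary n) 1" using abc by (intro b2) auto
          \<comment> \<open>The triangle is a degeneracy of the edge \<open>(a, c)\<close> that repeats its vertex \<open>z\<close>.\<close>
          define z where "z = (if a = b then 0 else 1 :: nat)"
          have zD: "seq_map [0, z, 1] \<in> Delta 2 1" by (intro seq_map_Delta) (auto simp: z_def)
          have "cmp 2 (seq_map [a, c]) (seq_map [0, z, 1]) = seq_map [a, b, c]" using abc(4) by (auto simp: z_def)
          from act[OF ac zD, unfolded this]
          have "tri (e 2 (seq_map [a, b, c])) 0 1 2 = triangle \<G> (e 1 (seq_map [a, c])) 0 z 1" by simp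
          also have "\<dots> = unit2 \<G> (edge \<G> (e 1 (seq_map [a, c])) 0 1)" by (simp add: triangle_alt z_def)
          finally show ?thesis using ge[OF ac, of 0 1] by simp
        qed
        have c: "u i = u j \<or> u j = u k" using False uijk by auto
        then have "triangle \<G> x (u i) (u j) (u k) = unit2 \<G> (g (u i) (u k))"
          using E[of "u i" "u k"] uijk by (auto simp: triangle_alt)
        then show ?thesis using deg[OF uijk c] by simp
      qed
      then show "tri (sact (nerve \<G>) m n u x) i j k = tri (e m u) i j k" using te ijk by simp
    qed
  qed
  ultimately show ?thesis using x by blast
qed

theorem nerve_lifts_up_to_homotopy: "lifts_up_to_homotopy (nerve \<G>) (nerve \<H>) (nerve_map F)"
  unfolding lifts_up_to_homotopy_def
proof (intro allI impI)
  fix n e y assume e: "simplicial_map (boundary n) (nerve \<G>) e" and y: "y \<in> simplices (nerve \<H>) n"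
    and "\<forall>m. \<forall>u\<in>simplices (boundary n) m. nerve_map F m (e m u) = sact (nerve \<H>) m n u y"
  then have ey: "nerve_map F m (e m u) = sact (nerve \<H>) m n u y" if "u \<in> simplices (boundary n) m" for m u
    using that by blast
  have yn: "y \<in> nerve_simplices \<H> n" using y by simp
  consider "n = 0" | "n = 1" | "2 \<le> n" by linarith
  then show "\<exists>x\<in>simplices (nerve \<G>) n. (\<forall>m. \<forall>u\<in>simplices (boundary n) m. sact (nerve \<G>) m n u x = e m u) \<and>
     (\<exists>h. simplicial_map (stdprod n 1) (nerve \<H>) h \<and>
        (\<forall>m. \<forall>u\<in>Delta m n. h m (u, constD m 0) = sact (nerve \<H>) m n u y \<and>
           h m (u, constD m 1) = nerve_map F m (sact (nerve \<G>) m n u x)) \<and>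
        (\<forall>m. \<forall>u\<in>simplices (boundary n) m. \<forall>w\<in>Delta m 1. h m (u, w) = sact (nerve \<H>) m n u y))"
  proof cases
    case 1
    have "u \<notin> simplices (boundary 0) m" for u m by (auto simp: boundary_iff Delta_0 atMost_0)
    then show ?thesis using lift_dim0[of y] yn unfolding 1 simplices_nerve by blast
  next
    case 2
    then show ?thesis using lift_dim1[of e y] e yn ey unfolding 2 simplices_nerve by blast
  next
    case 3
    then obtain x where x: "x \<in> nerve_simplices \<G> n" "nerve_map F n x = y"
      "\<And>m u. u \<in> simplices (boundary n) m \<Longrightarrow> sact (nerve \<G>) m n u x = e m u"
      using lift_dim_ge2[OF 3 e yn ey] by blast
    have hm: "simplicial_map (stdprod n 1) (nerve \<H>) (\<lambda>m s. sact (nerve \<H>) m n (fst s) y)"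
      by (rule stdprod_mapI) (simp_all add: sset_closed[OF SH _ y, simplified] sset_comp[OF SH _ _ y] del: cmp_apply)
    have Fx: "nerve_map F m (sact (nerve \<G>) m n u x) = sact (nerve \<H>) m n u y" if "u \<in> Delta m n" for m u
      using smap_nat[OF F_map that, of x] x(1,2) by simp
    show ?thesis
      by (rule bexI[of _ x], intro conjI allI ballI exI[of _ "\<lambda>m s. sact (nerve \<H>) m n (fst s) y"])
        (use x hm Fx in simp_all)
  qed
qed

end

section \<open>Descent\<close>

lemma cosimp_nerve_simps[simp]: "xlevel (cosimp_nerve G) p = nerve (glevel G p)"
  "xact (cosimp_nerve G) p q \<delta> = nerve_map (gact G p q \<delta>)"
  by (simp_all add: cosimp_nerve_def)

lemma rcosimp_cosimp_nerve:
  assumes G: "cosimplicial_two_groupoid G" and S: "\<And>p. simplicial_set (nerve (glevel G p))"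
  shows "rcosimp (cosimp_nerve G)"
proof (rule rcosimp.intro; unfold cosimp_nerve_simps)
  have tg: "two_groupoid (glevel G p)" for p using G by (simp add: cosimplicial_two_groupoid_def)
  show "simplicial_set (nerve (glevel G p))" for p by (rule S)
  show "simplicial_map (nerve (glevel G p)) (nerve (glevel G q)) (nerve_map (gact G p q \<delta>))" if "\<delta> \<in> Delta_r p q" for p q \<delta>
    by (rule two_groupoid.nerve_map_simplicial[OF tg])
      (use G Delta_r_Delta[OF that] in \<open>simp add: cosimplicial_two_groupoid_def\<close>)
  fix p k x assume "x \<in> simplices (nerve (glevel G p)) k"
  then have x: "x \<in> nerve_simplices (glevel G p) k" by simp
  have "two_fun_eq (glevel G p) (gact G p p (idD p)) two_fun_id" using G unfolding cosimplicial_two_groupoid_def by blast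
  from two_fun_eq_nerve[OF tg this x] nerve_map_id[OF x] show "nerve_map (gact G p p (idD p)) k x = x" by simp
next
  have tg: "two_groupoid (glevel G p)" for p using G by (simp add: cosimplicial_two_groupoid_def)
  fix p q r \<delta> \<epsilon> k x assume \<delta>: "\<delta> \<in> Delta_r p q" and \<epsilon>: "\<epsilon> \<in> Delta_r q r" and "x \<in> simplices (nerve (glevel G p)) k"
  then have x: "x \<in> nerve_simplices (glevel G p) k" by simp
  have "two_fun_eq (glevel G p) (gact G p r (cmp p \<epsilon> \<delta>)) (two_fun_comp (gact G q r \<epsilon>) (gact G p q \<delta>))"
    using G Delta_r_Delta[OF \<delta>] Delta_r_Delta[OF \<epsilon>] unfolding cosimplicial_two_groupoid_def by blast
  from two_fun_eq_nerve[OF tg this x]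
  show "nerve_map (gact G q r \<epsilon>) k (nerve_map (gact G p q \<delta>) k x) = nerve_map (gact G p r (cmp p \<epsilon> \<delta>)) k x"
    by (simp add: nerve_map_comp)
qed

theorem corollary6p2:
  fixes G :: "('o, 'm, 'c) cosimp_two_cat"
    and H :: "('p, 'q, 'd) cosimp_two_cat"
    and \<Phi> :: "nat \<Rightarrow> ('o, 'm, 'c, 'p, 'q, 'd) two_fun"
  assumes "cosimplicial_two_groupoid G"
    and "cosimplicial_two_groupoid H"
    and "cosimplicial_weak_equivalence G H \<Phi>"
  shows "weak_equivalence (Desc G) (Desc H) (Desc_map \<Phi>)"
proof -
  have tg: "two_groupoid (glevel G p)" "two_groupoid (glevel H p)" for p
    using assms(1,2) by (simp_all add: cosimplicial_two_groupoid_def)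
  have \<Phi>: "two_functor (glevel G p) (glevel H p) (\<Phi> p)"
    "weak_equivalence (nerve (glevel G p)) (nerve (glevel H p)) (nerve_map (\<Phi> p))" for p
    using assms(3) by (simp_all add: cosimplicial_weak_equivalence_def two_weak_equivalence_def)
  have eq: "nerve_equivalence (glevel G p) (glevel H p) (\<Phi> p)" for p
    by (rule nerve_equivalence.intro[OF tg nerve_equivalence_axioms.intro[OF \<Phi>]])
  note S = nerve_equivalence.SG[OF eq] nerve_equivalence.SH[OF eq]
  interpret rcosimp_map "cosimp_nerve G" "cosimp_nerve H" "\<lambda>p. nerve_map (\<Phi> p)"
  proof (intro rcosimp_map.intro rcosimp_map_axioms.intro; (unfold cosimp_nerve_simps)?)
    show "rcosimp (cosimp_nerve G)" by (rule rcosimp_cosimp_nerve[OF assms(1) S(1)])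
    show "rcosimp (cosimp_nerve H)" by (rule rcosimp_cosimp_nerve[OF assms(2) S(2)])
    show "simplicial_map (nerve (glevel G p)) (nerve (glevel H p)) (nerve_map (\<Phi> p))" for p
      by (rule nerve_equivalence.F_map[OF eq])
    fix p q \<delta> k x assume \<delta>: "\<delta> \<in> Delta_r p q" and "x \<in> simplices (nerve (glevel G p)) k"
    then have x: "x \<in> nerve_simplices (glevel G p) k" by simp
    have "two_fun_eq (glevel G p) (two_fun_comp (\<Phi> q) (gact G p q \<delta>)) (two_fun_comp (gact H p q \<delta>) (\<Phi> p))"
      using assms(3) Delta_r_Delta[OF \<delta>] unfolding cosimplicial_weak_equivalence_def cosimplicial_two_map_def by blast
    from two_fun_eq_nerve[OF tg(1) this x]
    show "nerve_map (\<Phi> q) k (nerve_map (gact G p q \<delta>) k x) = nerve_map (gact H p q \<delta>) k (nerve_map (\<Phi> p) k x)"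
      by (simp add: nerve_map_comp)
  qed
  show ?thesis
    unfolding Desc_def Desc_map_def
    by (rule weak_equivalence_Tot; unfold cosimp_nerve_simps)
      (rule nerve_equivalence.kan_G[OF eq] nerve_equivalence.kan_H[OF eq]
        nerve_equivalence.nerve_lifts_up_to_homotopy[OF eq])+
qed

end
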